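(* Let $H$ be a Hopf algebra with bijective antipode over a field $k$, let $A$ be a bialgebra over $k$, and suppose that $j : H \longrightarrow A$ and $\pi : A \longrightarrow H$ are bialgebra maps which satisfy $\pi\circ j = I_H$. Let $R = A^{co\,\pi}$ and let $(R, m, \eta, \Delta, \epsilon)$ be the bialgebra in ${}_H^H\mathcal{YD}$ associated to $(A, H, j, \pi)$. Then: (a) $\pi^o : H^o \longrightarrow A^o$ and $j^o : A^o \longrightarrow H^o$ are bialgebra maps which satisfy $j^o\circ\pi^o = I_{H^o}$. Let $R' = (A^o)^{co\,j^o}$. The linear map $i : R^*\to A^*$ determined by $i(r^* )(r j(h)) = r^*(r)\epsilon(h)$ for $r^*\in R^*$, $r\in R$, $h\in H$ restricts to a linear isomorphism $i|_{R^{\underline{o}}} : R^{\underline{o}}\longrightarrow R'$, and, under the identification of $R'$ with $R^{\underline{o}}$ via this isomorphism, the bialgebra in ${}_{H^o}^{H^o}\mathcal{YD}$ associated to $(A^o, H^o, \pi^o, j^o)$ is $R^{\underline{o}}$ with its bialgebra structure $(R^{\underline{o}}, \Delta^{\underline{o}}, \epsilon, m^{\underline{o}}, \eta)$. (b) The map $\vartheta : R^{\underline{o}}\# H^o \longrightarrow (R\# H)^o$ given by $\vartheta(r^{\underline{o}}\# h^o) = r^{\underline{o}}\otimes h^o$ for all $r^{\underline{o}}\in R^{\underline{o}}$ and $h^o\in H^o$ is an isomorphism of bialgebras. Furthermore $(f^{-1})^o\circ\vartheta = g\circ(i|_{R^{\underline{o}}}\# I_{H^o})$ as maps $R^{\underline{o}}\#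 H^o\to A^o$, where $f : R\# H\longrightarrow A$ and $g : R'\# H^o\longrightarrow A^o$ are the canonical isomorphisms.
   Context: Everything is over a field $k$. For an ordinary coalgebra write $\Delta(c) = c_{(1)}\otimes c_{(2)}$; for a left comodule write $\delta(m) = m_{(-1)}\otimes m_{(0)}$. $A^o$ denotes the finite (Sweedler) dual bialgebra of a bialgebra $A$, and $f^o$ denotes the restriction of the transpose $f^*$ to finite duals. $H^o$ is a Hopf algebra if $H$ is. $R^*\otimes H^*$ is regarded as a subspace of $(R\# H)^* = (R\otimes H)^*$ in the usual way, so $(r^{\underline{o}}\otimes h^o)(r\# h) = r^{\underline{o}}(r)h^o(h)$. Yetter–Drinfel'd modules. For a Hopf algebra $H$, ${}_H^H\mathcal{YD}$ is the category whose objects are left $H$-modules and left $H$-comodules $M$ with $h_{(1)}m_{(-1)}\otimes h_{(2)}\cdot m_{(0)} = (h_{(1)}\cdot m)_{(-1)}h_{(2)}\otimes (h_{(1)}\cdot m)_{(0)}$, and whose morphisms are module and comodule maps. It is monoidal with diagonal action and codiagonal coaction, with braiding $m\otimes n \mapsto m_{(-1)}\cdot n\otimes m_{(0)}$. Algebras and coalgebras in the category are those whose structure maps are morphisms; the coproduct of a coalgebra in the category is written $\Delta(c) = c^{(1)}\otimes c^{(2)}$. A bialgebra in the category is an algebra and coalgebra $R$ in the category such that $\epsilon$ and $\Delta: R\to R\otimes R$ are algebra maps, where $(a\otimes b)(a'\otimes b') = a(b_{(-1)}\cdot a')\otimes b_{(0)}b'$. Bi-product. For a bialgebra $R$ in ${}_H^H\mathcal{YD}$,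 $R\# H$ is the $k$-bialgebra $R\otimes H$ (with $r\# h = r\otimes h$) with unit $1\#1$, product $(r\# h)(r'\# h') = r(h_{(1)}\cdot r')\# h_{(2)}h'$, coproduct $\Delta(r\# h) = (r^{(1)}\# r^{(2)}_{\ (-1)}h_{(1)})\otimes(r^{(2)}_{\ (0)}\# h_{(2)})$ and counit $\epsilon(r\# h) = \epsilon(r)\epsilon(h)$. For linear maps $\psi,\varphi$, $(\psi\#\varphi)(r\# h) = \psi(r)\#\varphi(h)$. Associated bialgebra. Given bialgebra maps $j : H\to A$, $\pi : A\to H$ with $\pi\circ j = I_H$ ($H$ a Hopf algebra with antipode $S$), let $\Pi(a) = a_{(1)}j(S(\pi(a_{(2)})))$. Then $A^{co\,\pi} = \{a\in A \mid a_{(1)}\otimes\pi(a_{(2)}) = a\otimes 1\} = \mathrm{Im}\,\Pi$. The bialgebra $R$ in ${}_H^H\mathcal{YD}$ associated to $(A,H,j,\pi)$ is $R = A^{co\,\pi}$ as a subalgebra of $A$, with coproduct $\Delta_R(r) = \Pi(r_{(1)})\otimes r_{(2)}$, counit $\epsilon|_R$, action $h\cdot r = j(h_{(1)})\,r\,j(S(h_{(2)}))$ and coaction $\delta(r) = \pi(r_{(1)})\otimes r_{(2)}$. The canonical isomorphism $R\# H\to A$ is the $k$-bialgebra isomorphism $r\# h\mapsto r j(h)$. (Every element of $A$ is thus a sum of elements $rj(h)$.) The same definitions apply to $(A^o,H^o,\pi^o,j^o)$, with $\pi^o$ in the role of $j$ and $j^o$ in the role of $\pi$. The construction $R^{\underline{o}}$.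 Let $H$ have bijective antipode. For $M\in{}_H^H\mathcal{YD}$, let $M^r\subseteq M^*$ be the subspace of functionals vanishing on $I\cdot M$ for some cofinite ideal $I$ of $H$; it is an object of ${}_{H^o}^{H^o}\mathcal{YD}$ with coaction determined by $m^*_{(-1)}(h)m^*_{(0)}(m) = m^*(h\cdot m)$ and action $(h^o\cdot m^* )(m) = h^o(m_{(-1)})m^*(m_{(0)})$. For a bialgebra $R$ in ${}_H^H\mathcal{YD}$, $R^{\underline{o}}$ is the set of functionals in $R^*$ which vanish on some cofinite subspace of $R$ that is both an ideal and a left $H$-submodule of $R$; it is a subobject of $R^r$ and a bialgebra in ${}_{H^o}^{H^o}\mathcal{YD}$ with product $\Delta^{\underline{o}}$: $(pq)(r) = p(r^{(1)})q(r^{(2)})$, unit $\epsilon$, coproduct $m^{\underline{o}}$: $p^{(1)}(r)p^{(2)}(r') = p(rr')$, and counit $p\mapsto p(1)$. *)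

theory Defs
  imports Complex_Main "HOL-Library.Function_Algebras"
begin

section \<open>Vector spaces and linear maps\<close>

text \<open>
  Every vector space is a linear subspace \<open>carr V\<close> of an ambient vector space structure on a whole
  type, so that duals, tensor products, coinvariants and finite duals can be formed without leaving
  the setting. Maps are only ever evaluated on carriers; their values elsewhere are irrelevant
  (elements of dual spaces are normalised to be \<open>0\<close> off the carrier, see \<open>dual\<close>).
\<close>

record ('k, 'v) vect =
  carr :: "'v set"
  scale :: "'k \<Rightarrow> 'v \<Rightarrow> 'v"

definition vect :: "('k::field, 'v::ab_group_add, 'x) vect_scheme \<Rightarrow> bool" where
  "vect V \<longleftrightarrow> vector_space (scale V) \<and> module.subspace (scale V) (carr V)"

definition ground :: "('k::field, 'k) vect" where
  "ground = \<lparr>carr = UNIV, scale = (*)\<rparr>"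

definition lin_map ::
  "('k::field, 'v::ab_group_add, 'x) vect_scheme \<Rightarrow> ('k, 'w::ab_group_add, 'y) vect_scheme \<Rightarrow>
   ('v \<Rightarrow> 'w) \<Rightarrow> bool" where
  "lin_map V W f \<longleftrightarrow>
     (\<forall>v\<in>carr V. f v \<in> carr W) \<and>
     (\<forall>v\<in>carr V. \<forall>v'\<in>carr V. f (v + v') = f v + f v') \<and>
     (\<forall>c. \<forall>v\<in>carr V. f (scale V c v) = scale W c (f v))"

definition bilin_map ::
  "('k::field, 'v::ab_group_add, 'x) vect_scheme \<Rightarrow> ('k, 'w::ab_group_add, 'y) vect_scheme \<Rightarrow>
   ('k, 'u::ab_group_add, 'z) vect_scheme \<Rightarrow> ('v \<Rightarrow> 'w \<Rightarrow> 'u) \<Rightarrow> bool" where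
  "bilin_map V W U \<phi> \<longleftrightarrow>
     (\<forall>v\<in>carr V. lin_map W U (\<phi> v)) \<and> (\<forall>w\<in>carr W. lin_map V U (\<lambda>v. \<phi> v w))"

text \<open>\<open>I\<close> is a subspace of \<open>V\<close> with finite-dimensional quotient \<open>V/I\<close>.\<close>

definition finite_codim :: "('k::field, 'v::ab_group_add, 'x) vect_scheme \<Rightarrow> 'v set \<Rightarrow> bool" where
  "finite_codim V I \<longleftrightarrow>
     module.subspace (scale V) I \<and> I \<subseteq> carr V \<and>
     (\<exists>F. finite F \<and> F \<subseteq> carr V \<and> carr V = module.span (scale V) (I \<union> F))"

definition zero_ext :: "('k, 'v, 'x) vect_scheme \<Rightarrow> ('v \<Rightarrow> 'c::zero) \<Rightarrow> 'v \<Rightarrow> 'c" where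
  "zero_ext V f = (\<lambda>v. if v \<in> carr V then f v else 0)"

definition dual :: "('k::field, 'v::ab_group_add, 'x) vect_scheme \<Rightarrow> ('k, 'v \<Rightarrow> 'k) vect" where
  "dual V = \<lparr>carr = {p. lin_map V ground p \<and> (\<forall>v. v \<notin> carr V \<longrightarrow> p v = 0)},
            scale = (\<lambda>c p v. c * p v)\<rparr>"

text \<open>\<open>transp_map V f\<close> is the transpose of a map \<open>f\<close> with domain \<open>V\<close>.\<close>

definition transp_map :: "('k, 'v, 'x) vect_scheme \<Rightarrow> ('v \<Rightarrow> 'w) \<Rightarrow> ('w \<Rightarrow> 'k::zero) \<Rightarrow> 'v \<Rightarrow> 'k" where
  "transp_map V f p = zero_ext V (\<lambda>v. p (f v))"


section \<open>Tensor products\<close>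

text \<open>
  The pure tensor \<open>tens V W v w\<close> is evaluation at \<open>(v, w)\<close> on bilinear forms on the ambient spaces,
  and \<open>V \<otimes> W\<close> is the span of the pure tensors with entries in the carriers. Over a field this is
  the tensor product; \<open>tlift_universal\<close> below is its universal property. As the bilinear forms are
  those of the ambient spaces, \<open>V' \<otimes> W'\<close> is literally a subspace of \<open>V \<otimes> W\<close>
  for subspaces \<open>V'\<close>, \<open>W'\<close> of \<open>V\<close>, \<open>W\<close>.
\<close>

type_synonym ('k, 'v, 'w) tensor = "('v \<Rightarrow> 'w \<Rightarrow> 'k) \<Rightarrow> 'k"

definition bilin_form ::
  "('k::field, 'v::ab_group_add, 'x) vect_scheme \<Rightarrow> ('k, 'w::ab_group_add, 'y) vect_scheme \<Rightarrow>
   ('v \<Rightarrow> 'w \<Rightarrow> 'k) \<Rightarrow> bool" where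
  "bilin_form V W \<beta> \<longleftrightarrow>
     (\<forall>v. Vector_Spaces.linear (scale W) (*) (\<beta> v)) \<and>
     (\<forall>w. Vector_Spaces.linear (scale V) (*) (\<lambda>v. \<beta> v w))"

definition tens ::
  "('k::field, 'v::ab_group_add, 'x) vect_scheme \<Rightarrow> ('k, 'w::ab_group_add, 'y) vect_scheme \<Rightarrow>
   'v \<Rightarrow> 'w \<Rightarrow> ('k, 'v, 'w) tensor" where
  "tens V W v w = (\<lambda>\<beta>. if bilin_form V W \<beta> then \<beta> v w else 0)"

definition tprod ::
  "('k::field, 'v::ab_group_add, 'x) vect_scheme \<Rightarrow> ('k, 'w::ab_group_add, 'y) vect_scheme \<Rightarrow>
   ('k, ('k, 'v, 'w) tensor) vect" where
  "tprod V W = \<lparr>carr = module.span (\<lambda>c t \<beta>. c * t \<beta>) {tens V W v w |v w. v \<in> carr V \<and> w \<in> carr W},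
               scale = (\<lambda>c t \<beta>. c * t \<beta>)\<rparr>"

definition trep ::
  "('k::field, 'v::ab_group_add, 'x) vect_scheme \<Rightarrow> ('k, 'w::ab_group_add, 'y) vect_scheme \<Rightarrow>
   ('k, 'v, 'w) tensor \<Rightarrow> ('v \<times> 'w) list" where
  "trep V W t = (SOME ps. set ps \<subseteq> carr V \<times> carr W \<and> t = (\<Sum>(v, w)\<leftarrow>ps. tens V W v w))"

text \<open>
  \<open>tlift V W \<phi>\<close> is the linear map on \<open>V \<otimes> W\<close> induced by the bilinear map \<open>\<phi>\<close>. It renders
  Sweedler notation: \<open>tlift C C (\<lambda>c1 c2. \<phi> c1 c2) (comult C c)\<close> is \<open>\<phi>(c\<^sub>(\<^sub>1\<^sub>), c\<^sub>(\<^sub>2\<^sub>))\<close>.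
\<close>

definition tlift ::
  "('k::field, 'v::ab_group_add, 'x) vect_scheme \<Rightarrow> ('k, 'w::ab_group_add, 'y) vect_scheme \<Rightarrow>
   ('v \<Rightarrow> 'w \<Rightarrow> 'u::ab_group_add) \<Rightarrow> ('k, 'v, 'w) tensor \<Rightarrow> 'u" where
  "tlift V W \<phi> t = (\<Sum>(v, w)\<leftarrow>trep V W t. \<phi> v w)"

abbreviation tscale :: "'k::field \<Rightarrow> ('k, 'v, 'w) tensor \<Rightarrow> ('k, 'v, 'w) tensor" where
  "tscale \<equiv> (\<lambda>c t \<beta>. c * t \<beta>)"

lemma vs_tscale: "vector_space (tscale :: 'k::field \<Rightarrow> ('k, 'v, 'w) tensor \<Rightarrow> _)"
  by unfold_locales (auto simp: fun_eq_iff algebra_simps)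

lemma vs_ground: "vector_space ((*) :: 'k::field \<Rightarrow> 'k \<Rightarrow> 'k)"
  by unfold_locales (auto simp: algebra_simps)

lemma linear_formI:
  assumes "vector_space s" "\<And>x y. f (x + y) = f x + f y" "\<And>c x. f (s c x) = c * f x"
  shows "Vector_Spaces.linear (s :: 'k::field \<Rightarrow> 'v::ab_group_add \<Rightarrow> 'v) (*) f"
  using assms vs_ground
  unfolding Vector_Spaces.linear_def module_hom_def module_hom_axioms_def module_iff_vector_space
  by blast

lemma linear_form_scale: "Vector_Spaces.linear s (*) f \<Longrightarrow> f (s c x) = c * f x"
  unfolding Vector_Spaces.linear_def module_hom_def module_hom_axioms_def by blast

lemma vect_tprod: "vect (tprod V W)"
  unfolding vect_def tprod_def
  by (simp only: vect.simps, intro conjI vs_tscale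
      module.subspace_span[of tscale, unfolded module_iff_vector_space])

lemma vect_closed:
  assumes "vect V"
  shows "0 \<in> carr V" "x \<in> carr V \<Longrightarrow> y \<in> carr V \<Longrightarrow> x + y \<in> carr V"
    "x \<in> carr V \<Longrightarrow> scale V c x \<in> carr V"
proof -
  interpret vs: vector_space "scale V" using assms by (simp add: vect_def)
  have sub: "vs.subspace (carr V)" using assms by (simp add: vect_def)
  show "0 \<in> carr V" "x \<in> carr V \<Longrightarrow> y \<in> carr V \<Longrightarrow> x + y \<in> carr V"
    "x \<in> carr V \<Longrightarrow> scale V c x \<in> carr V"
    using vs.subspace_0[OF sub] vs.subspace_add[OF sub] vs.subspace_scale[OF sub] by auto
qed

lemma lin_map_0:
  assumes "vect V" "lin_map V W f"
  shows "f 0 = 0"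
proof -
  have "f (0 + 0) = f 0 + f 0"
    using assms vect_closed(1)[OF assms(1)] unfolding lin_map_def by blast
  then show ?thesis by simp
qed

lemma vect_sum_list:
  assumes "vect V" "\<And>x. x \<in> set xs \<Longrightarrow> f x \<in> carr V"
  shows "(\<Sum>x\<leftarrow>xs. f x) \<in> carr V"
  using assms(2) by (induction xs) (auto intro: vect_closed[OF assms(1)])

lemma lin_map_sum_list:
  assumes "vect V" "lin_map V W f" "\<And>x. x \<in> set xs \<Longrightarrow> g x \<in> carr V"
  shows "f (\<Sum>x\<leftarrow>xs. g x) = (\<Sum>x\<leftarrow>xs. f (g x))"
  using assms(3)
proof (induction xs)
  case Nil
  then show ?case using lin_map_0[OF assms(1,2)] by simp
next
  case (Cons a xs)
  then have "g a \<in> carr V" "(\<Sum>x\<leftarrow>xs. g x) \<in> carr V"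
    using vect_sum_list[OF assms(1), of xs g] by auto
  then show ?case using Cons assms(2) unfolding lin_map_def by simp
qed

lemma ex_projection:
  assumes "vect (V :: ('k::field, 'v::ab_group_add, 'x) vect_scheme)"
  shows "\<exists>p. Vector_Spaces.linear (scale V) (scale V) p \<and> range p \<subseteq> carr V \<and> (\<forall>x\<in>carr V. p x = x)"
proof -
  interpret vs: vector_space "scale V" using assms by (simp add: vect_def)
  interpret vp: vector_space_pair "scale V" "scale V" ..
  have sub: "vs.subspace (carr V)" using assms by (simp add: vect_def)
  show ?thesis
    using vp.linear_exists_left_inverse_on[OF vs.linear_id sub inj_on_id] by auto
qed

lemma ex_functional:
  assumes "vector_space (s :: 'k::field \<Rightarrow> 'u::ab_group_add \<Rightarrow> 'u)" "u \<noteq> 0"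
  shows "\<exists>\<psi>. Vector_Spaces.linear s (*) \<psi> \<and> \<psi> u = 1"
proof -
  interpret vs: vector_space s by fact
  interpret g: vector_space "(*) :: 'k \<Rightarrow> 'k \<Rightarrow> 'k" by (rule vs_ground)
  interpret vp: vector_space_pair s "(*) :: 'k \<Rightarrow> 'k \<Rightarrow> 'k" ..
  have "vs.independent {u}" using assms(2) by simp
  from vp.linear_independent_extend[OF this, of "\<lambda>_. 1"] show ?thesis by auto
qed

lemma tens_sum_list_eq:
  assumes V: "vect V" and W: "vect W" and U: "vect U" and \<phi>: "bilin_map V W U \<phi>"
    and ps: "set ps \<subseteq> carr V \<times> carr W" and qs: "set qs \<subseteq> carr V \<times> carr W"
    and eq: "(\<Sum>(v, w)\<leftarrow>ps. tens V W v w) = (\<Sum>(v, w)\<leftarrow>qs. tens V W v w)"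
  shows "(\<Sum>(v, w)\<leftarrow>ps. \<phi> v w) = (\<Sum>(v, w)\<leftarrow>qs. \<phi> v w)"
proof (rule ccontr)
  assume ne: "\<not> ?thesis"
  let ?u = "(\<Sum>(v, w)\<leftarrow>ps. \<phi> v w) - (\<Sum>(v, w)\<leftarrow>qs. \<phi> v w)"
  obtain \<psi> where \<psi>: "Vector_Spaces.linear (scale U) (*) \<psi>" and \<psi>1: "\<psi> ?u = 1"
    using ex_functional[of "scale U" ?u] U ne unfolding vect_def by auto
  interpret \<psi>: Vector_Spaces.linear "scale U" "(*)" \<psi> by (rule \<psi>)
  obtain p where p: "Vector_Spaces.linear (scale V) (scale V) p" "range p \<subseteq> carr V"
    "\<And>x. x \<in> carr V \<Longrightarrow> p x = x" using ex_projection[OF V] by blast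
  obtain q where q: "Vector_Spaces.linear (scale W) (scale W) q" "range q \<subseteq> carr W"
    "\<And>x. x \<in> carr W \<Longrightarrow> q x = x" using ex_projection[OF W] by blast
  interpret p: Vector_Spaces.linear "scale V" "scale V" p by (rule p)
  interpret q: Vector_Spaces.linear "scale W" "scale W" q by (rule q)
  define \<beta> where "\<beta> v w = \<psi> (\<phi> (p v) (q w))" for v w
  have pq: "p v \<in> carr V" "q w \<in> carr W" for v w using p(2) q(2) by auto
  have "bilin_form V W \<beta>"
    unfolding bilin_form_def
  proof (intro conjI allI)
    fix v
    show "Vector_Spaces.linear (scale W) (*) (\<beta> v)"
      by (rule linear_formI)
         (use \<phi> pq in \<open>auto simp: bilin_map_def lin_map_def \<beta>_def q.add q.scale \<psi>.add \<psi>.scale q.vs1.vector_space_axioms\<close>)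
  next
    fix w
    show "Vector_Spaces.linear (scale V) (*) (\<lambda>v. \<beta> v w)"
      by (rule linear_formI)
         (use \<phi> pq in \<open>auto simp: bilin_map_def lin_map_def \<beta>_def p.add p.scale \<psi>.add \<psi>.scale p.vs1.vector_space_axioms\<close>)
  qed
  then have ev: "(\<Sum>(v, w)\<leftarrow>xs. tens V W v w) \<beta> = \<psi> (\<Sum>(v, w)\<leftarrow>xs. \<phi> v w)"
    if "set xs \<subseteq> carr V \<times> carr W" for xs
    using that by (induction xs) (auto simp: \<psi>.zero \<psi>.add tens_def \<beta>_def p(3) q(3))
  have "\<psi> (\<Sum>(v, w)\<leftarrow>ps. \<phi> v w) = \<psi> (\<Sum>(v, w)\<leftarrow>qs. \<phi> v w)"
    unfolding ev[OF ps, symmetric] ev[OF qs, symmetric] eq ..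
  with \<psi>1 show False by (simp add: \<psi>.diff)
qed

lemma tens_scale: "tscale c (tens V W v w) = tens V W (scale V c v) w"
  by (auto simp: tens_def bilin_form_def fun_eq_iff linear_form_scale[of "scale V" "\<lambda>v. _ v w"])

lemma ex_trep:
  assumes "vect V" "t \<in> carr (tprod V W)"
  shows "\<exists>ps. set ps \<subseteq> carr V \<times> carr W \<and> t = (\<Sum>(v, w)\<leftarrow>ps. tens V W v w)"
proof -
  interpret T: vector_space "tscale :: 'a \<Rightarrow> ('a, 'b, 'd) tensor \<Rightarrow> _" by (rule vs_tscale)
  have "t \<in> T.span {tens V W v w |v w. v \<in> carr V \<and> w \<in> carr W}"
    using assms(2) by (simp add: tprod_def)
  then show ?thesis
  proof (induction rule: T.span_induct_alt)
    case base
    show ?case by (rule exI[of _ "[]"]) auto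
  next
    case (step c x y)
    then obtain v w ps where "x = tens V W v w" "v \<in> carr V" "w \<in> carr W"
      "set ps \<subseteq> carr V \<times> carr W" "y = (\<Sum>(v, w)\<leftarrow>ps. tens V W v w)" by auto
    then show ?case
      using tens_scale[of c V W v w] vect_closed(3)[OF assms(1)]
      by (intro exI[of _ "(scale V c v, w) # ps"]) auto
  qed
qed

lemma tens_in_tprod: "v \<in> carr V \<Longrightarrow> w \<in> carr W \<Longrightarrow> tens V W v w \<in> carr (tprod V W)"
  unfolding tprod_def
  by (auto intro!: module.span_base[of tscale, unfolded module_iff_vector_space, OF vs_tscale])

lemma trep:
  assumes "vect V" "t \<in> carr (tprod V W)"
  shows "set (trep V W t) \<subseteq> carr V \<times> carr W" "(\<Sum>(v, w)\<leftarrow>trep V W t. tens V W v w) = t"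
  using someI_ex[OF ex_trep[OF assms]] unfolding trep_def by auto

lemma tlift_sum_list:
  assumes "vect V" "vect W" "vect U" "bilin_map V W U \<phi>"
    and "set ps \<subseteq> carr V \<times> carr W"
  shows "tlift V W \<phi> (\<Sum>(v, w)\<leftarrow>ps. tens V W v w) = (\<Sum>(v, w)\<leftarrow>ps. \<phi> v w)"
proof -
  have "(\<Sum>(v, w)\<leftarrow>ps. tens V W v w) \<in> carr (tprod V W)"
    using assms(5) by (intro vect_sum_list vect_tprod) (auto intro: tens_in_tprod)
  from trep[OF assms(1) this] show ?thesis
    unfolding tlift_def by (intro tens_sum_list_eq[OF assms(1-4)]) (use assms(5) in auto)
qed

theorem tlift_universal:
  assumes V: "vect V" and W: "vect W" and U: "vect U" and \<phi>: "bilin_map V W U \<phi>"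
  shows "lin_map (tprod V W) U (tlift V W \<phi>)"
    and "\<And>v w. v \<in> carr V \<Longrightarrow> w \<in> carr W \<Longrightarrow> tlift V W \<phi> (tens V W v w) = \<phi> v w"
    and "\<And>f t. lin_map (tprod V W) U f \<Longrightarrow>
           (\<And>v w. v \<in> carr V \<Longrightarrow> w \<in> carr W \<Longrightarrow> f (tens V W v w) = \<phi> v w) \<Longrightarrow>
           t \<in> carr (tprod V W) \<Longrightarrow> f t = tlift V W \<phi> t"
proof -
  note sl = tlift_sum_list[OF assms]
  have \<phi>U: "\<phi> v w \<in> carr U" if "v \<in> carr V" "w \<in> carr W" for v w
    using \<phi> that unfolding bilin_map_def lin_map_def by blast
  show pure: "tlift V W \<phi> (tens V W v w) = \<phi> v w" if "v \<in> carr V" "w \<in> carr W" for v w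
    using sl[of "[(v, w)]"] that by simp
  show "lin_map (tprod V W) U (tlift V W \<phi>)"
    unfolding lin_map_def
  proof (intro conjI ballI allI)
    fix t assume t: "t \<in> carr (tprod V W)"
    note r = trep[OF V t]
    show "tlift V W \<phi> t \<in> carr U"
      unfolding tlift_def by (intro vect_sum_list[OF U]) (use r \<phi>U in auto)
    fix c
    have ts: "scale (tprod V W) c = tscale c" by (simp add: tprod_def)
    interpret su: vector_space "scale U" using U by (simp add: vect_def)
    have "tscale c (\<Sum>(v, w)\<leftarrow>ps. tens V W v w) = (\<Sum>(v, w)\<leftarrow>map (\<lambda>(v, w). (scale V c v, w)) ps. tens V W v w)"
      for ps
    proof (induction ps)
      case (Cons a ps)
      have "tscale c (x + y) = tscale c x + tscale c y" for x y :: "('a, 'b, 'd) tensor"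
        by (auto simp: algebra_simps)
      with Cons show ?case using tens_scale[of c V W "fst a" "snd a"] by (auto split: prod.splits)
    qed auto
    from this[of "trep V W t"]
    have "tlift V W \<phi> (tscale c t) = (\<Sum>(v, w)\<leftarrow>map (\<lambda>(v, w). (scale V c v, w)) (trep V W t). \<phi> v w)"
      using r sl[of "map (\<lambda>(v, w). (scale V c v, w)) (trep V W t)"] vect_closed(3)[OF V] by fastforce
    also have "\<dots> = scale U c (tlift V W \<phi> t)"
    proof -
      have "(\<Sum>(v, w)\<leftarrow>map (\<lambda>(v, w). (scale V c v, w)) ps. \<phi> v w) = scale U c (\<Sum>(v, w)\<leftarrow>ps. \<phi> v w)"
        if "set ps \<subseteq> carr V \<times> carr W" for ps
        using that by (induction ps) (use \<phi> in \<open>auto simp: bilin_map_def lin_map_def su.scale_right_distrib\<close>)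
      from this[OF r(1)] show ?thesis by (simp add: tlift_def)
    qed
    finally show "tlift V W \<phi> (scale (tprod V W) c t) = scale U c (tlift V W \<phi> t)" by (simp add: ts)
  next
    fix t t' assume t: "t \<in> carr (tprod V W)" "t' \<in> carr (tprod V W)"
    show "tlift V W \<phi> (t + t') = tlift V W \<phi> t + tlift V W \<phi> t'"
      using sl[of "trep V W t @ trep V W t'"] trep[OF V t(1)] trep[OF V t(2)] by (simp add: tlift_def)
  qed
  show "f t = tlift V W \<phi> t"
    if f: "lin_map (tprod V W) U f" "\<And>v w. v \<in> carr V \<Longrightarrow> w \<in> carr W \<Longrightarrow> f (tens V W v w) = \<phi> v w"
      and t: "t \<in> carr (tprod V W)" for f t
  proof -
    note r = trep[OF V t]
    have "f t = f (\<Sum>(v, w)\<leftarrow>trep V W t. tens V W v w)" using r by simp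
    also have "\<dots> = (\<Sum>x\<leftarrow>trep V W t. f (case x of (v, w) \<Rightarrow> tens V W v w))"
      by (rule lin_map_sum_list[OF vect_tprod f(1)]) (use r in \<open>auto intro: tens_in_tprod\<close>)
    also have "\<dots> = tlift V W \<phi> t"
      unfolding tlift_def by (intro arg_cong[where f = sum_list] map_cong) (use r f(2) in auto)
    finally show ?thesis .
  qed
qed


section \<open>Bialgebras and Hopf algebras\<close>

text \<open>
  One record serves for bialgebras over the field and, extended by an action and a coaction, for
  bialgebras in a Yetter-Drinfel'd category.
\<close>

record ('k, 'v) bialg = "('k, 'v) vect" +
  mult :: "'v \<Rightarrow> 'v \<Rightarrow> 'v"
  one :: "'v"
  comult :: "'v \<Rightarrow> ('k, 'v, 'v) tensor"
  counit :: "'v \<Rightarrow> 'k"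

definition algebra :: "('k::field, 'v::ab_group_add, 'x) bialg_scheme \<Rightarrow> bool" where
  "algebra A \<longleftrightarrow>
     vect A \<and> bilin_map A A A (mult A) \<and> one A \<in> carr A \<and>
     (\<forall>a\<in>carr A. \<forall>b\<in>carr A. \<forall>c\<in>carr A. mult A (mult A a b) c = mult A a (mult A b c)) \<and>
     (\<forall>a\<in>carr A. mult A (one A) a = a \<and> mult A a (one A) = a)"

definition coalgebra :: "('k::field, 'v::ab_group_add, 'x) bialg_scheme \<Rightarrow> bool" where
  "coalgebra C \<longleftrightarrow>
     vect C \<and> lin_map C (tprod C C) (comult C) \<and> lin_map C ground (counit C) \<and>
     (\<forall>c\<in>carr C.
        tlift C C (\<lambda>c1 c2. tens (tprod C C) C (comult C c1) c2) (comult C c) =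
        tlift C C (\<lambda>c1 c2. tlift C C (\<lambda>c3 c4. tens (tprod C C) C (tens C C c1 c3) c4) (comult C c2))
          (comult C c)) \<and>
     (\<forall>c\<in>carr C.
        tlift C C (\<lambda>c1 c2. scale C (counit C c1) c2) (comult C c) = c \<and>
        tlift C C (\<lambda>c1 c2. scale C (counit C c2) c1) (comult C c) = c)"

definition bialgebra :: "('k::field, 'v::ab_group_add, 'x) bialg_scheme \<Rightarrow> bool" where
  "bialgebra A \<longleftrightarrow>
     algebra A \<and> coalgebra A \<and>
     counit A (one A) = 1 \<and>
     (\<forall>a\<in>carr A. \<forall>b\<in>carr A. counit A (mult A a b) = counit A a * counit A b) \<and>
     comult A (one A) = tens A A (one A) (one A) \<and>
     (\<forall>a\<in>carr A. \<forall>b\<in>carr A.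
        comult A (mult A a b) =
        tlift A A (\<lambda>a1 a2. tlift A A (\<lambda>b1 b2. tens A A (mult A a1 b1) (mult A a2 b2)) (comult A b))
          (comult A a))"

definition antipode :: "('k::field, 'v::ab_group_add, 'x) bialg_scheme \<Rightarrow> ('v \<Rightarrow> 'v) \<Rightarrow> bool" where
  "antipode H S \<longleftrightarrow>
     lin_map H H S \<and>
     (\<forall>h\<in>carr H.
        tlift H H (\<lambda>h1 h2. mult H (S h1) h2) (comult H h) = scale H (counit H h) (one H) \<and>
        tlift H H (\<lambda>h1 h2. mult H h1 (S h2)) (comult H h) = scale H (counit H h) (one H))"

definition hopf_algebra :: "('k::field, 'v::ab_group_add, 'x) bialg_scheme \<Rightarrow> bool" where
  "hopf_algebra H \<longleftrightarrow> bialgebra H \<and> (\<exists>S. antipode H S)"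

text \<open>The antipode is unique on the carrier.\<close>

definition antip :: "('k::field, 'v::ab_group_add, 'x) bialg_scheme \<Rightarrow> 'v \<Rightarrow> 'v" where
  "antip H = (SOME S. antipode H S)"

definition bialg_map ::
  "('k::field, 'v::ab_group_add, 'x) bialg_scheme \<Rightarrow> ('k, 'w::ab_group_add, 'y) bialg_scheme \<Rightarrow>
   ('v \<Rightarrow> 'w) \<Rightarrow> bool" where
  "bialg_map A B f \<longleftrightarrow>
     bialgebra A \<and> bialgebra B \<and> lin_map A B f \<and>
     f (one A) = one B \<and>
     (\<forall>a\<in>carr A. \<forall>b\<in>carr A. f (mult A a b) = mult B (f a) (f b)) \<and>
     (\<forall>a\<in>carr A. counit B (f a) = counit A a) \<and>
     (\<forall>a\<in>carr A. comult B (f a) = tlift A A (\<lambda>a1 a2. tens B B (f a1) (f a2)) (comult A a))"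

definition bialg_iso ::
  "('k::field, 'v::ab_group_add, 'x) bialg_scheme \<Rightarrow> ('k, 'w::ab_group_add, 'y) bialg_scheme \<Rightarrow>
   ('v \<Rightarrow> 'w) \<Rightarrow> bool" where
  "bialg_iso A B f \<longleftrightarrow> bialg_map A B f \<and> bij_betw f (carr A) (carr B)"


section \<open>Finite duals\<close>

definition ideal :: "('k::field, 'v::ab_group_add, 'x) bialg_scheme \<Rightarrow> 'v set \<Rightarrow> bool" where
  "ideal A I \<longleftrightarrow>
     module.subspace (scale A) I \<and> I \<subseteq> carr A \<and>
     (\<forall>a\<in>carr A. \<forall>x\<in>I. mult A a x \<in> I \<and> mult A x a \<in> I)"

definition conv ::
  "('k::field, 'v::ab_group_add, 'x) bialg_scheme \<Rightarrow> ('v \<Rightarrow> 'k) \<Rightarrow> ('v \<Rightarrow> 'k) \<Rightarrow> 'v \<Rightarrow> 'k" where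
  "conv C p q = zero_ext C (\<lambda>c. tlift C C (\<lambda>c1 c2. p c1 * q c2) (comult C c))"

text \<open>
  For a space \<open>D\<close> of functionals on \<open>A\<close>: the element \<open>p\<^sup>(\<^sup>1\<^sup>) \<otimes> p\<^sup>(\<^sup>2\<^sup>)\<close> of \<open>D \<otimes> D\<close> with
  \<open>p\<^sup>(\<^sup>1\<^sup>)(a) p\<^sup>(\<^sup>2\<^sup>)(b) = p(ab)\<close>; at most one such tensor exists.
\<close>

definition transp_mult ::
  "('k::field, 'v::ab_group_add, 'x) bialg_scheme \<Rightarrow> ('k, 'v \<Rightarrow> 'k) vect \<Rightarrow> ('v \<Rightarrow> 'k) \<Rightarrow>
   ('k, 'v \<Rightarrow> 'k, 'v \<Rightarrow> 'k) tensor" where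
  "transp_mult A D p =
     (THE t. t \<in> carr (tprod D D) \<and>
        (\<forall>a\<in>carr A. \<forall>b\<in>carr A. tlift D D (\<lambda>p1 p2. p1 a * p2 b) t = p (mult A a b)))"

definition fin_dual_space ::
  "('k::field, 'v::ab_group_add, 'x) bialg_scheme \<Rightarrow> ('k, 'v \<Rightarrow> 'k) vect" where
  "fin_dual_space A =
     \<lparr>carr = {p \<in> carr (dual A). \<exists>I. ideal A I \<and> finite_codim A I \<and> (\<forall>a\<in>I. p a = 0)},
      scale = scale (dual A)\<rparr>"

definition fin_dual ::
  "('k::field, 'v::ab_group_add, 'x) bialg_scheme \<Rightarrow> ('k, 'v \<Rightarrow> 'k) bialg" where
  "fin_dual A =
     \<lparr>carr = carr (fin_dual_space A),
      scale = scale (fin_dual_space A),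
      mult = conv A,
      one = zero_ext A (counit A),
      comult = transp_mult A (fin_dual_space A),
      counit = (\<lambda>p. p (one A))\<rparr>"


section \<open>Yetter-Drinfel'd modules\<close>

record ('k, 'h, 'v) yd = "('k, 'v) vect" +
  yd_act :: "'h \<Rightarrow> 'v \<Rightarrow> 'v"
  yd_coact :: "'v \<Rightarrow> ('k, 'h, 'v) tensor"

definition left_module ::
  "('k::field, 'h::ab_group_add, 'x) bialg_scheme \<Rightarrow> ('k, 'h, 'v::ab_group_add) yd \<Rightarrow> bool" where
  "left_module H M \<longleftrightarrow>
     vect M \<and> bilin_map H M M (yd_act M) \<and>
     (\<forall>m\<in>carr M. yd_act M (one H) m = m) \<and>
     (\<forall>h\<in>carr H. \<forall>h'\<in>carr H. \<forall>m\<in>carr M.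
        yd_act M (mult H h h') m = yd_act M h (yd_act M h' m))"

definition left_comodule ::
  "('k::field, 'h::ab_group_add, 'x) bialg_scheme \<Rightarrow> ('k, 'h, 'v::ab_group_add) yd \<Rightarrow> bool" where
  "left_comodule H M \<longleftrightarrow>
     vect M \<and> lin_map M (tprod H M) (yd_coact M) \<and>
     (\<forall>m\<in>carr M.
        tlift H M (\<lambda>x y. tens (tprod H H) M (comult H x) y) (yd_coact M m) =
        tlift H M (\<lambda>x y. tlift H M (\<lambda>x' y'. tens (tprod H H) M (tens H H x x') y') (yd_coact M y))
          (yd_coact M m)) \<and>
     (\<forall>m\<in>carr M. tlift H M (\<lambda>x y. scale M (counit H x) y) (yd_coact M m) = m)"

definition yd_object ::
  "('k::field, 'h::ab_group_add, 'x) bialg_scheme \<Rightarrow> ('k, 'h, 'v::ab_group_add) yd \<Rightarrow> bool" where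
  "yd_object H M \<longleftrightarrow>
     left_module H M \<and> left_comodule H M \<and>
     (\<forall>h\<in>carr H. \<forall>m\<in>carr M.
        tlift H H (\<lambda>h1 h2. tlift H M (\<lambda>x y. tens H M (mult H h1 x) (yd_act M h2 y)) (yd_coact M m))
          (comult H h) =
        tlift H H (\<lambda>h1 h2. tlift H M (\<lambda>x y. tens H M (mult H x h2) y) (yd_coact M (yd_act M h1 m)))
          (comult H h))"

definition yd_morphism ::
  "('k::field, 'h::ab_group_add, 'x) bialg_scheme \<Rightarrow> ('k, 'h, 'v::ab_group_add) yd \<Rightarrow>
   ('k, 'h, 'w::ab_group_add) yd \<Rightarrow> ('v \<Rightarrow> 'w) \<Rightarrow> bool" where
  "yd_morphism H M N f \<longleftrightarrow>
     yd_object H M \<and> yd_object H N \<and> lin_map M N f \<and>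
     (\<forall>h\<in>carr H. \<forall>m\<in>carr M. f (yd_act M h m) = yd_act N h (f m)) \<and>
     (\<forall>m\<in>carr M. yd_coact N (f m) = tlift H M (\<lambda>x y. tens H N x (f y)) (yd_coact M m))"

definition yd_tensor ::
  "('k::field, 'h::ab_group_add, 'x) bialg_scheme \<Rightarrow> ('k, 'h, 'v::ab_group_add) yd \<Rightarrow>
   ('k, 'h, 'w::ab_group_add) yd \<Rightarrow> ('k, 'h, ('k, 'v, 'w) tensor) yd" where
  "yd_tensor H M N =
     \<lparr>carr = carr (tprod M N),
      scale = scale (tprod M N),
      yd_act = (\<lambda>h. tlift M N (\<lambda>m n.
        tlift H H (\<lambda>h1 h2. tens M N (yd_act M h1 m) (yd_act N h2 n)) (comult H h))),
      yd_coact = tlift M N (\<lambda>m n.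
        tlift H M (\<lambda>x m0. tlift H N (\<lambda>y n0. tens H (tprod M N) (mult H x y) (tens M N m0 n0))
          (yd_coact N n)) (yd_coact M m))\<rparr>"

definition yd_unit :: "('k::field, 'h::ab_group_add, 'x) bialg_scheme \<Rightarrow> ('k, 'h, 'k) yd" where
  "yd_unit H =
     \<lparr>carr = UNIV, scale = (*), yd_act = (\<lambda>h c. counit H h * c), yd_coact = tens H ground (one H)\<rparr>"

record ('k, 'h, 'v) yd_bialg = "('k, 'v) bialg" +
  act :: "'h \<Rightarrow> 'v \<Rightarrow> 'v"
  coact :: "'v \<Rightarrow> ('k, 'h, 'v) tensor"

definition yd_of :: "('k, 'h, 'v) yd_bialg \<Rightarrow> ('k, 'h, 'v) yd" where
  "yd_of R = \<lparr>carr = carr R, scale = scale R, yd_act = act R, yd_coact = coact R\<rparr>"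

definition yd_algebra ::
  "('k::field, 'h::ab_group_add, 'x) bialg_scheme \<Rightarrow> ('k, 'h, 'v::ab_group_add) yd_bialg \<Rightarrow> bool"
  where
  "yd_algebra H R \<longleftrightarrow>
     algebra R \<and> yd_object H (yd_of R) \<and>
     yd_morphism H (yd_tensor H (yd_of R) (yd_of R)) (yd_of R) (tlift R R (mult R)) \<and>
     yd_morphism H (yd_unit H) (yd_of R) (\<lambda>c. scale R c (one R))"

definition yd_coalgebra ::
  "('k::field, 'h::ab_group_add, 'x) bialg_scheme \<Rightarrow> ('k, 'h, 'v::ab_group_add) yd_bialg \<Rightarrow> bool"
  where
  "yd_coalgebra H R \<longleftrightarrow>
     coalgebra R \<and> yd_object H (yd_of R) \<and>
     yd_morphism H (yd_of R) (yd_tensor H (yd_of R) (yd_of R)) (comult R) \<and>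
     yd_morphism H (yd_of R) (yd_unit H) (counit R)"

text \<open>The last clause uses the product \<open>(a \<otimes> b)(a' \<otimes> b') = a (b\<^sub>(\<^sub>-\<^sub>1\<^sub>) \<cdot> a') \<otimes> b\<^sub>(\<^sub>0\<^sub>) b'\<close> on \<open>R \<otimes> R\<close>.\<close>

definition yd_bialgebra ::
  "('k::field, 'h::ab_group_add, 'x) bialg_scheme \<Rightarrow> ('k, 'h, 'v::ab_group_add) yd_bialg \<Rightarrow> bool"
  where
  "yd_bialgebra H R \<longleftrightarrow>
     hopf_algebra H \<and> yd_algebra H R \<and> yd_coalgebra H R \<and>
     counit R (one R) = 1 \<and>
     (\<forall>r\<in>carr R. \<forall>s\<in>carr R. counit R (mult R r s) = counit R r * counit R s) \<and>
     comult R (one R) = tens R R (one R) (one R) \<and>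
     (\<forall>r\<in>carr R. \<forall>s\<in>carr R.
        comult R (mult R r s) =
        tlift R R (\<lambda>a b. tlift R R (\<lambda>a' b'.
          tlift H R (\<lambda>x b0. tens R R (mult R a (act R x a')) (mult R b0 b')) (coact R b))
          (comult R s)) (comult R r))"

definition yd_bialg_iso ::
  "('k::field, 'h::ab_group_add, 'x) bialg_scheme \<Rightarrow> ('k, 'h, 'v::ab_group_add) yd_bialg \<Rightarrow>
   ('k, 'h, 'w::ab_group_add) yd_bialg \<Rightarrow> ('v \<Rightarrow> 'w) \<Rightarrow> bool" where
  "yd_bialg_iso H R R' f \<longleftrightarrow>
     yd_bialgebra H R \<and> yd_bialgebra H R' \<and>
     yd_morphism H (yd_of R) (yd_of R') f \<and> bij_betw f (carr R) (carr R') \<and>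
     f (one R) = one R' \<and>
     (\<forall>r\<in>carr R. \<forall>s\<in>carr R. f (mult R r s) = mult R' (f r) (f s)) \<and>
     (\<forall>r\<in>carr R. counit R' (f r) = counit R r) \<and>
     (\<forall>r\<in>carr R. comult R' (f r) = tlift R R (\<lambda>r1 r2. tens R' R' (f r1) (f r2)) (comult R r))"


section \<open>Bi-products and the associated bialgebra\<close>

definition biproduct ::
  "('k::field, 'h::ab_group_add, 'v::ab_group_add) yd_bialg \<Rightarrow> ('k, 'h, 'x) bialg_scheme \<Rightarrow>
   ('k, ('k, 'v, 'h) tensor) bialg" where
  "biproduct R H =
     \<lparr>carr = carr (tprod R H),
      scale = scale (tprod R H),
      mult = (\<lambda>x y.
        tlift R H (\<lambda>r h. tlift R H (\<lambda>r' h'. tlift H H (\<lambda>h1 h2.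
          tens R H (mult R r (act R h1 r')) (mult H h2 h')) (comult H h)) y) x),
      one = tens R H (one R) (one H),
      comult = tlift R H (\<lambda>r h.
        tlift R R (\<lambda>r1 r2. tlift H R (\<lambda>x y. tlift H H (\<lambda>h1 h2.
          tens (tprod R H) (tprod R H) (tens R H r1 (mult H x h1)) (tens R H y h2))
          (comult H h)) (coact R r2)) (comult R r)),
      counit = tlift R H (\<lambda>r h. counit R r * counit H h)\<rparr>"

definition coinvariants ::
  "('k::field, 'a::ab_group_add, 'x) bialg_scheme \<Rightarrow> ('k, 'h::ab_group_add, 'y) bialg_scheme \<Rightarrow>
   ('a \<Rightarrow> 'h) \<Rightarrow> 'a set" where
  "coinvariants A H \<pi> =
     {a \<in> carr A. tlift A A (\<lambda>a1 a2. tens A H a1 (\<pi> a2)) (comult A a) = tens A H a (one H)}"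

definition Pi_map ::
  "('k::field, 'a::ab_group_add, 'x) bialg_scheme \<Rightarrow> ('k, 'h::ab_group_add, 'y) bialg_scheme \<Rightarrow>
   ('h \<Rightarrow> 'a) \<Rightarrow> ('a \<Rightarrow> 'h) \<Rightarrow> 'a \<Rightarrow> 'a" where
  "Pi_map A H j \<pi> a = tlift A A (\<lambda>a1 a2. mult A a1 (j (antip H (\<pi> a2)))) (comult A a)"

definition assoc_bialg ::
  "('k::field, 'a::ab_group_add, 'x) bialg_scheme \<Rightarrow> ('k, 'h::ab_group_add, 'y) bialg_scheme \<Rightarrow>
   ('h \<Rightarrow> 'a) \<Rightarrow> ('a \<Rightarrow> 'h) \<Rightarrow> ('k, 'h, 'a) yd_bialg" where
  "assoc_bialg A H j \<pi> =
     \<lparr>carr = coinvariants A H \<pi>,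
      scale = scale A,
      mult = mult A,
      one = one A,
      comult = (\<lambda>r. tlift A A (\<lambda>r1 r2. tens A A (Pi_map A H j \<pi> r1) r2) (comult A r)),
      counit = counit A,
      act = (\<lambda>h r. tlift H H (\<lambda>h1 h2. mult A (mult A (j h1) r) (j (antip H h2))) (comult H h)),
      coact = (\<lambda>r. tlift A A (\<lambda>r1 r2. tens H A (\<pi> r1) r2) (comult A r))\<rparr>"

definition canonical_iso ::
  "('k::field, 'a::ab_group_add, 'x) bialg_scheme \<Rightarrow> ('k, 'h::ab_group_add, 'y) bialg_scheme \<Rightarrow>
   ('h \<Rightarrow> 'a) \<Rightarrow> ('a \<Rightarrow> 'h) \<Rightarrow> ('k, 'a, 'h) tensor \<Rightarrow> 'a" where
  "canonical_iso A H j \<pi> = tlift (assoc_bialg A H j \<pi>) H (\<lambda>r h. mult A r (j h))"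


section \<open>The dual of a bialgebra in the Yetter-Drinfel'd category\<close>

definition r_dual_space ::
  "('k::field, 'h::ab_group_add, 'x) bialg_scheme \<Rightarrow> ('k, 'h, 'v::ab_group_add) yd \<Rightarrow>
   ('k, 'v \<Rightarrow> 'k) vect" where
  "r_dual_space H M =
     \<lparr>carr = {p \<in> carr (dual M). \<exists>I. ideal H I \<and> finite_codim H I \<and>
               (\<forall>h\<in>I. \<forall>m\<in>carr M. p (yd_act M h m) = 0)},
      scale = scale (dual M)\<rparr>"

text \<open>\<open>M\<^sup>r\<close>; its coaction is determined by \<open>p\<^sub>(\<^sub>-\<^sub>1\<^sub>)(h) p\<^sub>(\<^sub>0\<^sub>)(m) = p(h \<cdot> m)\<close>.\<close>

definition r_dual ::
  "('k::field, 'h::ab_group_add, 'x) bialg_scheme \<Rightarrow> ('k, 'h, 'v::ab_group_add) yd \<Rightarrow>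
   ('k, 'h \<Rightarrow> 'k, 'v \<Rightarrow> 'k) yd" where
  "r_dual H M =
     \<lparr>carr = carr (r_dual_space H M),
      scale = scale (r_dual_space H M),
      yd_act = (\<lambda>q p. zero_ext M (\<lambda>m. tlift H M (\<lambda>x y. q x * p y) (yd_coact M m))),
      yd_coact = (\<lambda>p. THE t. t \<in> carr (tprod (fin_dual H) (r_dual_space H M)) \<and>
        (\<forall>h\<in>carr H. \<forall>m\<in>carr M.
           tlift (fin_dual H) (r_dual_space H M) (\<lambda>q p'. q h * p' m) t = p (yd_act M h m)))\<rparr>"

definition o_dual_space ::
  "('k::field, 'h::ab_group_add, 'x) bialg_scheme \<Rightarrow> ('k, 'h, 'v::ab_group_add) yd_bialg \<Rightarrow>
   ('k, 'v \<Rightarrow> 'k) vect" where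
  "o_dual_space H R =
     \<lparr>carr = {p \<in> carr (dual R). \<exists>I. ideal R I \<and> finite_codim R I \<and>
               (\<forall>h\<in>carr H. \<forall>r\<in>I. act R h r \<in> I) \<and> (\<forall>r\<in>I. p r = 0)},
      scale = scale (dual R)\<rparr>"

text \<open>The action and coaction are those of \<open>R\<^sup>r\<close>, of which this is a subobject.\<close>

definition o_dual ::
  "('k::field, 'h::ab_group_add, 'x) bialg_scheme \<Rightarrow> ('k, 'h, 'v::ab_group_add) yd_bialg \<Rightarrow>
   ('k, 'h \<Rightarrow> 'k, 'v \<Rightarrow> 'k) yd_bialg" where
  "o_dual H R =
     \<lparr>carr = carr (o_dual_space H R),
      scale = scale (o_dual_space H R),
      mult = conv R,
      one = zero_ext R (counit R),
      comult = transp_mult R (o_dual_space H R),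
      counit = (\<lambda>p. p (one R)),
      act = yd_act (r_dual H (yd_of R)),
      coact = yd_coact (r_dual H (yd_of R))\<rparr>"


section \<open>The two comparison maps\<close>

text \<open>The map \<open>R\<^sup>* \<rightarrow> A\<^sup>*\<close> determined by \<open>r\<^sup>* \<mapsto> (r j(h) \<mapsto> r\<^sup>*(r) \<epsilon>(h))\<close>, with \<open>R\<close> the coinvariants.\<close>

definition dual_ext ::
  "('k::field, 'a::ab_group_add, 'x) bialg_scheme \<Rightarrow> ('k, 'h::ab_group_add, 'y) bialg_scheme \<Rightarrow>
   ('h \<Rightarrow> 'a) \<Rightarrow> ('a \<Rightarrow> 'h) \<Rightarrow> ('a \<Rightarrow> 'k) \<Rightarrow> 'a \<Rightarrow> 'k" where
  "dual_ext A H j \<pi> p =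
     (THE q. q \<in> carr (dual A) \<and>
        (\<forall>r\<in>coinvariants A H \<pi>. \<forall>h\<in>carr H. q (mult A r (j h)) = p r * counit H h))"

text \<open>
  The identification of \<open>p \<otimes> q \<in> R\<^sup>* \<otimes> H\<^sup>*\<close> with the functional \<open>r \<otimes> h \<mapsto> p(r) q(h)\<close> on \<open>R \<otimes> H\<close>,
  restricted to the finite duals.
\<close>

definition theta ::
  "('k::field, 'h::ab_group_add, 'x) bialg_scheme \<Rightarrow> ('k, 'h, 'v::ab_group_add) yd_bialg \<Rightarrow>
   ('k, 'v \<Rightarrow> 'k, 'h \<Rightarrow> 'k) tensor \<Rightarrow> ('k, 'v, 'h) tensor \<Rightarrow> 'k" where
  "theta H R =
     tlift (o_dual H R) (fin_dual H)
       (\<lambda>p q. zero_ext (tprod R H) (tlift R H (\<lambda>r h. p r * q h)))"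

end

theory Submission
  imports Defs
begin

text \<open>
  Every \<open>a\<close> in \<open>A\<close> equals \<open>\<Pi>(a\<^sub>1) j(\<pi>(a\<^sub>2))\<close>, so \<open>i(p) = p \<circ> \<Pi>\<close>, and \<open>i\<close> identifies the functionals on \<open>R\<close>
  with those on \<open>A\<close> that are fixed by precomposition with \<open>\<Pi>\<close>; inside the finite dual of \<open>A\<close> these are
  exactly the coinvariants of the transpose of \<open>j\<close>. Hence all structure maps of the dual of \<open>R\<close> can be
  compared with those of \<open>R'\<close> by evaluating at elements of \<open>A\<close>.

  Radford's biproduct theorem is proved for an arbitrary \<open>R\<close> with an injective linear map onto the
  coinvariants that is compatible with the structure maps. It is applied to the inclusions of the coinvariants
  of \<open>A\<close> and of \<open>A\<^sup>o\<close>, and to \<open>i\<close>; the last application gives the Yetter-Drinfel'd axioms for the dual of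
  \<open>R\<close> and an isomorphism of its biproduct with \<open>A\<^sup>o\<close>, whose composite with \<open>f\<^sup>o\<close> is \<open>\<vartheta>\<close>.

  Membership in the finite dual is tested throughout by the criterion that \<open>p(a b)\<close> has finite rank
  as a function of \<open>a\<close> and \<open>b\<close>.
\<close>

text \<open>A functional is coinvariant for the dual data exactly when it is fixed by \<Pi>, because
  the projection belonging to the dual data is the transpose of \<Pi>: product, coproduct and
  antipode of the finite dual are transposes of coproduct, product and antipode. That the H-stable
  ideals in the definition of the dual of R match the ideals of A has two reasons. The adjoint
  action is built from multiplications in A, so a cofinite ideal of A meets R in a cofinite H-stable
  ideal. Conversely \<Pi>(a b) = \<Pi>(a1) (\<pi>(a2) . \<Pi>(b)), so if p vanishes on an H-stable
  ideal I of R, then p(\<Pi>(a b)) depends on b only through \<Pi>(b) modulo I.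

  The obstacle is that coaction and coproduct of the dual of R are specified only by their values on
  elements, while they must lie in tensor products of spaces of functionals. Such a tensor is
  determined by its evaluations, and one with the prescribed evaluations is obtained from the
  coproduct of the finite dual of A by projecting and restricting its legs.\<close>

section \<open>Tensor products\<close>

text \<open>Membership and (bi)linearity goals are syntax-directed:
  \<open>(rule ty | assumption)+\<close> proves them by following the shape of the term, and the
  same rules discharge side conditions of \<open>simp\<close>. Facts about the objects at hand are
  added locally by \<open>note [ty]\<close>.\<close>

named_theorems ty

lemma vect_ground [ty]: "vect ground"
  unfolding vect_def ground_def
  using vs_ground module.subspace_UNIV[OF vs_ground[folded module_iff_vector_space]] by simp

lemmas vect_tprod [ty]

lemma in_ground [ty]: "x \<in> carr ground"
  by (simp add: ground_def)

lemmas tens_in_tprod [ty]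

lemma scale_ground [simp]: "scale ground c x = c * x"
  by (simp add: ground_def)

lemma scale_tprod: "scale (tprod V W) = tscale"
  by (simp add: tprod_def)

lemma zero_closed [ty]: "vect V \<Longrightarrow> 0 \<in> carr V" by (rule vect_closed)
lemma plus_closed [ty]: "vect V \<Longrightarrow> x \<in> carr V \<Longrightarrow> y \<in> carr V \<Longrightarrow> x + y \<in> carr V" by (rule vect_closed)
lemma scale_closed [ty]: "vect V \<Longrightarrow> x \<in> carr V \<Longrightarrow> scale V c x \<in> carr V" by (rule vect_closed)

lemma lin_mapD:
  assumes "lin_map V W f"
  shows "v \<in> carr V \<Longrightarrow> f v \<in> carr W"
    and "v \<in> carr V \<Longrightarrow> v' \<in> carr V \<Longrightarrow> f (v + v') = f v + f v'"
    and "v \<in> carr V \<Longrightarrow> f (scale V c v) = scale W c (f v)"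
  using assms by (auto simp: lin_map_def)

lemma lin_mapI:
  assumes "\<And>v. v \<in> carr V \<Longrightarrow> f v \<in> carr W"
    and "\<And>v v'. v \<in> carr V \<Longrightarrow> v' \<in> carr V \<Longrightarrow> f (v + v') = f v + f v'"
    and "\<And>v c. v \<in> carr V \<Longrightarrow> f (scale V c v) = scale W c (f v)"
  shows "lin_map V W f"
  using assms by (auto simp: lin_map_def)

lemma lin_map_cong:
  assumes "vect V" "\<And>v. v \<in> carr V \<Longrightarrow> f v = g v"
  shows "lin_map V W f \<longleftrightarrow> lin_map V W g"
  using assms vect_closed[OF assms(1)] by (simp add: lin_map_def)

lemma lin_map_id [ty]: "lin_map V V (\<lambda>x. x)"
  by (simp add: lin_map_def)

lemma lin_map_comp: "lin_map V W g \<Longrightarrow> lin_map U V f \<Longrightarrow> lin_map U W (\<lambda>u. g (f u))"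
  by (auto simp: lin_map_def)

lemma bilin_mapI [ty]:
  assumes "\<And>v. v \<in> carr V \<Longrightarrow> lin_map W U (\<lambda>w. \<phi> v w)"
    and "\<And>w. w \<in> carr W \<Longrightarrow> lin_map V U (\<lambda>v. \<phi> v w)"
  shows "bilin_map V W U \<phi>"
  using assms by (simp add: bilin_map_def)

lemma bilin_mapD:
  assumes "bilin_map V W U \<phi>"
  shows "v \<in> carr V \<Longrightarrow> lin_map W U (\<lambda>w. \<phi> v w)"
    and "w \<in> carr W \<Longrightarrow> lin_map V U (\<lambda>v. \<phi> v w)"
    and "v \<in> carr V \<Longrightarrow> w \<in> carr W \<Longrightarrow> \<phi> v w \<in> carr U"
  using assms by (auto simp: bilin_map_def lin_map_def)

lemma vect_scale:
  assumes "vect V"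
  shows "scale V a (x + y) = scale V a x + scale V a y" "scale V (a + b) x = scale V a x + scale V b x"
    "scale V a (scale V b x) = scale V (a * b) x" "scale V 1 x = x" "scale V a 0 = 0" "scale V 0 x = 0"
    "scale V (- a) x = - scale V a x"
proof -
  interpret vector_space "scale V" using assms by (simp add: vect_def)
  show "scale V a (x + y) = scale V a x + scale V a y" "scale V (a + b) x = scale V a x + scale V b x"
    "scale V a (scale V b x) = scale V (a * b) x" "scale V 1 x = x" "scale V a 0 = 0" "scale V 0 x = 0"
    "scale V (- a) x = - scale V a x"
    by (simp_all add: scale_right_distrib scale_left_distrib)
qed

lemmas bilin_ty = bilin_mapD lin_map_comp[OF bilin_mapD(1)] lin_map_comp[OF bilin_mapD(2)]

lemma lin_map_plus [ty]:
  "vect W \<Longrightarrow> lin_map V W f \<Longrightarrow> lin_map V W g \<Longrightarrow> lin_map V W (\<lambda>v. f v + g v)"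
  by (rule lin_mapI) (simp_all add: lin_map_def vect_scale(1) plus_closed add_ac)

lemma vect_uminus: "vect V \<Longrightarrow> x \<in> carr V \<Longrightarrow> - x \<in> carr V"
  using vect_closed(3)[of V x "-1"] by (simp add: vect_scale)

lemma vect_minus: "vect V \<Longrightarrow> x \<in> carr V \<Longrightarrow> y \<in> carr V \<Longrightarrow> x - y \<in> carr V"
  using vect_closed(2)[of V x "- y"] vect_uminus[of V y] by simp

lemma lin_map_minus:
  assumes "vect V" "lin_map V W f" "x \<in> carr V" "y \<in> carr V"
  shows "f (x - y) = f x - f y"
proof -
  have "f (x - y + y) = f (x - y) + f y"
    by (rule lin_mapD(2)[OF assms(2)]) (rule vect_minus assms)+
  then show ?thesis by simp
qed

lemma lin_map_scale_const [ty]: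
  "vect W \<Longrightarrow> lin_map V W f \<Longrightarrow> lin_map V W (\<lambda>v. scale W c (f v))"
  by (auto simp: lin_map_def vect_scale mult.commute intro: vect_closed)

lemma lin_map_scale [ty]:
  "vect W \<Longrightarrow> w \<in> carr W \<Longrightarrow> lin_map V ground f \<Longrightarrow> lin_map V W (\<lambda>v. scale W (f v) w)"
  by (auto simp: lin_map_def vect_scale intro: vect_closed)

lemma lin_map_times [ty]:
  "lin_map V ground f \<Longrightarrow> lin_map V ground (\<lambda>v. f v * c)"
  "lin_map V ground f \<Longrightarrow> lin_map V ground (\<lambda>v. c * f v)"
  by (auto simp: lin_map_def algebra_simps in_ground)

lemma tens_add:
  assumes "vect V" "vect W"
  shows "tens V W (v + v') w = tens V W v w + tens V W v' w"
    "tens V W v (w + w') = tens V W v w + tens V W v w'"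
  by (auto simp: tens_def bilin_form_def fun_eq_iff Vector_Spaces.linear_def module_hom_def module_hom_axioms_def)

lemma tens_scale2: "tscale c (tens V W v w) = tens V W v (scale W c w)"
  by (auto simp: tens_def bilin_form_def fun_eq_iff linear_form_scale[of "scale W" "\<lambda>w. _ w"])

lemma lin_map_tens [ty]:
  "vect V \<Longrightarrow> vect W \<Longrightarrow> w \<in> carr W \<Longrightarrow> lin_map U V f \<Longrightarrow> lin_map U (tprod V W) (\<lambda>u. tens V W (f u) w)"
  "vect V \<Longrightarrow> vect W \<Longrightarrow> v \<in> carr V \<Longrightarrow> lin_map U W g \<Longrightarrow> lin_map U (tprod V W) (\<lambda>u. tens V W v (g u))"
  by (auto simp: lin_map_def tens_add tens_scale scale_tprod intro: tens_in_tprod)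
    (simp add: tens_scale[symmetric] tens_scale2)

lemma lin_map_sum_list2:
  assumes "vect X" "\<And>p. p \<in> set ps \<Longrightarrow> lin_map U X (\<lambda>u. g u p)"
  shows "lin_map U X (\<lambda>u. \<Sum>p\<leftarrow>ps. g u p)"
  using assms(2)
proof (induction ps)
  case Nil
  then show ?case using assms(1) by (auto simp: lin_map_def vect_scale intro: vect_closed)
next
  case (Cons a ps)
  then show ?case by (auto intro!: lin_map_plus[OF assms(1)])
qed

lemma tlift_closed [ty]:
  assumes "vect V" "vect X" "t \<in> carr (tprod V W)"
    and "\<And>v w. v \<in> carr V \<Longrightarrow> w \<in> carr W \<Longrightarrow> \<phi> v w \<in> carr X"
  shows "tlift V W \<phi> t \<in> carr X"
  unfolding tlift_def using trep[OF assms(1,3)] assms(2,4)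
  by (intro vect_sum_list) auto

lemma lin_map_tlift_const [ty]:
  assumes "vect V" "vect X" "t \<in> carr (tprod V W)"
    and "\<And>v w. v \<in> carr V \<Longrightarrow> w \<in> carr W \<Longrightarrow> lin_map U X (\<lambda>u. \<phi> u v w)"
  shows "lin_map U X (\<lambda>u. tlift V W (\<phi> u) t)"
  unfolding tlift_def using trep[OF assms(1,3)] assms(2,4)
  by (intro lin_map_sum_list2) auto

lemma lin_map_tlift [ty]:
  assumes "vect V" "vect W" "vect X" "bilin_map V W X \<phi>" "lin_map U (tprod V W) g"
  shows "lin_map U X (\<lambda>u. tlift V W \<phi> (g u))"
  by (rule lin_map_comp[OF tlift_universal(1)[OF assms(1-4)] assms(5)])

lemma tlift_tens:
  assumes "vect V" "vect W" "vect X" "bilin_map V W X \<phi>" "v \<in> carr V" "w \<in> carr W"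
  shows "tlift V W \<phi> (tens V W v w) = \<phi> v w"
  using tlift_universal(2) assms by blast

text \<open>\<open>trep\<close> picks its pairs from the carriers, so only values there matter.
  Passed to \<open>simp\<close> as a congruence rule, this makes the carrier membership of Sweedler
  components available below \<open>tlift\<close>.\<close>

lemma tlift_cong:
  assumes "t = t'" "vect V" "t' \<in> carr (tprod V W)"
    and "\<And>v w. v \<in> carr V \<Longrightarrow> w \<in> carr W \<Longrightarrow> \<phi> v w = \<psi> v w"
  shows "tlift V W \<phi> t = tlift V W \<psi> t'"
  unfolding tlift_def assms(1) using trep[OF assms(2,3)] assms(4)
  by (intro arg_cong[where f = sum_list] map_cong) auto

lemma tlift_fun_cong: "(\<And>v w. \<phi> v w = \<psi> v w) \<Longrightarrow> tlift V W \<phi> t = tlift V W \<psi> t"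
  by (simp add: tlift_def)

text \<open>A linear map passes through the finite sum that \<open>tlift\<close> stands for. The
  later \<open>push_\<close> lemmas specialise this to tensors, products and scalings.\<close>

lemma push_lin:
  assumes "lin_map X Y g" "vect X" "vect V" "t \<in> carr (tprod V W)"
    and "\<And>v w. v \<in> carr V \<Longrightarrow> w \<in> carr W \<Longrightarrow> \<phi> v w \<in> carr X"
  shows "g (tlift V W \<phi> t) = tlift V W (\<lambda>v w. g (\<phi> v w)) t"
  unfolding tlift_def using trep[OF assms(3,4)] assms(2,5)
  by (subst lin_map_sum_list[OF assms(2,1)]) (auto simp: case_prod_unfold)

lemma sum_list_swap:
  "(\<Sum>x\<leftarrow>xs. \<Sum>y\<leftarrow>ys. f x y) = (\<Sum>y\<leftarrow>ys. \<Sum>x\<leftarrow>xs. (f x y :: 'a::comm_monoid_add))"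
  by (induction xs) (auto simp: sum_list_addf)

text \<open>Each \<open>tlift\<close> is a sum over a fixed list of representatives, so this is an
  interchange of two finite sums.\<close>

lemma tlift_swap:
  "tlift V W (\<lambda>v w. tlift V' W' (\<lambda>v' w'. \<phi> v w v' w') t') t =
   tlift V' W' (\<lambda>v' w'. tlift V W (\<lambda>v w. \<phi> v w v' w') t) t'"
  unfolding tlift_def case_prod_unfold by (rule sum_list_swap)

lemma push_tlift:
  assumes "vect V'" "vect W'" "vect X" "bilin_map V' W' X \<psi>" "vect V" "t \<in> carr (tprod V W)"
    and "\<And>v w. v \<in> carr V \<Longrightarrow> w \<in> carr W \<Longrightarrow> \<phi> v w \<in> carr (tprod V' W')"
  shows "tlift V' W' \<psi> (tlift V W \<phi> t) = tlift V W (\<lambda>v w. tlift V' W' \<psi> (\<phi> v w)) t"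
  by (rule push_lin[OF tlift_universal(1)[OF assms(1-4)] vect_tprod assms(5-7)])

lemma push_tens1:
  assumes "vect V'" "vect W'" "vect V" "t \<in> carr (tprod V W)" "w' \<in> carr W'"
    and "\<And>v w. v \<in> carr V \<Longrightarrow> w \<in> carr W \<Longrightarrow> \<phi> v w \<in> carr V'"
  shows "tens V' W' (tlift V W \<phi> t) w' = tlift V W (\<lambda>v w. tens V' W' (\<phi> v w) w') t"
  by (rule push_lin[where X=V' and Y="tprod V' W'"], (rule ty assms | assumption)+)

lemma push_tens2:
  assumes "vect V'" "vect W'" "vect V" "t \<in> carr (tprod V W)" "v' \<in> carr V'"
    and "\<And>v w. v \<in> carr V \<Longrightarrow> w \<in> carr W \<Longrightarrow> \<phi> v w \<in> carr W'"
  shows "tens V' W' v' (tlift V W \<phi> t) = tlift V W (\<lambda>v w. tens V' W' v' (\<phi> v w)) t"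
  by (rule push_lin[where X=W' and Y="tprod V' W'"], (rule ty assms | assumption)+)

lemma push_scale:
  assumes "vect X" "vect V" "t \<in> carr (tprod V W)" "\<And>v w. v \<in> carr V \<Longrightarrow> w \<in> carr W \<Longrightarrow> \<phi> v w \<in> carr X"
  shows "scale X c (tlift V W \<phi> t) = tlift V W (\<lambda>v w. scale X c (\<phi> v w)) t"
  by (rule push_lin[where Y=X and X=X], (rule ty assms | assumption)+)

lemma tlift_id:
  assumes "vect V" "vect W" "t \<in> carr (tprod V W)"
  shows "tlift V W (tens V W) t = t"
  unfolding tlift_def using trep[OF assms(1,3)] by auto

lemma tprod_eqI:
  assumes "vect V" "vect W" "lin_map (tprod V W) X f" "lin_map (tprod V W) X g" "t \<in> carr (tprod V W)"
    and "\<And>v w. v \<in> carr V \<Longrightarrow> w \<in> carr W \<Longrightarrow> f (tens V W v w) = g (tens V W v w)"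
  shows "f t = g t"
proof -
  have *: "f t = tlift V W (\<lambda>v w. f (tens V W v w)) t" if "lin_map (tprod V W) X f" for f
  proof -
    have "f (tlift V W (tens V W) t) = tlift V W (\<lambda>v w. f (tens V W v w)) t"
      by (rule push_lin[where Y=X and X="tprod V W"]) (rule that assms(1-5) ty | assumption)+
    then show ?thesis using tlift_id[OF assms(1,2,5)] by simp
  qed
  show ?thesis unfolding *[OF assms(3)] *[OF assms(4)]
    by (rule tlift_cong) (use assms in auto)
qed

lemma tens_same:
  assumes "scale V = scale V'" "scale W = scale W'"
  shows "tens V W = tens V' W'"
  by (intro ext) (simp add: tens_def bilin_form_def assms)

lemma tprod_mono:
  assumes "scale V = scale V'" "scale W = scale W'" "carr V \<subseteq> carr V'" "carr W \<subseteq> carr W'"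
  shows "carr (tprod V W) \<subseteq> carr (tprod V' W')"
proof -
  have "{tens V' W' v w |v w. v \<in> carr V \<and> w \<in> carr W} \<subseteq> {tens V' W' v w |v w. v \<in> carr V' \<and> w \<in> carr W'}"
    using assms(3,4) by auto
  then show ?thesis
    unfolding tprod_def tens_same[OF assms(1,2)] vect.simps
    by (rule module.span_mono[of tscale, unfolded module_iff_vector_space, OF vs_tscale])
qed

text \<open>The representatives chosen for the small spaces and those chosen for the large ones may
  differ; bilinearity on the large spaces makes the two sums agree.\<close>

lemma tlift_restrict:
  assumes "vect V'" "vect W'" "vect V" "vect X" "scale V = scale V'" "scale W = scale W'"
    and "carr V \<subseteq> carr V'" "carr W \<subseteq> carr W'" "bilin_map V' W' X \<phi>" "t \<in> carr (tprod V W)"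
  shows "tlift V W \<phi> t = tlift V' W' \<phi> t"
proof -
  have "tlift V' W' \<phi> (\<Sum>(v, w)\<leftarrow>trep V W t. tens V' W' v w) = (\<Sum>(v, w)\<leftarrow>trep V W t. \<phi> v w)"
    by (rule tlift_sum_list) (use assms trep[OF assms(3,10)] in auto)
  moreover have "(\<Sum>(v, w)\<leftarrow>trep V W t. tens V' W' v w) = t"
    using trep[OF assms(3,10)] tens_same[OF assms(5,6)] by simp
  ultimately show ?thesis by (simp add: tlift_def)
qed

lemma tprod_same:
  assumes "scale V = scale V'" "scale W = scale W'" "carr V = carr V'" "carr W = carr W'"
  shows "tprod V W = tprod V' W'" "tlift V W = tlift V' W'"
  unfolding tprod_def tlift_def trep_def tens_same[OF assms(1,2)] assms(3,4) by (rule refl)+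

section \<open>Algebras and coalgebras, with their axioms in Sweedler form\<close>

lemma algebraD:
  assumes "algebra A"
  shows "vect A" and "bilin_map A A A (mult A)" and [ty]: "one A \<in> carr A"
    and "\<lbrakk>a \<in> carr A; b \<in> carr A; c \<in> carr A\<rbrakk> \<Longrightarrow> mult A (mult A a b) c = mult A a (mult A b c)"
    and "a \<in> carr A \<Longrightarrow> mult A (one A) a = a" and "a \<in> carr A \<Longrightarrow> mult A a (one A) = a"
  using assms by (auto simp: algebra_def)

lemma mult_closed [ty]: "algebra A \<Longrightarrow> a \<in> carr A \<Longrightarrow> b \<in> carr A \<Longrightarrow> mult A a b \<in> carr A"
  using algebraD(2)[of A] by (auto simp: bilin_map_def lin_map_def)

lemma lin_map_mult [ty]:
  "algebra A \<Longrightarrow> b \<in> carr A \<Longrightarrow> lin_map U A f \<Longrightarrow> lin_map U A (\<lambda>u. mult A (f u) b)"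
  "algebra A \<Longrightarrow> a \<in> carr A \<Longrightarrow> lin_map U A g \<Longrightarrow> lin_map U A (\<lambda>u. mult A a (g u))"
  by (rule lin_map_comp[OF bilin_mapD(2)[OF algebraD(2)]], assumption+)
     (rule lin_map_comp[OF bilin_mapD(1)[OF algebraD(2)]], assumption+)

lemma push_mult:
  assumes "algebra A" "vect V" "t \<in> carr (tprod V W)"
   "\<And>v w. v \<in> carr V \<Longrightarrow> w \<in> carr W \<Longrightarrow> \<phi> v w \<in> carr A"
  shows "b \<in> carr A \<Longrightarrow> mult A (tlift V W \<phi> t) b = tlift V W (\<lambda>v w. mult A (\<phi> v w) b) t"
    "b \<in> carr A \<Longrightarrow> mult A b (tlift V W \<phi> t) = tlift V W (\<lambda>v w. mult A b (\<phi> v w)) t"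
  by (rule push_lin[where X=A and Y=A], (rule ty assms algebraD(1)[OF assms(1)] | assumption)+)+

lemma coalgebraD:
  assumes "coalgebra C"
  shows "vect C" and "lin_map C (tprod C C) (comult C)" and "lin_map C ground (counit C)"
    and [ty]: "c \<in> carr C \<Longrightarrow> comult C c \<in> carr (tprod C C)"
  using assms by (auto simp: coalgebra_def lin_map_def)

lemma coalgebra_lin [ty]:
  "coalgebra C \<Longrightarrow> lin_map U C f \<Longrightarrow> lin_map U (tprod C C) (\<lambda>u. comult C (f u))"
  "coalgebra C \<Longrightarrow> lin_map U C f \<Longrightarrow> lin_map U ground (\<lambda>u. counit C (f u))"
  by (rule lin_map_comp[OF coalgebraD(2)], assumption+) (rule lin_map_comp[OF coalgebraD(3)], assumption+)

abbreviation sw :: "('k::field, 'v::ab_group_add, 'x) bialg_scheme \<Rightarrow> 'v \<Rightarrow> ('v \<Rightarrow> 'v \<Rightarrow> 'u::ab_group_add) \<Rightarrow> 'u"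
  where "sw C c \<phi> \<equiv> tlift C C \<phi> (comult C c)"

text \<open>The axiom is an equation between two elements of a triple tensor product. Applying the
  linear map induced by a trilinear \<open>\<phi>\<close> turns it into a rule for Sweedler
  expressions of any shape.\<close>

lemma coassoc:
  assumes C: "coalgebra C" and X: "vect X" and c: "c \<in> carr C"
    and 1: "\<And>y z. y \<in> carr C \<Longrightarrow> z \<in> carr C \<Longrightarrow> lin_map C X (\<lambda>x. \<phi> x y z)"
    and 2: "\<And>x z. x \<in> carr C \<Longrightarrow> z \<in> carr C \<Longrightarrow> lin_map C X (\<lambda>y. \<phi> x y z)"
    and 3: "\<And>x y. x \<in> carr C \<Longrightarrow> y \<in> carr C \<Longrightarrow> lin_map C X (\<lambda>z. \<phi> x y z)"
  shows "sw C c (\<lambda>s z. sw C s (\<lambda>x y. \<phi> x y z)) = sw C c (\<lambda>x s. sw C s (\<lambda>y z. \<phi> x y z))"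
proof -
  let ?F = "tlift (tprod C C) C (\<lambda>t z. tlift C C (\<lambda>x y. \<phi> x y z) t)"
  note [ty] = 1 2 3 C X c coalgebraD(1)[OF C]
  have bi: "bilin_map (tprod C C) C X (\<lambda>t z. tlift C C (\<lambda>x y. \<phi> x y z) t)"
    by (rule ty | assumption)+
  have F: "lin_map (tprod (tprod C C) C) X ?F"
    by (rule tlift_universal(1)) (rule ty bi | assumption)+
  have ev: "?F (tens (tprod C C) C t z) = tlift C C (\<lambda>x y. \<phi> x y z) t" if "t \<in> carr (tprod C C)" "z \<in> carr C" for t z
    by (rule tlift_tens[where X=X]) (rule ty bi that | assumption)+
  have "sw C c (\<lambda>c1 c2. tens (tprod C C) C (comult C c1) c2) =
        sw C c (\<lambda>c1 c2. sw C c2 (\<lambda>c3 c4. tens (tprod C C) C (tens C C c1 c3) c4))"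
    using C c unfolding coalgebra_def by (elim conjE) (erule (1) bspec)
  then have eq: "?F (sw C c (\<lambda>c1 c2. tens (tprod C C) C (comult C c1) c2)) =
        ?F (sw C c (\<lambda>c1 c2. sw C c2 (\<lambda>c3 c4. tens (tprod C C) C (tens C C c1 c3) c4)))" by simp
  have L: "?F (sw C c (\<lambda>c1 c2. tens (tprod C C) C (comult C c1) c2)) = sw C c (\<lambda>s z. sw C s (\<lambda>x y. \<phi> x y z))"
    apply (subst push_lin[OF F])
    apply (rule ty | assumption)+
    apply (rule tlift_cong)
    apply  (rule refl ty ev | assumption)+
    done
  have R1: "?F (sw C s (\<lambda>c3 c4. tens (tprod C C) C (tens C C x c3) c4)) = sw C s (\<lambda>y z. \<phi> x y z)"
    if "x \<in> carr C" "s \<in> carr C" for x s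
  proof -
    have *: "?F (tens (tprod C C) C (tens C C x y) z) = \<phi> x y z" if "y \<in> carr C" "z \<in> carr C" for y z
      apply (subst ev)
      apply (rule ty that \<open>x \<in> carr C\<close> | assumption)+
      apply (subst tlift_tens[where X=X])
      apply (rule ty that \<open>x \<in> carr C\<close> refl | assumption)+
      done
    show ?thesis
      apply (subst push_lin[OF F])
      apply (rule ty that | assumption)+
      apply (rule tlift_cong)
      apply (rule refl ty that * | assumption)+
      done
  qed
  have R: "?F (sw C c (\<lambda>c1 c2. sw C c2 (\<lambda>c3 c4. tens (tprod C C) C (tens C C c1 c3) c4))) =
    sw C c (\<lambda>x s. sw C s (\<lambda>y z. \<phi> x y z))"
    apply (subst push_lin[OF F])
    apply (rule ty | assumption)+
    apply (rule tlift_cong)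
    apply  (rule refl ty R1 | assumption)+
    done
  show ?thesis using eq L R by simp
qed

lemma counit_sw:
  assumes C: "coalgebra C" and X: "vect X" and c: "c \<in> carr C" and f: "lin_map C X f"
  shows "sw C c (\<lambda>x y. scale X (counit C x) (f y)) = f c"
    "sw C c (\<lambda>x y. scale X (counit C y) (f x)) = f c"
proof -
  note [ty] = C X c f coalgebraD(1)[OF C]
  have cu: "sw C c (\<lambda>x y. scale C (counit C x) y) = c" "sw C c (\<lambda>x y. scale C (counit C y) x) = c"
  proof -
    have "\<forall>c\<in>carr C. sw C c (\<lambda>x y. scale C (counit C x) y) = c \<and> sw C c (\<lambda>x y. scale C (counit C y) x) = c"
      using C unfolding coalgebra_def by (elim conjE)
    from bspec[OF this c] show "sw C c (\<lambda>x y. scale C (counit C x) y) = c" "sw C c (\<lambda>x y. scale C (counit C y) x) = c"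
      by (rule conjunct1, rule conjunct2)
  qed
  have fs: "f (scale C a y) = scale X a (f y)" if "y \<in> carr C" for a y
    using f that by (rule lin_mapD)
  have "f (sw C c (\<lambda>x y. scale C (counit C x) y)) = sw C c (\<lambda>x y. scale X (counit C x) (f y))"
    apply (subst push_lin[OF f])
    apply (rule ty | assumption)+
    apply (rule tlift_cong)
    apply  (rule refl ty fs | assumption)+
    done
  then show "sw C c (\<lambda>x y. scale X (counit C x) (f y)) = f c"
    unfolding cu by (rule sym)
  have "f (sw C c (\<lambda>x y. scale C (counit C y) x)) = sw C c (\<lambda>x y. scale X (counit C y) (f x))"
    apply (subst push_lin[OF f])
    apply (rule ty | assumption)+
    apply (rule tlift_cong)
    apply  (rule refl ty fs | assumption)+
    done
  then show "sw C c (\<lambda>x y. scale X (counit C y) (f x)) = f c"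
    unfolding cu by (rule sym)
qed

section \<open>Hopf algebras\<close>

text \<open>The rules \<open>swr\<close> must be instantiated at the target space \<open>X\<close>, which most of their conclusions do not determine.\<close>

named_theorems swr
named_theorems pu

declare tlift_tens [swr] push_tlift [swr] coassoc [swr] counit_sw [swr]
declare push_tens1 [pu] push_tens2 [pu] push_mult [pu]

lemma sw_push [swr]:
  assumes "coalgebra C" "vect X" "bilin_map C C X \<phi>" "vect V" "t \<in> carr (tprod V W)"
    and "\<And>v w. v \<in> carr V \<Longrightarrow> w \<in> carr W \<Longrightarrow> \<psi> v w \<in> carr C"
  shows "sw C (tlift V W \<psi> t) \<phi> = tlift V W (\<lambda>v w. sw C (\<psi> v w) \<phi>) t"
  by (rule push_lin[where X=C and Y=X and g="\<lambda>c. sw C c \<phi>"])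
     (rule ty assms coalgebraD(1)[OF assms(1)] | assumption)+

text \<open>Scalars move outwards, where counit factors have the shape that \<open>counit_sw\<close>
  expects.\<close>

lemma tens_scale_out [simp]:
  "tens V W (scale V c v) w = scale (tprod V W) c (tens V W v w)"
  "tens V W v (scale W c w) = scale (tprod V W) c (tens V W v w)"
  by (simp_all only: scale_tprod tens_scale[symmetric] tens_scale2[symmetric])

lemma mult_scale_out:
  assumes "algebra A" "a \<in> carr A" "b \<in> carr A"
  shows "mult A (scale A c a) b = scale A c (mult A a b)" "mult A a (scale A c b) = scale A c (mult A a b)"
  using algebraD(2)[OF assms(1)] assms(2,3) by (auto simp: bilin_map_def lin_map_def)

lemma bialgebraD:
  assumes "bialgebra A"
  shows "algebra A" "coalgebra A" "vect A" "counit A (one A) = 1"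
    "\<And>a b. a \<in> carr A \<Longrightarrow> b \<in> carr A \<Longrightarrow> counit A (mult A a b) = counit A a * counit A b"
    "comult A (one A) = tens A A (one A) (one A)"
    "\<And>a b. a \<in> carr A \<Longrightarrow> b \<in> carr A \<Longrightarrow> comult A (mult A a b) =
        tlift A A (\<lambda>a1 a2. tlift A A (\<lambda>b1 b2. tens A A (mult A a1 b1) (mult A a2 b2)) (comult A b)) (comult A a)"
  using assms unfolding bialgebra_def algebra_def by auto

lemma sw_mult [swr]:
  assumes A: "bialgebra A" and X: "vect X" and \<phi>: "bilin_map A A X \<phi>" and ab: "a \<in> carr A" "b \<in> carr A"
  shows "sw A (mult A a b) \<phi> = sw A a (\<lambda>a1 a2. sw A b (\<lambda>b1 b2. \<phi> (mult A a1 b1) (mult A a2 b2)))"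
  unfolding bialgebraD(7)[OF A ab]
  using X \<phi> ab bialgebraD(1-3)[OF A] by (simp add: push_tlift[where X=X] tlift_tens[where X=X] ty cong: tlift_cong)

lemma sw_one [swr]:
  assumes A: "bialgebra A" and X: "vect X" and \<phi>: "bilin_map A A X \<phi>"
  shows "sw A (one A) \<phi> = \<phi> (one A) (one A)"
  unfolding bialgebraD(6)[OF A]
  using X \<phi> bialgebraD(1-3)[OF A] by (simp add: tlift_tens[where X=X] ty)

lemma bialg_mapD:
  assumes "bialg_map A B f"
  shows "bialgebra A" "bialgebra B" "lin_map A B f" "f (one A) = one B"
    "\<And>a b. a \<in> carr A \<Longrightarrow> b \<in> carr A \<Longrightarrow> f (mult A a b) = mult B (f a) (f b)"
    "\<And>a. a \<in> carr A \<Longrightarrow> counit B (f a) = counit A a"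
    "\<And>a. a \<in> carr A \<Longrightarrow> comult B (f a) = sw A a (\<lambda>a1 a2. tens B B (f a1) (f a2))"
    "\<And>a. a \<in> carr A \<Longrightarrow> f a \<in> carr B"
  using assms unfolding bialg_map_def lin_map_def by auto

lemma sw_bialg_map:
  assumes f: "bialg_map A B f" and X: "vect X" and \<phi>: "bilin_map B B X \<phi>" and a: "a \<in> carr A"
  shows "sw B (f a) \<phi> = sw A a (\<lambda>x y. \<phi> (f x) (f y))"
  unfolding bialg_mapD(7)[OF f a]
  using X \<phi> a bialgebraD(1-3)[OF bialg_mapD(1)[OF f]] bialgebraD(1-3)[OF bialg_mapD(2)[OF f]] bialg_mapD(8)[OF f]
    by (simp add: push_tlift[where X=X] tlift_tens[where X=X] ty cong: tlift_cong)

text \<open>The tensor product algebra, needed as the target of a convolution in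
  \<open>comult_S\<close>. The coalgebra fields are fillers.\<close>

definition talg ::
  "('k::field, 'v::ab_group_add, 'x) bialg_scheme \<Rightarrow> ('k, 'w::ab_group_add, 'y) bialg_scheme \<Rightarrow>
   ('k, ('k, 'v, 'w) tensor) bialg" where
  "talg A B = \<lparr>carr = carr (tprod A B), scale = scale (tprod A B),
     mult = (\<lambda>s t. tlift A B (\<lambda>a b. tlift A B (\<lambda>a' b'. tens A B (mult A a a') (mult B b b')) t) s),
     one = tens A B (one A) (one B), comult = undefined, counit = undefined\<rparr>"

lemma talg_algebra:
  assumes A: "algebra A" and B: "algebra B"
  shows "algebra (talg A B)"
proof -
  note f[ty] = A B algebraD(1)[OF A] algebraD(1)[OF B]
  let ?M = "\<lambda>s t. tlift A B (\<lambda>a b. tlift A B (\<lambda>a' b'. tens A B (mult A a a') (mult B b b')) t) s"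
  let ?T = "tprod A B"
  have v: "vect (talg A B) = vect ?T" "bilin_map (talg A B) (talg A B) (talg A B) (mult (talg A B)) = bilin_map ?T ?T ?T ?M"
    by (simp_all add: vect_def bilin_map_def lin_map_def talg_def)
  have 1: "bilin_map ?T ?T ?T ?M" by (rule ty | assumption)+
  have 2: "?M (?M a b) c = ?M a (?M b c)" if "a \<in> carr ?T" "b \<in> carr ?T" "c \<in> carr ?T" for a b c
    using that by (simp add: ty push_tlift[where X="?T"] tlift_tens[where X="?T"] algebraD(4) cong: tlift_cong)
  have 3: "?M (tens A B (one A) (one B)) a = a" "?M a (tens A B (one A) (one B)) = a" if "a \<in> carr ?T" for a
    using that tlift_id[OF f(3,4) that]
    by (simp_all add: ty tlift_tens[where X="?T"] algebraD(5,6) cong: tlift_cong)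
  show ?thesis unfolding algebra_def v
    using 1 2 3 by (simp add: talg_def ty)
qed

text \<open>In the convolution algebra of maps from C to X, f = f(gh) = (fg)h = h: a left and a
  right inverse of g coincide.\<close>

lemma cv_unique:
  assumes C: "coalgebra C" and X: "algebra X" and f: "lin_map C X f" and g: "lin_map C X g" and h: "lin_map C X h"
    and fg: "\<And>c. c \<in> carr C \<Longrightarrow> sw C c (\<lambda>x y. mult X (f x) (g y)) = scale X (counit C c) (one X)"
    and gh: "\<And>c. c \<in> carr C \<Longrightarrow> sw C c (\<lambda>x y. mult X (g x) (h y)) = scale X (counit C c) (one X)"
    and c: "c \<in> carr C"
  shows "f c = h c"
proof -
  note [ty] = C X algebraD(1)[OF X] coalgebraD(1)[OF C] lin_map_comp[OF f] lin_map_comp[OF g] lin_map_comp[OF h] f g h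
    lin_mapD(1)[OF f] lin_mapD(1)[OF g] lin_mapD(1)[OF h]
  have 1: "sw C c (\<lambda>x t. mult X (f x) (sw C t (\<lambda>y z. mult X (g y) (h z)))) = f c"
    using c by (simp add: gh ty mult_scale_out algebraD(6) counit_sw[where X=X] cong: tlift_cong)
  have 2: "sw C c (\<lambda>s z. mult X (sw C s (\<lambda>x y. mult X (f x) (g y))) (h z)) = h c"
    using c by (simp add: fg ty mult_scale_out algebraD(5) counit_sw[where X=X] cong: tlift_cong)
  have "sw C c (\<lambda>s z. mult X (sw C s (\<lambda>x y. mult X (f x) (g y))) (h z)) =
    sw C c (\<lambda>x t. mult X (f x) (sw C t (\<lambda>y z. mult X (g y) (h z))))"
    using c by (simp add: ty pu algebraD(4) coassoc[where X=X] cong: tlift_cong)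
  then show ?thesis unfolding 1 2 by (rule sym)
qed

locale hopf =
  fixes H :: "('k::field, 'h::ab_group_add, 'x) bialg_scheme" and S :: "'h \<Rightarrow> 'h"
  assumes bialg [simp, ty]: "bialgebra H" and antip: "antipode H S"
begin

lemma H_facts [simp, ty]: "algebra H" "coalgebra H" "vect H"
  using bialgebraD[OF bialg] by auto

lemma S_lin: "lin_map H H S"
  using antip by (simp add: antipode_def)

lemmas S_ty [ty] = S_lin lin_map_comp[OF S_lin] lin_mapD(1)[OF S_lin]

lemma S_left: "h \<in> carr H \<Longrightarrow> sw H h (\<lambda>h1 h2. mult H (S h1) h2) = scale H (counit H h) (one H)"
  and S_right: "h \<in> carr H \<Longrightarrow> sw H h (\<lambda>h1 h2. mult H h1 (S h2)) = scale H (counit H h) (one H)"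
  using antip by (auto simp: antipode_def)

lemma S_lin_apply:
  assumes X: "vect X" and h: "h \<in> carr H" and \<psi>: "lin_map H X \<psi>"
  shows "sw H h (\<lambda>x y. \<psi> (mult H (S x) y)) = scale X (counit H h) (\<psi> (one H))"
    "sw H h (\<lambda>x y. \<psi> (mult H x (S y))) = scale X (counit H h) (\<psi> (one H))"
proof -
  note [ty] = X h \<psi>
  have "\<psi> (sw H h (\<lambda>x y. mult H (S x) y)) = sw H h (\<lambda>x y. \<psi> (mult H (S x) y))"
    by (rule push_lin[OF \<psi>]) (rule ty | assumption)+
  then show "sw H h (\<lambda>x y. \<psi> (mult H (S x) y)) = scale X (counit H h) (\<psi> (one H))"
    by (simp add: S_left h lin_mapD(3)[OF \<psi>] ty)
  have "\<psi> (sw H h (\<lambda>x y. mult H x (S y))) = sw H h (\<lambda>x y. \<psi> (mult H x (S y)))"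
    by (rule push_lin[OF \<psi>]) (rule ty | assumption)+
  then show "sw H h (\<lambda>x y. \<psi> (mult H x (S y))) = scale X (counit H h) (\<psi> (one H))"
    by (simp add: S_right h lin_mapD(3)[OF \<psi>] ty)
qed

text \<open>Of three consecutive legs two neighbours contract by the antipode to a counit value,
  which is then absorbed into the remaining leg.\<close>

lemma cancel:
  assumes X: "vect X" and h: "h \<in> carr H" and \<psi>: "bilin_map H H X \<psi>"
  shows "sw H h (\<lambda>x t. sw H t (\<lambda>y z. \<psi> (mult H (S x) y) z)) = \<psi> (one H) h"
    "sw H h (\<lambda>x t. sw H t (\<lambda>y z. \<psi> (mult H x (S y)) z)) = \<psi> (one H) h"
    "sw H h (\<lambda>x t. sw H t (\<lambda>y z. \<psi> x (mult H (S y) z))) = \<psi> h (one H)"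
    "sw H h (\<lambda>x t. sw H t (\<lambda>y z. \<psi> x (mult H y (S z)))) = \<psi> h (one H)"
proof -
  note [ty] = X h bilin_ty[OF \<psi>]
  note ca = coassoc[OF H_facts(2) X h, symmetric]
  have "sw H h (\<lambda>x t. sw H t (\<lambda>y z. \<psi> (mult H (S x) y) z)) = sw H h (\<lambda>s z. sw H s (\<lambda>x y. \<psi> (mult H (S x) y) z))"
    by (rule ca) (rule ty | assumption)+
  also have "\<dots> = \<psi> (one H) h"
    using h by (simp add: ty S_lin_apply[where X=X and \<psi>="\<lambda>u. \<psi> u _"] counit_sw[where X=X] cong: tlift_cong)
  finally show "sw H h (\<lambda>x t. sw H t (\<lambda>y z. \<psi> (mult H (S x) y) z)) = \<psi> (one H) h" .
  have "sw H h (\<lambda>x t. sw H t (\<lambda>y z. \<psi> (mult H x (S y)) z)) = sw H h (\<lambda>s z. sw H s (\<lambda>x y. \<psi> (mult H x (S y)) z))"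
    by (rule ca) (rule ty | assumption)+
  also have "\<dots> = \<psi> (one H) h"
    using h by (simp add: ty S_lin_apply[where X=X and \<psi>="\<lambda>u. \<psi> u _"] counit_sw[where X=X] cong: tlift_cong)
  finally show "sw H h (\<lambda>x t. sw H t (\<lambda>y z. \<psi> (mult H x (S y)) z)) = \<psi> (one H) h" .
  show "sw H h (\<lambda>x t. sw H t (\<lambda>y z. \<psi> x (mult H (S y) z))) = \<psi> h (one H)"
    using h by (simp add: ty S_lin_apply[where X=X and \<psi>="\<psi> _"] counit_sw[where X=X] cong: tlift_cong)
  show "sw H h (\<lambda>x t. sw H t (\<lambda>y z. \<psi> x (mult H y (S z)))) = \<psi> h (one H)"
    using h by (simp add: ty S_lin_apply[where X=X and \<psi>="\<psi> _"] counit_sw[where X=X] cong: tlift_cong)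
qed

lemma S_one [simp]: "S (one H) = one H"
proof -
  have "sw H (one H) (\<lambda>h1 h2. mult H (S h1) h2) = S (one H)"
    by (simp add: swr[where X=H] ty algebraD(6))
  then show ?thesis using S_left[of "one H"] by (simp add: bialgebraD(4) vect_scale ty)
qed

lemma counit_S: "h \<in> carr H \<Longrightarrow> counit H (S h) = counit H h"
proof -
  assume h: "h \<in> carr H"
  have "counit H (sw H h (\<lambda>x y. mult H (S x) y)) = sw H h (\<lambda>x y. counit H (mult H (S x) y))"
    by (rule push_lin[OF coalgebraD(3)]) (rule ty h| assumption)+
  also have "\<dots> = sw H h (\<lambda>x y. scale ground (counit H y) (counit H (S x)))"
    using h by (simp add: ty bialgebraD(5) mult.commute cong: tlift_cong)
  also have "\<dots> = counit H (S h)"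
    by (rule counit_sw) (rule ty h | assumption)+
  finally show ?thesis using h
    by (simp add: S_left lin_mapD(3)[OF coalgebraD(3)] bialgebraD(4) ty)
qed

lemma S_mult:
  assumes ab: "a \<in> carr H" "b \<in> carr H"
  shows "S (mult H a b) = mult H (S b) (S a)"
proof -
  note [ty] = ab
  \<comment> \<open>The triple product S(a1 b1) (a2 b2) (S(b3) S(a3)): contracting its last two
    factors leaves the left side of the claim, contracting its first two leaves the right
    side.\<close>
  let ?E = "sw H a (\<lambda>a1 a'. sw H a' (\<lambda>a2 a3. sw H b (\<lambda>b1 b'. sw H b' (\<lambda>b2 b3.
    mult H (S (mult H a1 b1)) (mult H (mult H a2 b2) (mult H (S b3) (S a3)))))))"
  have inner: "sw H b' (\<lambda>b2 b3. mult H (mult H a2 b2) (mult H (S b3) (S a3))) = scale H (counit H b') (mult H a2 (S a3))"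
    if [ty]: "a2 \<in> carr H" "a3 \<in> carr H" "b' \<in> carr H" for a2 a3 b'
  proof -
    have "sw H b' (\<lambda>b2 b3. mult H (mult H a2 b2) (mult H (S b3) (S a3))) =
       sw H b' (\<lambda>b2 b3. mult H a2 (mult H (mult H b2 (S b3)) (S a3)))"
      using that by (simp add: ty algebraD(4) cong: tlift_cong)
    also have "\<dots> = scale H (counit H b') (mult H a2 (S a3))"
      using that by (simp add: ty S_lin_apply[where X=H and \<psi>="\<lambda>u. mult H a2 (mult H u (S a3))"] algebraD(5))
    finally show ?thesis .
  qed
  have "?E = sw H a (\<lambda>a1 a'. sw H b (\<lambda>b1 b'. sw H a' (\<lambda>a2 a3. sw H b' (\<lambda>b2 b3.
    mult H (S (mult H a1 b1)) (mult H (mult H a2 b2) (mult H (S b3) (S a3)))))))"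
    by (subst tlift_swap) (rule refl)
  also have "\<dots> = sw H a (\<lambda>a1 a'. sw H b (\<lambda>b1 b'. 
    mult H (S (mult H a1 b1)) (sw H a' (\<lambda>a2 a3. sw H b' (\<lambda>b2 b3. mult H (mult H a2 b2) (mult H (S b3) (S a3)))))))"
    by (simp add: ty pu cong: tlift_cong)
  also have "\<dots> = sw H a (\<lambda>a1 a'. sw H b (\<lambda>b1 b'. scale H (counit H b') (scale H (counit H a') (S (mult H a1 b1)))))"
    by (simp add: ty inner push_scale[symmetric] S_right mult_scale_out algebraD(6) cong: tlift_cong)
  also have "\<dots> = S (mult H a b)"
    by (simp add: ty counit_sw[where X=H] cong: tlift_cong)
  finally have 1: "?E = S (mult H a b)" .
  have "?E = sw H a (\<lambda>s a3. sw H s (\<lambda>a1 a2. sw H b (\<lambda>t b3. sw H t (\<lambda>b1 b2. 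
     mult H (mult H (S (mult H a1 b1)) (mult H a2 b2)) (mult H (S b3) (S a3))))))"
    by (simp add: ty algebraD(4) coassoc[where X=H] cong: tlift_cong)
  also have "\<dots> = sw H a (\<lambda>s a3. sw H b (\<lambda>t b3. 
      mult H (sw H s (\<lambda>a1 a2. sw H t (\<lambda>b1 b2. mult H (S (mult H a1 b1)) (mult H a2 b2)))) (mult H (S b3) (S a3))))"
    by (subst tlift_swap) (simp add: ty pu cong: tlift_cong)
  also have "\<dots> = sw H a (\<lambda>s a3. sw H b (\<lambda>t b3. 
      mult H (sw H (mult H s t) (\<lambda>x y. mult H (S x) y)) (mult H (S b3) (S a3))))"
    by (simp add: ty sw_mult[where X=H] cong: tlift_cong)
  also have "\<dots> = sw H a (\<lambda>s a3. sw H b (\<lambda>t b3. scale H (counit H s) (scale H (counit H t) (mult H (S b3) (S a3)))))"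
    by (simp add: ty S_left mult_scale_out algebraD(5) bialgebraD(5) vect_scale cong: tlift_cong)
  also have "\<dots> = mult H (S b) (S a)"
    by (simp add: ty counit_sw[where X=H] push_scale[symmetric] cong: tlift_cong)
  finally show ?thesis using 1 by simp
qed

text \<open>Both sides invert the coproduct under convolution with values in H \<otimes> H: the left
  one because the coproduct is multiplicative, the right one because its legs cancel from the inside
  out. Inverses agree by \<open>cv_unique\<close>.\<close>

lemma comult_S:
  assumes h: "h \<in> carr H"
  shows "comult H (S h) = sw H h (\<lambda>x y. tens H H (S y) (S x))"
proof -
  let ?T = "talg H H"
  have T: "algebra ?T" by (simp add: talg_algebra)
  have sT: "scale ?T = scale (tprod H H)" "carr ?T = carr (tprod H H)" "one ?T = tens H H (one H) (one H)"
    by (simp_all add: talg_def)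
  have lT: "lin_map U ?T = lin_map U (tprod H H)" for U :: "('k, 'h, 'x) bialg_scheme"
    by (intro ext) (simp add: lin_map_def talg_def)
  have mc: "mult ?T (comult H x) (comult H y) = comult H (mult H x y)" if "x \<in> carr H" "y \<in> carr H" for x y
    using that by (simp add: talg_def bialgebraD(7))
  show ?thesis
  proof (rule cv_unique[OF H_facts(2) T, where f="\<lambda>h. comult H (S h)" and g="comult H" and h="\<lambda>h. sw H h (\<lambda>x y. tens H H (S y) (S x))"])
    show "lin_map H ?T (\<lambda>h. comult H (S h))" "lin_map H ?T (comult H)" "lin_map H ?T (\<lambda>h. sw H h (\<lambda>x y. tens H H (S y) (S x)))"
      unfolding lT by (rule ty | assumption)+
    show "h \<in> carr H" by fact
    fix c assume c[ty]: "c \<in> carr H"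
    have "sw H c (\<lambda>x y. mult ?T (comult H (S x)) (comult H y)) = comult H (sw H c (\<lambda>x y. mult H (S x) y))"
      by (subst push_lin[OF coalgebraD(2)]) (simp_all add: ty mc cong: tlift_cong)
    also have "\<dots> = scale ?T (counit H c) (one ?T)"
      by (simp add: S_left c lin_mapD(3)[OF coalgebraD(2)] ty bialgebraD(6) sT)
    finally show "sw H c (\<lambda>x y. mult ?T (comult H (S x)) (comult H y)) = scale ?T (counit H c) (one ?T)" .
    let ?X = "tprod H H"
    have k: "sw H t (\<lambda>h2 t'. sw H t' (\<lambda>h3 h4. tens H H (mult H h1 (S h4)) (mult H h2 (S h3)))) = tens H H (mult H h1 (S t)) (one H)"
      if "h1 \<in> carr H" "t \<in> carr H" for h1 t
      by (rule cancel(2)[where X="?X" and \<psi>="\<lambda>u v. tens H H (mult H h1 (S v)) u"]) (rule ty that | assumption)+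
    have "sw H c (\<lambda>x y. mult ?T (comult H x) (sw H y (\<lambda>x y. tens H H (S y) (S x)))) =
      sw H c (\<lambda>h1 t. sw H t (\<lambda>h2 t'. sw H t' (\<lambda>h3 h4. tens H H (mult H h1 (S h4)) (mult H h2 (S h3)))))"
      by (simp add: talg_def ty swr[where X="?X"] cong: tlift_cong)
    also have "\<dots> = sw H c (\<lambda>h1 t. tens H H (mult H h1 (S t)) (one H))"
      by (simp add: k ty cong: tlift_cong)
    also have "\<dots> = scale ?X (counit H c) (tens H H (one H) (one H))"
      by (rule S_lin_apply(2)[where X="?X" and \<psi>="\<lambda>u. tens H H u (one H)"]) (rule ty | assumption)+
    finally show "sw H c (\<lambda>x y. mult ?T (comult H x) (sw H y (\<lambda>x y. tens H H (S y) (S x)))) = scale ?T (counit H c) (one ?T)"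
      by (simp add: sT)
  qed
qed

lemma sw_S:
  assumes X: "vect X" and \<phi>: "bilin_map H H X \<phi>" and h: "h \<in> carr H"
  shows "sw H (S h) \<phi> = sw H h (\<lambda>x y. \<phi> (S y) (S x))"
  unfolding comult_S[OF h]
  using X \<phi> h by (simp add: push_tlift[where X=X] tlift_tens[where X=X] ty cong: tlift_cong)

lemma antipode_unique:
  assumes "antipode H T" "h \<in> carr H"
  shows "T h = S h"
proof (rule cv_unique[OF H_facts(2) H_facts(1), where f=T and g="\<lambda>x. x" and h=S])
  show "lin_map H H T" "lin_map H H S" "h \<in> carr H" "lin_map H H (\<lambda>x. x)"
    using assms by (auto simp: antipode_def ty)
  show "sw H c (\<lambda>x y. mult H (T x) y) = scale H (counit H c) (one H)"
    "sw H c (\<lambda>x y. mult H x (S y)) = scale H (counit H c) (one H)" if "c \<in> carr H" for c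
    using assms that S_right by (auto simp: antipode_def)
qed

end

section \<open>Separation of tensors by functionals\<close>

lemma linear_lin_map:
  assumes "Vector_Spaces.linear (scale V) (*) \<alpha>"
  shows "lin_map V ground \<alpha>"
proof -
  interpret Vector_Spaces.linear "scale V" "(*)" \<alpha> by fact
  show ?thesis by (simp add: lin_map_def add scale ground_def)
qed

text \<open>Induction on the length of the sum. If the first left entry v is nonzero, a functional
  \<open>\<alpha>0\<close> with \<open>\<alpha>0 v \<noteq> 0\<close> expresses w through the other
  right entries, so the first summand can be distributed over the remaining ones.\<close>

lemma tens_sep_list:
  fixes V :: "('k::field, 'v::ab_group_add, 'x) vect_scheme" and W :: "('k, 'w::ab_group_add, 'y) vect_scheme"
  assumes V: "vect V" and W: "vect W"
    and P: "\<And>\<alpha>. \<alpha> \<in> P \<Longrightarrow> lin_map V ground \<alpha>" "\<And>v. v \<in> carr V \<Longrightarrow> (\<And>\<alpha>. \<alpha> \<in> P \<Longrightarrow> \<alpha> v = 0) \<Longrightarrow> v = 0"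
    and Q: "\<And>\<beta>. \<beta> \<in> Q \<Longrightarrow> lin_map W ground \<beta>" "\<And>w. w \<in> carr W \<Longrightarrow> (\<And>\<beta>. \<beta> \<in> Q \<Longrightarrow> \<beta> w = 0) \<Longrightarrow> w = 0"
    and ps: "set ps \<subseteq> carr V \<times> carr W"
    and z: "\<And>\<alpha> \<beta>. \<alpha> \<in> P \<Longrightarrow> \<beta> \<in> Q \<Longrightarrow> (\<Sum>(v, w)\<leftarrow>ps. \<alpha> v * \<beta> w) = 0"
  shows "(\<Sum>(v, w)\<leftarrow>ps. tens V W v w) = 0"
  using ps z
proof (induction "length ps" arbitrary: ps)
  case 0
  then show ?case by simp
next
  case (Suc n)
  then obtain v w qs where ps: "ps = (v, w) # qs" and n: "n = length qs" by (cases ps) auto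
  have vw: "v \<in> carr V" "w \<in> carr W" and qs: "set qs \<subseteq> carr V \<times> carr W" using Suc.prems ps by auto
  have z: "\<alpha> v * \<beta> w + (\<Sum>(v, w)\<leftarrow>qs. \<alpha> v * \<beta> w) = 0" if "\<alpha> \<in> P" "\<beta> \<in> Q" for \<alpha> \<beta>
    using Suc.prems(2)[OF that] ps by simp
  show ?case
  proof (cases "v = 0")
    case True
    have "tens V W v w = 0"
      using tens_scale[of 0 V W v w] True V by (simp add: vect_scale fun_eq_iff)
    moreover have "\<alpha> v = 0" if "\<alpha> \<in> P" for \<alpha> using lin_map_0[OF V P(1)[OF that]] True by simp
    moreover have "(\<Sum>(v, w)\<leftarrow>qs. \<alpha> v * \<beta> w) = 0" if "\<alpha> \<in> P" "\<beta> \<in> Q" for \<alpha> \<beta>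
      using z[OF that] calculation(2)[OF that(1)] by simp
    ultimately show ?thesis using Suc.hyps(1)[OF n qs] ps by simp
  next
    case False
    then obtain \<alpha>0 where \<alpha>0: "\<alpha>0 \<in> P" "\<alpha>0 v \<noteq> 0" using P(2)[OF vw(1)] by blast
    \<comment> \<open>The coefficient of v in x along the kernel of \<open>\<alpha>0\<close>.
      Pairing the whole sum with \<open>\<alpha>0\<close> and dividing by \<open>\<alpha>0 v\<close>
      will give w + s = 0.\<close>
    define c where "c x = \<alpha>0 x / \<alpha>0 v" for x
    define s where "s = (\<Sum>(x, y)\<leftarrow>qs. scale W (c x) y)"
    have s: "s \<in> carr W" unfolding s_def using qs by (intro vect_sum_list[OF W]) (auto intro: scale_closed[OF W])
    have \<beta>s: "\<beta> s = (\<Sum>(x, y)\<leftarrow>qs. c x * \<beta> y)" if "\<beta> \<in> Q" for \<beta>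
    proof -
      have "\<beta> s = (\<Sum>p\<leftarrow>qs. \<beta> (case p of (x, y) \<Rightarrow> scale W (c x) y))"
        unfolding s_def by (rule lin_map_sum_list[OF W Q(1)[OF that]])
          (use qs in \<open>auto intro: scale_closed[OF W]\<close>)
      also have "\<dots> = (\<Sum>(x, y)\<leftarrow>qs. c x * \<beta> y)"
        by (rule arg_cong[where f=sum_list], rule map_cong)
          (use qs lin_mapD(3)[OF Q(1)[OF that]] in auto)
      finally show ?thesis .
    qed
    have csum: "(\<Sum>(x, y)\<leftarrow>qs. c x * \<beta> y) = (\<Sum>(x, y)\<leftarrow>qs. \<alpha>0 x * \<beta> y) / \<alpha>0 v" for \<beta>
      by (induction qs) (auto simp: c_def add_divide_distrib)
    have "w + s = 0"
    proof (rule Q(2))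
      show "w + s \<in> carr W" using vw s W by (intro plus_closed)
      fix \<beta> assume \<beta>: "\<beta> \<in> Q"
      have "\<beta> (w + s) = \<beta> w + \<beta> s" using lin_mapD(2)[OF Q(1)[OF \<beta>] vw(2) s] .
      also have "\<dots> = (\<alpha>0 v * \<beta> w + (\<Sum>(v, w)\<leftarrow>qs. \<alpha>0 v * \<beta> w)) / \<alpha>0 v"
        using \<beta>s[OF \<beta>] csum \<alpha>0(2) by (simp add: add_divide_distrib)
      finally show "\<beta> (w + s) = 0" using z[OF \<alpha>0(1) \<beta>] by simp
    qed
    \<comment> \<open>Each x is moved into the kernel of \<open>\<alpha>0\<close>. As w = - s, the
      shorter sum represents the same tensor as the whole sum.\<close>
    define qs' where "qs' = map (\<lambda>(x, y). (x - scale V (c x) v, y)) qs"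
    have qs': "set qs' \<subseteq> carr V \<times> carr W"
      using qs vw V by (auto simp: qs'_def intro!: vect_minus scale_closed)
    have "(\<Sum>(v, w)\<leftarrow>qs'. tens V W v w) = 0"
    proof (rule Suc.hyps(1))
      show "n = length qs'" by (simp add: n qs'_def)
      show "set qs' \<subseteq> carr V \<times> carr W" by (rule qs')
      fix \<alpha> \<beta> assume ab: "\<alpha> \<in> P" "\<beta> \<in> Q"
      have "(\<Sum>(x, y)\<leftarrow>qs'. \<alpha> x * \<beta> y) = (\<Sum>(x, y)\<leftarrow>qs. \<alpha> x * \<beta> y) - \<alpha> v * (\<Sum>(x, y)\<leftarrow>qs. c x * \<beta> y)"
        unfolding qs'_def using qs
        by (induction qs) (auto simp: lin_map_minus[OF V P(1)[OF ab(1)]] scale_closed[OF V] vw lin_mapD(3)[OF P(1)[OF ab(1)]] algebra_simps)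
      also have "\<dots> = (\<Sum>(x, y)\<leftarrow>qs. \<alpha> x * \<beta> y) - \<alpha> v * \<beta> s" using \<beta>s[OF ab(2)] by simp
      also have "\<beta> s = - \<beta> w"
        using \<open>w + s = 0\<close> lin_mapD(2)[OF Q(1)[OF ab(2)] vw(2) s] lin_map_0[OF W Q(1)[OF ab(2)]]
        by (simp add: eq_neg_iff_add_eq_0 add.commute)
      finally show "(\<Sum>(x, y)\<leftarrow>qs'. \<alpha> x * \<beta> y) = 0" using z[OF ab] by (simp add: add.commute)
    qed
    moreover have "(\<Sum>(x, y)\<leftarrow>qs'. tens V W x y) = (\<Sum>(x, y)\<leftarrow>qs. tens V W x y) - tens V W v s"
    proof -
      have t0: "tens V W v 0 = 0" using tens_scale2[of 0 V W v 0] W by (simp add: vect_scale fun_eq_iff)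
      have m: "tens V W (x - scale V (c x) v) y = tens V W x y - tens V W v (scale W (c x) y)" for x y
      proof -
        have "tens V W (x - scale V (c x) v + scale V (c x) v) y = tens V W (x - scale V (c x) v) y + tens V W (scale V (c x) v) y"
          by (rule tens_add[OF V W])
        then show ?thesis by (simp only: diff_add_cancel tens_scale_out add_diff_cancel_right')
      qed
      show ?thesis unfolding qs'_def s_def using qs
        by (induction qs) (auto simp: t0 m tens_add[OF V W] simp del: tens_scale_out)
    qed
    moreover have "tens V W v s = - tens V W v w"
    proof -
      have "tens V W v (w + s) = 0" using tens_scale2[of 0 V W v 0] W \<open>w + s = 0\<close> by (simp add: vect_scale fun_eq_iff)
      then show ?thesis unfolding tens_add[OF V W] by (simp add: eq_neg_iff_add_eq_0 add.commute)
    qed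
    ultimately show ?thesis using ps by (simp add: add.commute)
  qed
qed

lemma tens_sep:
  fixes V :: "('k::field, 'v::ab_group_add, 'x) vect_scheme" and W :: "('k, 'w::ab_group_add, 'y) vect_scheme"
  assumes V: "vect V" and W: "vect W"
    and P: "\<And>\<alpha>. \<alpha> \<in> P \<Longrightarrow> lin_map V ground \<alpha>" "\<And>v. v \<in> carr V \<Longrightarrow> (\<And>\<alpha>. \<alpha> \<in> P \<Longrightarrow> \<alpha> v = 0) \<Longrightarrow> v = 0"
    and Q: "\<And>\<beta>. \<beta> \<in> Q \<Longrightarrow> lin_map W ground \<beta>" "\<And>w. w \<in> carr W \<Longrightarrow> (\<And>\<beta>. \<beta> \<in> Q \<Longrightarrow> \<beta> w = 0) \<Longrightarrow> w = 0"
    and t: "t \<in> carr (tprod V W)" "t' \<in> carr (tprod V W)"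
    and z: "\<And>\<alpha> \<beta>. \<alpha> \<in> P \<Longrightarrow> \<beta> \<in> Q \<Longrightarrow> tlift V W (\<lambda>v w. \<alpha> v * \<beta> w) t = tlift V W (\<lambda>v w. \<alpha> v * \<beta> w) t'"
  shows "t = t'"
proof -
  have d: "t - t' \<in> carr (tprod V W)" by (rule vect_minus[OF vect_tprod t])
  have "t - t' = (\<Sum>(v, w)\<leftarrow>trep V W (t - t'). tens V W v w)" using trep[OF V d] by simp
  also have "\<dots> = 0"
  proof (rule tens_sep_list[OF V W P Q])
    show "set (trep V W (t - t')) \<subseteq> carr V \<times> carr W" by (rule trep[OF V d])
    fix \<alpha> \<beta> assume ab: "\<alpha> \<in> P" "\<beta> \<in> Q"
    have "lin_map (tprod V W) ground (tlift V W (\<lambda>v w. \<alpha> v * \<beta> w))"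
      by (rule tlift_universal(1)) (rule ty V W P(1)[OF ab(1)] Q(1)[OF ab(2)] | assumption)+
    from lin_map_minus[OF vect_tprod this t] z[OF ab]
    show "(\<Sum>(v, w)\<leftarrow>trep V W (t - t'). \<alpha> v * \<beta> w) = 0" by (simp add: tlift_def)
  qed auto
  finally show ?thesis by simp
qed

text \<open>Functionals that factor through f separate the points of V because f is injective, and
  likewise for g, so \<open>tens_sep\<close> applies. Equations between tensors over a subspace are
  checked this way in the ambient space.\<close>

lemma tmap_inj:
  assumes V: "vect V" and W: "vect W" and V': "vect V'" and W': "vect W'"
    and f: "lin_map V V' f" "inj_on f (carr V)" and g: "lin_map W W' g" "inj_on g (carr W)"
    and t: "t \<in> carr (tprod V W)" "t' \<in> carr (tprod V W)"
    and eq: "tlift V W (\<lambda>v w. tens V' W' (f v) (g w)) t = tlift V W (\<lambda>v w. tens V' W' (f v) (g w)) t'"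
  shows "t = t'"
proof (rule tens_sep[OF V W _ _ _ _ t, where P="{\<lambda>v. \<alpha> (f v) |\<alpha>. lin_map V' ground \<alpha>}" and Q="{\<lambda>v. \<beta> (g v) |\<beta>. lin_map W' ground \<beta>}"])
  show "lin_map V ground \<alpha>" if "\<alpha> \<in> {\<lambda>v. \<alpha> (f v) |\<alpha>. lin_map V' ground \<alpha>}" for \<alpha>
    using that lin_map_comp[OF _ f(1)] by auto
  show "lin_map W ground \<alpha>" if "\<alpha> \<in> {\<lambda>v. \<alpha> (g v) |\<alpha>. lin_map W' ground \<alpha>}" for \<alpha>
    using that lin_map_comp[OF _ g(1)] by auto
  show "v = 0" if v: "v \<in> carr V" "\<And>\<alpha>. \<alpha> \<in> {\<lambda>v. \<alpha> (f v) |\<alpha>. lin_map V' ground \<alpha>} \<Longrightarrow> \<alpha> v = 0" for v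
  proof (rule ccontr)
    assume "v \<noteq> 0"
    then have "f v \<noteq> 0" using f(2) v(1) vect_closed(1)[OF V] lin_map_0[OF V f(1)] by (metis inj_onD)
    then obtain \<psi> where "Vector_Spaces.linear (scale V') (*) \<psi>" "\<psi> (f v) = 1"
      using ex_functional V' unfolding vect_def by blast
    with v(2)[of "\<lambda>v. \<psi> (f v)"] linear_lin_map show False by force
  qed
  show "v = 0" if v: "v \<in> carr W" "\<And>\<alpha>. \<alpha> \<in> {\<lambda>v. \<alpha> (g v) |\<alpha>. lin_map W' ground \<alpha>} \<Longrightarrow> \<alpha> v = 0" for v
  proof (rule ccontr)
    assume "v \<noteq> 0"
    then have "g v \<noteq> 0" using g(2) v(1) vect_closed(1)[OF W] lin_map_0[OF W g(1)] by (metis inj_onD)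
    then obtain \<psi> where "Vector_Spaces.linear (scale W') (*) \<psi>" "\<psi> (g v) = 1"
      using ex_functional W' unfolding vect_def by blast
    with v(2)[of "\<lambda>v. \<psi> (g v)"] linear_lin_map show False by force
  qed
  fix \<alpha> \<beta> assume "\<alpha> \<in> {\<lambda>v. \<alpha> (f v) |\<alpha>. lin_map V' ground \<alpha>}" "\<beta> \<in> {\<lambda>v. \<beta> (g v) |\<beta>. lin_map W' ground \<beta>}"
  then obtain a b where a: "\<alpha> = (\<lambda>v. a (f v))" "lin_map V' ground a" and b: "\<beta> = (\<lambda>v. b (g v))" "lin_map W' ground b"
    by auto
  note [ty] = V W V' W' lin_mapD(1)[OF f(1)] lin_mapD(1)[OF g(1)] lin_map_comp[OF a(2)] lin_map_comp[OF b(2)] a(2) b(2)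
  have *: "tlift V W (\<lambda>v w. \<alpha> v * \<beta> w) t = tlift V' W' (\<lambda>v w. a v * b w) (tlift V W (\<lambda>v w. tens V' W' (f v) (g w)) t)"
    if "t \<in> carr (tprod V W)" for t
    using that by (simp add: ty push_tlift[where X=ground] tlift_tens[where X=ground] a(1) b(1) cong: tlift_cong)
  show "tlift V W (\<lambda>v w. \<alpha> v * \<beta> w) t = tlift V W (\<lambda>v w. \<alpha> v * \<beta> w) t'"
    using *[OF t(1)] *[OF t(2)] eq by simp
qed

section \<open>Yetter-Drinfel'd modules\<close>

locale yd_mod = hopf H S
  for H :: "('k::field, 'h::ab_group_add, 'x) bialg_scheme" and S +
  fixes M :: "('k, 'h, 'v::ab_group_add) yd"
  assumes obj: "yd_object H M"
begin

lemma M_facts [simp, ty]: "vect M"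
  using obj by (simp add: yd_object_def left_module_def)

lemma act_bilin: "bilin_map H M M (yd_act M)"
  using obj by (simp add: yd_object_def left_module_def)

lemma coact_lin: "lin_map M (tprod H M) (yd_coact M)"
  using obj by (simp add: yd_object_def left_comodule_def)

lemmas act_ty [ty] = bilin_mapD(3)[OF act_bilin] lin_map_comp[OF bilin_mapD(1)[OF act_bilin]]
  lin_map_comp[OF bilin_mapD(2)[OF act_bilin]] lin_mapD(1)[OF coact_lin] lin_map_comp[OF coact_lin]

lemma act_simps:
  "m \<in> carr M \<Longrightarrow> yd_act M (one H) m = m"
  "h \<in> carr H \<Longrightarrow> h' \<in> carr H \<Longrightarrow> m \<in> carr M \<Longrightarrow> yd_act M (mult H h h') m = yd_act M h (yd_act M h' m)"
  using obj by (simp_all add: yd_object_def left_module_def)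

lemma coact_coassoc:
  assumes X: "vect X" and m: "m \<in> carr M"
    and 1: "\<And>y z. y \<in> carr H \<Longrightarrow> z \<in> carr M \<Longrightarrow> lin_map H X (\<lambda>x. \<phi> x y z)"
    and 2: "\<And>x z. x \<in> carr H \<Longrightarrow> z \<in> carr M \<Longrightarrow> lin_map H X (\<lambda>y. \<phi> x y z)"
    and 3: "\<And>x y. x \<in> carr H \<Longrightarrow> y \<in> carr H \<Longrightarrow> lin_map M X (\<lambda>z. \<phi> x y z)"
  shows "tlift H M (\<lambda>s z. sw H s (\<lambda>x y. \<phi> x y z)) (yd_coact M m) =
    tlift H M (\<lambda>x s. tlift H M (\<lambda>y z. \<phi> x y z) (yd_coact M s)) (yd_coact M m)"
proof -
  let ?F = "\<lambda>t z. tlift H H (\<lambda>x y. \<phi> x y z) t"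
  note [ty] = 1 2 3 X m
  have bi: "bilin_map (tprod H H) M X ?F"
    by (rule ty | assumption)+
  have "tlift H M (\<lambda>x y. tens (tprod H H) M (comult H x) y) (yd_coact M m) =
        tlift H M (\<lambda>x y. tlift H M (\<lambda>x' y'. tens (tprod H H) M (tens H H x x') y') (yd_coact M y))
          (yd_coact M m)"
    using obj m unfolding yd_object_def left_comodule_def by (elim conjE) (erule (1) bspec)
  then have "tlift (tprod H H) M ?F (tlift H M (\<lambda>x y. tens (tprod H H) M (comult H x) y) (yd_coact M m)) =
    tlift (tprod H H) M ?F (tlift H M (\<lambda>x y. tlift H M (\<lambda>x' y'. tens (tprod H H) M (tens H H x x') y') (yd_coact M y))
          (yd_coact M m))" by simp
  then show ?thesis
    by (simp add: ty swr[where X=X] cong: tlift_cong)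
qed

lemma coact_counit:
  assumes X: "vect X" and m: "m \<in> carr M" and f: "lin_map M X f"
  shows "tlift H M (\<lambda>x y. scale X (counit H x) (f y)) (yd_coact M m) = f m"
proof -
  note [ty] = X m f lin_mapD(1)[OF f]
  have "tlift H M (\<lambda>x y. scale M (counit H x) y) (yd_coact M m) = m"
    using obj m unfolding yd_object_def left_comodule_def by (elim conjE) (erule (1) bspec)
  then have "f m = f (tlift H M (\<lambda>x y. scale M (counit H x) y) (yd_coact M m))" by simp
  also have "\<dots> = tlift H M (\<lambda>x y. scale X (counit H x) (f y)) (yd_coact M m)"
    by (subst push_lin[OF f]) (simp_all add: ty lin_mapD(3)[OF f] cong: tlift_cong)
  finally show ?thesis by (rule sym)
qed

lemma yd_compat:
  assumes X: "vect X" and h: "h \<in> carr H" and m: "m \<in> carr M" and \<psi>: "bilin_map H M X \<psi>"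
  shows "sw H h (\<lambda>h1 h2. tlift H M (\<lambda>x y. \<psi> (mult H h1 x) (yd_act M h2 y)) (yd_coact M m)) =
    sw H h (\<lambda>h1 h2. tlift H M (\<lambda>x y. \<psi> (mult H x h2) y) (yd_coact M (yd_act M h1 m)))"
proof -
  note [ty] = X h m bilin_ty[OF \<psi>]
  have "sw H h (\<lambda>h1 h2. tlift H M (\<lambda>x y. tens H M (mult H h1 x) (yd_act M h2 y)) (yd_coact M m)) =
        sw H h (\<lambda>h1 h2. tlift H M (\<lambda>x y. tens H M (mult H x h2) y) (yd_coact M (yd_act M h1 m)))"
    using obj h m unfolding yd_object_def by (elim conjE) (drule (1) bspec, erule (1) bspec)
  then have "tlift H M \<psi> (sw H h (\<lambda>h1 h2. tlift H M (\<lambda>x y. tens H M (mult H h1 x) (yd_act M h2 y)) (yd_coact M m))) =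
        tlift H M \<psi> (sw H h (\<lambda>h1 h2. tlift H M (\<lambda>x y. tens H M (mult H x h2) y) (yd_coact M (yd_act M h1 m))))"
    by simp
  then show ?thesis
    by (simp add: ty push_tlift[where X=X] tlift_tens[where X=X] cong: tlift_cong)
qed

end

lemma yd_tensor_fields [simp]:
  "carr (yd_tensor H M N) = carr (tprod M N)" "scale (yd_tensor H M N) = scale (tprod M N)"
  by (simp_all add: yd_tensor_def)

lemma same_yd_tensor [simp]:
  "vect (yd_tensor H M N) = vect (tprod M N)"
  "lin_map U (yd_tensor H M N) = lin_map U (tprod M N)"
  "lin_map (yd_tensor H M N) U' = lin_map (tprod M N) U'"
  "tprod W (yd_tensor H M N) = tprod W (tprod M N)"
  "tens W (yd_tensor H M N) = tens W (tprod M N)"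
  "tlift W (yd_tensor H M N) = tlift W (tprod M N)"
proof -
  show "tens W (yd_tensor H M N) = tens W (tprod M N)" by (rule tens_same) simp_all
  show "tprod W (yd_tensor H M N) = tprod W (tprod M N)" "tlift W (yd_tensor H M N) = tlift W (tprod M N)"
    by (rule tprod_same; simp)+
qed (auto simp: vect_def lin_map_def fun_eq_iff)

text \<open>A product or coproduct can be a morphism only if R \<otimes> R is an object, so closure
  under tensor products precedes every statement about algebras and coalgebras in the
  category.\<close>

lemma yd_object_tensor:
  assumes "hopf H S" "yd_object H M" "yd_object H N"
  shows "yd_object H (yd_tensor H M N)"
proof -
  interpret M: yd_mod H S M using assms by (simp add: yd_mod_def yd_mod_axioms_def)
  interpret N: yd_mod H S N using assms by (simp add: yd_mod_def yd_mod_axioms_def)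
  let ?T = "tprod M N"
  let ?act = "yd_act (yd_tensor H M N)"
  let ?co = "yd_coact (yd_tensor H M N)"
  have act: "?act h t = tlift M N (\<lambda>m n. sw H h (\<lambda>h1 h2. tens M N (yd_act M h1 m) (yd_act N h2 n))) t" for h t
    by (simp add: yd_tensor_def)
  have co: "?co t = tlift M N (\<lambda>m n.
        tlift H M (\<lambda>x m0. tlift H N (\<lambda>y n0. tens H (tprod M N) (mult H x y) (tens M N m0 n0))
          (yd_coact N n)) (yd_coact M m)) t" for t
    by (simp add: yd_tensor_def)
  have 1: "bilin_map H ?T ?T ?act" unfolding act by (rule ty | assumption)+
  have 2: "?act (one H) t = t" if "t \<in> carr ?T" for t
    using that tlift_id[OF M.M_facts N.M_facts that] unfolding act
    by (simp add: ty swr[where X="?T"] M.act_simps N.act_simps cong: tlift_cong)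
  have 3: "?act (mult H h h') t = ?act h (?act h' t)" if "h \<in> carr H" "h' \<in> carr H" "t \<in> carr ?T" for h h' t
    using that unfolding act
    apply (simp add: ty swr[where X="?T"] M.act_simps N.act_simps cong: tlift_cong)
    apply (subst tlift_swap)
    apply (rule refl)
    done
  have m: "left_module H (yd_tensor H M N)"
    unfolding left_module_def using 1 2 3 by (simp add: vect_tprod bilin_map_def)
  have 4: "lin_map ?T (tprod H ?T) ?co" unfolding co by (rule ty | assumption)+
  let ?X = "tprod (tprod H H) ?T"
  \<comment> \<open>Coassociativity of the codiagonal coaction on m \<otimes> n: after an
    interchange of sums, that of N and then that of M.\<close>
  have 5: "tlift H M (\<lambda>x m0. tlift H N (\<lambda>y n0. sw H x (\<lambda>x1 x2. sw H y (\<lambda>y1 y2.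
         tens (tprod H H) ?T (tens H H (mult H x1 y1) (mult H x2 y2)) (tens M N m0 n0)))) (yd_coact N n)) (yd_coact M m) =
     tlift H M (\<lambda>x m'. tlift H N (\<lambda>y n'. tlift H M (\<lambda>x' m0. tlift H N (\<lambda>y' n0.
         tens (tprod H H) ?T (tens H H (mult H x y) (mult H x' y')) (tens M N m0 n0)) (yd_coact N n')) (yd_coact M m')) (yd_coact N n)) (yd_coact M m)"
      (is "?L = ?R")
    if [ty]: "m \<in> carr M" "n \<in> carr N" for m n
  proof -
    have "?L = tlift H M (\<lambda>x m0. sw H x (\<lambda>x1 x2. tlift H N (\<lambda>y n0. sw H y (\<lambda>y1 y2.
         tens (tprod H H) ?T (tens H H (mult H x1 y1) (mult H x2 y2)) (tens M N m0 n0))) (yd_coact N n))) (yd_coact M m)"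
      by (rule tlift_fun_cong, rule tlift_swap)
    also have "\<dots> = tlift H M (\<lambda>x m0. sw H x (\<lambda>x1 x2. tlift H N (\<lambda>y n'. tlift H N (\<lambda>y' n0.
         tens (tprod H H) ?T (tens H H (mult H x1 y) (mult H x2 y')) (tens M N m0 n0)) (yd_coact N n')) (yd_coact N n))) (yd_coact M m)"
      by (simp add: ty N.coact_coassoc[where X="?X"] cong: tlift_cong)
    also have "\<dots> = tlift H M (\<lambda>x m'. tlift H M (\<lambda>x' m0. tlift H N (\<lambda>y n'. tlift H N (\<lambda>y' n0.
         tens (tprod H H) ?T (tens H H (mult H x y) (mult H x' y')) (tens M N m0 n0)) (yd_coact N n')) (yd_coact N n)) (yd_coact M m')) (yd_coact M m)"
      by (rule M.coact_coassoc[where X="?X"]) (rule ty | assumption)+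
    also have "\<dots> = ?R"
      by (rule tlift_fun_cong, rule tlift_swap)
    finally show ?thesis .
  qed
  have 6: "tlift H ?T (\<lambda>x y. tens (tprod H H) ?T (comult H x) y) (?co t) =
        tlift H ?T (\<lambda>x y. tlift H ?T (\<lambda>x' y'. tens (tprod H H) ?T (tens H H x x') y') (?co y)) (?co t)"
    if t: "t \<in> carr ?T" for t
  proof (rule tprod_eqI[OF M.M_facts N.M_facts _ _ t, where X="?X" and
        f="\<lambda>t. tlift H ?T (\<lambda>x y. tens (tprod H H) ?T (comult H x) y) (?co t)" and
        g="\<lambda>t. tlift H ?T (\<lambda>x y. tlift H ?T (\<lambda>x' y'. tens (tprod H H) ?T (tens H H x x') y') (?co y)) (?co t)"])
    note [ty] = lin_mapD(1)[OF 4] lin_map_comp[OF 4]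
    show "lin_map ?T ?X (\<lambda>t. tlift H ?T (\<lambda>x y. tens (tprod H H) ?T (comult H x) y) (?co t))"
      "lin_map ?T ?X (\<lambda>t. tlift H ?T (\<lambda>x y. tlift H ?T (\<lambda>x' y'. tens (tprod H H) ?T (tens H H x x') y') (?co y)) (?co t))"
      by (rule ty | assumption)+
    fix m n assume mn: "m \<in> carr M" "n \<in> carr N"
    have cm: "comult H (mult H x y) = sw H x (\<lambda>x1 x2. sw H y (\<lambda>y1 y2. tens H H (mult H x1 y1) (mult H x2 y2)))" if "x \<in> carr H" "y \<in> carr H" for x y
      using that by (simp add: bialgebraD(7))
    show "tlift H ?T (\<lambda>x y. tens (tprod H H) ?T (comult H x) y) (?co (tens M N m n)) =
       tlift H ?T (\<lambda>x y. tlift H ?T (\<lambda>x' y'. tens (tprod H H) ?T (tens H H x x') y') (?co y)) (?co (tens M N m n))"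
      using mn 5[OF mn] unfolding co
      by (simp add: ty pu cm push_tlift[where X="?X"] tlift_tens[where X="?X"] tlift_tens[where X="tprod H ?T"] cong: tlift_cong)
  qed
  have 7: "tlift H ?T (\<lambda>x y. scale ?T (counit H x) y) (?co t) = t" if t: "t \<in> carr ?T" for t
  proof (rule tprod_eqI[OF M.M_facts N.M_facts _ _ t, where X="?T"])
    note [ty] = lin_mapD(1)[OF 4] lin_map_comp[OF 4]
    show "lin_map ?T ?T (\<lambda>t. tlift H ?T (\<lambda>x y. scale ?T (counit H x) y) (?co t))" "lin_map ?T ?T (\<lambda>t. t)"
      by (rule ty | assumption)+
    fix m n assume mn: "m \<in> carr M" "n \<in> carr N"
    show "tlift H ?T (\<lambda>x y. scale ?T (counit H x) y) (?co (tens M N m n)) = tens M N m n"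
      using mn unfolding co
      by (simp add: ty push_tlift[where X="?T"] tlift_tens[where X="?T"] tlift_tens[where X="tprod H ?T"] bialgebraD(5)
          vect_scale(3)[OF vect_tprod, symmetric] push_scale[symmetric] N.coact_counit[where X="?T"] M.coact_counit[where X="?T"] cong: tlift_cong)
  qed
  have c: "left_comodule H (yd_tensor H M N)"
    unfolding left_comodule_def using 4 6 7 by (simp add: vect_tprod)
  let ?Y = "tprod H ?T"
  have 8: "sw H h (\<lambda>h1 h2. tlift H ?T (\<lambda>x y. tens H ?T (mult H h1 x) (?act h2 y)) (?co t)) =
        sw H h (\<lambda>h1 h2. tlift H ?T (\<lambda>x y. tens H ?T (mult H x h2) y) (?co (?act h1 t)))"
    if h[ty]: "h \<in> carr H" and t: "t \<in> carr ?T" for h t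
  proof (rule tprod_eqI[OF M.M_facts N.M_facts _ _ t, where X="?Y" and
        f="\<lambda>t. sw H h (\<lambda>h1 h2. tlift H ?T (\<lambda>x y. tens H ?T (mult H h1 x) (?act h2 y)) (?co t))" and
        g="\<lambda>t. sw H h (\<lambda>h1 h2. tlift H ?T (\<lambda>x y. tens H ?T (mult H x h2) y) (?co (?act h1 t)))"])
    note aty = lin_mapD(1)[OF 4] lin_map_comp[OF 4] bilin_mapD(3)[OF 1] lin_map_comp[OF bilin_mapD(1)[OF 1]] lin_map_comp[OF bilin_mapD(2)[OF 1]]
    show "lin_map ?T ?Y (\<lambda>t. sw H h (\<lambda>h1 h2. tlift H ?T (\<lambda>x y. tens H ?T (mult H h1 x) (?act h2 y)) (?co t)))"
      "lin_map ?T ?Y (\<lambda>t. sw H h (\<lambda>h1 h2. tlift H ?T (\<lambda>x y. tens H ?T (mult H x h2) y) (?co (?act h1 t))))"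
      by (rule ty aty | assumption)+
    fix m n assume mn[ty]: "m \<in> carr M" "n \<in> carr N"
    let ?G = "\<lambda>u v w. tens H ?T u (tens M N v w)"
    have "sw H h (\<lambda>h1 h2. tlift H ?T (\<lambda>x y. tens H ?T (mult H h1 x) (?act h2 y)) (?co (tens M N m n))) =
      sw H h (\<lambda>h1 h2. tlift H M (\<lambda>x m0. tlift H N (\<lambda>y n0. sw H h2 (\<lambda>a b.
        ?G (mult H h1 (mult H x y)) (yd_act M a m0) (yd_act N b n0))) (yd_coact N n)) (yd_coact M m))"
      unfolding co act
      by (simp add: ty pu push_tlift[where X="?Y"] tlift_tens[where X="?Y"] tlift_tens[where X="?T"] cong: tlift_cong)
    also have "\<dots> = sw H h (\<lambda>h1 h2. tlift H M (\<lambda>x m0. sw H h2 (\<lambda>a b. tlift H N (\<lambda>y n0.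
        ?G (mult H h1 (mult H x y)) (yd_act M a m0) (yd_act N b n0)) (yd_coact N n))) (yd_coact M m))"
      by (rule tlift_fun_cong,
          rule tlift_fun_cong, rule tlift_swap)
    also have "\<dots> = sw H h (\<lambda>h1 h2. sw H h2 (\<lambda>a b. tlift H M (\<lambda>x m0. tlift H N (\<lambda>y n0.
        ?G (mult H h1 (mult H x y)) (yd_act M a m0) (yd_act N b n0)) (yd_coact N n)) (yd_coact M m)))"
      by (rule tlift_fun_cong, rule tlift_swap)
    also have "\<dots> = sw H h (\<lambda>h' h3. sw H h' (\<lambda>h1 h2. tlift H M (\<lambda>x m0. tlift H N (\<lambda>y n0.
        ?G (mult H (mult H h1 x) y) (yd_act M h2 m0) (yd_act N h3 n0)) (yd_coact N n)) (yd_coact M m)))"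
      by (simp add: ty coassoc[where X="?Y"] algebraD(4) cong: tlift_cong)
    \<comment> \<open>The compatibility condition of M on the legs h1, h2, with h3 as a bystander;
      the one of N on h2, h3 follows below.\<close>
    also have "\<dots> = sw H h (\<lambda>h' h3. sw H h' (\<lambda>h1 h2. tlift H M (\<lambda>x m0. tlift H N (\<lambda>y n0.
        ?G (mult H (mult H x h2) y) m0 (yd_act N h3 n0)) (yd_coact N n)) (yd_coact M (yd_act M h1 m))))"
      by (rule tlift_cong[OF refl], (rule ty | assumption)+,
          rule M.yd_compat[where X="?Y" and \<psi>="\<lambda>u v. tlift H N (\<lambda>y n0. ?G (mult H u y) v (yd_act N _ n0)) (yd_coact N n)"])
         (rule ty | assumption)+
    also have "\<dots> = sw H h (\<lambda>h1 h'. sw H h' (\<lambda>h2 h3. tlift H M (\<lambda>x m0. tlift H N (\<lambda>y n0.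
        ?G (mult H x (mult H h2 y)) m0 (yd_act N h3 n0)) (yd_coact N n)) (yd_coact M (yd_act M h1 m))))"
      by (simp add: ty coassoc[where X="?Y"] algebraD(4) cong: tlift_cong)
    also have "\<dots> = sw H h (\<lambda>h1 h'. tlift H M (\<lambda>x m0. sw H h' (\<lambda>h2 h3. tlift H N (\<lambda>y n0.
        ?G (mult H x (mult H h2 y)) m0 (yd_act N h3 n0)) (yd_coact N n))) (yd_coact M (yd_act M h1 m)))"
      by (rule tlift_fun_cong, rule tlift_swap)
    also have "\<dots> = sw H h (\<lambda>h1 h'. tlift H M (\<lambda>x m0. sw H h' (\<lambda>h2 h3. tlift H N (\<lambda>y n0.
        ?G (mult H x (mult H y h3)) m0 n0) (yd_coact N (yd_act N h2 n)))) (yd_coact M (yd_act M h1 m)))"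
      by (rule tlift_cong[OF refl], (rule ty | assumption)+, rule tlift_cong[OF refl], (rule ty | assumption)+,
          rule N.yd_compat[where X="?Y" and \<psi>="\<lambda>u v. ?G (mult H _ u) _ v"])
         (rule ty | assumption)+
    also have "\<dots> = sw H h (\<lambda>h1 h'. sw H h' (\<lambda>h2 h3. tlift H M (\<lambda>x m0. tlift H N (\<lambda>y n0.
        ?G (mult H x (mult H y h3)) m0 n0) (yd_coact N (yd_act N h2 n))) (yd_coact M (yd_act M h1 m))))"
      by (rule tlift_fun_cong, rule tlift_swap)
    also have "\<dots> = sw H h (\<lambda>h1 h2. tlift H ?T (\<lambda>x y. tens H ?T (mult H x h2) y) (?co (?act h1 (tens M N m n))))"
      unfolding co act
      by (simp add: ty pu swr[where X="?Y"] tlift_tens[where X="?T"] algebraD(4) cong: tlift_cong)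
    finally show "sw H h (\<lambda>h1 h2. tlift H ?T (\<lambda>x y. tens H ?T (mult H h1 x) (?act h2 y)) (?co (tens M N m n))) =
        sw H h (\<lambda>h1 h2. tlift H ?T (\<lambda>x y. tens H ?T (mult H x h2) y) (?co (?act h1 (tens M N m n))))" .
  qed
  show ?thesis unfolding yd_object_def using m c 8 by simp
qed

section \<open>Bialgebras with a projection\<close>

locale projection = hopf H "antip H"
  for H :: "('k::field, 'h::ab_group_add) bialg" +
  fixes A :: "('k, 'a::ab_group_add) bialg" and j :: "'h \<Rightarrow> 'a" and \<pi> :: "'a \<Rightarrow> 'h"
  assumes jm: "bialg_map H A j" and pm: "bialg_map A H \<pi>"
    and pj [simp]: "h \<in> carr H \<Longrightarrow> \<pi> (j h) = h"
begin

abbreviation "S \<equiv> antip H"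

lemma A_facts [simp, ty]: "bialgebra A" "algebra A" "coalgebra A" "vect A"
  using bialg_mapD(2)[OF jm] bialgebraD[OF bialg_mapD(2)[OF jm]] by auto

lemmas j_ty [ty] = bialg_mapD(8)[OF jm] lin_map_comp[OF bialg_mapD(3)[OF jm]] bialg_mapD(3)[OF jm]
lemmas p_ty [ty] = bialg_mapD(8)[OF pm] lin_map_comp[OF bialg_mapD(3)[OF pm]] bialg_mapD(3)[OF pm]

lemmas jp_simps = bialg_mapD(4-6)[OF jm] bialg_mapD(4-6)[OF pm] S_mult S_one counit_S
lemmas jp_sw = sw_bialg_map[OF jm] sw_bialg_map[OF pm] sw_S

lemmas A_assoc = algebraD(4)[OF A_facts(2)] algebraD(5,6)[OF A_facts(2)]
lemmas H_assoc = algebraD(4)[OF H_facts(1)] algebraD(5,6)[OF H_facts(1)]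

definition Pr :: "'a \<Rightarrow> 'a" where
  "Pr = Pi_map A H j \<pi>"

lemma Pr_eq: "Pr a = sw A a (\<lambda>x y. mult A x (j (S (\<pi> y))))"
  by (simp add: Pr_def Pi_map_def)

text \<open>The adjoint action is taken on all of A, where its laws are plain Sweedler computations.
  The action of the associated bialgebra is the same function (\<open>RA_fields\<close>).\<close>

definition ad :: "'h \<Rightarrow> 'a \<Rightarrow> 'a" where
  "ad h a = sw H h (\<lambda>h1 h2. mult A (mult A (j h1) a) (j (S h2)))"

lemma Pr_lin: "lin_map A A Pr"
  unfolding Pr_eq by (rule ty | assumption)+

lemma ad_bilin: "bilin_map H A A ad"
  unfolding ad_def by (rule ty | assumption)+

lemmas Pr_ty [ty] = Pr_lin lin_mapD(1)[OF Pr_lin] lin_map_comp[OF Pr_lin]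
lemmas ad_ty [ty] = bilin_mapD(3)[OF ad_bilin] lin_map_comp[OF bilin_mapD(1)[OF ad_bilin]] lin_map_comp[OF bilin_mapD(2)[OF ad_bilin]]

text \<open>As \<pi> respects coproducts, this is the antipode law at
  \<open>\<pi> a\<close>.\<close>

lemma cancel_pi:
  assumes X: "vect X" and a: "a \<in> carr A" and \<psi>: "lin_map H X \<psi>"
  shows "sw A a (\<lambda>x y. \<psi> (mult H (S (\<pi> x)) (\<pi> y))) = scale X (counit A a) (\<psi> (one H))"
    "sw A a (\<lambda>x y. \<psi> (mult H (\<pi> x) (S (\<pi> y)))) = scale X (counit A a) (\<psi> (one H))"
proof -
  note [ty] = X lin_map_comp[OF \<psi>]
  have "sw H (\<pi> a) (\<lambda>x y. \<psi> (mult H (S x) y)) = sw A a (\<lambda>x y. \<psi> (mult H (S (\<pi> x)) (\<pi> y)))"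
     "sw H (\<pi> a) (\<lambda>x y. \<psi> (mult H x (S y))) = sw A a (\<lambda>x y. \<psi> (mult H (\<pi> x) (S (\<pi> y))))"
    using a by (simp_all add: ty jp_sw[where X=X])
  then show "sw A a (\<lambda>x y. \<psi> (mult H (S (\<pi> x)) (\<pi> y))) = scale X (counit A a) (\<psi> (one H))"
    "sw A a (\<lambda>x y. \<psi> (mult H (\<pi> x) (S (\<pi> y)))) = scale X (counit A a) (\<psi> (one H))"
    using a S_lin_apply[OF X _ \<psi>] by (simp_all add: ty jp_simps)
qed

lemma coinvI:
  assumes "a \<in> carr A" "sw A a (\<lambda>x y. tens A H x (\<pi> y)) = tens A H a (one H)"
  shows "a \<in> coinvariants A H \<pi>"
  using assms by (simp add: coinvariants_def)

lemma coinvD: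
  assumes "a \<in> coinvariants A H \<pi>"
  shows "a \<in> carr A" "sw A a (\<lambda>x y. tens A H x (\<pi> y)) = tens A H a (one H)"
  using assms by (auto simp: coinvariants_def)

lemma coinv_sw:
  assumes r: "r \<in> coinvariants A H \<pi>" and X: "vect X" and \<phi>: "bilin_map A H X \<phi>"
  shows "sw A r (\<lambda>x y. \<phi> x (\<pi> y)) = \<phi> r (one H)"
proof -
  note [ty] = coinvD(1)[OF r] X bilin_ty[OF \<phi>]
  have "tlift A H \<phi> (sw A r (\<lambda>x y. tens A H x (\<pi> y))) = tlift A H \<phi> (tens A H r (one H))"
    by (simp add: coinvD(2)[OF r])
  then show ?thesis by (simp add: ty push_tlift[where X=X] tlift_tens[where X=X] cong: tlift_cong)
qed

text \<open>In three legs coinvariance reads r1 \<otimes> r2 \<otimes> \<pi>(r3) = r1 \<otimes> r2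
  \<otimes> 1: coassociativity puts the last leg where \<open>coinv_sw\<close> applies.\<close>

lemma coinv_sw3:
  assumes r: "r \<in> coinvariants A H \<pi>" and X: "vect X"
    and 1: "\<And>y z. y \<in> carr A \<Longrightarrow> z \<in> carr H \<Longrightarrow> lin_map A X (\<lambda>x. \<phi> x y z)"
    and 2: "\<And>x z. x \<in> carr A \<Longrightarrow> z \<in> carr H \<Longrightarrow> lin_map A X (\<lambda>y. \<phi> x y z)"
    and 3: "\<And>x y. x \<in> carr A \<Longrightarrow> y \<in> carr A \<Longrightarrow> lin_map H X (\<lambda>z. \<phi> x y z)"
  shows "sw A r (\<lambda>x s. sw A s (\<lambda>y z. \<phi> x y (\<pi> z))) = sw A r (\<lambda>x y. \<phi> x y (one H))"
proof -
  note [ty] = coinvD(1)[OF r] X 1 2 3 lin_map_comp[OF 1] lin_map_comp[OF 2] lin_map_comp[OF 3]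
  have "sw A r (\<lambda>x s. sw A s (\<lambda>y z. \<phi> x y (\<pi> z))) = sw A r (\<lambda>s z. sw A s (\<lambda>x y. \<phi> x y (\<pi> z)))"
    by (rule sym, rule coassoc) (rule ty | assumption)+
  also have "\<dots> = sw A r (\<lambda>x y. \<phi> x y (one H))"
    by (rule coinv_sw[OF r X, where \<phi>="\<lambda>s u. sw A s (\<lambda>x y. \<phi> x y u)"]) (rule ty | assumption)+
  finally show ?thesis .
qed

text \<open>The coproduct of \<Pi>(a) is a1 j(S(\<pi>(a4))) \<otimes> a2 j(S(\<pi>(a3))), because
  the antipode reverses legs; the two middle legs combine to a value of \<Pi>.\<close>

lemma Pr_sw:
  assumes a[ty]: "a \<in> carr A" and X: "vect X" and \<phi>: "bilin_map A A X \<phi>"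
  shows "sw A (Pr a) \<phi> = sw A a (\<lambda>x s. sw A s (\<lambda>y z. \<phi> (mult A x (j (S (\<pi> z)))) (Pr y)))"
proof -
  note [ty] = X bilin_ty[OF \<phi>] \<phi>
  have phi2: "\<phi> u (sw A a \<psi>) = sw A a (\<lambda>x y. \<phi> u (\<psi> x y))"
    if "u \<in> carr A" "a \<in> carr A" "\<And>v w. v \<in> carr A \<Longrightarrow> w \<in> carr A \<Longrightarrow> \<psi> v w \<in> carr A" for u a \<psi>
    by (rule push_lin[where X=A and Y=X]) (rule ty that | assumption)+
  show ?thesis unfolding Pr_eq
    by (simp add: ty swr[where X=X] jp_sw[where X=X] phi2 cong: tlift_cong)
qed

lemma pi_Pr: "a \<in> carr A \<Longrightarrow> \<pi> (Pr a) = scale H (counit A a) (one H)"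
  unfolding Pr_eq
  by (subst push_lin[OF bialg_mapD(3)[OF pm]])
     (simp_all add: ty jp_simps cancel_pi[where X=H and \<psi>="\<lambda>x. x"] cong: tlift_cong)

lemma Pr_coinv:
  assumes a[ty]: "a \<in> carr A"
  shows "Pr a \<in> coinvariants A H \<pi>"
proof (rule coinvI)
  let ?X = "tprod A H"
  have "sw A (Pr a) (\<lambda>x y. tens A H x (\<pi> y)) = sw A a (\<lambda>x s. sw A s (\<lambda>y z. tens A H (mult A x (j (S (\<pi> z)))) (\<pi> (Pr y))))"
    by (rule Pr_sw) (rule ty | assumption)+
  also have "\<dots> = sw A a (\<lambda>x z. tens A H (mult A x (j (S (\<pi> z)))) (one H))"
    by (simp add: ty pi_Pr counit_sw[where X="?X"] cong: tlift_cong)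
  also have "\<dots> = tens A H (Pr a) (one H)"
    by (simp add: Pr_eq ty pu cong: tlift_cong)
  finally show "sw A (Pr a) (\<lambda>x y. tens A H x (\<pi> y)) = tens A H (Pr a) (one H)" .
qed (rule ty a)+

lemma Pr_id:
  assumes r: "r \<in> coinvariants A H \<pi>"
  shows "Pr r = r"
proof -
  have "Pr r = mult A r (j (S (one H)))"
    unfolding Pr_eq by (rule coinv_sw[OF r, where X=A and \<phi>="\<lambda>x u. mult A x (j (S u))"]) (rule ty | assumption)+
  then show ?thesis using coinvD(1)[OF r] by (simp add: jp_simps A_assoc)
qed

text \<open>The second leg of the coproduct of a coinvariant is again coinvariant. This is what
  places the coaction and the coproduct of R in tensor products over R.\<close>

lemma coinv_Pr2:
  assumes r: "r \<in> coinvariants A H \<pi>" and X: "vect X" and \<phi>: "bilin_map A A X \<phi>"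
  shows "sw A r (\<lambda>x y. \<phi> x (Pr y)) = sw A r \<phi>"
proof -
  note [ty] = coinvD(1)[OF r] X bilin_ty[OF \<phi>]
  have phi2: "\<phi> u (sw A a \<psi>) = sw A a (\<lambda>x y. \<phi> u (\<psi> x y))"
    if "u \<in> carr A" "a \<in> carr A" "\<And>v w. v \<in> carr A \<Longrightarrow> w \<in> carr A \<Longrightarrow> \<psi> v w \<in> carr A" for u a \<psi>
    by (rule push_lin[where X=A and Y=X]) (rule ty that | assumption)+
  have "sw A r (\<lambda>x y. \<phi> x (Pr y)) = sw A r (\<lambda>x s. sw A s (\<lambda>y z. \<phi> x (mult A y (j (S (\<pi> z))))))"
    unfolding Pr_eq by (simp add: ty phi2 cong: tlift_cong)
  also have "\<dots> = sw A r (\<lambda>x y. \<phi> x (mult A y (j (S (one H)))))"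
    by (rule coinv_sw3[OF r X, where \<phi>="\<lambda>x y u. \<phi> x (mult A y (j (S u)))"]) (rule ty | assumption)+
  also have "\<dots> = sw A r \<phi>" by (simp add: jp_simps A_assoc ty cong: tlift_cong)
  finally show ?thesis .
qed

text \<open>The legs of h meet as h1 S(h2) between a1 and j(S(\<pi>(a2))).\<close>

lemma Pr_mult_j:
  assumes [ty]: "a \<in> carr A" "h \<in> carr H"
  shows "Pr (mult A a (j h)) = scale A (counit H h) (Pr a)"
proof -
  have "Pr (mult A a (j h)) = sw A a (\<lambda>a1 a2. sw H h (\<lambda>h1 h2. mult A a1 (mult A (j (mult H h1 (S h2))) (j (S (\<pi> a2))))))"
    unfolding Pr_eq by (simp add: ty swr[where X=A] jp_sw[where X=A] jp_simps A_assoc cong: tlift_cong)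
  also have "\<dots> = sw A a (\<lambda>a1 a2. scale A (counit H h) (mult A a1 (mult A (j (one H)) (j (S (\<pi> a2))))))"
    by (rule tlift_cong[OF refl], (rule ty | assumption)+,
        rule S_lin_apply(2)[where X=A and \<psi>="\<lambda>u. mult A _ (mult A (j u) (j (S (\<pi> _))))"]) (rule ty | assumption)+
  also have "\<dots> = scale A (counit H h) (Pr a)"
    by (simp add: ty jp_simps A_assoc push_scale[symmetric] Pr_eq cong: tlift_cong)
  finally show ?thesis .
qed

text \<open>S(\<pi>(a2)) \<pi>(a3) cancels. This decomposition of A into products r j(h) gives
  surjectivity of the canonical map and shows that a functional on A is determined by its values on
  such products.\<close>

lemma Pr_jpi:
  assumes [ty]: "a \<in> carr A"
  shows "sw A a (\<lambda>x y. mult A (Pr x) (j (\<pi> y))) = a"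
proof -
  have "sw A a (\<lambda>x y. mult A (Pr x) (j (\<pi> y))) = sw A a (\<lambda>x t. sw A t (\<lambda>y z. mult A x (j (mult H (S (\<pi> y)) (\<pi> z)))))"
    unfolding Pr_eq by (simp add: ty pu swr[where X=A] jp_simps A_assoc cong: tlift_cong)
  also have "\<dots> = sw A a (\<lambda>x t. scale A (counit A t) (mult A x (j (one H))))"
    by (rule tlift_cong[OF refl], (rule ty | assumption)+,
        rule cancel_pi(1)[where X=A and \<psi>="\<lambda>u. mult A _ (j u)"]) (rule ty | assumption)+
  also have "\<dots> = a"
    by (simp add: ty jp_simps A_assoc counit_sw[where X=A] cong: tlift_cong)
  finally show ?thesis .
qed

lemma coinv_one: "one A \<in> coinvariants A H \<pi>"
  by (rule coinvI) (simp_all add: ty swr[where X="tprod A H"] jp_simps)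

lemma coinv_mult:
  assumes r: "r \<in> coinvariants A H \<pi>" and s: "s \<in> coinvariants A H \<pi>"
  shows "mult A r s \<in> coinvariants A H \<pi>"
proof (rule coinvI)
  note [ty] = coinvD(1)[OF r] coinvD(1)[OF s]
  let ?X = "tprod A H"
  show "mult A r s \<in> carr A" by (rule ty)+
  have "sw A (mult A r s) (\<lambda>x y. tens A H x (\<pi> y)) =
    sw A r (\<lambda>r1 r2. sw A s (\<lambda>s1 s2. tens A H (mult A r1 s1) (mult H (\<pi> r2) (\<pi> s2))))"
    by (simp add: ty swr[where X="?X"] jp_simps cong: tlift_cong)
  also have "\<dots> = sw A r (\<lambda>r1 r2. tens A H (mult A r1 s) (mult H (\<pi> r2) (one H)))"
    by (rule tlift_cong[OF refl], (rule ty | assumption)+,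
        rule coinv_sw[OF s, where X="?X" and \<phi>="\<lambda>u v. tens A H (mult A _ u) (mult H (\<pi> _) v)"]) (rule ty | assumption)+
  also have "\<dots> = tens A H (mult A r s) (mult H (one H) (one H))"
    by (rule coinv_sw[OF r, where X="?X" and \<phi>="\<lambda>u v. tens A H (mult A u s) (mult H v (one H))"]) (rule ty | assumption)+
  finally show "sw A (mult A r s) (\<lambda>x y. tens A H x (\<pi> y)) = tens A H (mult A r s) (one H)"
    by (simp add: ty H_assoc)
qed

text \<open>Coinvariants are the fixed points of the linear map \<open>Pr\<close>, which gives
  closure.\<close>

lemma coinv_subspace: "vect (assoc_bialg A H j \<pi>)"
proof -
  note [ty] = coinvD(1)
  have *: "Pr a \<in> coinvariants A H \<pi>" if "a \<in> carr A" for a using Pr_coinv that .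
  have "0 \<in> coinvariants A H \<pi>"
    using *[of 0] Pr_id lin_map_0[OF A_facts(4) Pr_lin] by (simp add: ty)
  moreover have "x + y \<in> coinvariants A H \<pi>" if "x \<in> coinvariants A H \<pi>" "y \<in> coinvariants A H \<pi>" for x y
    using *[of "x + y"] Pr_id[OF that(1)] Pr_id[OF that(2)] lin_mapD(2)[OF Pr_lin] coinvD(1) that by (simp add: ty)
  moreover have "scale A c x \<in> coinvariants A H \<pi>" if "x \<in> coinvariants A H \<pi>" for x c
    using *[of "scale A c x"] Pr_id[OF that(1)] lin_mapD(3)[OF Pr_lin] coinvD(1) that by (simp add: ty)
  moreover have "vector_space (scale A)" using A_facts(4) by (simp add: vect_def)
  ultimately show ?thesis
    unfolding vect_def assoc_bialg_def
    by (simp add: module.subspace_def module_iff_vector_space)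
qed

text \<open>Of the four legs of h the outer two multiply r1 from both sides and the inner two
  multiply r2; coassociativity groups the inner ones into an adjoint action.\<close>

lemma ad_sw:
  assumes [ty]: "h \<in> carr H" "r \<in> carr A" and X: "vect X" and \<phi>: "bilin_map A A X \<phi>"
  shows "sw A (ad h r) \<phi> = sw H h (\<lambda>h1 t. sw H t (\<lambda>s h3. sw A r (\<lambda>r1 r2.
     \<phi> (mult A (mult A (j h1) r1) (j (S h3))) (ad s r2))))"
proof -
  note [ty] = X bilin_ty[OF \<phi>] \<phi>
  have phi2: "\<phi> u (sw H a \<psi>) = sw H a (\<lambda>x y. \<phi> u (\<psi> x y))"
    if "u \<in> carr A" "a \<in> carr H" "\<And>v w. v \<in> carr H \<Longrightarrow> w \<in> carr H \<Longrightarrow> \<psi> v w \<in> carr A" for u a \<psi>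
    by (rule push_lin[where X=A and Y=X]) (rule ty that | assumption)+
  have "sw A (ad h r) \<phi> = sw H h (\<lambda>h1 s. sw H s (\<lambda>h2 t. sw A r (\<lambda>r1 r2. sw H t (\<lambda>h3 h4.
      \<phi> (mult A (mult A (j h1) r1) (j (S h4))) (mult A (mult A (j h2) r2) (j (S h3)))))))"
    unfolding ad_def
    by (simp add: ty swr[where X=X] jp_sw[where X=X] phi2 cong: tlift_cong)
  also have "\<dots> = sw H h (\<lambda>h1 s. sw H s (\<lambda>h2 t. sw H t (\<lambda>h3 h4. sw A r (\<lambda>r1 r2.
      \<phi> (mult A (mult A (j h1) r1) (j (S h4))) (mult A (mult A (j h2) r2) (j (S h3)))))))"
    by (rule tlift_fun_cong,
        rule tlift_fun_cong, rule tlift_swap)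
  also have "\<dots> = sw H h (\<lambda>h1 s. sw H s (\<lambda>t h4. sw H t (\<lambda>h2 h3. sw A r (\<lambda>r1 r2.
      \<phi> (mult A (mult A (j h1) r1) (j (S h4))) (mult A (mult A (j h2) r2) (j (S h3)))))))"
    by (simp add: ty coassoc[where X=X] cong: tlift_cong)
  also have "\<dots> = sw H h (\<lambda>h1 s. sw H s (\<lambda>t h4. sw A r (\<lambda>r1 r2. sw H t (\<lambda>h2 h3.
      \<phi> (mult A (mult A (j h1) r1) (j (S h4))) (mult A (mult A (j h2) r2) (j (S h3)))))))"
    by (rule tlift_fun_cong,
        rule tlift_fun_cong, rule tlift_swap)
  also have "\<dots> = sw H h (\<lambda>h1 t. sw H t (\<lambda>s h3. sw A r (\<lambda>r1 r2.
     \<phi> (mult A (mult A (j h1) r1) (j (S h3))) (ad s r2))))"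
    unfolding ad_def by (simp add: ty phi2 cong: tlift_cong)
  finally show ?thesis .
qed

lemma ad_one: "a \<in> carr A \<Longrightarrow> ad (one H) a = a"
  by (simp add: ad_def ty swr[where X=A] jp_simps A_assoc)

lemma ad_mult_H:
  assumes [ty]: "h \<in> carr H" "k \<in> carr H" "a \<in> carr A"
  shows "ad (mult H h k) a = ad h (ad k a)"
  unfolding ad_def by (simp add: ty pu swr[where X=A] jp_simps A_assoc cong: tlift_cong)

lemma ad_A_one: "h \<in> carr H \<Longrightarrow> ad h (one A) = scale A (counit H h) (one A)"
  using S_lin_apply(2)[where X=A and \<psi>=j]
  by (simp add: ad_def ty jp_simps A_assoc cong: tlift_cong)

text \<open>In the product on the right, the two inner legs of h meet as S(h2) h3 between a and b
  and cancel.\<close>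

lemma ad_mult_A:
  assumes [ty]: "h \<in> carr H" "a \<in> carr A" "b \<in> carr A"
  shows "ad h (mult A a b) = sw H h (\<lambda>x y. mult A (ad x a) (ad y b))"
proof -
  have "sw H h (\<lambda>x y. mult A (ad x a) (ad y b)) = sw H h (\<lambda>x y. sw H y (\<lambda>h3 h4. sw H x (\<lambda>h1 h2.
     mult A (mult A (j h1) a) (mult A (j (mult H (S h2) h3)) (mult A b (j (S h4)))))))"
    unfolding ad_def by (simp add: ty pu jp_simps A_assoc cong: tlift_cong)
  also have "\<dots> = sw H h (\<lambda>x y. sw H x (\<lambda>h1 h2. sw H y (\<lambda>h3 h4.
     mult A (mult A (j h1) a) (mult A (j (mult H (S h2) h3)) (mult A b (j (S h4)))))))"
    by (rule tlift_fun_cong, rule tlift_swap)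
  also have "\<dots> = sw H h (\<lambda>h1 t. sw H t (\<lambda>h2 t'. sw H t' (\<lambda>h3 h4.
     mult A (mult A (j h1) a) (mult A (j (mult H (S h2) h3)) (mult A b (j (S h4)))))))"
    by (simp add: ty coassoc[where X=A] cong: tlift_cong)
  also have "\<dots> = sw H h (\<lambda>h1 t. mult A (mult A (j h1) a) (mult A (j (one H)) (mult A b (j (S t)))))"
    by (rule tlift_cong[OF refl], (rule ty | assumption)+,
        rule cancel(1)[where X=A and \<psi>="\<lambda>u v. mult A (mult A (j _) a) (mult A (j u) (mult A b (j (S v))))"])
      (rule ty | assumption)+
  also have "\<dots> = ad h (mult A a b)"
    unfolding ad_def by (simp add: ty jp_simps A_assoc cong: tlift_cong)
  finally show ?thesis by (rule sym)
qed

text \<open>Functionals that factor through \<Pi> therefore see left multiplication by j(h) as the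
  action of h on R. The coaction on the dual of R is identified through this.\<close>

lemma Pr_j_mult:
  assumes [ty]: "h \<in> carr H" "a \<in> carr A"
  shows "Pr (mult A (j h) a) = ad h (Pr a)"
  unfolding ad_def Pr_eq by (simp add: ty pu swr[where X=A] jp_sw[where X=A] jp_simps A_assoc cong: tlift_cong)

text \<open>Once the right side is written out, S(\<pi>(a2)) \<pi>(a3) cancels. The formula makes
  the coproduct of R multiplicative for the braided product, and it controls p \<circ> \<Pi> on
  products.\<close>

lemma Pr_mult:
  assumes [ty]: "a \<in> carr A" "b \<in> carr A"
  shows "Pr (mult A a b) = sw A a (\<lambda>x y. mult A (Pr x) (ad (\<pi> y) (Pr b)))"
proof -
  \<comment> \<open>An opaque name, since unfolding \<open>Pr_eq\<close> below must not expand
    \<Pi>(b).\<close>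
  define c where "c = Pr b"
  have [ty]: "c \<in> carr A" by (simp add: c_def ty)
  have "sw A a (\<lambda>x y. mult A (Pr x) (ad (\<pi> y) c)) = sw A a (\<lambda>x t. sw A t (\<lambda>z w. sw A x (\<lambda>x y.
     mult A x (mult A (j (mult H (S (\<pi> y)) (\<pi> z))) (mult A c (j (S (\<pi> w))))))))"
    unfolding ad_def Pr_eq by (simp add: ty pu jp_sw[where X=A] jp_simps A_assoc cong: tlift_cong)
  also have "\<dots> = sw A a (\<lambda>x t. sw A x (\<lambda>x y. sw A t (\<lambda>z w.
     mult A x (mult A (j (mult H (S (\<pi> y)) (\<pi> z))) (mult A c (j (S (\<pi> w))))))))"
    by (rule tlift_fun_cong, rule tlift_swap)
  also have "\<dots> = sw A a (\<lambda>x t. sw A t (\<lambda>t w. sw A t (\<lambda>y z.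
     mult A x (mult A (j (mult H (S (\<pi> y)) (\<pi> z))) (mult A c (j (S (\<pi> w))))))))"
    by (simp add: ty coassoc[where X=A] cong: tlift_cong)
  also have "\<dots> = sw A a (\<lambda>x t. sw A t (\<lambda>t w. scale A (counit A t) (
     mult A x (mult A (j (one H)) (mult A c (j (S (\<pi> w))))))))"
    by (rule tlift_cong[OF refl], (rule ty | assumption)+, rule tlift_cong[OF refl], (rule ty | assumption)+,
        rule cancel_pi(1)[where X=A and \<psi>="\<lambda>u. mult A _ (mult A (j u) (mult A c (j (S (\<pi> _)))))"])
      (rule ty | assumption)+
  also have "\<dots> = sw A a (\<lambda>x w. mult A x (mult A c (j (S (\<pi> w)))))"
    by (simp add: ty jp_simps A_assoc counit_sw[where X=A] cong: tlift_cong)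
  also have "\<dots> = Pr (mult A a b)"
    unfolding c_def Pr_eq by (simp add: ty pu swr[where X=A] jp_simps A_assoc cong: tlift_cong)
  finally show ?thesis unfolding c_def by (rule sym)
qed

lemma ad_coinv:
  assumes [ty]: "h \<in> carr H" and r: "r \<in> coinvariants A H \<pi>"
  shows "ad h r \<in> coinvariants A H \<pi>"
proof (rule coinvI)
  note [ty] = coinvD(1)[OF r]
  let ?X = "tprod A H"
  show "ad h r \<in> carr A" by (rule ty)+
  have pa: "\<pi> (ad s y) = sw H s (\<lambda>x z. mult H (mult H x (\<pi> y)) (S z))" if [ty]: "s \<in> carr H" "y \<in> carr A" for s y
    unfolding ad_def by (subst push_lin[OF bialg_mapD(3)[OF pm]]) (simp_all add: ty jp_simps cong: tlift_cong)
  have "sw A (ad h r) (\<lambda>x y. tens A H x (\<pi> y)) = sw H h (\<lambda>h1 t. sw H t (\<lambda>s h3. sw A r (\<lambda>r1 r2.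
     tens A H (mult A (mult A (j h1) r1) (j (S h3))) (sw H s (\<lambda>x z. mult H (mult H x (\<pi> r2)) (S z))))))"
    by (subst ad_sw[where X="?X"]) (simp_all add: ty pa cong: tlift_cong)
  also have "\<dots> = sw H h (\<lambda>h1 t. sw H t (\<lambda>s h3.
     tens A H (mult A (mult A (j h1) r) (j (S h3))) (sw H s (\<lambda>x z. mult H (mult H x (one H)) (S z)))))"
    by (rule tlift_cong[OF refl], (rule ty | assumption)+, rule tlift_cong[OF refl], (rule ty | assumption)+,
        rule coinv_sw[OF r, where X="?X" and \<phi>="\<lambda>u v. tens A H (mult A (mult A (j _) u) (j (S _))) (sw H _ (\<lambda>x z. mult H (mult H x v) (S z)))"])
      (rule ty | assumption)+
  also have "\<dots> = sw H h (\<lambda>h1 t. tens A H (mult A (mult A (j h1) r) (j (S t))) (one H))"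
    by (simp add: ty H_assoc S_right counit_sw[where X="?X"] cong: tlift_cong)
  also have "\<dots> = tens A H (ad h r) (one H)"
    by (simp add: ad_def ty pu cong: tlift_cong)
  finally show "sw A (ad h r) (\<lambda>x y. tens A H x (\<pi> y)) = tens A H (ad h r) (one H)" .
qed

end

section \<open>Structure pulled back along an injective linear map\<close>

lemma lin_map_eq:
  assumes "lin_map V W g" "vect V" "\<And>v. v \<in> carr V \<Longrightarrow> f v = g v"
  shows "lin_map V W f"
  using lin_map_cong[OF assms(2), of f g W] assms(1,3) by blast

lemma lin_map_inj:
  assumes U: "vect U" and Y: "vect Y" and F: "lin_map Y Z F" "inj_on F (carr Y)"
    and g: "\<And>u. u \<in> carr U \<Longrightarrow> g u \<in> carr Y" and Fg: "lin_map U Z (\<lambda>u. F (g u))"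
  shows "lin_map U Y g"
proof (rule lin_mapI)
  fix v v' c assume v: "v \<in> carr U"
  show "g v \<in> carr Y" by (rule g[OF v])
  have "F (g (scale U c v)) = F (scale Y c (g v))"
    using lin_mapD(3)[OF Fg v] lin_mapD(3)[OF F(1) g[OF v]] by simp
  then show "g (scale U c v) = scale Y c (g v)"
    by (rule inj_onD[OF F(2)]) (intro g scale_closed U Y v)+
  assume v': "v' \<in> carr U"
  have "F (g (v + v')) = F (g v + g v')"
    using lin_mapD(2)[OF Fg v v'] lin_mapD(2)[OF F(1) g[OF v] g[OF v']] by simp
  then show "g (v + v') = g v + g v'"
    by (rule inj_onD[OF F(2)]) (intro g plus_closed U Y v v')+
qed

lemma algebra_inj:
  assumes A: "algebra A" and B: "vect B" and F: "lin_map B A F" "inj_on F (carr B)"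
    and m: "\<And>x y. x \<in> carr B \<Longrightarrow> y \<in> carr B \<Longrightarrow> mult B x y \<in> carr B"
      "\<And>x y. x \<in> carr B \<Longrightarrow> y \<in> carr B \<Longrightarrow> F (mult B x y) = mult A (F x) (F y)"
    and o: "one B \<in> carr B" "F (one B) = one A"
  shows "algebra B"
proof -
  note [ty] = A B algebraD(1)[OF A] F(1) lin_map_comp[OF F(1)] lin_mapD(1)[OF F(1)]
  have "lin_map B B (\<lambda>y. mult B x y)" "lin_map B B (\<lambda>y. mult B y x)" if x[ty]: "x \<in> carr B" for x
  proof -
    have "lin_map B A (\<lambda>y. F (mult B x y)) = lin_map B A (\<lambda>y. mult A (F x) (F y))"
      "lin_map B A (\<lambda>y. F (mult B y x)) = lin_map B A (\<lambda>y. mult A (F y) (F x))"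
      by (rule lin_map_cong, rule B, simp add: m x)+
    moreover have "lin_map B A (\<lambda>y. mult A (F x) (F y))" "lin_map B A (\<lambda>y. mult A (F y) (F x))"
      by (rule ty | assumption)+
    ultimately show "lin_map B B (\<lambda>y. mult B x y)" "lin_map B B (\<lambda>y. mult B y x)"
      by (auto intro!: lin_map_inj[OF B B F] m x)
  qed
  then have "bilin_map B B B (mult B)" by (simp add: bilin_map_def)
  moreover have eq: "x = y" if "F x = F y" "x \<in> carr B" "y \<in> carr B" for x y
    using inj_onD[OF F(2)] that by blast
  have "mult B (mult B x y) z = mult B x (mult B y z)" if "x \<in> carr B" "y \<in> carr B" "z \<in> carr B" for x y z
    by (rule eq) (simp_all add: m that algebraD(4)[OF A] lin_mapD(1)[OF F(1)])
  moreover have "mult B (one B) x = x" "mult B x (one B) = x" if "x \<in> carr B" for x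
    by (rule eq; simp add: m o that algebraD(5,6)[OF A] lin_mapD(1)[OF F(1)])+
  ultimately show ?thesis using B o by (simp add: algebra_def)
qed

lemma tlift_transport:
  assumes A: "vect A" and B: "vect B" and F: "lin_map B A F"
    and t: "t \<in> carr (tprod B B)" "tlift B B (\<lambda>x y. tens A A (F x) (F y)) t = t'"
    and X: "vect X" and \<psi>: "bilin_map A A X \<psi>"
  shows "tlift B B (\<lambda>x y. \<psi> (F x) (F y)) t = tlift A A \<psi> t'"
proof -
  note [ty] = A B t(1) lin_mapD(1)[OF F] X bilin_mapD[OF \<psi>] \<psi>
  show ?thesis unfolding t(2)[symmetric]
    by (simp add: ty push_tlift[where X=X] tlift_tens[where X=X] cong: tlift_cong)
qed

text \<open>Under F the coproduct on B corresponds to that of A with its first leg projected by g.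
  For g = \<Pi> this is the coproduct of R, for g the identity F respects coproducts. The last
  condition on g is what coassociativity rests on.\<close>

lemma coalgebra_inj:
  assumes A: "coalgebra A" and B: "vect B" and F: "lin_map B A F" "inj_on F (carr B)"
    and g: "lin_map A A g" "\<And>a. a \<in> carr A \<Longrightarrow> counit A (g a) = counit A a"
      "\<And>b. b \<in> carr B \<Longrightarrow> g (F b) = F b"
      "\<And>a. a \<in> carr A \<Longrightarrow> sw A (g a) (\<lambda>x y. tens A A (g x) y) = sw A a (\<lambda>x y. tens A A (g x) (g y))"
    and cu: "\<And>b. b \<in> carr B \<Longrightarrow> counit B b = counit A (F b)"
    and cm: "\<And>b. b \<in> carr B \<Longrightarrow> comult B b \<in> carr (tprod B B)"
      "\<And>b. b \<in> carr B \<Longrightarrow> tlift B B (\<lambda>x y. tens A A (F x) (F y)) (comult B b) = sw A (F b) (\<lambda>x y. tens A A (g x) y)"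
  shows "coalgebra B"
proof -
  note [ty] = A coalgebraD(1)[OF A] B F(1) lin_mapD(1)[OF F(1)] lin_map_comp[OF F(1)] cm(1)
    g(1) lin_mapD(1)[OF g(1)] lin_map_comp[OF g(1)]
  let ?F2 = "tlift B B (\<lambda>x y. tens A A (F x) (F y))"
  have F2: "lin_map (tprod B B) (tprod A A) ?F2"
    by (rule tlift_universal(1), (rule ty | assumption)+)
  have F2_inj: "inj_on ?F2 (carr (tprod B B))"
    by (rule inj_onI, rule tmap_inj[where f=F and g=F and V'=A and W'=A]) (simp_all add: ty F)
  have "lin_map B (tprod A A) (\<lambda>b. sw A (F b) (\<lambda>x y. tens A A (g x) y))" by (rule ty | assumption)+
  then have F2c: "lin_map B (tprod A A) (\<lambda>b. ?F2 (comult B b))" by (rule lin_map_eq[OF _ B cm(2)])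
  have comult_lin: "lin_map B (tprod B B) (comult B)"
    by (rule lin_map_inj[where g="comult B", OF B vect_tprod F2 F2_inj cm(1) F2c])
  have "lin_map B ground (\<lambda>b. counit A (F b))" by (rule ty)+
  then have counit_lin: "lin_map B ground (counit B)" by (rule lin_map_eq[OF _ B cu])
  note [ty] = comult_lin lin_map_comp[OF comult_lin] counit_lin lin_map_comp[OF counit_lin]
  \<comment> \<open>Sweedler expressions over B are computed in A, with g on the first leg. The
    targets needed are the triple tensor space here and A itself in \<open>trA\<close>.\<close>
  have tr: "tlift B B (\<lambda>x y. \<psi> (F x) (F y)) (comult B b) = sw A (F b) (\<lambda>x y. \<psi> (g x) y)"
    if X: "vect X" and \<psi>: "bilin_map A A X \<psi>" and b[ty]: "b \<in> carr B"
    for X :: "('a, ('a, ('a, 'b, 'b) tensor, 'b) tensor) vect" and \<psi> b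
  proof -
    note [ty] = X bilin_ty[OF \<psi>] \<psi>
    show ?thesis unfolding tlift_transport[OF coalgebraD(1)[OF A] B F(1) cm(1)[OF b] cm(2)[OF b] X \<psi>]
      by (simp add: ty push_tlift[where X=X] tlift_tens[where X=X] cong: tlift_cong)
  qed
  have trA: "tlift B B (\<lambda>x y. \<psi> (F x) (F y)) (comult B b) = sw A (F b) (\<lambda>x y. \<psi> (g x) y)"
    if \<psi>: "bilin_map A A A \<psi>" and b[ty]: "b \<in> carr B" for \<psi> b
  proof -
    note [ty] = bilin_ty[OF \<psi>] \<psi>
    show ?thesis unfolding tlift_transport[OF coalgebraD(1)[OF A] B F(1) cm(1)[OF b] cm(2)[OF b] coalgebraD(1)[OF A] \<psi>]
      by (simp add: ty push_tlift[where X=A] tlift_tens[where X=A] cong: tlift_cong)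
  qed
  have 1: "tlift B B (\<lambda>c1 c2. tens (tprod B B) B (comult B c1) c2) (comult B c) =
        tlift B B (\<lambda>c1 c2. tlift B B (\<lambda>c3 c4. tens (tprod B B) B (tens B B c1 c3) c4) (comult B c2))
          (comult B c)" (is "?L = ?R") if [ty]: "c \<in> carr B" for c
  proof (rule tmap_inj[where f="?F2" and g=F and V="tprod B B" and W=B and V'="tprod A A" and W'=A])
    let ?X = "tprod (tprod A A) A"
    let ?F3 = "tlift (tprod B B) B (\<lambda>v w. tens (tprod A A) A (?F2 v) (F w))"
    have "?F3 ?L = tlift B B (\<lambda>x y. tens (tprod A A) A (sw A (F x) (\<lambda>x y. tens A A (g x) y)) (F y)) (comult B c)"
      by (simp add: ty push_tlift[where X="?X"] tlift_tens[where X="?X"] cm cong: tlift_cong)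
    also have "\<dots> = sw A (F c) (\<lambda>x y. tens (tprod A A) A (sw A (g x) (\<lambda>x y. tens A A (g x) y)) y)"
      by (rule tr[where X="?X" and \<psi>="\<lambda>x y. tens (tprod A A) A (sw A x (\<lambda>x y. tens A A (g x) y)) y"]) (rule ty | assumption)+
    also have "\<dots> = sw A (F c) (\<lambda>x s. sw A s (\<lambda>u v. tens (tprod A A) A (tens A A (g x) (g u)) v))"
      by (simp add: ty g(4) pu coassoc[where X="?X"] cong: tlift_cong)
    also have "\<dots> = tlift B B (\<lambda>x y. sw A (F y) (\<lambda>u v. tens (tprod A A) A (tens A A (F x) (g u)) v)) (comult B c)"
      by (rule tr[where X="?X" and \<psi>="\<lambda>x y. sw A y (\<lambda>u v. tens (tprod A A) A (tens A A x (g u)) v)", symmetric]) (rule ty | assumption)+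
    also have "\<dots> = tlift B B (\<lambda>x y. tlift B B (\<lambda>u v. tens (tprod A A) A (tens A A (F x) (F u)) (F v)) (comult B y)) (comult B c)"
      by (rule tlift_cong[OF refl], (rule ty | assumption)+,
          rule tr[where X="?X" and \<psi>="\<lambda>u v. tens (tprod A A) A (tens A A (F _) u) v", symmetric]) (rule ty | assumption)+
    also have "\<dots> = ?F3 ?R"
      by (simp add: ty push_tlift[where X="?X"] tlift_tens[where X="?X"] tlift_tens[where X="tprod A A"] cong: tlift_cong)
    finally show "?F3 ?L = ?F3 ?R" .
    show "inj_on ?F2 (carr (tprod B B))" "inj_on F (carr B)" by (rule F2_inj, rule F(2))
  qed (rule ty F2 | assumption)+
  have 2: "tlift B B (\<lambda>c1 c2. scale B (counit B c1) c2) (comult B c) = c"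
    "tlift B B (\<lambda>c1 c2. scale B (counit B c2) c1) (comult B c) = c" if [ty]: "c \<in> carr B" for c
  proof -
    have "F (tlift B B (\<lambda>c1 c2. scale B (counit B c1) c2) (comult B c)) = tlift B B (\<lambda>x y. scale A (counit A (F x)) (F y)) (comult B c)"
      by (subst push_lin[OF F(1)]) (simp_all add: ty cu lin_mapD(3)[OF F(1)] cong: tlift_cong)
    also have "\<dots> = sw A (F c) (\<lambda>x y. scale A (counit A (g x)) y)"
      by (rule trA[where \<psi>="\<lambda>x y. scale A (counit A x) y"]) (rule ty | assumption)+
    also have "\<dots> = F c" by (simp add: ty g(2) counit_sw[where X=A] cong: tlift_cong)
    finally show "tlift B B (\<lambda>c1 c2. scale B (counit B c1) c2) (comult B c) = c"
      by (rule inj_onD[OF F(2)]) (rule ty | assumption)+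
    have "F (tlift B B (\<lambda>c1 c2. scale B (counit B c2) c1) (comult B c)) = tlift B B (\<lambda>x y. scale A (counit A (F y)) (F x)) (comult B c)"
      by (subst push_lin[OF F(1)]) (simp_all add: ty cu lin_mapD(3)[OF F(1)] cong: tlift_cong)
    also have "\<dots> = sw A (F c) (\<lambda>x y. scale A (counit A y) (g x))"
      by (rule trA[where \<psi>="\<lambda>x y. scale A (counit A y) x"]) (rule ty | assumption)+
    also have "\<dots> = F c" by (simp add: ty g(3) counit_sw[where X=A] cong: tlift_cong)
    finally show "tlift B B (\<lambda>c1 c2. scale B (counit B c2) c1) (comult B c) = c"
      by (rule inj_onD[OF F(2)]) (rule ty | assumption)+
  qed
  show ?thesis unfolding coalgebra_def
    using comult_lin counit_lin B
    by (intro conjI ballI) (simp_all only: 1 2)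
qed

lemma yd_of_fields [simp]:
  "carr (yd_of R) = carr R" "scale (yd_of R) = scale R" "yd_act (yd_of R) = act R" "yd_coact (yd_of R) = coact R"
  by (simp_all add: yd_of_def)

lemma same_yd_of [simp]:
  "vect (yd_of R) = vect R"
  "lin_map U (yd_of R) = lin_map U R"
  "lin_map (yd_of R) U' = lin_map R U'"
  "bilin_map W (yd_of R) (yd_of R) = bilin_map W R R"
  "tprod W (yd_of R) = tprod W R"
  "tens W (yd_of R) = tens W R"
  "tlift W (yd_of R) = tlift W R"
  "tprod (yd_of R) W = tprod R W"
  "tens (yd_of R) W = tens R W"
  "tlift (yd_of R) W = tlift R W"
proof -
  show "tens W (yd_of R) = tens W R" "tens (yd_of R) W = tens R W" by (rule tens_same; simp)+
  show "tprod W (yd_of R) = tprod W R" "tlift W (yd_of R) = tlift W R"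
    "tprod (yd_of R) W = tprod R W" "tlift (yd_of R) W = tlift R W"
    by (rule tprod_same; simp)+
qed (auto simp: vect_def lin_map_def bilin_map_def fun_eq_iff)

lemma same_yd_unit [simp]:
  "vect (yd_unit (H :: ('k::field, 'h::ab_group_add, 'x) bialg_scheme)) = vect (ground :: ('k, 'k) vect)"
  "lin_map U (yd_unit H) = lin_map U ground"
  "lin_map (yd_unit H) U' = lin_map ground U'"
  "bilin_map W (yd_unit H) (yd_unit H) = bilin_map W ground ground"
  "tprod W (yd_unit H) = tprod W ground"
  "tens W (yd_unit H) = tens W ground"
  "tlift W (yd_unit H) = tlift W ground"
  "scale (yd_unit H) = (*)" "carr (yd_unit H) = UNIV"
proof -
  show "scale (yd_unit H) = (*)" "carr (yd_unit H) = UNIV"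
    by (simp_all add: yd_unit_def)
  show "tens W (yd_unit H) = tens W ground" by (rule tens_same; simp add: yd_unit_def ground_def)
  show "tprod W (yd_unit H) = tprod W ground" "tlift W (yd_unit H) = tlift W ground"
    by (rule tprod_same; simp add: yd_unit_def ground_def)+
qed (auto simp: vect_def lin_map_def bilin_map_def fun_eq_iff ground_def yd_unit_def)

lemma tens_ground: "tens V ground v c = scale (tprod V ground) c (tens V ground v 1)"
  using tens_scale_out(2)[of V ground v c 1] by simp

context hopf begin

lemma yd_object_unit: "yd_object H (yd_unit H)"
proof -
  have act: "yd_act (yd_unit H) h c = counit H h * c" and co: "yd_coact (yd_unit H) c = tens H ground (one H) c" for h c
    by (simp_all add: yd_unit_def)
  have m: "left_module H (yd_unit H)"
    unfolding left_module_def act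
    by (simp add: bialgebraD(4,5) bilin_map_def act ty)
  let ?X = "tprod (tprod H H) ground"
  have "lin_map ground (tprod H ground) (yd_coact (yd_unit H))"
    unfolding co by (rule ty | assumption)+
  then have c: "left_comodule H (yd_unit H)"
    unfolding left_comodule_def co
    by (simp add: ty tlift_tens[where X="?X"] tlift_tens[where X="ground"] bialgebraD(4,6))
  have "sw H h (\<lambda>h1 h2. tlift H ground (\<lambda>x y. tens H ground (mult H h1 x) (counit H h2 * y)) (tens H ground (one H) c)) =
        sw H h (\<lambda>h1 h2. tlift H ground (\<lambda>x y. tens H ground (mult H x h2) y) (tens H ground (one H) (counit H h1 * c)))"
    if [ty]: "h \<in> carr H" for h c
  proof -
    have t: "tens H ground x (a * b) = scale (tprod H ground) a (tens H ground x b)" for x a b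
      using tens_scale_out(2)[of H ground x a b] by simp
    show ?thesis
      by (simp add: ty tlift_tens[where X="tprod H ground"] algebraD(5,6) cong: tlift_cong)
        (simp add: ty t counit_sw[where X="tprod H ground"] cong: tlift_cong)
  qed
  then show ?thesis unfolding yd_object_def act co using m c by (simp add: act co)
qed

end

section \<open>Identities in A that become the bialgebra axioms of R\<close>

context projection begin

lemma counit_Pr: "a \<in> carr A \<Longrightarrow> counit A (Pr a) = counit A a"
  unfolding Pr_eq
  by (subst push_lin[OF coalgebraD(3)])
    (simp_all add: ty bialgebraD(5) jp_simps counit_sw[where X=ground, simplified] mult.commute cong: tlift_cong)

lemma counit_ad: "h \<in> carr H \<Longrightarrow> a \<in> carr A \<Longrightarrow> counit A (ad h a) = counit H h * counit A a"
  unfolding ad_def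
  by (subst push_lin[OF coalgebraD(3)])
    (simp_all add: ty bialgebraD(5) jp_simps counit_sw(2)[where X=ground and f="\<lambda>x. counit A a * counit H x", simplified] mult.commute cong: tlift_cong)

text \<open>By \<open>Pr_sw\<close> the first leg has the form a1 j(S(\<pi>(a3))), and \<Pi> reduces
  the factor from j(H) to a counit value. This is the condition on g in
  \<open>coalgebra_inj\<close>.\<close>

lemma Pr_comult:
  assumes [ty]: "a \<in> carr A" and X: "vect X" and \<phi>: "bilin_map A A X \<phi>"
  shows "sw A (Pr a) (\<lambda>x y. \<phi> (Pr x) y) = sw A a (\<lambda>x y. \<phi> (Pr x) (Pr y))"
proof -
  note [ty] = X bilin_ty[OF \<phi>] \<phi>
  have s: "\<phi> (scale A c x) y = scale X c (\<phi> x y)" if "x \<in> carr A" "y \<in> carr A" for c x y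
    using lin_mapD(3)[OF bilin_mapD(2)[OF \<phi> that(2)] that(1)] .
  show ?thesis
    by (simp add: ty Pr_sw[where X=X] Pr_mult_j jp_simps s counit_sw[where X=X] cong: tlift_cong)
qed

text \<open>The Yetter-Drinfel'd condition already holds on all of A: the first leg of the coproduct
  of h . a ends in an antipode factor, which the extra leg of h cancels.\<close>

lemma yd_A:
  assumes [ty]: "h \<in> carr H" "a \<in> carr A"
  shows "sw H h (\<lambda>h1 h2. sw A a (\<lambda>u v. tens H A (mult H h1 (\<pi> u)) (ad h2 v))) =
    sw H h (\<lambda>h1 h2. sw A (ad h1 a) (\<lambda>u v. tens H A (mult H (\<pi> u) h2) v))"
proof -
  let ?X = "tprod H A"
  have "sw H h (\<lambda>h1 h2. sw A (ad h1 a) (\<lambda>u v. tens H A (mult H (\<pi> u) h2) v)) =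
    sw H h (\<lambda>h1 t. sw H t (\<lambda>s t'. sw H t' (\<lambda>h3 h4. sw A a (\<lambda>r1 r2. tens H A (mult H h1 (mult H (\<pi> r1) (mult H (S h3) h4))) (ad s r2)))))"
    by (simp add: ty ad_sw[where X="?X"] jp_simps H_assoc coassoc[where X="?X"] cong: tlift_cong)
  also have "\<dots> = sw H h (\<lambda>h1 t. sw H t (\<lambda>s t'. scale ?X (counit H t') (sw A a (\<lambda>r1 r2. tens H A (mult H h1 (mult H (\<pi> r1) (one H))) (ad s r2)))))"
    by (rule tlift_cong[OF refl], (rule ty | assumption)+, rule tlift_cong[OF refl], (rule ty | assumption)+,
        rule S_lin_apply(1)[where X="?X" and \<psi>="\<lambda>u. sw A a (\<lambda>r1 r2. tens H A (mult H _ (mult H (\<pi> r1) u)) (ad _ r2))"])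
      (rule ty | assumption)+
  also have "\<dots> = sw H h (\<lambda>h1 h2. sw A a (\<lambda>u v. tens H A (mult H h1 (\<pi> u)) (ad h2 v)))"
    by (simp add: ty counit_sw[where X="?X"] H_assoc cong: tlift_cong)
  finally show ?thesis by (rule sym)
qed

text \<open>S(h2) h3 cancels. The rule moves j(h) past an element of A and so matches the product of
  A with that of the biproduct.\<close>

lemma ad_j:
  assumes [ty]: "h \<in> carr H" "a \<in> carr A"
  shows "sw H h (\<lambda>h1 h2. mult A (ad h1 a) (j h2)) = mult A (j h) a"
proof -
  have "sw H h (\<lambda>h1 h2. mult A (ad h1 a) (j h2)) = sw H h (\<lambda>h1 t. sw H t (\<lambda>h2 h3. mult A (mult A (j h1) a) (j (mult H (S h2) h3))))"
    unfolding ad_def by (simp add: ty pu jp_simps A_assoc coassoc[where X=A] cong: tlift_cong)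
  also have "\<dots> = mult A (mult A (j h) a) (j (one H))"
    by (rule cancel(3)[where X=A and \<psi>="\<lambda>u v. mult A (mult A (j u) a) (j v)"]) (rule ty | assumption)+
  finally show ?thesis by (simp add: jp_simps A_assoc ty)
qed

text \<open>The comodule property of the coproduct of R, read in A: the antipode factor hidden in
  \<Pi> meets \<pi> of the next leg and cancels.\<close>

lemma comult_coact_A:
  assumes [ty]: "a \<in> carr A"
  shows "sw A a (\<lambda>c b. sw A (Pr c) (\<lambda>u v. sw A b (\<lambda>u' v'. tens H (tprod A A) (mult H (\<pi> u) (\<pi> u')) (tens A A v v')))) =
    sw A a (\<lambda>u v. sw A v (\<lambda>p q. tens H (tprod A A) (\<pi> u) (tens A A (Pr p) q)))"
proof -
  let ?X = "tprod H (tprod A A)"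
  have "sw A a (\<lambda>c b. sw A (Pr c) (\<lambda>u v. sw A b (\<lambda>u' v'. tens H (tprod A A) (mult H (\<pi> u) (\<pi> u')) (tens A A v v')))) =
    sw A a (\<lambda>x t. sw A t (\<lambda>y t'. sw A t' (\<lambda>s v'. sw A s (\<lambda>z u'.
      tens H (tprod A A) (mult H (\<pi> x) (mult H (S (\<pi> z)) (\<pi> u'))) (tens A A (Pr y) v')))))"
    by (simp add: ty Pr_sw[where X="?X"] jp_simps H_assoc coassoc[where X="?X"] cong: tlift_cong)
  also have "\<dots> = sw A a (\<lambda>x t. sw A t (\<lambda>y t'. sw A t' (\<lambda>s v'. scale ?X (counit A s)
      (tens H (tprod A A) (mult H (\<pi> x) (one H)) (tens A A (Pr y) v')))))"
    by (rule tlift_cong[OF refl], (rule ty | assumption)+, rule tlift_cong[OF refl], (rule ty | assumption)+,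
        rule tlift_cong[OF refl], (rule ty | assumption)+,
        rule cancel_pi(1)[where X="?X" and \<psi>="\<lambda>u. tens H (tprod A A) (mult H (\<pi> _) u) (tens A A (Pr _) _)"])
      (rule ty | assumption)+
  also have "\<dots> = sw A a (\<lambda>u v. sw A v (\<lambda>p q. tens H (tprod A A) (\<pi> u) (tens A A (Pr p) q)))"
    by (simp add: ty counit_sw[where X="?X"] H_assoc del: tens_scale_out cong: tlift_cong)
  finally show ?thesis .
qed

text \<open>This is \<open>Pr_jpi\<close> on the first of two legs.\<close>

lemma Pr_jpi_sw:
  assumes [ty]: "a \<in> carr A" and X: "vect X" and \<phi>: "bilin_map A A X \<phi>"
  shows "sw A a (\<lambda>c d. sw A d (\<lambda>u v. \<phi> (mult A (Pr c) (j (\<pi> u))) v)) = sw A a \<phi>"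
proof -
  note [ty] = X bilin_ty[OF \<phi>] \<phi>
  have p: "sw A s (\<lambda>x y. \<phi> (mult A (Pr x) (j (\<pi> y))) v) = \<phi> s v" if [ty]: "s \<in> carr A" "v \<in> carr A" for s v
  proof -
    have "\<phi> (sw A s (\<lambda>x y. mult A (Pr x) (j (\<pi> y)))) v = sw A s (\<lambda>x y. \<phi> (mult A (Pr x) (j (\<pi> y))) v)"
      by (rule push_lin[where X=A and Y=X]) (rule ty | assumption)+
    then show ?thesis by (simp add: Pr_jpi ty)
  qed
  have "sw A a (\<lambda>c d. sw A d (\<lambda>u v. \<phi> (mult A (Pr c) (j (\<pi> u))) v)) = sw A a (\<lambda>s v. sw A s (\<lambda>x y. \<phi> (mult A (Pr x) (j (\<pi> y))) v))"
    by (rule sym, rule coassoc[where X=X]) (rule ty | assumption)+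
  also have "\<dots> = sw A a \<phi>" by (simp add: p ty cong: tlift_cong)
  finally show ?thesis .
qed

end

section \<open>The biproduct theorem\<close>

text \<open>The equations \<open>f_coact\<close> and \<open>f_comult\<close> live in tensor products
  over A; about tensors over R only membership is assumed. The axioms of a bialgebra in the category
  are conclusions.\<close>

locale radford = projection H A j \<pi>
  for H :: "('k::field, 'h::ab_group_add) bialg" and A :: "('k, 'a::ab_group_add) bialg"
    and j :: "'h \<Rightarrow> 'a" and \<pi> :: "'a \<Rightarrow> 'h" +
  fixes R :: "('k, 'h, 'r::ab_group_add) yd_bialg" and f :: "'r \<Rightarrow> 'a"
  assumes vR [simp, ty]: "vect R"
    and fl: "lin_map R A f" and finj: "inj_on f (carr R)" and fim: "f ` carr R = coinvariants A H \<pi>"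
    and mult_R [ty]: "\<And>r s. r \<in> carr R \<Longrightarrow> s \<in> carr R \<Longrightarrow> mult R r s \<in> carr R"
    and f_mult: "\<And>r s. r \<in> carr R \<Longrightarrow> s \<in> carr R \<Longrightarrow> f (mult R r s) = mult A (f r) (f s)"
    and one_R [ty]: "one R \<in> carr R" and f_one: "f (one R) = one A"
    and counit_R: "\<And>r. r \<in> carr R \<Longrightarrow> counit R r = counit A (f r)"
    and act_R [ty]: "\<And>h r. h \<in> carr H \<Longrightarrow> r \<in> carr R \<Longrightarrow> act R h r \<in> carr R"
    and f_act: "\<And>h r. h \<in> carr H \<Longrightarrow> r \<in> carr R \<Longrightarrow> f (act R h r) = ad h (f r)"
    and coact_R [ty]: "\<And>r. r \<in> carr R \<Longrightarrow> coact R r \<in> carr (tprod H R)"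
    and f_coact: "\<And>r. r \<in> carr R \<Longrightarrow> tlift H R (\<lambda>x y. tens H A x (f y)) (coact R r) = sw A (f r) (\<lambda>x y. tens H A (\<pi> x) y)"
    and comult_R [ty]: "\<And>r. r \<in> carr R \<Longrightarrow> comult R r \<in> carr (tprod R R)"
    and f_comult: "\<And>r. r \<in> carr R \<Longrightarrow> tlift R R (\<lambda>x y. tens A A (f x) (f y)) (comult R r) = sw A (f r) (\<lambda>x y. tens A A (Pr x) y)"
begin

lemmas f_ty [ty] = fl lin_mapD(1)[OF fl] lin_map_comp[OF fl]

lemma f_coinv: "r \<in> carr R \<Longrightarrow> f r \<in> coinvariants A H \<pi>"
  using fim by auto

lemma f_eqI: "f x = f y \<Longrightarrow> x \<in> carr R \<Longrightarrow> y \<in> carr R \<Longrightarrow> x = y"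
  using inj_onD[OF finj] by blast

text \<open>The maps id \<otimes> f and f \<otimes> f. They are injective, so equations between
  tensors over R are verified in tensor products over A.\<close>

abbreviation "F1 \<equiv> tlift H R (\<lambda>x y. tens H A x (f y))"
abbreviation "F2 \<equiv> tlift R R (\<lambda>x y. tens A A (f x) (f y))"

lemma F1_lin: "lin_map (tprod H R) (tprod H A) F1"
  and F2_lin: "lin_map (tprod R R) (tprod A A) F2"
  by (rule tlift_universal(1), (rule ty | assumption)+)+

lemma F1_eqI: "F1 t = F1 t' \<Longrightarrow> t \<in> carr (tprod H R) \<Longrightarrow> t' \<in> carr (tprod H R) \<Longrightarrow> t = t'"
  by (rule tmap_inj[where f="\<lambda>x. x" and g=f and V'=H and W'=A]) (simp_all add: ty finj)

lemma F2_eqI: "F2 t = F2 t' \<Longrightarrow> t \<in> carr (tprod R R) \<Longrightarrow> t' \<in> carr (tprod R R) \<Longrightarrow> t = t'"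
  by (rule tmap_inj[where f=f and g=f and V'=A and W'=A]) (simp_all add: ty finj)

lemma F1_inj: "inj_on F1 (carr (tprod H R))" and F2_inj: "inj_on F2 (carr (tprod R R))"
  using F1_eqI F2_eqI by (auto intro!: inj_onI)

lemma coact_lin_R: "lin_map R (tprod H R) (coact R)"
proof (rule lin_map_inj[OF vR vect_tprod F1_lin F1_inj])
  have "lin_map R (tprod H A) (\<lambda>r. sw A (f r) (\<lambda>x y. tens H A (\<pi> x) y))"
    by (rule ty | assumption)+
  then show "lin_map R (tprod H A) (\<lambda>u. F1 (coact R u))"
    by (rule lin_map_eq[OF _ vR f_coact])
qed (rule ty)

lemma coalgebra_R: "coalgebra R"
proof (rule coalgebra_inj[OF A_facts(3) vR fl finj Pr_lin counit_Pr _ _ counit_R comult_R f_comult])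
  show "Pr (f r) = f r" if "r \<in> carr R" for r using Pr_id[OF f_coinv[OF that]] .
  show "sw A (Pr a) (\<lambda>x y. tens A A (Pr x) y) = sw A a (\<lambda>x y. tens A A (Pr x) (Pr y))" if "a \<in> carr A" for a
    by (rule Pr_comult[OF that, where X="tprod A A" and \<phi>="tens A A"]) (rule ty | assumption)+
qed

lemmas comult_lin_R = coalgebraD(2)[OF coalgebra_R] and counit_lin_R = coalgebraD(3)[OF coalgebra_R]

lemma act_bilin_R: "bilin_map H R R (act R)"
proof (rule bilin_mapI)
  fix h assume [ty]: "h \<in> carr H"
  have "lin_map R A (\<lambda>r. ad h (f r))" by (rule ty)+
  then have "lin_map R A (\<lambda>r. f (act R h r))" by (rule lin_map_eq[OF _ vR]) (simp add: f_act ty)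
  then show "lin_map R R (act R h)" by (intro lin_map_inj[OF vR vR fl finj]) (simp_all add: ty)
next
  fix r assume [ty]: "r \<in> carr R"
  have "lin_map H A (\<lambda>h. ad h (f r))" by (rule ty)+
  then have "lin_map H A (\<lambda>h. f (act R h r))" by (rule lin_map_eq[OF _ H_facts(3)]) (simp add: f_act ty)
  then show "lin_map H R (\<lambda>h. act R h r)" by (intro lin_map_inj[OF H_facts(3) vR fl finj]) (simp_all add: ty)
qed

lemmas R_ty [ty] = lin_map_comp[OF coact_lin_R] coact_lin_R lin_map_comp[OF comult_lin_R] comult_lin_R
  lin_map_comp[OF counit_lin_R] counit_lin_R lin_map_comp[OF bilin_mapD(1)[OF act_bilin_R]] lin_map_comp[OF bilin_mapD(2)[OF act_bilin_R]]

lemma algebra_R [simp, ty]: "algebra R"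
  by (rule algebra_inj[OF A_facts(2) vR fl finj mult_R f_mult one_R f_one])

lemma R_coact:
  assumes X: "vect X" and r: "r \<in> carr R" and \<psi>: "bilin_map H A X \<psi>"
  shows "tlift H R (\<lambda>x y. \<psi> x (f y)) (coact R r) = sw A (f r) (\<lambda>x y. \<psi> (\<pi> x) y)"
proof -
  note [ty] = X r bilin_ty[OF \<psi>]
  have "tlift H A \<psi> (F1 (coact R r)) = tlift H A \<psi> (sw A (f r) (\<lambda>x y. tens H A (\<pi> x) y))"
    by (simp add: f_coact r)
  then show ?thesis by (simp add: ty push_tlift[where X=X] tlift_tens[where X=X] cong: tlift_cong)
qed

text \<open>The first leg carries \<open>Pr\<close> because the coproduct of R is \<Pi>(r1)
  \<otimes> r2.\<close>

lemma R_comult: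
  assumes X: "vect X" and r: "r \<in> carr R" and \<psi>: "bilin_map A A X \<psi>"
  shows "tlift R R (\<lambda>x y. \<psi> (f x) (f y)) (comult R r) = sw A (f r) (\<lambda>x y. \<psi> (Pr x) y)"
proof -
  note [ty] = X r bilin_ty[OF \<psi>] \<psi>
  show ?thesis unfolding tlift_transport[OF A_facts(4) vR fl comult_R[OF r] f_comult[OF r] X \<psi>]
    by (simp add: ty push_tlift[where X=X] tlift_tens[where X=X] cong: tlift_cong)
qed

lemma pi_f: "r \<in> carr R \<Longrightarrow> \<pi> (f r) = scale H (counit A (f r)) (one H)"
  using pi_Pr[of "f r"] Pr_id[OF f_coinv] by (simp add: ty)

lemma Pr_f: "r \<in> carr R \<Longrightarrow> Pr (f r) = f r"
  using Pr_id[OF f_coinv] by simp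

lemma yd_object_R: "yd_object H (yd_of R)"
proof -
  have "left_module H (yd_of R)"
    unfolding left_module_def
  proof (intro conjI ballI)
    show "bilin_map H (yd_of R) (yd_of R) (yd_act (yd_of R))" using act_bilin_R by (simp add: bilin_map_def)
    fix m assume "m \<in> carr (yd_of R)"
    then have m[ty]: "m \<in> carr R" by simp
    show "yd_act (yd_of R) (one H) m = m"
      by (simp, rule f_eqI) (simp_all add: ty f_act ad_one)
    fix h h' assume [ty]: "h \<in> carr H" "h' \<in> carr H"
    show "yd_act (yd_of R) (mult H h h') m = yd_act (yd_of R) h (yd_act (yd_of R) h' m)"
      by (simp, rule f_eqI) (simp_all add: ty f_act ad_mult_H)
  qed simp
  moreover have "left_comodule H (yd_of R)"
    unfolding left_comodule_def
  proof (intro conjI ballI)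
    show "lin_map (yd_of R) (tprod H (yd_of R)) (yd_coact (yd_of R))" by (simp add: coact_lin_R)
    fix m assume "m \<in> carr (yd_of R)"
    then have m[ty]: "m \<in> carr R" by simp
    let ?X = "tprod (tprod H H) A"
    let ?L = "tlift H R (\<lambda>x y. tens (tprod H H) R (comult H x) y) (coact R m)"
    let ?R = "tlift H R (\<lambda>x y. tlift H R (\<lambda>x' y'. tens (tprod H H) R (tens H H x x') y') (coact R y)) (coact R m)"
    have "?L = ?R"
    proof (rule tmap_inj[where f="\<lambda>x. x" and g=f and V="tprod H H" and W=R and V'="tprod H H" and W'=A])
      have "tlift (tprod H H) R (\<lambda>v w. tens (tprod H H) A v (f w)) ?L = tlift H R (\<lambda>x y. tens (tprod H H) A (comult H x) (f y)) (coact R m)"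
        by (simp add: ty push_tlift[where X="?X"] tlift_tens[where X="?X"] cong: tlift_cong)
      also have "\<dots> = sw A (f m) (\<lambda>x y. tens (tprod H H) A (comult H (\<pi> x)) y)"
        by (rule R_coact[where X="?X" and \<psi>="\<lambda>x y. tens (tprod H H) A (comult H x) y"]) (rule ty | assumption)+
      also have "\<dots> = sw A (f m) (\<lambda>x s. sw A s (\<lambda>u v. tens (tprod H H) A (tens H H (\<pi> x) (\<pi> u)) v))"
        by (simp add: ty bialg_mapD(7)[OF pm] pu coassoc[where X="?X"] cong: tlift_cong)
      also have "\<dots> = tlift H R (\<lambda>x y. sw A (f y) (\<lambda>u v. tens (tprod H H) A (tens H H x (\<pi> u)) v)) (coact R m)"
        by (rule R_coact[where X="?X" and \<psi>="\<lambda>x y. sw A y (\<lambda>u v. tens (tprod H H) A (tens H H x (\<pi> u)) v)", symmetric]) (rule ty | assumption)+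
      also have "\<dots> = tlift H R (\<lambda>x y. tlift H R (\<lambda>u v. tens (tprod H H) A (tens H H x u) (f v)) (coact R y)) (coact R m)"
        by (rule tlift_cong[OF refl], (rule ty | assumption)+,
          rule R_coact[where X="?X" and \<psi>="\<lambda>u v. tens (tprod H H) A (tens H H _ u) v", symmetric]) (rule ty | assumption)+
      also have "\<dots> = tlift (tprod H H) R (\<lambda>v w. tens (tprod H H) A v (f w)) ?R"
        by (simp add: ty push_tlift[where X="?X"] tlift_tens[where X="?X"] cong: tlift_cong)
      finally show "tlift (tprod H H) R (\<lambda>v w. tens (tprod H H) A v (f w)) ?L = tlift (tprod H H) R (\<lambda>v w. tens (tprod H H) A v (f w)) ?R" .
      show "inj_on (\<lambda>x. x) (carr (tprod H H))" "inj_on f (carr R)" by (simp, rule finj)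
    qed (rule ty | assumption)+
    then show "tlift H (yd_of R) (\<lambda>x y. tens (tprod H H) (yd_of R) (comult H x) y) (yd_coact (yd_of R) m) =
        tlift H (yd_of R) (\<lambda>x y. tlift H (yd_of R) (\<lambda>x' y'. tens (tprod H H) (yd_of R) (tens H H x x') y') (yd_coact (yd_of R) y))
          (yd_coact (yd_of R) m)" by simp
    have "tlift H R (\<lambda>x y. scale R (counit H x) y) (coact R m) = m"
    proof (rule f_eqI)
      have "f (tlift H R (\<lambda>x y. scale R (counit H x) y) (coact R m)) = tlift H R (\<lambda>x y. scale A (counit H x) (f y)) (coact R m)"
        by (subst push_lin[OF fl]) (simp_all add: ty lin_mapD(3)[OF fl] cong: tlift_cong)
      also have "\<dots> = sw A (f m) (\<lambda>x y. scale A (counit H (\<pi> x)) y)"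
        by (rule R_coact[where X=A and \<psi>="\<lambda>x y. scale A (counit H x) y"]) (rule ty | assumption)+
      also have "\<dots> = f m" by (simp add: ty jp_simps counit_sw[where X=A] cong: tlift_cong)
      finally show "f (tlift H R (\<lambda>x y. scale R (counit H x) y) (coact R m)) = f m" .
    qed (rule ty | assumption)+
    then show "tlift H (yd_of R) (\<lambda>x y. scale (yd_of R) (counit H x) y) (yd_coact (yd_of R) m) = m" by simp
  qed simp
  moreover have "sw H h (\<lambda>h1 h2. tlift H R (\<lambda>x y. tens H R (mult H h1 x) (act R h2 y)) (coact R m)) =
        sw H h (\<lambda>h1 h2. tlift H R (\<lambda>x y. tens H R (mult H x h2) y) (coact R (act R h1 m)))" (is "?L = ?R")
    if [ty]: "h \<in> carr H" "m \<in> carr R" for h m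
  proof (rule F1_eqI)
    let ?X = "tprod H A"
    have "F1 ?L = sw H h (\<lambda>h1 h2. tlift H R (\<lambda>x y. tens H A (mult H h1 x) (ad h2 (f y))) (coact R m))"
      by (simp add: ty push_tlift[where X="?X"] tlift_tens[where X="?X"] f_act cong: tlift_cong)
    also have "\<dots> = sw H h (\<lambda>h1 h2. sw A (f m) (\<lambda>u v. tens H A (mult H h1 (\<pi> u)) (ad h2 v)))"
      by (rule tlift_cong[OF refl], (rule ty | assumption)+,
          rule R_coact[where X="?X" and \<psi>="\<lambda>x y. tens H A (mult H _ x) (ad _ y)"]) (rule ty | assumption)+
    also have "\<dots> = sw H h (\<lambda>h1 h2. sw A (ad h1 (f m)) (\<lambda>u v. tens H A (mult H (\<pi> u) h2) v))"
      by (rule yd_A) (rule ty | assumption)+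
    also have "\<dots> = sw H h (\<lambda>h1 h2. sw A (f (act R h1 m)) (\<lambda>u v. tens H A (mult H (\<pi> u) h2) v))"
      by (simp add: ty f_act cong: tlift_cong)
    also have "\<dots> = sw H h (\<lambda>h1 h2. tlift H R (\<lambda>x y. tens H A (mult H x h2) (f y)) (coact R (act R h1 m)))"
      by (rule tlift_cong[OF refl], (rule ty | assumption)+,
          rule R_coact[where X="?X" and \<psi>="\<lambda>x y. tens H A (mult H x _) y", symmetric]) (rule ty | assumption)+
    also have "\<dots> = F1 ?R"
      by (simp add: ty push_tlift[where X="?X"] tlift_tens[where X="?X"] f_act cong: tlift_cong)
    finally show "F1 ?L = F1 ?R" .
  qed (rule ty | assumption)+
  ultimately show ?thesis unfolding yd_object_def by simp
qed

end

lemma yd_unit_fields [simp]: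
  "yd_act (yd_unit H) h c = counit H h * c" "yd_coact (yd_unit H) c = tens H ground (one H) c"
  by (simp_all add: yd_unit_def)

section \<open>The structure maps of R are morphisms in the category\<close>

context radford begin

abbreviation "YR \<equiv> yd_of R"
abbreviation "YT \<equiv> yd_tensor H (yd_of R) (yd_of R)"

lemma hopf_ax: "hopf H S" by unfold_locales

lemma yd_object_RR: "yd_object H YT"
  by (rule yd_object_tensor[OF hopf_ax yd_object_R yd_object_R])

lemma act_T: "yd_act YT h t = tlift R R (\<lambda>m n. sw H h (\<lambda>h1 h2. tens R R (act R h1 m) (act R h2 n))) t"
  by (simp add: yd_tensor_def)

lemma coact_T: "yd_coact YT t = tlift R R (\<lambda>m n. tlift H R (\<lambda>x m0. tlift H R (\<lambda>y n0.
    tens H (tprod R R) (mult H x y) (tens R R m0 n0)) (coact R n)) (coact R m)) t"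
  by (simp add: yd_tensor_def)

lemma mult_morphism: "yd_morphism H YT YR (tlift R R (mult R))"
proof -
  have lin: "lin_map (tprod R R) R (tlift R R (mult R))"
    by (rule tlift_universal(1)) (rule ty algebraD(2) | assumption)+
  note [ty] = lin lin_map_comp[OF lin]
  have 1: "tlift R R (mult R) (tlift R R (\<lambda>m n. sw H h (\<lambda>h1 h2. tens R R (act R h1 m) (act R h2 n))) t) = act R h (tlift R R (mult R) t)"
    if [ty]: "h \<in> carr H" and t: "t \<in> carr (tprod R R)" for h t
  proof (rule tprod_eqI[OF vR vR _ _ t, where X=R and f="\<lambda>t. tlift R R (mult R) (tlift R R (\<lambda>m n. sw H h (\<lambda>h1 h2. tens R R (act R h1 m) (act R h2 n))) t)"
          and g="\<lambda>t. act R h (tlift R R (mult R) t)"])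
    fix r s assume [ty]: "r \<in> carr R" "s \<in> carr R"
    have "sw H h (\<lambda>h1 h2. mult R (act R h1 r) (act R h2 s)) = act R h (mult R r s)"
    proof (rule f_eqI)
      have "f (sw H h (\<lambda>h1 h2. mult R (act R h1 r) (act R h2 s))) = sw H h (\<lambda>h1 h2. mult A (ad h1 (f r)) (ad h2 (f s)))"
        by (subst push_lin[OF fl]) (simp_all add: ty f_mult f_act cong: tlift_cong)
      also have "\<dots> = f (act R h (mult R r s))" by (simp add: f_act f_mult ad_mult_A ty)
      finally show "f (sw H h (\<lambda>h1 h2. mult R (act R h1 r) (act R h2 s))) = f (act R h (mult R r s))" .
    qed (rule ty | assumption)+
    then show "tlift R R (mult R) (tlift R R (\<lambda>m n. sw H h (\<lambda>h1 h2. tens R R (act R h1 m) (act R h2 n))) (tens R R r s)) = act R h (tlift R R (mult R) (tens R R r s))"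
      by (simp add: ty push_tlift[where X=R] tlift_tens[where X="tprod R R"] tlift_tens[where X=R] cong: tlift_cong)
  qed (rule ty | assumption)+
  let ?co = "tlift R R (\<lambda>m n. tlift H R (\<lambda>x m0. tlift H R (\<lambda>y n0.
    tens H (tprod R R) (mult H x y) (tens R R m0 n0)) (coact R n)) (coact R m))"
  have 2: "coact R (tlift R R (mult R) t) = tlift H (tprod R R) (\<lambda>x y. tens H R x (tlift R R (mult R) y)) (?co t)"
    if t: "t \<in> carr (tprod R R)" for t
  proof (rule tprod_eqI[OF vR vR _ _ t, where X="tprod H R" and f="\<lambda>t. coact R (tlift R R (mult R) t)"
         and g="\<lambda>t. tlift H (tprod R R) (\<lambda>x y. tens H R x (tlift R R (mult R) y)) (?co t)"])
    fix r s assume [ty]: "r \<in> carr R" "s \<in> carr R"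
    let ?X = "tprod H A"
    have "coact R (mult R r s) = tlift H R (\<lambda>x m0. tlift H R (\<lambda>y n0. tens H R (mult H x y) (mult R m0 n0)) (coact R s)) (coact R r)"
      (is "_ = ?R")
    proof (rule F1_eqI)
      have "F1 ?R = tlift H R (\<lambda>x m0. tlift H R (\<lambda>y n0. tens H A (mult H x y) (mult A (f m0) (f n0))) (coact R s)) (coact R r)"
        by (simp add: ty f_mult push_tlift[where X="?X"] tlift_tens[where X="?X"] cong: tlift_cong)
      also have "\<dots> = tlift H R (\<lambda>x m0. sw A (f s) (\<lambda>u v. tens H A (mult H x (\<pi> u)) (mult A (f m0) v))) (coact R r)"
        by (rule tlift_cong[OF refl], (rule ty | assumption)+,
            rule R_coact[where X="?X" and \<psi>="\<lambda>u v. tens H A (mult H _ u) (mult A (f _) v)"]) (rule ty | assumption)+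
      also have "\<dots> = sw A (f r) (\<lambda>x y. sw A (f s) (\<lambda>u v. tens H A (mult H (\<pi> x) (\<pi> u)) (mult A y v)))"
        by (rule R_coact[where X="?X" and \<psi>="\<lambda>x y. sw A (f s) (\<lambda>u v. tens H A (mult H x (\<pi> u)) (mult A y v))"]) (rule ty | assumption)+
      also have "\<dots> = F1 (coact R (mult R r s))"
        by (simp add: f_coact ty f_mult jp_simps swr[where X="?X"] cong: tlift_cong)
      finally show "F1 (coact R (mult R r s)) = F1 ?R" by (rule sym)
    qed (rule ty | assumption)+
    then show "coact R (tlift R R (mult R) (tens R R r s)) = tlift H (tprod R R) (\<lambda>x y. tens H R x (tlift R R (mult R) y)) (?co (tens R R r s))"
      by (simp add: ty push_tlift[where X="tprod H R"] tlift_tens[where X="tprod H R"] tlift_tens[where X="tprod H (tprod R R)"] tlift_tens[where X=R] cong: tlift_cong)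
  qed (rule ty | assumption)+
  show ?thesis unfolding yd_morphism_def act_T coact_T
    using yd_object_RR yd_object_R lin 1 2 by simp
qed

lemma coact_one: "coact R (one R) = tens H R (one H) (one R)"
proof (rule F1_eqI)
  show "F1 (coact R (one R)) = F1 (tens H R (one H) (one R))"
    by (simp add: f_coact f_one ty swr[where X="tprod H A"] jp_simps)
qed (rule ty)+

lemma unit_morphism: "yd_morphism H (yd_unit H) YR (\<lambda>c. scale R c (one R))"
proof -
  have a: "act R h (one R) = scale R (counit H h) (one R)" if [ty]: "h \<in> carr H" for h
    by (rule f_eqI) (simp_all add: f_act f_one ad_A_one ty lin_mapD(3)[OF fl])
  have "lin_map (yd_unit H) YR (\<lambda>c. scale R c (one R))"
    by (simp, rule lin_mapI) (simp_all add: ty vect_scale)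
  moreover have "scale R (counit H h * c) (one R) = act R h (scale R c (one R))" if [ty]: "h \<in> carr H" for h c
    by (simp add: lin_mapD(3)[OF bilin_mapD(1)[OF act_bilin_R]] ty a vect_scale mult.commute)
  moreover have "coact R (scale R c (one R)) = tlift H ground (\<lambda>x y. tens H R x (scale R y (one R))) (tens H ground (one H) c)" for c
  proof -
    have [ty]: "lin_map ground (tprod H R) (\<lambda>y. scale (tprod H R) y (tens H R x (one R)))" if [ty]: "x \<in> carr H" for x
      by (rule ty | assumption)+
    show ?thesis
      by (simp add: lin_mapD(3)[OF coact_lin_R] ty coact_one tlift_tens[where X="tprod H R"])
  qed
  ultimately show ?thesis unfolding yd_morphism_def
    using yd_object_R yd_object_unit by simp
qed

lemma comult_morphism: "yd_morphism H YR YT (comult R)"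
proof -
  have 1: "comult R (act R h r) = tlift R R (\<lambda>m n. sw H h (\<lambda>h1 h2. tens R R (act R h1 m) (act R h2 n))) (comult R r)" (is "_ = ?R")
    if [ty]: "h \<in> carr H" "r \<in> carr R" for h r
  proof (rule F2_eqI)
    let ?X = "tprod A A"
    have "F2 ?R = tlift R R (\<lambda>m n. sw H h (\<lambda>h1 h2. tens A A (ad h1 (f m)) (ad h2 (f n)))) (comult R r)"
      by (simp add: ty f_act push_tlift[where X="?X"] tlift_tens[where X="?X"] cong: tlift_cong)
    also have "\<dots> = sw A (f r) (\<lambda>u v. sw H h (\<lambda>h1 h2. tens A A (ad h1 (Pr u)) (ad h2 v)))"
      by (rule R_comult[where X="?X" and \<psi>="\<lambda>u v. sw H h (\<lambda>h1 h2. tens A A (ad h1 u) (ad h2 v))"]) (rule ty | assumption)+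
    also have "\<dots> = sw H h (\<lambda>h1 h2. sw A (f r) (\<lambda>u v. tens A A (ad h1 (Pr u)) (ad h2 v)))"
      by (rule tlift_swap)
    also have "\<dots> = sw A (ad h (f r)) (\<lambda>x y. tens A A (Pr x) y)"
      by (simp add: ty ad_sw[where X="?X"] Pr_mult_j Pr_j_mult jp_simps push_scale[symmetric] counit_sw[where X="?X"] cong: tlift_cong)
    also have "\<dots> = F2 (comult R (act R h r))" by (simp add: f_comult f_act ty)
    finally show "F2 (comult R (act R h r)) = F2 ?R" by (rule sym)
  qed (rule ty | assumption)+
  let ?co = "tlift R R (\<lambda>m n. tlift H R (\<lambda>x m0. tlift H R (\<lambda>y n0.
    tens H (tprod R R) (mult H x y) (tens R R m0 n0)) (coact R n)) (coact R m))"
  have 2: "?co (comult R r) = tlift H R (\<lambda>x y. tens H (tprod R R) x (comult R y)) (coact R r)" (is "?L = ?R")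
    if [ty]: "r \<in> carr R" for r
  \<comment> \<open>The test map is id \<otimes> F2, injective because \<open>F2\<close> is.\<close>
  proof (rule tmap_inj[where f="\<lambda>x. x" and g=F2 and V=H and W="tprod R R" and V'=H and W'="tprod A A"])
    let ?X = "tprod H (tprod A A)"
    note [ty] = F2_lin
    let ?F = "tlift H (tprod R R) (\<lambda>v w. tens H (tprod A A) v (F2 w))"
    have "?F ?L = tlift R R (\<lambda>m n. tlift H R (\<lambda>x m0. tlift H R (\<lambda>y n0.
        tens H (tprod A A) (mult H x y) (tens A A (f m0) (f n0))) (coact R n)) (coact R m)) (comult R r)"
      by (simp add: ty push_tlift[where X="?X"] tlift_tens[where X="?X"] tlift_tens[where X="tprod A A"] cong: tlift_cong)
    also have "\<dots> = tlift R R (\<lambda>m n. tlift H R (\<lambda>x m0. sw A (f n) (\<lambda>u' v'.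
        tens H (tprod A A) (mult H x (\<pi> u')) (tens A A (f m0) v'))) (coact R m)) (comult R r)"
      by (rule tlift_cong[OF refl], (rule ty | assumption)+, rule tlift_cong[OF refl], (rule ty | assumption)+,
          rule R_coact[where X="?X" and \<psi>="\<lambda>u v. tens H (tprod A A) (mult H _ u) (tens A A (f _) v)"]) (rule ty | assumption)+
    also have "\<dots> = tlift R R (\<lambda>m n. sw A (f m) (\<lambda>u v. sw A (f n) (\<lambda>u' v'.
        tens H (tprod A A) (mult H (\<pi> u) (\<pi> u')) (tens A A v v')))) (comult R r)"
      by (rule tlift_cong[OF refl], (rule ty | assumption)+,
          rule R_coact[where X="?X" and \<psi>="\<lambda>u v. sw A (f _) (\<lambda>u' v'. tens H (tprod A A) (mult H u (\<pi> u')) (tens A A v v'))"]) (rule ty | assumption)+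
    also have "\<dots> = sw A (f r) (\<lambda>a b. sw A (Pr a) (\<lambda>u v. sw A b (\<lambda>u' v'.
        tens H (tprod A A) (mult H (\<pi> u) (\<pi> u')) (tens A A v v'))))"
      by (rule R_comult[where X="?X" and \<psi>="\<lambda>m n. sw A m (\<lambda>u v. sw A n (\<lambda>u' v'. tens H (tprod A A) (mult H (\<pi> u) (\<pi> u')) (tens A A v v')))"]) (rule ty | assumption)+
    also have "\<dots> = sw A (f r) (\<lambda>u v. sw A v (\<lambda>p q. tens H (tprod A A) (\<pi> u) (tens A A (Pr p) q)))"
      by (rule comult_coact_A) (rule ty | assumption)+
    also have "\<dots> = sw A (f r) (\<lambda>u v. tens H (tprod A A) (\<pi> u) (sw A v (\<lambda>p q. tens A A (Pr p) q)))"
      by (simp add: ty pu cong: tlift_cong)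
    also have "\<dots> = tlift H R (\<lambda>x y. tens H (tprod A A) x (sw A (f y) (\<lambda>p q. tens A A (Pr p) q))) (coact R r)"
      by (rule R_coact[where X="?X" and \<psi>="\<lambda>x y. tens H (tprod A A) x (sw A y (\<lambda>p q. tens A A (Pr p) q))", symmetric]) (rule ty | assumption)+
    also have "\<dots> = ?F ?R"
      by (simp add: ty f_comult push_tlift[where X="?X"] tlift_tens[where X="?X"] cong: tlift_cong)
    finally show "?F ?L = ?F ?R" .
    show "inj_on (\<lambda>x. x) (carr H)" "inj_on F2 (carr (tprod R R))" by (simp, rule F2_inj)
  qed (rule ty F2_lin | assumption)+
  show ?thesis unfolding yd_morphism_def act_T coact_T
    using yd_object_RR yd_object_R comult_lin_R 1 2 by simp
qed

lemma counit_morphism: "yd_morphism H YR (yd_unit H) (counit R)"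
proof -
  have 1: "counit R (act R h r) = counit H h * counit R r" if [ty]: "h \<in> carr H" "r \<in> carr R" for h r
    by (simp add: counit_R ty f_act counit_ad)
  have 2: "tens H ground (one H) (counit R r) = tlift H R (\<lambda>x y. tens H ground x (counit R y)) (coact R r)" if [ty]: "r \<in> carr R" for r
  proof -
    let ?X = "tprod H ground"
    have "tlift H R (\<lambda>x y. tens H ground x (counit R y)) (coact R r) = tlift H R (\<lambda>x y. tens H ground x (counit A (f y))) (coact R r)"
      by (simp add: ty counit_R cong: tlift_cong)
    also have "\<dots> = sw A (f r) (\<lambda>x y. tens H ground (\<pi> x) (counit A y))"
      by (rule R_coact[where X="?X" and \<psi>="\<lambda>x y. tens H ground x (counit A y)"]) (rule ty | assumption)+
    \<comment> \<open>The counit value is taken out of the tensor as a scalar, so that the counit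
      law applies.\<close>
    also have "\<dots> = sw A (f r) (\<lambda>x y. scale ?X (counit A y) (tens H ground (\<pi> x) 1))"
      by (subst tens_ground) (rule refl)
    also have "\<dots> = tens H ground (\<pi> (f r)) 1"
      by (simp add: ty counit_sw[where X="?X"])
    also have "\<dots> = scale ?X (counit A (f r)) (tens H ground (one H) 1)"
      by (simp add: pi_f ty)
    also have "\<dots> = tens H ground (one H) (counit R r)"
      by (simp add: counit_R ty tens_ground[of H "one H" "counit A (f r)"])
    finally show ?thesis by (rule sym)
  qed
  show ?thesis unfolding yd_morphism_def
    using yd_object_unit yd_object_R counit_lin_R 1 2
    by simp
qed

theorem yd_bialgebra_R: "yd_bialgebra H R"
proof -
  have "hopf_algebra H" using antip by (auto simp: hopf_algebra_def)
  moreover have "yd_algebra H R"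
    unfolding yd_algebra_def using yd_object_R mult_morphism unit_morphism by simp
  moreover have "yd_coalgebra H R"
    unfolding yd_coalgebra_def using yd_object_R coalgebra_R comult_morphism counit_morphism by simp
  moreover have "counit R (one R) = 1" by (simp add: counit_R ty f_one bialgebraD(4))
  moreover have "counit R (mult R r s) = counit R r * counit R s" if "r \<in> carr R" "s \<in> carr R" for r s
    using that by (simp add: counit_R ty f_mult bialgebraD(5))
  moreover have "comult R (one R) = tens R R (one R) (one R)"
    by (rule F2_eqI) (simp_all add: ty f_comult f_one swr[where X="tprod A A"] Pr_id[OF coinv_one])
  moreover have "comult R (mult R r s) =
        tlift R R (\<lambda>a b. tlift R R (\<lambda>a' b'.
          tlift H R (\<lambda>x b0. tens R R (mult R a (act R x a')) (mult R b0 b')) (coact R b))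
          (comult R s)) (comult R r)" (is "_ = ?R") if [ty]: "r \<in> carr R" "s \<in> carr R" for r s
  proof (rule F2_eqI)
    let ?X = "tprod A A"
    have "F2 ?R = tlift R R (\<lambda>a b. tlift R R (\<lambda>a' b'.
          tlift H R (\<lambda>x b0. tens A A (mult A (f a) (ad x (f a'))) (mult A (f b0) (f b'))) (coact R b)) (comult R s)) (comult R r)"
      by (simp add: ty f_act f_mult push_tlift[where X="?X"] tlift_tens[where X="?X"] cong: tlift_cong)
    also have "\<dots> = tlift R R (\<lambda>a b. tlift R R (\<lambda>a' b'.
          sw A (f b) (\<lambda>u v. tens A A (mult A (f a) (ad (\<pi> u) (f a'))) (mult A v (f b')))) (comult R s)) (comult R r)"
      by (rule tlift_cong[OF refl], (rule ty | assumption)+, rule tlift_cong[OF refl], (rule ty | assumption)+,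
          rule R_coact[where X="?X" and \<psi>="\<lambda>u v. tens A A (mult A (f _) (ad u (f _))) (mult A v (f _))"]) (rule ty | assumption)+
    also have "\<dots> = tlift R R (\<lambda>a b. sw A (f s) (\<lambda>p q. 
          sw A (f b) (\<lambda>u v. tens A A (mult A (f a) (ad (\<pi> u) (Pr p))) (mult A v q)))) (comult R r)"
      by (rule tlift_cong[OF refl], (rule ty | assumption)+,
          rule R_comult[where X="?X" and \<psi>="\<lambda>p q. sw A (f _) (\<lambda>u v. tens A A (mult A (f _) (ad (\<pi> u) p)) (mult A v q))"]) (rule ty | assumption)+
    also have "\<dots> = sw A (f r) (\<lambda>c d. sw A (f s) (\<lambda>p q. 
          sw A d (\<lambda>u v. tens A A (mult A (Pr c) (ad (\<pi> u) (Pr p))) (mult A v q))))"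
      by (rule R_comult[where X="?X" and \<psi>="\<lambda>c d. sw A (f s) (\<lambda>p q. sw A d (\<lambda>u v. tens A A (mult A c (ad (\<pi> u) (Pr p))) (mult A v q)))"]) (rule ty | assumption)+
    also have "\<dots> = sw A (f r) (\<lambda>c d. sw A d (\<lambda>u v. sw A (f s) (\<lambda>p q. 
          tens A A (mult A (Pr c) (ad (\<pi> u) (Pr p))) (mult A v q))))"
      by (rule tlift_fun_cong, rule tlift_swap)
    also have "\<dots> = sw A (f r) (\<lambda>k v. sw A k (\<lambda>c u. sw A (f s) (\<lambda>p q. 
          tens A A (mult A (Pr c) (ad (\<pi> u) (Pr p))) (mult A v q))))"
      by (rule coassoc[where X="?X", symmetric]) (rule ty | assumption)+
    also have "\<dots> = sw A (f r) (\<lambda>k v. sw A (f s) (\<lambda>p q. sw A k (\<lambda>c u. 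
          tens A A (mult A (Pr c) (ad (\<pi> u) (Pr p))) (mult A v q))))"
      by (rule tlift_fun_cong, rule tlift_swap)
    also have "\<dots> = sw A (f r) (\<lambda>k v. sw A (f s) (\<lambda>p q. tens A A (Pr (mult A k p)) (mult A v q)))"
      by (simp add: ty Pr_mult pu cong: tlift_cong)
    also have "\<dots> = F2 (comult R (mult R r s))"
      by (simp add: f_comult f_mult ty swr[where X="?X"] cong: tlift_cong)
    finally show "F2 (comult R (mult R r s)) = F2 ?R" by (rule sym)
  qed (rule ty | assumption)+
  ultimately show ?thesis unfolding yd_bialgebra_def by blast
qed

end

text \<open>\<open>bialg_map\<close> includes that its source is a bialgebra; here that is derived,
  the axioms of B being pulled back along the injective F.\<close>

lemma bialg_map_inj:
  assumes A: "bialgebra A" and B: "vect B" and F: "lin_map B A F" "inj_on F (carr B)"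
    and m: "\<And>x y. x \<in> carr B \<Longrightarrow> y \<in> carr B \<Longrightarrow> mult B x y \<in> carr B"
      "\<And>x y. x \<in> carr B \<Longrightarrow> y \<in> carr B \<Longrightarrow> F (mult B x y) = mult A (F x) (F y)"
    and o: "one B \<in> carr B" "F (one B) = one A"
    and cu: "\<And>x. x \<in> carr B \<Longrightarrow> counit B x = counit A (F x)"
    and cm: "\<And>x. x \<in> carr B \<Longrightarrow> comult B x \<in> carr (tprod B B)"
      "\<And>x. x \<in> carr B \<Longrightarrow> tlift B B (\<lambda>x y. tens A A (F x) (F y)) (comult B x) = comult A (F x)"
  shows "bialg_map B A F"
proof -
  note Af = bialgebraD(1-3)[OF A]
  have algB: "algebra B" by (rule algebra_inj[OF Af(1) B F m o])
  have coalgB: "coalgebra B"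
    by (rule coalgebra_inj[OF Af(2) B F lin_map_id _ _ _ cu cm(1)])
       (simp_all add: cm(2) tlift_id[OF Af(3,3) coalgebraD(4)[OF Af(2)]] lin_mapD(1)[OF F(1)])
  note [ty] = A Af B algB F(1) lin_mapD(1)[OF F(1)] lin_map_comp[OF F(1)] m(1) o(1) cm(1) coalgB
  let ?F2 = "tlift B B (\<lambda>x y. tens A A (F x) (F y))"
  have F2_eqI: "?F2 t = ?F2 t' \<Longrightarrow> t \<in> carr (tprod B B) \<Longrightarrow> t' \<in> carr (tprod B B) \<Longrightarrow> t = t'" for t t'
    by (rule tmap_inj[where f=F and g=F and V'=A and W'=A]) (simp_all add: ty F)
  note B_comult = tlift_transport[OF Af(3) B F(1) cm]
  have "comult B (one B) = tens B B (one B) (one B)"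
    by (rule F2_eqI) (simp_all add: ty cm o bialgebraD(6)[OF A] tlift_tens[where X="tprod A A"])
  moreover have "comult B (mult B r s) = sw B r (\<lambda>a1 a2. sw B s (\<lambda>b1 b2. tens B B (mult B a1 b1) (mult B a2 b2)))" (is "_ = ?R")
    if [ty]: "r \<in> carr B" "s \<in> carr B" for r s
  proof (rule F2_eqI)
    let ?X = "tprod A A"
    have "?F2 ?R = sw B r (\<lambda>a1 a2. sw B s (\<lambda>b1 b2. tens A A (mult A (F a1) (F b1)) (mult A (F a2) (F b2))))"
      by (simp add: ty m push_tlift[where X="?X"] tlift_tens[where X="?X"] cong: tlift_cong)
    also have "\<dots> = sw B r (\<lambda>a1 a2. sw A (F s) (\<lambda>b1 b2. tens A A (mult A (F a1) b1) (mult A (F a2) b2)))"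
      by (rule tlift_cong[OF refl], (rule ty | assumption)+,
          rule B_comult[where X="?X" and \<psi>="\<lambda>u v. tens A A (mult A (F _) u) (mult A (F _) v)"]) (rule ty | assumption)+
    also have "\<dots> = sw A (F r) (\<lambda>a1 a2. sw A (F s) (\<lambda>b1 b2. tens A A (mult A a1 b1) (mult A a2 b2)))"
      by (rule B_comult[where X="?X" and \<psi>="\<lambda>u v. sw A (F s) (\<lambda>b1 b2. tens A A (mult A u b1) (mult A v b2))"]) (rule ty | assumption)+
    also have "\<dots> = ?F2 (comult B (mult B r s))"
      by (simp add: cm m ty bialgebraD(7)[OF A])
    finally show "?F2 (comult B (mult B r s)) = ?F2 ?R" by (rule sym)
  qed (rule ty coalgB | assumption)+
  ultimately have "bialgebra B" unfolding bialgebra_def using algB coalgB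
    by (simp add: cu o m ty bialgebraD(4,5)[OF A])
  then show ?thesis unfolding bialg_map_def using A F m o cu cm by simp
qed

section \<open>The isomorphism of the biproduct with A\<close>

context radford begin

text \<open>For the inclusion of the coinvariants this is \<open>canonical_iso\<close> (see
  \<open>can_eq\<close>).\<close>

definition G :: "('k, 'r, 'h) tensor \<Rightarrow> 'a" where
  "G = tlift R H (\<lambda>r h. mult A (f r) (j h))"

abbreviation "RH \<equiv> tprod R H"

lemma G_lin: "lin_map RH A G"
  unfolding G_def by (rule tlift_universal(1)) (rule ty | assumption)+

lemmas G_ty [ty] = G_lin lin_mapD(1)[OF G_lin] lin_map_comp[OF G_lin]

lemma G_tens: "r \<in> carr R \<Longrightarrow> h \<in> carr H \<Longrightarrow> G (tens R H r h) = mult A (f r) (j h)"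
  unfolding G_def by (rule tlift_tens[where X=A]) (rule ty | assumption)+

text \<open>The map a \<mapsto> \<Pi>(a1) \<otimes> \<pi>(a2) undoes r \<otimes> h \<mapsto> f(r)
  j(h) up to the embedding f \<otimes> id: \<pi> of the second leg of f(r) collapses to 1, and \<Pi>
  removes the factor from j(H). Injectivity of \<open>G\<close> follows.\<close>

lemma G_left_inv:
  assumes t: "t \<in> carr RH"
  shows "sw A (G t) (\<lambda>x y. tens A H (Pr x) (\<pi> y)) = tlift R H (\<lambda>r h. tens A H (f r) h) t"
proof (rule tprod_eqI[OF vR H_facts(3) _ _ t, where X="tprod A H" and f="\<lambda>t. sw A (G t) (\<lambda>x y. tens A H (Pr x) (\<pi> y))"
      and g="\<lambda>t. tlift R H (\<lambda>r h. tens A H (f r) h) t"])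
  let ?X = "tprod A H"
  fix r h assume [ty]: "r \<in> carr R" "h \<in> carr H"
  have "sw A (G (tens R H r h)) (\<lambda>x y. tens A H (Pr x) (\<pi> y)) = sw A (f r) (\<lambda>x y. tens A H (Pr x) (mult H (\<pi> y) h))"
    by (simp add: G_tens ty swr[where X="?X"] jp_sw[where X="?X"] jp_simps Pr_mult_j cong: tlift_cong)
  also have "\<dots> = tens A H (Pr (f r)) (mult H (one H) h)"
    by (rule coinv_sw[OF f_coinv, where X="?X" and \<phi>="\<lambda>x y. tens A H (Pr x) (mult H y h)"]) (rule ty | assumption)+
  also have "\<dots> = tlift R H (\<lambda>r h. tens A H (f r) h) (tens R H r h)"
    by (simp add: Pr_f H_assoc ty tlift_tens[where X="?X"])
  finally show "sw A (G (tens R H r h)) (\<lambda>x y. tens A H (Pr x) (\<pi> y)) = tlift R H (\<lambda>r h. tens A H (f r) h) (tens R H r h)" .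
qed (rule ty | assumption)+

lemma G_inj: "inj_on G (carr RH)"
proof (rule inj_onI)
  fix t t' assume t: "t \<in> carr RH" "t' \<in> carr RH" and eq: "G t = G t'"
  show "t = t'"
  proof (rule tmap_inj[where f=f and g="\<lambda>x. x" and V'=A and W'=H and V=R and W=H])
    show "tlift R H (\<lambda>v w. tens A H (f v) w) t = tlift R H (\<lambda>v w. tens A H (f v) w) t'"
      using G_left_inv[OF t(1)] G_left_inv[OF t(2)] eq by simp
  qed (simp_all add: ty finj t)
qed

lemma G_surj: "G ` carr RH = carr A"
proof (intro equalityI subsetI)
  fix a assume a: "a \<in> carr A"
  \<comment> \<open>A set-theoretic inverse of f. The preimage of a is \<Pi>(a1) \<otimes> \<pi>(a2)
    with the first leg read back in R.\<close>
  define e where "e = inv_into (carr R) f"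
  have e: "e (Pr x) \<in> carr R" "f (e (Pr x)) = Pr x" if "x \<in> carr A" for x
    using Pr_coinv[OF that] fim by (auto simp: e_def inv_into_into f_inv_into_f)
  note [ty] = a e(1)
  have "G (sw A a (\<lambda>x y. tens R H (e (Pr x)) (\<pi> y))) = sw A a (\<lambda>x y. mult A (Pr x) (j (\<pi> y)))"
    by (subst push_lin[OF G_lin]) (simp_all add: ty G_tens e cong: tlift_cong)
  also have "\<dots> = a" by (rule Pr_jpi[OF a])
  finally have "G (sw A a (\<lambda>x y. tens R H (e (Pr x)) (\<pi> y))) = a" .
  moreover have "sw A a (\<lambda>x y. tens R H (e (Pr x)) (\<pi> y)) \<in> carr RH" by (rule ty | assumption)+
  ultimately show "a \<in> G ` carr RH" by (rule image_eqI[OF sym])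
qed (auto simp: ty)

theorem biproduct_iso: "bialg_iso (biproduct R H) A G"
proof -
  let ?B = "biproduct R H"
  have fields: "carr ?B = carr RH" "scale ?B = scale RH" "one ?B = tens R H (one R) (one H)" by (simp_all add: biproduct_def)
  have same: "lin_map ?B A = lin_map RH A" by (intro ext) (simp add: lin_map_def fields)
  have tl: "tens ?B ?B = tens RH RH" "tprod ?B ?B = tprod RH RH" "tlift ?B ?B = tlift RH RH"
    by (rule tens_same tprod_same; simp add: fields)+
  have v: "vect ?B" using vect_tprod[of R H] by (simp add: vect_def fields)
  have mu: "mult ?B x y = tlift R H (\<lambda>r h. tlift R H (\<lambda>r' h'. sw H h (\<lambda>h1 h2.
          tens R H (mult R r (act R h1 r')) (mult H h2 h'))) y) x" for x y
    by (simp add: biproduct_def)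
  have co: "comult ?B t = tlift R H (\<lambda>r h.
        tlift R R (\<lambda>r1 r2. tlift H R (\<lambda>x y. sw H h (\<lambda>h1 h2.
          tens RH RH (tens R H r1 (mult H x h1)) (tens R H y h2))) (coact R r2)) (comult R r)) t" for t
    by (simp add: biproduct_def)
  have cu: "counit ?B t = tlift R H (\<lambda>r h. counit R r * counit H h) t" for t
    by (simp add: biproduct_def)
  have ca: "coalgebra R" by (rule coalgebra_R)
  note [ty] = ca
  \<comment> \<open>This also yields that the biproduct is a bialgebra.\<close>
  have 1: "bialg_map ?B A G"
  proof (rule bialg_map_inj[OF A_facts(1) v], unfold same fields tl)
    show "lin_map RH A G" by (rule G_lin)
    show "inj_on G (carr RH)" by (rule G_inj)
    show "tens R H (one R) (one H) \<in> carr RH" by (rule ty)+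
    show "G (tens R H (one R) (one H)) = one A" by (simp add: G_tens ty f_one jp_simps A_assoc)
    show "mult ?B x y \<in> carr RH" if "x \<in> carr RH" "y \<in> carr RH" for x y
      unfolding mu by (rule ty that | assumption)+
    show "G (mult ?B x y) = mult A (G x) (G y)" if x: "x \<in> carr RH" and y[ty]: "y \<in> carr RH" for x y
    proof (rule tprod_eqI[OF vR H_facts(3) _ _ x, where X=A and f="\<lambda>x. G (mult ?B x y)" and g="\<lambda>x. mult A (G x) (G y)"])
      show "lin_map RH A (\<lambda>x. G (mult ?B x y))" "lin_map RH A (\<lambda>x. mult A (G x) (G y))"
        unfolding mu by (rule ty | assumption)+
      fix r h assume [ty]: "r \<in> carr R" "h \<in> carr H"
      show "G (mult ?B (tens R H r h) y) = mult A (G (tens R H r h)) (G y)"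
      proof (rule tprod_eqI[OF vR H_facts(3) _ _ y, where X=A and f="\<lambda>y. G (mult ?B (tens R H r h) y)" and g="\<lambda>y. mult A (G (tens R H r h)) (G y)"])
        show "lin_map RH A (\<lambda>y. G (mult ?B (tens R H r h) y))" "lin_map RH A (\<lambda>y. mult A (G (tens R H r h)) (G y))"
          unfolding mu by (rule ty | assumption)+
        fix s k assume [ty]: "s \<in> carr R" "k \<in> carr H"
        have "mult ?B (tens R H r h) (tens R H s k) = sw H h (\<lambda>h1 h2. tens R H (mult R r (act R h1 s)) (mult H h2 k))"
          unfolding mu by (simp add: ty tlift_tens[where X=RH] cong: tlift_cong)
        then have "G (mult ?B (tens R H r h) (tens R H s k)) = sw H h (\<lambda>h1 h2. mult A (f r) (mult A (mult A (ad h1 (f s)) (j h2)) (j k)))"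
          by (simp, subst push_lin[OF G_lin]) (simp_all add: ty G_tens f_mult f_act jp_simps A_assoc cong: tlift_cong)
        also have "\<dots> = mult A (f r) (mult A (sw H h (\<lambda>h1 h2. mult A (ad h1 (f s)) (j h2))) (j k))"
          by (simp add: ty pu cong: tlift_cong)
        also have "\<dots> = mult A (G (tens R H r h)) (G (tens R H s k))"
          by (simp add: ad_j ty G_tens A_assoc)
        finally show "G (mult ?B (tens R H r h) (tens R H s k)) = mult A (G (tens R H r h)) (G (tens R H s k))" .
      qed
    qed
    show "counit ?B t = counit A (G t)" if t[ty]: "t \<in> carr RH" for t
      unfolding cu G_def
      by (subst push_lin[OF coalgebraD(3)]) (simp_all add: ty bialgebraD(5) counit_R jp_simps cong: tlift_cong)
    show "comult ?B t \<in> carr (tprod RH RH)" if "t \<in> carr RH" for t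
      unfolding co by (rule ty that | assumption)+
    show "tlift RH RH (\<lambda>x y. tens A A (G x) (G y)) (comult ?B t) = comult A (G t)" if t: "t \<in> carr RH" for t
    proof (rule tprod_eqI[OF vR H_facts(3) _ _ t, where X="tprod A A" and f="\<lambda>t. tlift RH RH (\<lambda>x y. tens A A (G x) (G y)) (comult ?B t)" and g="\<lambda>t. comult A (G t)"])
      show "lin_map RH (tprod A A) (\<lambda>t. tlift RH RH (\<lambda>x y. tens A A (G x) (G y)) (comult ?B t))" "lin_map RH (tprod A A) (\<lambda>t. comult A (G t))"
        unfolding co by (rule ty | assumption)+
      fix r h assume [ty]: "r \<in> carr R" "h \<in> carr H"
      let ?X = "tprod A A"
      have "comult ?B (tens R H r h) = tlift R R (\<lambda>r1 r2. tlift H R (\<lambda>x y. sw H h (\<lambda>h1 h2.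
          tens RH RH (tens R H r1 (mult H x h1)) (tens R H y h2))) (coact R r2)) (comult R r)"
        unfolding co by (simp add: ty tlift_tens[where X="tprod RH RH"] cong: tlift_cong)
      then have "tlift RH RH (\<lambda>x y. tens A A (G x) (G y)) (comult ?B (tens R H r h)) =
         tlift R R (\<lambda>r1 r2. tlift H R (\<lambda>x y. sw H h (\<lambda>h1 h2.
          tens A A (mult A (f r1) (j (mult H x h1))) (mult A (f y) (j h2)))) (coact R r2)) (comult R r)"
        by (simp add: ty push_tlift[where X="?X"] tlift_tens[where X="?X"] G_tens del: bialg_mapD cong: tlift_cong)
      also have "\<dots> = tlift R R (\<lambda>r1 r2. sw A (f r2) (\<lambda>u v. sw H h (\<lambda>h1 h2.
          tens A A (mult A (f r1) (j (mult H (\<pi> u) h1))) (mult A v (j h2))))) (comult R r)"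
        by (rule tlift_cong[OF refl], (rule ty | assumption)+,
            rule R_coact[where X="?X" and \<psi>="\<lambda>u v. sw H h (\<lambda>h1 h2. tens A A (mult A (f _) (j (mult H u h1))) (mult A v (j h2)))"]) (rule ty | assumption)+
      also have "\<dots> = sw A (f r) (\<lambda>c d. sw A d (\<lambda>u v. sw H h (\<lambda>h1 h2.
          tens A A (mult A (Pr c) (j (mult H (\<pi> u) h1))) (mult A v (j h2)))))"
        by (rule R_comult[where X="?X" and \<psi>="\<lambda>c d. sw A d (\<lambda>u v. sw H h (\<lambda>h1 h2.
          tens A A (mult A c (j (mult H (\<pi> u) h1))) (mult A v (j h2))))"]) (rule ty | assumption)+
      also have "\<dots> = sw A (f r) (\<lambda>c d. sw A d (\<lambda>u v. sw H h (\<lambda>h1 h2.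
          tens A A (mult A (mult A (Pr c) (j (\<pi> u))) (j h1)) (mult A v (j h2)))))"
        by (simp add: ty jp_simps A_assoc cong: tlift_cong)
      \<comment> \<open>\<Pi>(c) j(\<pi>(u)) recombines into a single leg of f(r), which leaves the
        ordinary coproduct of A.\<close>
      also have "\<dots> = sw A (f r) (\<lambda>c d. sw H h (\<lambda>h1 h2. tens A A (mult A c (j h1)) (mult A d (j h2))))"
        by (rule Pr_jpi_sw[where X="?X" and \<phi>="\<lambda>c d. sw H h (\<lambda>h1 h2. tens A A (mult A c (j h1)) (mult A d (j h2)))"]) (rule ty | assumption)+
      also have "\<dots> = comult A (G (tens R H r h))"
        by (simp add: G_tens ty bialgebraD(7) bialg_mapD(7)[OF jm] push_tlift[where X="?X"] tlift_tens[where X="?X"] cong: tlift_cong)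
      finally show "tlift RH RH (\<lambda>x y. tens A A (G x) (G y)) (comult ?B (tens R H r h)) = comult A (G (tens R H r h))" .
    qed
  qed
  have "bij_betw G (carr ?B) (carr A)"
    unfolding fields bij_betw_def using G_inj G_surj by simp
  with 1 show ?thesis by (simp add: bialg_iso_def)
qed

end

section \<open>Functions of finite rank\<close>

text \<open>Rank is measured on plain sets with arbitrary factor functions, which keeps the closure
  properties elementary. By \<open>rank_factor\<close> the factors can be chosen among the rows and
  columns of F, and these inherit linearity.\<close>

definition finite_rank :: "'x set \<Rightarrow> 'y set \<Rightarrow> ('x \<Rightarrow> 'y \<Rightarrow> 'k::field) \<Rightarrow> bool" where
  "finite_rank X Y F \<longleftrightarrow> (\<exists>(I::nat set) u v. finite I \<and> (\<forall>x\<in>X. \<forall>y\<in>Y. F x y = (\<Sum>i\<in>I. u i x * v i y)))"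

lemma finite_rankI_list:
  assumes "\<And>x y. x \<in> X \<Longrightarrow> y \<in> Y \<Longrightarrow> F x y = (\<Sum>p\<leftarrow>ps. g p x * h p y)"
  shows "finite_rank X Y F"
  unfolding finite_rank_def
proof (intro exI conjI ballI)
  show "finite {..<length ps}" by simp
  fix x y assume "x \<in> X" "y \<in> Y"
  then show "F x y = (\<Sum>i\<in>{..<length ps}. g (ps ! i) x * h (ps ! i) y)"
    using assms by (simp add: sum_list_sum_nth atLeast0LessThan)
qed

text \<open>Wedderburn's rank reduction: subtracting \<open>F x y0 * F x0 y / F x0 y0\<close> lowers the rank by one.\<close>

lemma rank_factor:
  assumes "finite (I :: nat set)" "\<And>x y. x \<in> X \<Longrightarrow> y \<in> Y \<Longrightarrow> F x y = (\<Sum>i\<in>I. u i x * (v i y :: 'k::field))"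
  shows "\<exists>ps. set ps \<subseteq> UNIV \<times> X \<times> Y \<and> (\<forall>x\<in>X. \<forall>y\<in>Y. F x y = (\<Sum>(m, a, b)\<leftarrow>ps. m * F x b * F a y))"
  using assms
proof (induction "card I" arbitrary: I F u v)
  case 0
  then show ?case by (intro exI[of _ "[]"]) simp
next
  case (Suc n)
  show ?case
  proof (cases "\<exists>x0\<in>X. \<exists>y0\<in>Y. F x0 y0 \<noteq> 0")
    case False
    then show ?thesis by (intro exI[of _ "[]"]) simp
  next
    case True
    then obtain x0 y0 where x0: "x0 \<in> X" and y0: "y0 \<in> Y" and d0: "F x0 y0 \<noteq> 0" by blast
    have "\<exists>i0\<in>I. v i0 y0 \<noteq> 0"
    proof (rule ccontr)
      assume "\<not> ?thesis"
      then have "F x0 y0 = 0" using Suc.prems(2)[OF x0 y0] by simp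
      with d0 show False by simp
    qed
    then obtain i0 where i0: "i0 \<in> I" "v i0 y0 \<noteq> 0" by blast
    define d where "d = F x0 y0"
    define F' where "F' x y = F x y - F x y0 * F x0 y / d" for x y
    define u' where "u' i x = u i x - F x y0 / d * u i x0" for i x
    \<comment> \<open>\<open>F' x y0 = 0\<close> lets the summand of \<open>i0\<close> be expressed
      by the others; absorbing it changes \<open>v\<close> to \<open>v'\<close> and drops one
      index.\<close>
    define v' where "v' i y = v i y - v i y0 / v i0 y0 * v i0 y" for i y
    have 1: "F' x y = (\<Sum>i\<in>I. u' i x * v i y)" if "x \<in> X" "y \<in> Y" for x y
    proof -
      have "(\<Sum>i\<in>I. u' i x * v i y) = (\<Sum>i\<in>I. u i x * v i y) - F x y0 / d * (\<Sum>i\<in>I. u i x0 * v i y)"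
        by (simp add: u'_def left_diff_distrib sum_subtractf sum_distrib_left mult.assoc)
      then show ?thesis using Suc.prems(2)[OF that] Suc.prems(2)[OF x0 that(2)] by (simp add: F'_def)
    qed
    have 2: "F' x y = (\<Sum>i\<in>I - {i0}. u' i x * v' i y)" if "x \<in> X" "y \<in> Y" for x y
    proof -
      have "F' x y0 = 0" using d0 by (simp add: F'_def d_def)
      then have z: "u' i0 x * v i0 y0 = - (\<Sum>i\<in>I - {i0}. u' i x * v i y0)"
        using 1[OF that(1) y0] sum.remove[OF Suc.prems(1) i0(1), of "\<lambda>i. u' i x * v i y0"]
        by (simp add: eq_neg_iff_add_eq_0)
      have "u' i0 x * v i0 y = (u' i0 x * v i0 y0) / v i0 y0 * v i0 y" using i0(2) by simp
      also have "\<dots> = - (\<Sum>i\<in>I - {i0}. u' i x * (v i y0 / v i0 y0 * v i0 y))"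
        unfolding z by (simp add: sum_distrib_right sum_divide_distrib mult.assoc times_divide_eq_right)
      finally have w: "u' i0 x * v i0 y = - (\<Sum>i\<in>I - {i0}. u' i x * (v i y0 / v i0 y0 * v i0 y))" .
      have "F' x y = u' i0 x * v i0 y + (\<Sum>i\<in>I - {i0}. u' i x * v i y)"
        using 1[OF that] sum.remove[OF Suc.prems(1) i0(1)] by simp
      also have "\<dots> = (\<Sum>i\<in>I - {i0}. u' i x * v' i y)"
        unfolding w by (simp add: v'_def right_diff_distrib sum_subtractf)
      finally show ?thesis .
    qed
    have "n = card (I - {i0})" "finite (I - {i0})" using Suc.hyps(2) Suc.prems(1) i0(1) by simp_all
    from Suc.hyps(1)[OF this, of F' u' v'] 2 obtain ps where
      ps: "set ps \<subseteq> UNIV \<times> X \<times> Y" "\<And>x y. x \<in> X \<Longrightarrow> y \<in> Y \<Longrightarrow> F' x y = (\<Sum>(m, a, b)\<leftarrow>ps. m * F' x b * F' a y)"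
      by blast
    \<comment> \<open>Writing F' back in terms of F turns one product of slices into four, all of
      them slices of F at the old points or at x0, y0.\<close>
    define ex where "ex = (\<lambda>(m, a, b). [(m, a, b), (- m * F a y0 / d, x0, b), (- m * F x0 b / d, a, y0),
        (m * F x0 b * F a y0 / d / d, x0, y0)])"
    have e: "m * F' x b * F' a y = m * F x b * F a y + - m * F a y0 / d * F x b * F x0 y +
        - m * F x0 b / d * F x y0 * F a y + m * F x0 b * F a y0 / d / d * F x y0 * F x0 y" for m a b x y
      by (simp add: F'_def right_diff_distrib left_diff_distrib mult.assoc mult.left_commute mult.commute)
    have 3: "(\<Sum>(m, a, b)\<leftarrow>qs. m * F' x b * F' a y) = (\<Sum>(m, a, b)\<leftarrow>concat (map ex qs). m * F x b * F a y)" for qs x y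
    proof (induction qs)
      case (Cons q qs)
      obtain m a b where q: "q = (m, a, b)" by (cases q)
      show ?case using Cons unfolding q
        by (simp only: list.map concat.simps map_append sum_list_append sum_list.Cons case_prod_conv e) (simp add: ex_def)
    qed simp
    show ?thesis
    proof (intro exI conjI ballI)
      show "set ((1 / d, x0, y0) # concat (map ex ps)) \<subseteq> UNIV \<times> X \<times> Y"
        using ps(1) x0 y0 by (fastforce simp: ex_def)
      fix x y assume xy: "x \<in> X" "y \<in> Y"
      have "F x y = F x y0 * F x0 y / d + F' x y" by (simp add: F'_def)
      also have "\<dots> = (\<Sum>(m, a, b)\<leftarrow>(1 / d, x0, y0) # concat (map ex ps). m * F x b * F a y)"
        unfolding ps(2)[OF xy] 3 by simp
      finally show "F x y = (\<Sum>(m, a, b)\<leftarrow>(1 / d, x0, y0) # concat (map ex ps). m * F x b * F a y)" .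
    qed
  qed
qed

lemma finite_rankD:
  assumes "finite_rank X Y F"
  shows "\<exists>ps. set ps \<subseteq> UNIV \<times> X \<times> Y \<and> (\<forall>x\<in>X. \<forall>y\<in>Y. F x y = (\<Sum>(m, a, b)\<leftarrow>ps. m * F x b * F a y))"
proof -
  obtain I :: "nat set" and u v where "finite I" "\<And>x y. x \<in> X \<Longrightarrow> y \<in> Y \<Longrightarrow> F x y = (\<Sum>i\<in>I. u i x * v i y)"
    using assms unfolding finite_rank_def by blast
  then show ?thesis by (rule rank_factor)
qed

lemma finite_rank_swap:
  assumes "finite_rank X Y F"
  shows "finite_rank Y X (\<lambda>y x. F x y)"
proof -
  obtain I :: "nat set" and u v where "finite I" "\<forall>x\<in>X. \<forall>y\<in>Y. F x y = (\<Sum>i\<in>I. u i x * v i y)"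
    using assms unfolding finite_rank_def by blast
  then show ?thesis unfolding finite_rank_def
    by (intro exI[of _ I] exI[of _ v] exI[of _ u]) (simp add: mult.commute)
qed

lemma finite_rank_comp:
  assumes "finite_rank X Y F" "\<And>x. x \<in> X' \<Longrightarrow> f x \<in> X" "\<And>y. y \<in> Y' \<Longrightarrow> g y \<in> Y"
  shows "finite_rank X' Y' (\<lambda>x y. F (f x) (g y))"
proof -
  obtain I :: "nat set" and u v where "finite I" "\<forall>x\<in>X. \<forall>y\<in>Y. F x y = (\<Sum>i\<in>I. u i x * v i y)"
    using assms(1) unfolding finite_rank_def by blast
  then show ?thesis unfolding finite_rank_def using assms(2,3)
    by (intro exI[of _ I] exI[of _ "\<lambda>i x. u i (f x)"] exI[of _ "\<lambda>i y. v i (g y)"]) auto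
qed

lemma finite_rank_cong: "finite_rank X Y F \<Longrightarrow> (\<And>x y. x \<in> X \<Longrightarrow> y \<in> Y \<Longrightarrow> F' x y = F x y) \<Longrightarrow> finite_rank X Y F'"
  unfolding finite_rank_def by simp

lemma finite_rank_add:
  assumes "finite_rank X Y F" "finite_rank X Y F'"
  shows "finite_rank X Y (\<lambda>x y. F x y + F' x y)"
proof -
  obtain ps where ps: "set ps \<subseteq> UNIV \<times> X \<times> Y \<and> (\<forall>x\<in>X. \<forall>y\<in>Y. F x y = (\<Sum>(m, a, b)\<leftarrow>ps. m * F x b * F a y))"
    using finite_rankD[OF assms(1)] by (elim exE)
  obtain qs where qs: "set qs \<subseteq> UNIV \<times> X \<times> Y \<and> (\<forall>x\<in>X. \<forall>y\<in>Y. F' x y = (\<Sum>(m, a, b)\<leftarrow>qs. m * F' x b * F' a y))"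
    using finite_rankD[OF assms(2)] by (elim exE)
  let ?g = "\<lambda>s x. case s of Inl (m, a, b) \<Rightarrow> m * F x b | Inr (m, a, b) \<Rightarrow> m * F' x b"
  let ?h = "\<lambda>s y. case s of Inl (m, a, b) \<Rightarrow> F a y | Inr (m, a, b) \<Rightarrow> F' a y"
  have 1: "(\<Sum>(m, a, b)\<leftarrow>ps. m * F x b * F a y) = (\<Sum>s\<leftarrow>map Inl ps. ?g s x * ?h s y)" for x y
    by (induction ps) auto
  have 2: "(\<Sum>(m, a, b)\<leftarrow>qs. m * F' x b * F' a y) = (\<Sum>s\<leftarrow>map Inr qs. ?g s x * ?h s y)" for x y
    by (induction qs) auto
  show ?thesis
    by (rule finite_rankI_list[where ps="map Inl ps @ map Inr qs" and g="?g" and h="?h"])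
       (simp only: map_append sum_list_append 1[symmetric] 2[symmetric] bspec[OF bspec[OF conjunct2[OF ps]]] bspec[OF bspec[OF conjunct2[OF qs]]])
qed

lemma finite_rank_scale: "finite_rank X Y F \<Longrightarrow> finite_rank X Y (\<lambda>x y. c * F x y)"
proof -
  assume "finite_rank X Y F"
  then obtain I :: "nat set" and u v where "finite I" "\<forall>x\<in>X. \<forall>y\<in>Y. F x y = (\<Sum>i\<in>I. u i x * v i y)"
    unfolding finite_rank_def by blast
  then show ?thesis unfolding finite_rank_def
    by (intro exI[of _ I] exI[of _ "\<lambda>i x. c * u i x"] exI[of _ v]) (auto simp: sum_distrib_left mult.assoc)
qed

lemma finite_rank_zero: "finite_rank X Y (\<lambda>x y. 0)"
  by (rule finite_rankI_list[where ps="[]"]) simp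

lemma finite_rank_times: "finite_rank X Y (\<lambda>x y. u x * v y)"
  by (rule finite_rankI_list[where ps="[()]" and g="\<lambda>_. u" and h="\<lambda>_. v"]) simp

lemma finite_rank_tlift:
  assumes "\<And>v w. finite_rank X Y (F v w)"
  shows "finite_rank X Y (\<lambda>x y. tlift V W (\<lambda>v w. F v w x y) t)"
proof -
  have "finite_rank X Y (\<lambda>x y. \<Sum>p\<leftarrow>ps. F (fst p) (snd p) x y)" for ps
    by (induction ps) (simp_all add: finite_rank_zero finite_rank_add assms)
  then show ?thesis unfolding tlift_def case_prod_unfold .
qed

section \<open>Cofinite subspaces\<close>

text \<open>Coordinates modulo I with respect to a finite list of generators. They are picked
  pointwise, which is enough for the factors in a finite-rank expansion.\<close>

lemma finite_codim_coeff:
  assumes V: "vect V" and I: "finite_codim V I"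
  obtains es c where "set es \<subseteq> carr V" "\<And>v. v \<in> carr V \<Longrightarrow> v - (\<Sum>e\<leftarrow>es. scale V (c e v) e) \<in> I"
proof -
  interpret vs: vector_space "scale V" using V by (simp add: vect_def)
  obtain F where F: "vs.subspace I" "finite F" "F \<subseteq> carr V" "carr V = vs.span (I \<union> F)"
    using I unfolding finite_codim_def by blast
  obtain es where es: "set es = F" "distinct es" using finite_distinct_list[OF F(2)] by blast
  have "\<exists>c. v - (\<Sum>e\<leftarrow>es. scale V (c e) e) \<in> I" if "v \<in> carr V" for v
  proof -
    have "v \<in> vs.span (I \<union> F)" using that F(4) by simp
    then obtain x y where xy: "v = x + y" "x \<in> vs.span I" "y \<in> vs.span F" unfolding vs.span_Un by auto
    from xy(3) obtain c where "y = (\<Sum>e\<in>F. scale V (c e) e)" unfolding vs.span_finite[OF F(2)] by blast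
    then have y: "y = (\<Sum>e\<leftarrow>es. scale V (c e) e)" using sum_list_distinct_conv_sum_set[OF es(2)] es(1) by metis
    have "x \<in> I" using xy(2) unfolding vs.span_eq_iff[THEN iffD2, OF F(1)] .
    then have "v - (\<Sum>e\<leftarrow>es. scale V (c e) e) \<in> I" unfolding xy(1) y[symmetric] by simp
    then show ?thesis by blast
  qed
  then have "\<forall>v\<in>carr V. \<exists>c. v - (\<Sum>e\<leftarrow>es. scale V (c e) e) \<in> I" by blast
  from bchoice[OF this] obtain c where "\<forall>v\<in>carr V. v - (\<Sum>e\<leftarrow>es. scale V (c v e) e) \<in> I" by blast
  then show ?thesis by (intro that[of es "\<lambda>e v. c v e"]) (simp_all add: es F(3))
qed

text \<open>Induction on a finite set F that spans V together with J: adjoining one vector x to J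
  enlarges the preimage by at most one dimension.\<close>

lemma finite_codim_preimage:
  assumes U: "vect U" and V: "vect V" and f: "lin_map U V f" and J: "finite_codim V J"
  shows "finite_codim U {u \<in> carr U. f u \<in> J}"
proof -
  interpret u: vector_space "scale U" using U by (simp add: vect_def)
  interpret v: vector_space "scale V" using V by (simp add: vect_def)
  have subU: "u.subspace (carr U)" using U by (simp add: vect_def)
  have subp: "u.subspace {u \<in> carr U. f u \<in> J}" if "v.subspace J" for J
    unfolding u.subspace_def
    using vect_closed[OF U] lin_mapD(2,3)[OF f] lin_map_0[OF U f] that
    by (auto simp: v.subspace_def)
  have "finite F \<Longrightarrow> v.subspace J \<Longrightarrow> carr V \<subseteq> v.span (J \<union> F) \<Longrightarrow>
     \<exists>E. finite E \<and> E \<subseteq> carr U \<and> carr U = u.span ({u \<in> carr U. f u \<in> J} \<union> E)" for F J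
  proof (induction F arbitrary: J rule: finite_induct)
    case empty
    have "carr V \<subseteq> J" using empty(2) unfolding Un_empty_right v.span_eq_iff[THEN iffD2, OF empty(1)] .
    then have e: "{u \<in> carr U. f u \<in> J} = carr U" using lin_mapD(1)[OF f] by blast
    have "carr U = u.span ({u \<in> carr U. f u \<in> J} \<union> {})"
      unfolding e Un_empty_right u.span_eq_iff[THEN iffD2, OF subU] ..
    then show ?case by (intro exI[of _ "{}"] conjI) (rule finite.emptyI empty_subsetI | assumption)+
  next
    case (insert x F)
    define J' where "J' = v.span (J \<union> {x})"
    have "carr V \<subseteq> v.span (J' \<union> F)"
    proof -
      have "J \<union> {x} \<subseteq> J'" unfolding J'_def by (rule v.span_superset)
      moreover have "J' \<union> F \<subseteq> v.span (J' \<union> F)" by (rule v.span_superset)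
      ultimately have "J \<union> insert x F \<subseteq> v.span (J' \<union> F)" by blast
      then have "v.span (J \<union> insert x F) \<subseteq> v.span (J' \<union> F)" by (rule v.span_minimal) simp
      then show ?thesis using insert.prems(2) by blast
    qed
    moreover have "v.subspace J'" unfolding J'_def by (rule v.subspace_span)
    ultimately have "\<exists>E. finite E \<and> E \<subseteq> carr U \<and> carr U = u.span ({u \<in> carr U. f u \<in> J'} \<union> E)"
      by (intro insert.IH)
    then obtain E where E0: "finite E \<and> E \<subseteq> carr U \<and> carr U = u.span ({u \<in> carr U. f u \<in> J'} \<union> E)"
      by (elim exE)
    note E = E0[THEN conjunct1] E0[THEN conjunct2, THEN conjunct1] E0[THEN conjunct2, THEN conjunct2]
    have J'eq: "\<exists>j\<in>J. \<exists>c. w = j + scale V c x" if w: "w \<in> J'" for w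
    proof -
      obtain a b where ab: "w = a + b" "a \<in> v.span J" "b \<in> v.span {x}"
        using w unfolding J'_def v.span_Un by blast
      have "a \<in> J" using ab(2) unfolding v.span_eq_iff[THEN iffD2, OF insert.prems(1)] .
      moreover obtain c where "b = scale V c x" using ab(3) unfolding v.span_singleton by blast
      ultimately show ?thesis using ab(1) by blast
    qed
    show ?case
    \<comment> \<open>If the preimage grows, a single u0 outside the old one generates the new one
      modulo the old.\<close>
    proof (cases "\<exists>u0\<in>carr U. f u0 \<in> J' \<and> f u0 \<notin> J")
      case False
      then have "{u \<in> carr U. f u \<in> J'} \<subseteq> {u \<in> carr U. f u \<in> J}" by auto
      then have "carr U \<subseteq> u.span ({u \<in> carr U. f u \<in> J} \<union> E)"
        by (subst E(3)) (intro u.span_mono Un_mono order_refl)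
      moreover have "u.span ({u \<in> carr U. f u \<in> J} \<union> E) \<subseteq> carr U"
        by (rule u.span_minimal[OF _ subU]) (use E(2) in auto)
      ultimately show ?thesis using E by blast
    next
      case True
      then obtain u0 where u0: "u0 \<in> carr U" "f u0 \<in> J'" "f u0 \<notin> J" by blast
      obtain j0 c0 where j0: "j0 \<in> J" "f u0 = j0 + scale V c0 x" using J'eq[OF u0(2)] by blast
      have c0: "c0 \<noteq> 0" using j0 u0(3) by auto
      have *: "u \<in> u.span ({u \<in> carr U. f u \<in> J} \<union> insert u0 E)" if u: "u \<in> carr U" "f u \<in> J'" for u
      proof -
        obtain j c where jc: "j \<in> J" "f u = j + scale V c x" using J'eq[OF u(2)] by blast
        \<comment> \<open>c and c0 are the coefficients of x in f u and f u0, so this multiple of u0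
          cancels x from f u.\<close>
        define w where "w = u + scale U (- (c / c0)) u0"
        have w: "w \<in> carr U" unfolding w_def using u u0 vect_closed[OF U] by blast
        have "f w = f u + scale V (- (c / c0)) (f u0)"
          unfolding w_def lin_mapD(2)[OF f u(1) vect_closed(3)[OF U u0(1)]] lin_mapD(3)[OF f u0(1)] ..
        also have "\<dots> = j + scale V (- (c / c0)) j0"
          unfolding jc j0 using c0 by (simp add: v.scale_right_distrib v.scale_left_distrib[symmetric] add.assoc)
        finally have fw: "f w = j + scale V (- (c / c0)) j0" .
        have "f w \<in> J" unfolding fw
          by (intro v.subspace_add[OF insert.prems(1)] v.subspace_scale[OF insert.prems(1)] jc(1) j0(1))
        with w have 1: "w \<in> u.span ({u \<in> carr U. f u \<in> J} \<union> insert u0 E)" by (intro u.span_base) simp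
        have 2: "scale U (c / c0) u0 \<in> u.span ({u \<in> carr U. f u \<in> J} \<union> insert u0 E)"
          by (intro u.span_scale u.span_base) simp
        have 3: "u = w + scale U (c / c0) u0" by (simp add: w_def)
        show ?thesis by (subst 3) (rule u.span_add[OF 1 2])
      qed
      have "carr U = u.span ({u \<in> carr U. f u \<in> J} \<union> insert u0 E)"
      proof
        have "{u \<in> carr U. f u \<in> J'} \<union> E \<subseteq> u.span ({u \<in> carr U. f u \<in> J} \<union> insert u0 E)"
          using * by (auto intro: u.span_base)
        from u.span_minimal[OF this u.subspace_span] show "carr U \<subseteq> u.span ({u \<in> carr U. f u \<in> J} \<union> insert u0 E)"
          unfolding E(3)[symmetric] .
        show "u.span ({u \<in> carr U. f u \<in> J} \<union> insert u0 E) \<subseteq> carr U"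
          by (rule u.span_minimal[OF _ subU]) (use E(2) u0 in auto)
      qed
      moreover have "finite (insert u0 E)" "insert u0 E \<subseteq> carr U" using E(1,2) u0(1) by auto
      ultimately show ?thesis by blast
    qed
  qed
  note ind = this
  obtain F where F: "finite F" "v.subspace J" "carr V = v.span (J \<union> F)"
    using J unfolding finite_codim_def by blast
  have "\<exists>E. finite E \<and> E \<subseteq> carr U \<and> carr U = u.span ({u \<in> carr U. f u \<in> J} \<union> E)"
    by (rule ind[OF F(1,2)]) (simp add: F(3))
  then show ?thesis using subp[OF F(2)] unfolding finite_codim_def by blast
qed

lemma finite_codim_mono:
  assumes V: "vect V" and K: "finite_codim V K" "K \<subseteq> I" and I: "module.subspace (scale V) I" "I \<subseteq> carr V"
  shows "finite_codim V I"
proof -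
  interpret vs: vector_space "scale V" using V by (simp add: vect_def)
  have subV: "vs.subspace (carr V)" using V by (simp add: vect_def)
  obtain F where F: "finite F" "F \<subseteq> carr V" "carr V = vs.span (K \<union> F)"
    using K(1) unfolding finite_codim_def by blast
  have "carr V \<subseteq> vs.span (I \<union> F)" using F(3) K(2) vs.span_mono[of "K \<union> F" "I \<union> F"] by blast
  moreover have "vs.span (I \<union> F) \<subseteq> carr V" by (rule vs.span_minimal[OF _ subV]) (use I F in auto)
  ultimately show ?thesis unfolding finite_codim_def using I F by blast
qed

lemma finite_codim_refl: "vect V \<Longrightarrow> finite_codim V (carr V)"
proof -
  assume V: "vect V"
  then interpret vs: vector_space "scale V" by (simp add: vect_def)
  have sub: "vs.subspace (carr V)" using V by (simp add: vect_def)
  have "carr V = vs.span (carr V \<union> {})" unfolding Un_empty_right vs.span_eq_iff[THEN iffD2, OF sub] ..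
  then show ?thesis unfolding finite_codim_def using sub by blast
qed

lemma finite_codim_trans:
  assumes V: "vect V" and K: "finite_codim V K" and L: "module.subspace (scale V) L" "L \<subseteq> K" "finite F" "F \<subseteq> K"
    "K \<subseteq> module.span (scale V) (L \<union> F)"
  shows "finite_codim V L"
proof -
  interpret vs: vector_space "scale V" using V by (simp add: vect_def)
  have subV: "vs.subspace (carr V)" using V by (simp add: vect_def)
  obtain E where E: "finite E" "E \<subseteq> carr V" "carr V = vs.span (K \<union> E)" "K \<subseteq> carr V"
    using K(1) unfolding finite_codim_def by blast
  have "K \<union> E \<subseteq> vs.span (L \<union> (F \<union> E))"
    using L(5) vs.span_mono[of "L \<union> F" "L \<union> (F \<union> E)"] by (auto intro: vs.span_base)
  from vs.span_minimal[OF this] have "carr V \<subseteq> vs.span (L \<union> (F \<union> E))" using E(3) by simp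
  moreover have "vs.span (L \<union> (F \<union> E)) \<subseteq> carr V" by (rule vs.span_minimal[OF _ subV]) (use L E in auto)
  ultimately show ?thesis unfolding finite_codim_def using L E
    by (intro conjI exI[of _ "F \<union> E"]) auto
qed

text \<open>Each further functional cuts the common kernel down by at most one dimension; any w of
  the old kernel on which it does not vanish is the extra generator.\<close>

lemma finite_codim_kernel:
  assumes V: "vect V" and fs: "\<And>\<phi>. \<phi> \<in> set fs \<Longrightarrow> lin_map V ground \<phi>"
  shows "finite_codim V {v \<in> carr V. \<forall>\<phi>\<in>set fs. \<phi> v = 0}"
  using fs
proof (induction fs)
  case Nil
  then show ?case using finite_codim_refl[OF V] by simp
next
  case (Cons \<phi> fs)
  interpret vs: vector_space "scale V" using V by (simp add: vect_def)
  let ?K = "{v \<in> carr V. \<forall>\<phi>\<in>set fs. \<phi> v = 0}"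
  let ?L = "{v \<in> carr V. \<forall>\<phi>\<in>set (\<phi> # fs). \<phi> v = 0}"
  have K: "finite_codim V ?K" using Cons by simp
  have L: "vs.subspace ?L"
  proof (unfold vs.subspace_def, intro conjI ballI allI)
    show "0 \<in> ?L" using vect_closed(1)[OF V] lin_map_0[OF V Cons.prems] by blast
    fix x assume x: "x \<in> ?L"
    have "\<forall>\<psi>\<in>set (\<phi> # fs). \<psi> (scale V c x) = 0" for c
    proof
      fix \<psi> assume \<psi>: "\<psi> \<in> set (\<phi> # fs)"
      then show "\<psi> (scale V c x) = 0" using lin_mapD(3)[OF Cons.prems[OF \<psi>], of x c] x by auto
    qed
    then show "scale V c x \<in> ?L" for c using vect_closed(3)[OF V] x by blast
    fix y assume y: "y \<in> ?L"
    have "\<forall>\<psi>\<in>set (\<phi> # fs). \<psi> (x + y) = 0"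
    proof
      fix \<psi> assume \<psi>: "\<psi> \<in> set (\<phi> # fs)"
      then show "\<psi> (x + y) = 0" using lin_mapD(2)[OF Cons.prems[OF \<psi>], of x y] x y by auto
    qed
    then show "x + y \<in> ?L" using vect_closed(2)[OF V] x y by blast
  qed
  show ?case
  proof (cases "\<exists>w\<in>?K. \<phi> w \<noteq> 0")
    case False
    then have "?L = ?K" by auto
    then show ?thesis using K by simp
  next
    case True
    then obtain w where w: "w \<in> ?K" "\<phi> w \<noteq> 0" by blast
    have "?K \<subseteq> vs.span (?L \<union> {w})"
    proof
      fix v assume v: "v \<in> ?K"
      define x where "x = v + scale V (- (\<phi> v / \<phi> w)) w"
      have vw: "v \<in> carr V" "w \<in> carr V" using v w by auto
      have lin: "\<psi> x = \<psi> v - \<phi> v / \<phi> w * \<psi> w" if \<psi>: "\<psi> \<in> set (\<phi> # fs)" for \<psi>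
        unfolding x_def lin_mapD(2)[OF Cons.prems[OF \<psi>] vw(1) vect_closed(3)[OF V vw(2)]]
          lin_mapD(3)[OF Cons.prems[OF \<psi>] vw(2)] by simp
      have "\<forall>\<psi>\<in>set (\<phi> # fs). \<psi> x = 0"
      proof
        fix \<psi> assume \<psi>: "\<psi> \<in> set (\<phi> # fs)"
        show "\<psi> x = 0" using lin[OF \<psi>] \<psi> v w by auto
      qed
      moreover have "x \<in> carr V" unfolding x_def using vw vect_closed[OF V] by blast
      ultimately have "x \<in> ?L" by blast
      then have 1: "x \<in> vs.span (?L \<union> {w})" by (intro vs.span_base) blast
      have 2: "scale V (\<phi> v / \<phi> w) w \<in> vs.span (?L \<union> {w})" by (intro vs.span_scale vs.span_base) blast
      have 3: "v = x + scale V (\<phi> v / \<phi> w) w" by (simp add: x_def)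
      show "v \<in> vs.span (?L \<union> {w})" by (subst 3) (rule vs.span_add[OF 1 2])
    qed
    then show ?thesis by (intro finite_codim_trans[OF V K L, of "{w}"]) (use w in auto)
  qed
qed

section \<open>Spaces of functionals\<close>

abbreviation (input) fscale :: "'k::field \<Rightarrow> ('v \<Rightarrow> 'k) \<Rightarrow> 'v \<Rightarrow> 'k" where
  "fscale \<equiv> (\<lambda>c p v. c * p v)"

lemma vs_fscale: "vector_space (fscale :: 'k::field \<Rightarrow> ('v \<Rightarrow> 'k) \<Rightarrow> _)"
  by unfold_locales (auto simp: fun_eq_iff algebra_simps)

lemma vect_funI:
  assumes "scale D = fscale" "0 \<in> carr D" "\<And>p q. p \<in> carr D \<Longrightarrow> q \<in> carr D \<Longrightarrow> p + q \<in> carr D"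
    "\<And>c p. p \<in> carr D \<Longrightarrow> fscale c p \<in> carr D"
  shows "vect D"
proof -
  interpret f: vector_space "fscale :: 'a \<Rightarrow> ('b \<Rightarrow> 'a) \<Rightarrow> _" by (rule vs_fscale)
  show ?thesis unfolding vect_def assms(1) f.subspace_def
    using vs_fscale assms(2-4) by blast
qed

lemma eval_lin: "scale D = fscale \<Longrightarrow> lin_map D ground (\<lambda>p. p a)"
  by (auto simp: lin_map_def in_ground)

lemma dual_iff: "p \<in> carr (dual V) \<longleftrightarrow> lin_map V ground p \<and> (\<forall>v. v \<notin> carr V \<longrightarrow> p v = 0)"
  by (simp add: dual_def)

lemma scale_dual [simp]: "scale (dual V) = fscale"
  by (simp add: dual_def)

lemma vect_dual: "vect (dual V)"
proof (rule vect_funI)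
  show "0 \<in> carr (dual V)" by (auto simp: dual_iff lin_map_def in_ground)
  show "p + q \<in> carr (dual V)" if "p \<in> carr (dual V)" "q \<in> carr (dual V)" for p q
    using that by (auto simp: dual_iff lin_map_def in_ground algebra_simps)
  show "fscale c p \<in> carr (dual V)" if "p \<in> carr (dual V)" for c p
    using that by (auto simp: dual_iff lin_map_def in_ground algebra_simps)
qed simp

lemma dual_eqI:
  assumes "p \<in> carr (dual V)" "q \<in> carr (dual V)" "\<And>v. v \<in> carr V \<Longrightarrow> p v = q v"
  shows "p = q"
proof
  fix v show "p v = q v" using assms by (cases "v \<in> carr V") (auto simp: dual_iff)
qed

lemma zero_ext_dual: "vect V \<Longrightarrow> lin_map V ground f \<Longrightarrow> zero_ext V f \<in> carr (dual V)"
  unfolding dual_iff by (intro conjI, rule lin_map_eq[where g=f]) (simp_all add: zero_ext_def)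

lemma zero_ext_apply [simp]: "v \<in> carr V \<Longrightarrow> zero_ext V f v = f v"
  by (simp add: zero_ext_def)

text \<open>Evaluations at points separate functionals, so \<open>tens_sep\<close> applies. This is
  the uniqueness behind the coproducts and coactions given by definite descriptions.\<close>

lemma fun_tens_sep:
  assumes D: "vect D" "scale D = fscale" "carr D \<subseteq> carr (dual V)"
    and E: "vect E" "scale E = fscale" "carr E \<subseteq> carr (dual W)"
    and t: "t \<in> carr (tprod D E)" "t' \<in> carr (tprod D E)"
    and eq: "\<And>v w. v \<in> carr V \<Longrightarrow> w \<in> carr W \<Longrightarrow> tlift D E (\<lambda>p q. p v * q w) t = tlift D E (\<lambda>p q. p v * q w) t'"
  shows "t = t'"
proof (rule tens_sep[OF D(1) E(1) _ _ _ _ t, where P="{\<lambda>p. p v |v. v \<in> carr V}" and Q="{\<lambda>p. p v |v. v \<in> carr W}"])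
  show "lin_map D ground \<alpha>" if "\<alpha> \<in> {\<lambda>p. p v |v. v \<in> carr V}" for \<alpha> using that eval_lin[OF D(2)] by auto
  show "lin_map E ground \<alpha>" if "\<alpha> \<in> {\<lambda>p. p v |v. v \<in> carr W}" for \<alpha> using that eval_lin[OF E(2)] by auto
  show "p = 0" if "p \<in> carr D" "\<And>\<alpha>. \<alpha> \<in> {\<lambda>p. p v |v. v \<in> carr V} \<Longrightarrow> \<alpha> p = 0" for p
  proof
    fix v show "p v = 0 v" using that(1) that(2)[of "\<lambda>p. p v"] D(3) by (cases "v \<in> carr V") (auto simp: dual_iff)
  qed
  show "p = 0" if "p \<in> carr E" "\<And>\<alpha>. \<alpha> \<in> {\<lambda>p. p v |v. v \<in> carr W} \<Longrightarrow> \<alpha> p = 0" for p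
  proof
    fix v show "p v = 0 v" using that(1) that(2)[of "\<lambda>p. p v"] E(3) by (cases "v \<in> carr W") (auto simp: dual_iff)
  qed
qed (use eq in auto)

lemma transp_mult_eqI:
  assumes D: "vect D" "scale D = fscale" "carr D \<subseteq> carr (dual A)"
    and t: "t \<in> carr (tprod D D)"
    and eq: "\<And>a b. a \<in> carr A \<Longrightarrow> b \<in> carr A \<Longrightarrow> tlift D D (\<lambda>p1 p2. p1 a * p2 b) t = p (mult A a b)"
  shows "transp_mult A D p = t"
  unfolding transp_mult_def
proof (rule the_equality)
  fix t' assume t': "t' \<in> carr (tprod D D) \<and> (\<forall>a\<in>carr A. \<forall>b\<in>carr A. tlift D D (\<lambda>p1 p2. p1 a * p2 b) t' = p (mult A a b))"
  show "t' = t"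
    by (rule fun_tens_sep[OF D D]) (use t t' eq in auto)
qed (use t eq in auto)

lemma tlift_times:
  "tlift V W (\<lambda>v w. \<phi> v w) t * tlift V' W' (\<lambda>v w. \<psi> v w) t' =
   tlift V W (\<lambda>v w. tlift V' W' (\<lambda>v' w'. \<phi> v w * (\<psi> v' w' :: 'k::field)) t') t"
  unfolding tlift_def case_prod_unfold
  by (simp add: sum_list_const_mult sum_list_mult_const)

lemma tlift_swap3:
  "tlift V W (\<lambda>v w. tlift V1 W1 (\<lambda>v1 w1. tlift V2 W2 (\<lambda>v2 w2. \<phi> v w v1 w1 v2 w2) t2) t1) t =
   tlift V1 W1 (\<lambda>v1 w1. tlift V2 W2 (\<lambda>v2 w2. tlift V W (\<lambda>v w. \<phi> v w v1 w1 v2 w2) t) t2) t1"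
  by (subst tlift_swap, rule arg_cong2[where f="tlift V1 W1", OF _ refl], rule ext, rule ext, rule tlift_swap)

lemma sum_list_apply: "(\<Sum>p\<leftarrow>ps. g p) a = (\<Sum>p\<leftarrow>ps. (g p a :: 'c::ab_group_add))"
  by (induction ps) auto

lemma tlift_eval: "tlift V W \<phi> t a = tlift V W (\<lambda>v w. (\<phi> v w :: 'b \<Rightarrow> 'c::ab_group_add) a) t"
  unfolding tlift_def case_prod_unfold by (rule sum_list_apply)

lemma fin_dual_fields [simp]:
  "carr (fin_dual A) = carr (fin_dual_space A)" "scale (fin_dual A) = fscale"
  "mult (fin_dual A) = conv A" "one (fin_dual A) = zero_ext A (counit A)"
  "comult (fin_dual A) = transp_mult A (fin_dual_space A)" "counit (fin_dual A) p = p (one A)"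
  by (simp_all add: fin_dual_def fin_dual_space_def)

lemma fin_dual_space_fields:
  "p \<in> carr (fin_dual_space A) \<longleftrightarrow> p \<in> carr (dual A) \<and> (\<exists>I. ideal A I \<and> finite_codim A I \<and> (\<forall>a\<in>I. p a = 0))"
  "scale (fin_dual_space A) = fscale"
  by (simp_all add: fin_dual_space_def)

text \<open>For every x the functional F x factors through the finite-dimensional quotient
  V/I.\<close>

lemma finite_rank_linear_right:
  assumes V: "vect V" and I: "finite_codim V I"
    and F: "\<And>x. x \<in> X \<Longrightarrow> lin_map V ground (F x)" "\<And>x v. x \<in> X \<Longrightarrow> v \<in> I \<Longrightarrow> F x v = 0"
  shows "finite_rank X (carr V) F"
proof -
  obtain es c where es: "set es \<subseteq> carr V" and c: "\<And>v. v \<in> carr V \<Longrightarrow> v - (\<Sum>e\<leftarrow>es. scale V (c e v) e) \<in> I"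
    by (rule finite_codim_coeff[OF V I]) blast
  show ?thesis
  proof (rule finite_rankI_list[where ps=es and g="\<lambda>e x. F x e" and h="c"])
    fix x v assume x: "x \<in> X" and v: "v \<in> carr V"
    let ?s = "\<Sum>e\<leftarrow>es. scale V (c e v) e"
    have s: "?s \<in> carr V" using es by (intro vect_sum_list[OF V]) (auto intro: vect_closed[OF V])
    have "F x v - F x ?s = 0" using F(2)[OF x c[OF v]] lin_map_minus[OF V F(1)[OF x] v s] by simp
    moreover have "F x ?s = (\<Sum>e\<leftarrow>es. F x (scale V (c e v) e))"
      using es by (intro lin_map_sum_list[OF V F(1)[OF x]]) (auto intro: vect_closed[OF V])
    moreover have "(\<Sum>e\<leftarrow>es. F x (scale V (c e v) e)) = (\<Sum>e\<leftarrow>es. F x e * c e v)"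
      using es lin_mapD(3)[OF F(1)[OF x]] by (intro arg_cong[where f=sum_list] map_cong) auto
    ultimately show "F x v = (\<Sum>e\<leftarrow>es. F x e * c e v)" by simp
  qed
qed

text \<open>An ideal on which p vanishes makes p(a b) depend on b only modulo that ideal. Conversely
  the largest such ideal has finite codimension, since finite rank reduces its definition to
  finitely many linear conditions.\<close>

lemma fin_dual_iff:
  assumes A: "algebra A"
  shows "p \<in> carr (fin_dual_space A) \<longleftrightarrow> p \<in> carr (dual A) \<and> finite_rank (carr A) (carr A) (\<lambda>a b. p (mult A a b))"
proof
  note [ty] = A algebraD(1)[OF A]
  assume "p \<in> carr (fin_dual_space A)"
  then obtain I where p: "p \<in> carr (dual A)" and I: "ideal A I" "finite_codim A I" "\<forall>a\<in>I. p a = 0"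
    by (auto simp: fin_dual_space_fields)
  have l: "lin_map A ground p" using p by (simp add: dual_iff)
  have "finite_rank (carr A) (carr A) (\<lambda>a b. p (mult A a b))"
  proof (rule finite_rank_linear_right[OF _ I(2)])
    show "lin_map A ground (\<lambda>b. p (mult A x b))" if "x \<in> carr A" for x
      by (rule ty lin_map_comp[OF l] that)+
    show "p (mult A x v) = 0" if "x \<in> carr A" "v \<in> I" for x v
      using I(1,3) that unfolding ideal_def by blast
  qed (rule ty)
  then show "p \<in> carr (dual A) \<and> finite_rank (carr A) (carr A) (\<lambda>a b. p (mult A a b))" using p by blast
next
  note [ty] = A algebraD(1)[OF A]
  assume a: "p \<in> carr (dual A) \<and> finite_rank (carr A) (carr A) (\<lambda>a b. p (mult A a b))"
  then have l: "lin_map A ground p" by (simp add: dual_iff)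
  obtain ps where ps: "set ps \<subseteq> UNIV \<times> carr A \<times> carr A \<and> (\<forall>a\<in>carr A. \<forall>b\<in>carr A. p (mult A a b) = (\<Sum>(m, x, y)\<leftarrow>ps. m * p (mult A a y) * p (mult A x b)))"
    using finite_rankD[OF a[THEN conjunct2]] by (elim exE)
  have ps2: "p (mult A a b) = (\<Sum>(m, x, y)\<leftarrow>ps. m * p (mult A a y) * p (mult A x b))" if "a \<in> carr A" "b \<in> carr A" for a b
    using ps that by blast
  interpret vs: vector_space "scale A" using algebraD(1)[OF A] by (simp add: vect_def)
  define I where "I = {x \<in> carr A. \<forall>a\<in>carr A. \<forall>b\<in>carr A. p (mult A (mult A a x) b) = 0}"
  have lx: "lin_map A ground (\<lambda>x. p (mult A (mult A a x) b))" if "a \<in> carr A" "b \<in> carr A" for a b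
    by (rule ty lin_map_comp[OF l] that)+
  \<comment> \<open>One condition p(x u y') = 0 for each pair of entries of the factorisation; two
    uses of \<open>ps2\<close> extend it to all outer factors.\<close>
  define fs where "fs = concat (map (\<lambda>(m, x, y). map (\<lambda>(m', x', y') u. p (mult A (mult A x u) y')) ps) ps)"
  have "finite_codim A {v \<in> carr A. \<forall>\<phi>\<in>set fs. \<phi> v = 0}"
  proof (rule finite_codim_kernel)
    fix \<phi> assume "\<phi> \<in> set fs"
    then obtain m x y m' x' y' where "(m, x, y) \<in> set ps" "(m', x', y') \<in> set ps" "\<phi> = (\<lambda>u. p (mult A (mult A x u) y'))"
      unfolding fs_def by auto
    then show "lin_map A ground \<phi>" using lx ps by auto
  qed (rule ty)
  note cod = this
  have sub: "{v \<in> carr A. \<forall>\<phi>\<in>set fs. \<phi> v = 0} \<subseteq> I"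
  proof
    fix v assume v: "v \<in> {v \<in> carr A. \<forall>\<phi>\<in>set fs. \<phi> v = 0}"
    then have vc[ty]: "v \<in> carr A" by simp
    have z: "p (mult A (mult A x v) y') = 0" if "(m, x, y) \<in> set ps" "(m', x', y') \<in> set ps" for m x y m' x' y'
    proof -
      have "(\<lambda>u. p (mult A (mult A x u) y')) \<in> set fs" unfolding fs_def using that by force
      moreover have "\<forall>\<phi>\<in>set fs. \<phi> v = 0" using v by simp
      ultimately show ?thesis by (rule bspec[rotated])
    qed
    have z2: "p (mult A (mult A x v) b) = 0" if "(m, x, y) \<in> set ps" "b \<in> carr A" for m x y b
    proof -
      have x[ty]: "x \<in> carr A" using that ps by auto
      have "p (mult A (mult A x v) b) = (\<Sum>(m, x', y)\<leftarrow>ps. m * p (mult A (mult A x v) y) * p (mult A x' b))"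
        by (rule ps2) (rule ty that)+
      also have "\<dots> = (\<Sum>p\<leftarrow>ps. 0)"
        by (intro arg_cong[where f=sum_list] map_cong refl) (use z that in auto)
      finally show ?thesis by simp
    qed
    have "p (mult A (mult A a v) b) = 0" if "a \<in> carr A" "b \<in> carr A" for a b
    proof -
      have "p (mult A (mult A a v) b) = p (mult A a (mult A v b))" using algebraD(4)[OF A] that vc by simp
      also have "\<dots> = (\<Sum>(m, x, y)\<leftarrow>ps. m * p (mult A a y) * p (mult A x (mult A v b)))"
        by (rule ps2) (rule ty that)+
      also have "\<dots> = (\<Sum>p\<leftarrow>ps. 0)"
      proof (intro arg_cong[where f=sum_list] map_cong refl)
        fix q assume q: "q \<in> set ps"
        obtain m x y where qe: "q = (m, x, y)" by (cases q)
        have "x \<in> carr A" using q ps qe by auto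
        then have "mult A x (mult A v b) = mult A (mult A x v) b" using algebraD(4)[OF A] that vc by simp
        then show "(case q of (m, x, y) \<Rightarrow> m * p (mult A a y) * p (mult A x (mult A v b))) = 0"
          using z2[of m x y b] q qe that by simp
      qed
      finally show ?thesis by simp
    qed
    then show "v \<in> I" unfolding I_def using vc by blast
  qed
  have sI: "vs.subspace I"
  proof (unfold vs.subspace_def, intro conjI ballI allI)
    note va = algebraD(1)[OF A]
    show "0 \<in> I" unfolding I_def using vect_closed(1)[OF va] lin_map_0[OF va lx] by blast
    fix x assume x: "x \<in> I"
    have xc: "x \<in> carr A" using x by (simp add: I_def)
    have xz: "p (mult A (mult A a x) b) = 0" if "a \<in> carr A" "b \<in> carr A" for a b
      using x that by (simp add: I_def)
    show "scale A c x \<in> I" for c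
      using vect_closed(3)[OF va xc] lin_mapD(3)[OF lx xc] xz by (simp add: I_def)
    fix y assume y: "y \<in> I"
    have yc: "y \<in> carr A" using y by (simp add: I_def)
    have yz: "p (mult A (mult A a y) b) = 0" if "a \<in> carr A" "b \<in> carr A" for a b
      using y that by (simp add: I_def)
    show "x + y \<in> I"
      using vect_closed(2)[OF va xc yc] lin_mapD(2)[OF lx xc yc] xz yz by (simp add: I_def)
  qed
  have "finite_codim A I"
    by (rule finite_codim_mono[OF algebraD(1)[OF A] cod sub sI]) (auto simp: I_def)
  moreover have "ideal A I"
  proof -
    have "mult A c x \<in> I" "mult A x c \<in> I" if "c \<in> carr A" "x \<in> I" for c x
    proof -
      have x[ty]: "x \<in> carr A" "c \<in> carr A" using that I_def by auto
      have "p (mult A (mult A a (mult A c x)) b) = 0" "p (mult A (mult A a (mult A x c)) b) = 0" if [ty]: "a \<in> carr A" "b \<in> carr A" for a b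
      proof -
        have "mult A (mult A a (mult A c x)) b = mult A (mult A (mult A a c) x) b" using algebraD(4)[OF A] by (simp add: ty)
        moreover have "mult A (mult A a (mult A x c)) b = mult A (mult A a x) (mult A c b)" using algebraD(4)[OF A] by (simp add: ty)
        moreover have "mult A a c \<in> carr A" "mult A c b \<in> carr A" by (rule ty)+
        ultimately show "p (mult A (mult A a (mult A c x)) b) = 0" "p (mult A (mult A a (mult A x c)) b) = 0"
          using \<open>x \<in> I\<close> that unfolding I_def by auto
      qed
      moreover have "mult A c x \<in> carr A" "mult A x c \<in> carr A" by (rule ty)+
      ultimately show "mult A c x \<in> I" "mult A x c \<in> I" unfolding I_def by auto
    qed
    then show ?thesis unfolding ideal_def using sI by (auto simp: I_def)
  qed
  moreover have "p x = 0" if "x \<in> I" for x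
  proof -
    have "x \<in> carr A" "p (mult A (mult A (one A) x) (one A)) = 0" using that algebraD(3)[OF A] by (auto simp: I_def)
    then show ?thesis using algebraD(5,6)[OF A] by simp
  qed
  ultimately show "p \<in> carr (fin_dual_space A)" using a by (auto simp: fin_dual_space_fields)
qed

section \<open>Finite duals\<close>

locale bialg_dual =
  fixes A :: "('k::field, 'a::ab_group_add, 'x) bialg_scheme"
  assumes bi [simp, ty]: "bialgebra A"
begin

lemma A_facts [simp, ty]: "algebra A" "coalgebra A" "vect A"
  using bialgebraD[OF bi] by auto

abbreviation "D \<equiv> fin_dual_space A"
abbreviation "Ao \<equiv> fin_dual A"

lemma D_dual: "p \<in> carr D \<Longrightarrow> p \<in> carr (dual A)"
  by (simp add: fin_dual_space_fields)

lemma D_lin: "p \<in> carr D \<Longrightarrow> lin_map A ground p"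
  by (simp add: fin_dual_space_fields dual_iff)

lemma D_finite_rank: "p \<in> carr D \<Longrightarrow> finite_rank (carr A) (carr A) (\<lambda>a b. p (mult A a b))"
  by (simp add: fin_dual_iff)

lemma DI: "p \<in> carr (dual A) \<Longrightarrow> finite_rank (carr A) (carr A) (\<lambda>a b. p (mult A a b)) \<Longrightarrow> p \<in> carr D"
  by (simp add: fin_dual_iff)

lemma zero_ext_DI:
  assumes "lin_map A ground p" "finite_rank (carr A) (carr A) (\<lambda>a b. p (mult A a b))"
  shows "zero_ext A p \<in> carr D"
  by (rule DI[OF zero_ext_dual[OF A_facts(3) assms(1)] finite_rank_cong[OF assms(2)]]) (simp add: ty)

lemma vect_D [simp, ty]: "vect D"
proof (rule vect_funI)
  show "scale D = fscale" by (simp add: fin_dual_space_fields)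
  note vd = vect_closed[OF vect_dual[of A], unfolded scale_dual]
  show "0 \<in> carr D" by (rule DI[OF vd(1)]) (simp add: finite_rank_zero)
  show "p + q \<in> carr D" if "p \<in> carr D" "q \<in> carr D" for p q
    by (rule DI[OF vd(2)[OF D_dual[OF that(1)] D_dual[OF that(2)]]])
      (simp add: finite_rank_add D_finite_rank that)
  show "fscale c p \<in> carr D" if "p \<in> carr D" for c p
    by (rule DI[OF vd(3)[OF D_dual[OF that]]]) (simp add: finite_rank_scale D_finite_rank that)
qed

lemma scale_D [simp]: "scale D = fscale" by (simp add: fin_dual_space_fields)

lemma same_Ao [simp]:
  "vect Ao = vect D" "lin_map U Ao = lin_map U D" "lin_map Ao U' = lin_map D U'"
  "tprod Ao Ao = tprod D D" "tens Ao Ao = tens D D" "tlift Ao Ao = tlift D D"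
  "tprod W Ao = tprod W D" "tens W Ao = tens W D" "tlift W Ao = tlift W D"
  "tprod Ao W' = tprod D W'" "tens Ao W' = tens D W'" "tlift Ao W' = tlift D W'"
  "bilin_map Ao Ao Ao = bilin_map D D D"
proof -
  show "tens Ao Ao = tens D D" "tens W Ao = tens W D" "tens Ao W' = tens D W'" by (rule tens_same; simp)+
  show "tprod Ao Ao = tprod D D" "tlift Ao Ao = tlift D D"
    "tprod W Ao = tprod W D" "tlift W Ao = tlift W D"
    "tprod Ao W' = tprod D W'" "tlift Ao W' = tlift D W'" by (rule tprod_same; simp)+
qed (auto simp: vect_def lin_map_def bilin_map_def fun_eq_iff)

lemma D_eqI: "p \<in> carr D \<Longrightarrow> q \<in> carr D \<Longrightarrow> (\<And>a. a \<in> carr A \<Longrightarrow> p a = q a) \<Longrightarrow> p = q"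
  by (rule dual_eqI[OF D_dual D_dual])

lemma eval_D [ty]: "lin_map D ground (\<lambda>p. p a)"
  by (rule eval_lin) simp

lemma DD_eqI:
  assumes "t \<in> carr (tprod D D)" "t' \<in> carr (tprod D D)"
    and "\<And>a b. a \<in> carr A \<Longrightarrow> b \<in> carr A \<Longrightarrow> tlift D D (\<lambda>p q. p a * q b) t = tlift D D (\<lambda>p q. p a * q b) t'"
  shows "t = t'"
  by (rule fun_tens_sep[OF vect_D scale_D _ vect_D scale_D _ assms]) (auto simp: D_dual)

text \<open>The factors of p(a b) are taken among the slices a \<mapsto> p(a y) and b \<mapsto> p(x
  b); by associativity such slices lie in the finite dual again.\<close>

lemma ex_transp:
  assumes p: "p \<in> carr D"
  shows "\<exists>t\<in>carr (tprod D D). \<forall>a\<in>carr A. \<forall>b\<in>carr A. tlift D D (\<lambda>p1 p2. p1 a * p2 b) t = p (mult A a b)"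
proof -
  obtain ps where ps: "set ps \<subseteq> UNIV \<times> carr A \<times> carr A \<and> (\<forall>a\<in>carr A. \<forall>b\<in>carr A. p (mult A a b) = (\<Sum>(m, x, y)\<leftarrow>ps. m * p (mult A a y) * p (mult A x b)))"
    using finite_rankD[OF D_finite_rank[OF p]] by (elim exE)
  note l = D_lin[OF p]
  define L where "L y = zero_ext A (\<lambda>a. p (mult A a y))" for y
  define R where "R x = zero_ext A (\<lambda>b. p (mult A x b))" for x
  have L: "L y \<in> carr D" and R: "R y \<in> carr D" if [ty]: "y \<in> carr A" for y
  proof -
    have 1: "lin_map A ground (\<lambda>a. p (mult A a y))" "lin_map A ground (\<lambda>b. p (mult A y b))"
      by (rule ty lin_map_comp[OF l])+
    have "finite_rank (carr A) (carr A) (\<lambda>a b. p (mult A a (mult A b y)))"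
      by (rule finite_rank_comp[OF D_finite_rank[OF p], where f="\<lambda>x. x" and g="\<lambda>b. mult A b y"]) (simp_all add: ty)
    then have 2: "finite_rank (carr A) (carr A) (\<lambda>a b. p (mult A (mult A a b) y))"
      by (rule finite_rank_cong) (simp add: algebraD(4) ty)
    have "finite_rank (carr A) (carr A) (\<lambda>a b. p (mult A (mult A y a) b))"
      by (rule finite_rank_comp[OF D_finite_rank[OF p], where f="\<lambda>a. mult A y a" and g="\<lambda>b. b"]) (simp_all add: ty)
    then have 3: "finite_rank (carr A) (carr A) (\<lambda>a b. p (mult A y (mult A a b)))"
      by (rule finite_rank_cong) (simp add: algebraD(4) ty)
    show "L y \<in> carr D" "R y \<in> carr D" unfolding L_def R_def
      by (rule zero_ext_DI[OF 1(1) 2], rule zero_ext_DI[OF 1(2) 3])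
  qed
  define qs where "qs = map (\<lambda>(m, x, y). (fscale m (L y), R x)) ps"
  have qs: "set qs \<subseteq> carr D \<times> carr D"
  proof
    fix q assume "q \<in> set qs"
    then obtain m x y where q: "(m, x, y) \<in> set ps" "q = (fscale m (L y), R x)" unfolding qs_def by auto
    have xy: "x \<in> carr A" "y \<in> carr A" using subsetD[OF conjunct1[OF ps] q(1)] by auto
    show "q \<in> carr D \<times> carr D"
      unfolding q(2) using vect_closed(3)[OF vect_D L[OF xy(2)], of m] R[OF xy(1)] by simp
  qed
  have "(\<Sum>(v, w)\<leftarrow>qs. tens D D v w) \<in> carr (tprod D D)"
    using qs by (intro vect_sum_list vect_tprod) (auto intro: tens_in_tprod)
  moreover have "tlift D D (\<lambda>p1 p2. p1 a * p2 b) (\<Sum>(v, w)\<leftarrow>qs. tens D D v w) = p (mult A a b)"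
    if "a \<in> carr A" "b \<in> carr A" for a b
  proof -
    have "tlift D D (\<lambda>p1 p2. p1 a * p2 b) (\<Sum>(v, w)\<leftarrow>qs. tens D D v w) = (\<Sum>(v, w)\<leftarrow>qs. v a * w b)"
      by (rule tlift_sum_list[where U=ground]) (rule ty qs | assumption)+
    also have "\<dots> = (\<Sum>(m, x, y)\<leftarrow>ps. m * p (mult A a y) * p (mult A x b))"
      unfolding qs_def using that by (simp add: L_def R_def case_prod_unfold comp_def)
    finally show ?thesis using ps that by simp
  qed
  ultimately show ?thesis by blast
qed

lemma transp_eqI:
  assumes "t \<in> carr (tprod D D)"
    and "\<And>a b. a \<in> carr A \<Longrightarrow> b \<in> carr A \<Longrightarrow> tlift D D (\<lambda>p1 p2. p1 a * p2 b) t = p (mult A a b)"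
  shows "transp_mult A D p = t"
  by (rule transp_mult_eqI[OF vect_D scale_D _ assms]) (auto simp: D_dual)

lemma transp:
  assumes p: "p \<in> carr D"
  shows transp_in [ty]: "transp_mult A D p \<in> carr (tprod D D)"
    and transp_eval: "\<And>a b. a \<in> carr A \<Longrightarrow> b \<in> carr A \<Longrightarrow> tlift D D (\<lambda>p1 p2. p1 a * p2 b) (transp_mult A D p) = p (mult A a b)"
proof -
  obtain t where t: "t \<in> carr (tprod D D)" "\<And>a b. a \<in> carr A \<Longrightarrow> b \<in> carr A \<Longrightarrow> tlift D D (\<lambda>p1 p2. p1 a * p2 b) t = p (mult A a b)"
    using ex_transp[OF p] by blast
  have "transp_mult A D p = t" by (rule transp_eqI[OF t])
  with t show "transp_mult A D p \<in> carr (tprod D D)"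
    "\<And>a b. a \<in> carr A \<Longrightarrow> b \<in> carr A \<Longrightarrow> tlift D D (\<lambda>p1 p2. p1 a * p2 b) (transp_mult A D p) = p (mult A a b)" by simp_all
qed

lemma ev2_lin: "lin_map (tprod D D) ground (tlift D D (\<lambda>p q. p a * q b))"
  by (rule tlift_universal(1)) (rule ty | assumption)+

lemma transp_lin: "lin_map D (tprod D D) (transp_mult A D)"
proof (rule lin_mapI)
  fix p q c assume p: "p \<in> carr D"
  show "transp_mult A D p \<in> carr (tprod D D)" by (rule transp_in[OF p])
  show "transp_mult A D (scale D c p) = scale (tprod D D) c (transp_mult A D p)"
    by (rule transp_eqI)
      (simp_all add: lin_mapD(3)[OF ev2_lin] transp_eval p transp_in scale_closed[OF vect_tprod])
  assume q: "q \<in> carr D"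
  show "transp_mult A D (p + q) = transp_mult A D p + transp_mult A D q"
    by (rule transp_eqI)
      (simp_all add: lin_mapD(2)[OF ev2_lin] transp_eval p q transp_in plus_closed[OF vect_tprod])
qed

lemmas transp_ty [ty] = lin_map_comp[OF transp_lin]

text \<open>After evaluation at points, coassociativity is associativity of A and the counit laws
  are the unit laws.\<close>

lemma coalgebra_Ao: "coalgebra Ao"
proof -
  let ?c = "transp_mult A D"
  have 1: "tlift D D (\<lambda>c1 c2. tens (tprod D D) D (?c c1) c2) (?c p) =
      tlift D D (\<lambda>c1 c2. tlift D D (\<lambda>c3 c4. tens (tprod D D) D (tens D D c1 c3) c4) (?c c2)) (?c p)" (is "?L = ?R")
    if [ty]: "p \<in> carr D" for p
  proof (rule tens_sep[where V="tprod D D" and W=D and P="{tlift D D (\<lambda>p q. p a * q b) |a b. a \<in> carr A \<and> b \<in> carr A}" and Q="{\<lambda>p. p c |c. c \<in> carr A}"])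
    show "lin_map (tprod D D) ground \<alpha>" if "\<alpha> \<in> {tlift D D (\<lambda>p q. p a * q b) |a b. a \<in> carr A \<and> b \<in> carr A}" for \<alpha>
      using that ev2_lin by auto
    show "lin_map D ground \<alpha>" if "\<alpha> \<in> {\<lambda>p. p c |c. c \<in> carr A}" for \<alpha>
      using that eval_D by auto
    show "t = 0" if t: "t \<in> carr (tprod D D)" "\<And>\<alpha>. \<alpha> \<in> {tlift D D (\<lambda>p q. p a * q b) |a b. a \<in> carr A \<and> b \<in> carr A} \<Longrightarrow> \<alpha> t = 0" for t
    proof (rule DD_eqI[OF t(1)])
      show "0 \<in> carr (tprod D D)" by (rule ty)+
      fix a b assume "a \<in> carr A" "b \<in> carr A"
      then have "tlift D D (\<lambda>p q. p a * q b) t = 0" using t(2) by blast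
      then show "tlift D D (\<lambda>p q. p a * q b) t = tlift D D (\<lambda>p q. p a * q b) 0"
        using lin_map_0[OF vect_tprod ev2_lin, of a b] by simp
    qed
    show "p = 0" if "p \<in> carr D" "\<And>\<alpha>. \<alpha> \<in> {\<lambda>p. p c |c. c \<in> carr A} \<Longrightarrow> \<alpha> p = 0" for p
      by (rule D_eqI[OF that(1)]) (use that(2) in \<open>auto simp: ty\<close>)
    fix \<alpha> :: "('k, 'a \<Rightarrow> 'k, 'a \<Rightarrow> 'k) tensor \<Rightarrow> 'k" and \<beta> :: "('a \<Rightarrow> 'k) \<Rightarrow> 'k" assume "\<alpha> \<in> {tlift D D (\<lambda>p q. p a * q b) |a b. a \<in> carr A \<and> b \<in> carr A}" "\<beta> \<in> {\<lambda>p. p c |c. c \<in> carr A}"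
    then obtain a b c where ab: "\<alpha> = tlift D D (\<lambda>p q. p a * q b)" "\<beta> = (\<lambda>p. p c)" and [ty]: "a \<in> carr A" "b \<in> carr A" "c \<in> carr A" by blast
    have [ty]: "lin_map (tprod D D) ground (tlift D D (\<lambda>p q. p a * q b))" by (rule ev2_lin)
    have "tlift (tprod D D) D (\<lambda>v w. \<alpha> v * \<beta> w) ?L = tlift D D (\<lambda>c1 c2. tlift D D (\<lambda>p q. p a * q b) (?c c1) * c2 c) (?c p)"
      unfolding ab by (simp add: ty push_tlift[where X=ground] tlift_tens[where X=ground] cong: tlift_cong)
    also have "\<dots> = p (mult A (mult A a b) c)" by (simp add: transp_eval ty cong: tlift_cong)
    also have "\<dots> = p (mult A a (mult A b c))" by (simp add: algebraD(4) ty)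
    also have "\<dots> = tlift D D (\<lambda>c1 c2. c1 a * tlift D D (\<lambda>c3 c4. c3 b * c4 c) (?c c2)) (?c p)"
      by (simp add: transp_eval ty cong: tlift_cong)
    also have "\<dots> = tlift D D (\<lambda>c1 c2. tlift D D (\<lambda>c3 c4. c1 a * c3 b * c4 c) (?c c2)) (?c p)"
    proof -
      have "c1 a * tlift D D (\<lambda>c3 c4. c3 b * c4 c) t = tlift D D (\<lambda>c3 c4. c1 a * c3 b * c4 c) t" for c1 t
        unfolding tlift_def case_prod_unfold by (simp add: sum_list_const_mult mult.assoc)
      then show ?thesis by simp
    qed
    also have "\<dots> = tlift (tprod D D) D (\<lambda>v w. \<alpha> v * \<beta> w) ?R"
      unfolding ab by (simp add: ty push_tlift[where X=ground] tlift_tens[where X=ground] cong: tlift_cong)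
    finally show "tlift (tprod D D) D (\<lambda>v w. \<alpha> v * \<beta> w) ?L = tlift (tprod D D) D (\<lambda>v w. \<alpha> v * \<beta> w) ?R" .
  qed (rule ty | assumption)+
  have 2: "tlift D D (\<lambda>c1 c2. scale D (c1 (one A)) c2) (?c p) = p" if [ty]: "p \<in> carr D" for p
  proof (rule D_eqI)
    show "tlift D D (\<lambda>c1 c2. scale D (c1 (one A)) c2) (?c p) \<in> carr D" by (rule ty | assumption)+
    fix a assume "a \<in> carr A"
    then show "tlift D D (\<lambda>c1 c2. scale D (c1 (one A)) c2) (?c p) a = p a"
      by (simp add: tlift_eval transp_eval ty algebraD(5))
  qed (rule ty)
  have 3: "tlift D D (\<lambda>c1 c2. scale D (c2 (one A)) c1) (?c p) = p" if [ty]: "p \<in> carr D" for p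
  proof (rule D_eqI)
    show "tlift D D (\<lambda>c1 c2. scale D (c2 (one A)) c1) (?c p) \<in> carr D" by (rule ty | assumption)+
    fix a assume "a \<in> carr A"
    then show "tlift D D (\<lambda>c1 c2. scale D (c2 (one A)) c1) (?c p) a = p a"
      using transp_eval[of p a "one A"] by (simp add: tlift_eval ty algebraD(6) mult.commute)
  qed (rule ty)
  have "lin_map D ground (counit Ao)"
    by (rule lin_map_eq[OF eval_D[of "one A"] vect_D]) simp
  then show ?thesis unfolding coalgebra_def
    using 1 2 3 by (simp add: transp_lin)
qed

lemma conv_apply: "c \<in> carr A \<Longrightarrow> conv A p q c = sw A c (\<lambda>x y. p x * q y)"
  by (simp add: conv_def)

text \<open>Multiplicativity of the coproduct of A, with p and q expanded by their own coproducts.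
  It serves twice: the convolution product has finite rank, and the coproduct of the dual is
  multiplicative.\<close>

lemma conv_mult:
  assumes p: "p \<in> carr D" and q: "q \<in> carr D" and ab[ty]: "a \<in> carr A" "b \<in> carr A"
  shows "sw A (mult A a b) (\<lambda>x y. p x * q y) = tlift D D (\<lambda>p1 p2. tlift D D (\<lambda>q1 q2.
      sw A a (\<lambda>x y. p1 x * q1 y) * sw A b (\<lambda>x y. p2 x * q2 y)) (transp_mult A D q)) (transp_mult A D p)"
proof -
  let ?c = "transp_mult A D"
  note [ty] = p q lin_map_comp[OF D_lin[OF p]] lin_map_comp[OF D_lin[OF q]] D_lin[OF p] D_lin[OF q]
  have "tlift D D (\<lambda>p1 p2. tlift D D (\<lambda>q1 q2. sw A a (\<lambda>x y. p1 x * q1 y) * sw A b (\<lambda>x y. p2 x * q2 y)) (?c q)) (?c p) =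
     tlift D D (\<lambda>p1 p2. tlift D D (\<lambda>q1 q2. sw A a (\<lambda>a1 a2. sw A b (\<lambda>b1 b2. (p1 a1 * q1 a2) * (p2 b1 * q2 b2)))) (?c q)) (?c p)"
    by (simp only: tlift_times)
  also have "\<dots> = tlift D D (\<lambda>p1 p2. sw A a (\<lambda>a1 a2. sw A b (\<lambda>b1 b2. tlift D D (\<lambda>q1 q2. (p1 a1 * q1 a2) * (p2 b1 * q2 b2)) (?c q)))) (?c p)"
    by (rule tlift_fun_cong, rule tlift_swap3)
  also have "\<dots> = sw A a (\<lambda>a1 a2. sw A b (\<lambda>b1 b2. tlift D D (\<lambda>p1 p2. tlift D D (\<lambda>q1 q2. (p1 a1 * q1 a2) * (p2 b1 * q2 b2)) (?c q)) (?c p)))"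
    by (rule tlift_swap3)
  also have "\<dots> = sw A a (\<lambda>a1 a2. sw A b (\<lambda>b1 b2. tlift D D (\<lambda>p1 p2. p1 a1 * p2 b1) (?c p) * tlift D D (\<lambda>q1 q2. q1 a2 * q2 b2) (?c q)))"
    by (simp only: tlift_times) (simp add: mult_ac)
  also have "\<dots> = sw A (mult A a b) (\<lambda>x y. p x * q y)"
    by (simp add: transp_eval ty swr[where X=ground] cong: tlift_cong)
  finally show ?thesis by (rule sym)
qed

lemma conv_in [ty]:
  assumes p: "p \<in> carr D" and q: "q \<in> carr D"
  shows "conv A p q \<in> carr D"
  unfolding conv_def
proof (rule zero_ext_DI)
  note [ty] = lin_map_comp[OF D_lin[OF p]] lin_map_comp[OF D_lin[OF q]] D_lin[OF p] D_lin[OF q]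
  show "lin_map A ground (\<lambda>c. sw A c (\<lambda>x y. p x * q y))" by (rule ty | assumption)+
  show "finite_rank (carr A) (carr A) (\<lambda>a b. sw A (mult A a b) (\<lambda>x y. p x * q y))"
    by (rule finite_rank_cong[OF finite_rank_tlift[OF finite_rank_tlift[OF finite_rank_times]] conv_mult[OF p q]])
qed

lemma conv_bilin: "bilin_map D D D (conv A)"
proof -
  have l: "lin_map A ground (\<lambda>x. p x)" if "p \<in> carr D" for p using D_lin[OF that] .
  have e: "lin_map D ground (\<lambda>q. conv A p q c)" "lin_map D ground (\<lambda>q. conv A q p c)" if "c \<in> carr A" for p c
    unfolding conv_apply[OF that] by (rule ty that | assumption)+
  have "lin_map D D (conv A p)" if p[ty]: "p \<in> carr D" for p
  proof (rule lin_mapI)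
    fix q q' c assume q[ty]: "q \<in> carr D"
    show "conv A p q \<in> carr D" by (rule ty)+
    show "conv A p (scale D c q) = scale D c (conv A p q)"
      by (rule D_eqI, (rule ty)+, use lin_mapD(3)[OF e(1) q] in simp)
    assume [ty]: "q' \<in> carr D"
    show "conv A p (q + q') = conv A p q + conv A p q'"
      by (rule D_eqI, (rule ty)+, use lin_mapD(2)[OF e(1) q] in \<open>simp add: ty\<close>)
  qed
  moreover have "lin_map D D (\<lambda>q. conv A q p)" if p[ty]: "p \<in> carr D" for p
  proof (rule lin_mapI)
    fix q q' c assume q[ty]: "q \<in> carr D"
    show "conv A q p \<in> carr D" by (rule ty)+
    show "conv A (scale D c q) p = scale D c (conv A q p)"
      by (rule D_eqI, (rule ty)+, use lin_mapD(3)[OF e(2) q] in simp)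
    assume [ty]: "q' \<in> carr D"
    show "conv A (q + q') p = conv A q p + conv A q' p"
      by (rule D_eqI, (rule ty)+, use lin_mapD(2)[OF e(2) q] in \<open>simp add: ty\<close>)
  qed
  ultimately show ?thesis by (simp add: bilin_map_def)
qed

lemmas conv_ty [ty] = lin_map_comp[OF bilin_mapD(1)[OF conv_bilin]] lin_map_comp[OF bilin_mapD(2)[OF conv_bilin]]

lemma counit_finite_rank: "finite_rank (carr A) (carr A) (\<lambda>a b. counit A (mult A a b))"
  by (rule finite_rankI_list[where ps="[()]" and g="\<lambda>_. counit A" and h="\<lambda>_. counit A"]) (simp add: bialgebraD(5))

lemma one_in [ty]: "zero_ext A (counit A) \<in> carr D"
  by (rule zero_ext_DI[OF coalgebraD(3)[OF A_facts(2)] counit_finite_rank])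

lemma algebra_Ao: "algebra Ao"
proof -
  have 1: "conv A (conv A p q) r = conv A p (conv A q r)" if [ty]: "p \<in> carr D" "q \<in> carr D" "r \<in> carr D" for p q r
  proof (rule D_eqI)
    note [ty] = lin_map_comp[OF D_lin[OF that(1)]] lin_map_comp[OF D_lin[OF that(2)]] lin_map_comp[OF D_lin[OF that(3)]]
       D_lin[OF that(1)] D_lin[OF that(2)] D_lin[OF that(3)]
    fix c assume [ty]: "c \<in> carr A"
    have "conv A (conv A p q) r c = sw A c (\<lambda>s z. sw A s (\<lambda>x y. p x * q y) * r z)"
      by (simp add: conv_apply ty cong: tlift_cong)
    also have "\<dots> = sw A c (\<lambda>s z. sw A s (\<lambda>x y. p x * (q y * r z)))"
      unfolding tlift_def case_prod_unfold by (simp add: sum_list_mult_const[symmetric] mult.assoc)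
    also have "\<dots> = sw A c (\<lambda>x s. sw A s (\<lambda>y z. p x * (q y * r z)))"
      by (rule coassoc[where X=ground]) (rule ty | assumption)+
    also have "\<dots> = sw A c (\<lambda>x s. p x * sw A s (\<lambda>y z. q y * r z))"
      unfolding tlift_def case_prod_unfold by (simp add: sum_list_const_mult)
    also have "\<dots> = conv A p (conv A q r) c"
      by (simp add: conv_apply ty cong: tlift_cong)
    finally show "conv A (conv A p q) r c = conv A p (conv A q r) c" .
  qed (rule ty)+
  have 2: "conv A (zero_ext A (counit A)) p = p" "conv A p (zero_ext A (counit A)) = p" if [ty]: "p \<in> carr D" for p
  proof -
    note l = D_lin[OF that]
    have "conv A (zero_ext A (counit A)) p c = p c" "conv A p (zero_ext A (counit A)) c = p c" if [ty]: "c \<in> carr A" for c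
      using counit_sw[OF A_facts(2) vect_ground that l]
      by (simp_all add: conv_apply ty mult.commute[of "p _"] cong: tlift_cong)
    then show "conv A (zero_ext A (counit A)) p = p" "conv A p (zero_ext A (counit A)) = p"
      by (auto intro!: D_eqI ty that)
  qed
  show ?thesis unfolding algebra_def
    using 1 2 conv_bilin by (simp add: ty)
qed

theorem bialgebra_Ao: "bialgebra Ao"
proof -
  let ?c = "transp_mult A D"
  have 1: "?c (zero_ext A (counit A)) = tens D D (zero_ext A (counit A)) (zero_ext A (counit A))"
    by (rule transp_eqI) (simp_all add: ty tlift_tens[where X=ground] bialgebraD(5))
  have 2: "?c (conv A p q) = tlift D D (\<lambda>a1 a2. tlift D D (\<lambda>b1 b2. tens D D (conv A a1 b1) (conv A a2 b2)) (?c q)) (?c p)"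
    if p[ty]: "p \<in> carr D" and q[ty]: "q \<in> carr D" for p q
  proof (rule transp_eqI)
    note [ty] = D_lin[OF p] D_lin[OF q] lin_map_comp[OF D_lin[OF p]] lin_map_comp[OF D_lin[OF q]]
    show "tlift D D (\<lambda>a1 a2. tlift D D (\<lambda>b1 b2. tens D D (conv A a1 b1) (conv A a2 b2)) (?c q)) (?c p) \<in> carr (tprod D D)"
      by (rule ty | assumption)+
    fix a b assume [ty]: "a \<in> carr A" "b \<in> carr A"
    show "tlift D D (\<lambda>p1 p2. p1 a * p2 b) (tlift D D (\<lambda>a1 a2. tlift D D (\<lambda>b1 b2. tens D D (conv A a1 b1) (conv A a2 b2)) (?c q)) (?c p)) = conv A p q (mult A a b)"
      by (simp add: ty push_tlift[where X=ground] tlift_tens[where X=ground] conv_apply conv_mult cong: tlift_cong)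
  qed
  have 3: "conv A p q (one A) = p (one A) * q (one A)" if p: "p \<in> carr D" and q: "q \<in> carr D" for p q
  proof -
    note [ty] = D_lin[OF p] D_lin[OF q] lin_map_comp[OF D_lin[OF p]] lin_map_comp[OF D_lin[OF q]]
    show ?thesis by (simp add: conv_apply ty swr[where X=ground])
  qed
  show ?thesis unfolding bialgebra_def
    using algebra_Ao coalgebra_Ao 1 2 3 by (simp add: ty bialgebraD(4))
qed

text \<open>S reverses products, so p(S(a b)) arises from p(a b) by composing with S and exchanging
  the arguments, and it still has finite rank.\<close>

lemma antipode_Ao:
  assumes "antipode A S"
  shows "antipode Ao (transp_map A S)"
proof -
  interpret hopf A S using assms by unfold_locales simp_all
  let ?T = "transp_map A S"
  have T: "?T p a = p (S a)" if "a \<in> carr A" for p a using that by (simp add: transp_map_def)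
  have T_in: "?T p \<in> carr D" if p: "p \<in> carr D" for p
    unfolding transp_map_def
  proof (rule zero_ext_DI)
    show "lin_map A ground (\<lambda>v. p (S v))" by (rule lin_map_comp[OF D_lin[OF p] S_lin])
    have "finite_rank (carr A) (carr A) (\<lambda>a b. p (mult A (S b) (S a)))"
      by (rule finite_rank_swap, rule finite_rank_comp[OF D_finite_rank[OF p]]) (rule ty | assumption)+
    then show "finite_rank (carr A) (carr A) (\<lambda>a b. p (S (mult A a b)))"
      by (rule finite_rank_cong) (simp add: S_mult)
  qed
  have lin: "lin_map D D ?T"
  proof (rule lin_mapI)
    fix p q c assume p[ty]: "p \<in> carr D"
    show "?T p \<in> carr D" by (rule T_in[OF p])
    show "?T (scale D c p) = scale D c (?T p)" by (auto simp: transp_map_def zero_ext_def)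
    show "?T (p + q) = ?T p + ?T q" by (auto simp: transp_map_def zero_ext_def)
  qed
  note [ty] = T_in lin lin_map_comp[OF lin]
  have 1: "tlift D D (\<lambda>h1 h2. conv A (?T h1) h2) (transp_mult A D p) = scale D (p (one A)) (zero_ext A (counit A))"
    "tlift D D (\<lambda>h1 h2. conv A h1 (?T h2)) (transp_mult A D p) = scale D (p (one A)) (zero_ext A (counit A))"
    if p[ty]: "p \<in> carr D" for p
  proof -
    note l = D_lin[OF p]
    have "tlift D D (\<lambda>h1 h2. conv A (?T h1) h2) (transp_mult A D p) c = counit A c * p (one A)"
      "tlift D D (\<lambda>h1 h2. conv A h1 (?T h2)) (transp_mult A D p) c = counit A c * p (one A)" if [ty]: "c \<in> carr A" for c
    proof -
      have "tlift D D (\<lambda>h1 h2. conv A (?T h1) h2) (transp_mult A D p) c = tlift D D (\<lambda>h1 h2. sw A c (\<lambda>x y. h1 (S x) * h2 y)) (transp_mult A D p)"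
        by (simp add: tlift_eval conv_apply T ty cong: tlift_cong)
      also have "\<dots> = sw A c (\<lambda>x y. tlift D D (\<lambda>h1 h2. h1 (S x) * h2 y) (transp_mult A D p))"
        by (rule tlift_swap)
      also have "\<dots> = sw A c (\<lambda>x y. p (mult A (S x) y))"
        by (simp add: transp_eval ty cong: tlift_cong)
      also have "\<dots> = counit A c * p (one A)"
        using S_lin_apply(1)[OF vect_ground that l] by simp
      finally show "tlift D D (\<lambda>h1 h2. conv A (?T h1) h2) (transp_mult A D p) c = counit A c * p (one A)" .
      have "tlift D D (\<lambda>h1 h2. conv A h1 (?T h2)) (transp_mult A D p) c = tlift D D (\<lambda>h1 h2. sw A c (\<lambda>x y. h1 x * h2 (S y))) (transp_mult A D p)"
        by (simp add: tlift_eval conv_apply T ty cong: tlift_cong)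
      also have "\<dots> = sw A c (\<lambda>x y. tlift D D (\<lambda>h1 h2. h1 x * h2 (S y)) (transp_mult A D p))"
        by (rule tlift_swap)
      also have "\<dots> = sw A c (\<lambda>x y. p (mult A x (S y)))"
        by (simp add: transp_eval ty cong: tlift_cong)
      also have "\<dots> = counit A c * p (one A)"
        using S_lin_apply(2)[OF vect_ground that l] by simp
      finally show "tlift D D (\<lambda>h1 h2. conv A h1 (?T h2)) (transp_mult A D p) c = counit A c * p (one A)" .
    qed
    note c = this
    have s: "scale D (p (one A)) (zero_ext A (counit A)) \<in> carr D" by (rule ty)+
    have t: "tlift D D (\<lambda>h1 h2. conv A (?T h1) h2) (transp_mult A D p) \<in> carr D"
      "tlift D D (\<lambda>h1 h2. conv A h1 (?T h2)) (transp_mult A D p) \<in> carr D" by (rule ty | assumption)+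
    show "tlift D D (\<lambda>h1 h2. conv A (?T h1) h2) (transp_mult A D p) = scale D (p (one A)) (zero_ext A (counit A))"
      by (rule D_eqI[OF t(1) s]) (simp add: c(1) mult.commute)
    show "tlift D D (\<lambda>h1 h2. conv A h1 (?T h2)) (transp_mult A D p) = scale D (p (one A)) (zero_ext A (counit A))"
      by (rule D_eqI[OF t(2) s]) (simp add: c(2) mult.commute)
  qed
  show ?thesis unfolding antipode_def using lin 1 by simp
qed

end

section \<open>Transposes between finite duals\<close>

lemma bialg_map_transp:
  fixes A :: "('k::field, 'a::ab_group_add, 'x) bialg_scheme" and B :: "('k, 'b::ab_group_add, 'y) bialg_scheme"
  assumes f: "bialg_map A B f"
  shows "bialg_map (fin_dual B) (fin_dual A) (transp_map A f)"
proof -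
  interpret A: bialg_dual A using bialg_mapD(1)[OF f] by unfold_locales
  interpret B: bialg_dual B using bialg_mapD(2)[OF f] by unfold_locales
  let ?T = "transp_map A f"
  note fc = bialg_mapD(8)[OF f]
  have T: "?T p a = p (f a)" if "a \<in> carr A" for p a using that by (simp add: transp_map_def)
  have T_in: "?T p \<in> carr A.D" if p: "p \<in> carr B.D" for p
    unfolding transp_map_def
  proof (rule A.zero_ext_DI)
    show "lin_map A ground (\<lambda>v. p (f v))" by (rule lin_map_comp[OF B.D_lin[OF p] bialg_mapD(3)[OF f]])
    have "finite_rank (carr A) (carr A) (\<lambda>a b. p (mult B (f a) (f b)))"
      by (rule finite_rank_comp[OF B.D_finite_rank[OF p]]) (rule fc, assumption)+
    then show "finite_rank (carr A) (carr A) (\<lambda>a b. p (f (mult A a b)))"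
      by (rule finite_rank_cong) (simp add: bialg_mapD(5)[OF f])
  qed
  have lin: "lin_map B.D A.D ?T"
  proof (rule lin_mapI)
    fix p q c assume p[ty]: "p \<in> carr B.D"
    show "?T p \<in> carr A.D" by (rule T_in[OF p])
    show "?T (scale B.D c p) = scale A.D c (?T p)" by (auto simp: transp_map_def zero_ext_def)
    show "?T (p + q) = ?T p + ?T q" by (auto simp: transp_map_def zero_ext_def)
  qed
  note [ty] = T_in lin lin_map_comp[OF lin] fc lin_map_comp[OF bialg_mapD(3)[OF f]]
  have 1: "?T (zero_ext B (counit B)) = zero_ext A (counit A)"
    by (rule A.D_eqI) (simp_all add: ty T bialg_mapD(6)[OF f])
  have 2: "?T (conv B p q) = conv A (?T p) (?T q)" if p[ty]: "p \<in> carr B.D" and q[ty]: "q \<in> carr B.D" for p q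
  proof (rule A.D_eqI)
    note [ty] = B.D_lin[OF p] B.D_lin[OF q] lin_map_comp[OF B.D_lin[OF p]] lin_map_comp[OF B.D_lin[OF q]]
    fix a assume [ty]: "a \<in> carr A"
    show "?T (conv B p q) a = conv A (?T p) (?T q) a"
      by (simp add: T B.conv_apply A.conv_apply ty sw_bialg_map[OF f vect_ground] cong: tlift_cong)
  qed (rule ty)+
  have 3: "?T p (one A) = p (one B)" for p
    by (simp add: T ty bialg_mapD(4)[OF f])
  have 4: "transp_mult A A.D (?T p) = tlift B.D B.D (\<lambda>a1 a2. tens A.D A.D (?T a1) (?T a2)) (transp_mult B B.D p)"
    if [ty]: "p \<in> carr B.D" for p
  proof (rule A.transp_eqI)
    show "tlift B.D B.D (\<lambda>a1 a2. tens A.D A.D (?T a1) (?T a2)) (transp_mult B B.D p) \<in> carr (tprod A.D A.D)"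
      by (rule ty | assumption)+
    fix a b assume [ty]: "a \<in> carr A" "b \<in> carr A"
    have "tlift A.D A.D (\<lambda>p1 p2. p1 a * p2 b) (tlift B.D B.D (\<lambda>a1 a2. tens A.D A.D (?T a1) (?T a2)) (transp_mult B B.D p)) =
       tlift B.D B.D (\<lambda>p1 p2. p1 (f a) * p2 (f b)) (transp_mult B B.D p)"
      by (simp add: ty T push_tlift[where X=ground] tlift_tens[where X=ground] cong: tlift_cong)
    also have "\<dots> = ?T p (mult A a b)"
      by (simp add: B.transp_eval T ty bialg_mapD(5)[OF f])
    finally show "tlift A.D A.D (\<lambda>p1 p2. p1 a * p2 b) (tlift B.D B.D (\<lambda>a1 a2. tens A.D A.D (?T a1) (?T a2)) (transp_mult B B.D p)) = ?T p (mult A a b)" .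
  qed
  show ?thesis unfolding bialg_map_def
    using A.bialgebra_Ao B.bialgebra_Ao lin 1 2 3 4 by simp
qed

text \<open>From here on the finite dual stays folded, so that facts about arbitrary bialgebras can
  be used for it; the evaluation rules below take the place of its definition.\<close>

declare fin_dual_fields [simp del]

context bialg_dual begin

declare same_Ao [simp del]

lemma carr_Ao: "carr Ao = carr D" and scale_Ao: "scale Ao = fscale"
  by (simp_all add: fin_dual_fields)

lemma sw_Ao: "p \<in> carr Ao \<Longrightarrow> a \<in> carr A \<Longrightarrow> b \<in> carr A \<Longrightarrow> sw Ao p (\<lambda>p1 p2. p1 a * p2 b) = p (mult A a b)"
  by (simp add: same_Ao fin_dual_fields transp_eval)

lemma mult_Ao: "c \<in> carr A \<Longrightarrow> mult Ao p q c = sw A c (\<lambda>x y. p x * q y)"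
  by (simp add: fin_dual_fields conv_apply)

lemma one_Ao: "c \<in> carr A \<Longrightarrow> one Ao c = counit A c"
  by (simp add: fin_dual_fields)

lemma Ao_lin: "p \<in> carr Ao \<Longrightarrow> lin_map A ground p"
  by (simp add: carr_Ao D_lin)

lemma Ao_dual: "p \<in> carr Ao \<Longrightarrow> p \<in> carr (dual A)"
  by (simp add: carr_Ao D_dual)

lemma Ao_eqI: "p \<in> carr Ao \<Longrightarrow> q \<in> carr Ao \<Longrightarrow> (\<And>a. a \<in> carr A \<Longrightarrow> p a = q a) \<Longrightarrow> p = q"
  unfolding carr_Ao by (rule D_eqI)

lemma eval_Ao: "lin_map Ao ground (\<lambda>p. p a)"
  by (rule eval_lin[OF scale_Ao])

end

text \<open>The inverse of f is linear and multiplicative, so precomposition with it preserves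
  finite rank and inverts the transpose.\<close>

lemma bialg_iso_transp:
  fixes A :: "('k::field, 'a::ab_group_add, 'x) bialg_scheme" and B :: "('k, 'b::ab_group_add, 'y) bialg_scheme"
  assumes "bialg_iso A B f"
  shows "bialg_iso (fin_dual B) (fin_dual A) (transp_map A f)"
proof -
  have f: "bialg_map A B f" and bij: "bij_betw f (carr A) (carr B)" using assms by (auto simp: bialg_iso_def)
  interpret A: bialg_dual A using bialg_mapD(1)[OF f] by unfold_locales
  interpret B: bialg_dual B using bialg_mapD(2)[OF f] by unfold_locales
  let ?T = "transp_map A f"
  note m = bialg_map_transp[OF f]
  define g where "g = inv_into (carr A) f"
  have g: "g b \<in> carr A" "f (g b) = b" if "b \<in> carr B" for b
    using that bij by (auto simp: g_def bij_betw_def inv_into_into f_inv_into_f)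
  have gf: "g (f a) = a" if "a \<in> carr A" for a
    using that bij by (auto simp: g_def bij_betw_def)
  have inj: "inj_on f (carr A)" using bij by (simp add: bij_betw_def)
  have glin: "lin_map B A g"
  proof (rule lin_map_inj[OF B.A_facts(3) A.A_facts(3) bialg_mapD(3)[OF f] inj g(1)])
    show "lin_map B B (\<lambda>u. f (g u))" by (rule lin_map_eq[OF lin_map_id B.A_facts(3)]) (rule g(2))
  qed
  have gm: "g (mult B b c) = mult A (g b) (g c)" if "b \<in> carr B" "c \<in> carr B" for b c
    using gf[of "mult A (g b) (g c)"] g that by (simp add: bialg_mapD(5)[OF f] ty)
  have "inj_on ?T (carr (fin_dual B))"
  proof (rule inj_onI)
    fix p q assume pq: "p \<in> carr (fin_dual B)" "q \<in> carr (fin_dual B)" "?T p = ?T q"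
    show "p = q"
    proof (rule B.Ao_eqI[OF pq(1,2)])
      fix b assume b: "b \<in> carr B"
      have "?T p (g b) = ?T q (g b)" using pq(3) by simp
      then show "p b = q b" using g[OF b] by (simp add: transp_map_def)
    qed
  qed
  moreover have "?T ` carr (fin_dual B) = carr (fin_dual A)"
  proof (intro equalityI subsetI)
    fix P assume P: "P \<in> carr (fin_dual A)"
    define Q where "Q = zero_ext B (\<lambda>b. P (g b))"
    have "finite_rank (carr B) (carr B) (\<lambda>a b. P (mult A (g a) (g b)))"
      by (rule finite_rank_comp[OF A.D_finite_rank]) (use P g in \<open>simp_all add: A.carr_Ao\<close>)
    then have "finite_rank (carr B) (carr B) (\<lambda>a b. P (g (mult B a b)))"
      by (rule finite_rank_cong) (simp add: gm)
    then have "Q \<in> carr (fin_dual B)" unfolding Q_def B.carr_Ao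
      by (intro B.zero_ext_DI lin_map_comp[OF A.Ao_lin[OF P] glin])
    moreover have "?T Q = P"
      by (rule A.Ao_eqI[OF bialg_mapD(8)[OF m calculation] P])
        (simp add: transp_map_def Q_def bialg_mapD(8)[OF f] gf)
    ultimately show "P \<in> ?T ` carr (fin_dual B)" by blast
  qed (use bialg_mapD(8)[OF m] in auto)
  ultimately show ?thesis using m by (simp add: bialg_iso_def bij_betw_def)
qed

lemma bialg_map_comp:
  assumes f: "bialg_map A B f" and g: "bialg_map B C g" and h: "\<And>a. a \<in> carr A \<Longrightarrow> h a = g (f a)"
  shows "bialg_map A C h"
proof -
  note [ty] = bialgebraD(1-3)[OF bialg_mapD(1)[OF f]] bialgebraD(1-3)[OF bialg_mapD(1)[OF g]] bialgebraD(1-3)[OF bialg_mapD(2)[OF g]]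
    bialg_mapD(8)[OF f] bialg_mapD(8)[OF g] lin_map_comp[OF bialg_mapD(3)[OF f]] lin_map_comp[OF bialg_mapD(3)[OF g]]
    bialg_mapD(3)[OF f] bialg_mapD(3)[OF g]
  have "lin_map A C (\<lambda>a. g (f a))" by (rule ty)+
  then have "lin_map A C h" by (rule lin_map_eq) (simp_all add: ty h)
  moreover have "comult C (h a) = sw A a (\<lambda>a1 a2. tens C C (h a1) (h a2))" if [ty]: "a \<in> carr A" for a
    by (simp add: h ty bialg_mapD(7)[OF g] sw_bialg_map[OF f, where X="tprod C C"] cong: tlift_cong)
  ultimately show ?thesis unfolding bialg_map_def
    using bialg_mapD(1)[OF f] bialg_mapD(2)[OF g]
    by (simp add: h ty bialg_mapD(4-6)[OF f] bialg_mapD(4-6)[OF g])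
qed

lemma bialg_iso_comp:
  assumes f: "bialg_iso A B f" and g: "bialg_iso B C g" and h: "\<And>a. a \<in> carr A \<Longrightarrow> h a = g (f a)"
  shows "bialg_iso A C h"
proof -
  have "bialg_map A C h"
    by (rule bialg_map_comp[where f=f and g=g and B=B]) (use f g in \<open>simp_all add: bialg_iso_def h\<close>)
  moreover have "bij_betw (g \<circ> f) (carr A) (carr C)"
    using f g by (auto simp: bialg_iso_def intro: bij_betw_trans)
  then have "bij_betw h (carr A) (carr C)"
    using bij_betw_cong[of "carr A" h "g \<circ> f" "carr C"] h by simp
  ultimately show ?thesis by (simp add: bialg_iso_def)
qed

text \<open>\<open>antip\<close> is a choice, so its values on the dual are known only through
  uniqueness of the antipode.\<close>

lemma hopf_fin_dual:
  assumes "hopf H S"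
  shows "hopf (fin_dual H) (antip (fin_dual H))" "q \<in> carr (fin_dual H) \<Longrightarrow> h \<in> carr H \<Longrightarrow> antip (fin_dual H) q h = q (S h)"
proof -
  interpret hopf H S by fact
  interpret bialg_dual H by unfold_locales simp
  note a = antipode_Ao[OF antip]
  have "antipode Ao (antip Ao)" unfolding antip_def by (rule someI[of "antipode Ao", OF a])
  then show hA: "hopf (fin_dual H) (antip (fin_dual H))" using bialgebra_Ao by unfold_locales simp_all
  show "antip Ao q h = q (S h)" if "q \<in> carr Ao" "h \<in> carr H"
    using fun_cong[OF hopf.antipode_unique[OF hA a that(1)], of h] that(2) by (simp add: transp_map_def)
qed

section \<open>The associated bialgebra and the explicit form of the map i\<close>

context projection begin

abbreviation "RA \<equiv> assoc_bialg A H j \<pi>"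

lemma RA_fields [simp]:
  "carr RA = coinvariants A H \<pi>" "scale RA = scale A" "mult RA = mult A" "one RA = one A"
  "counit RA = counit A" "act RA = ad"
  by (auto simp: assoc_bialg_def ad_def fun_eq_iff)

lemma radford_assoc: "radford H A j \<pi> RA (\<lambda>x. x)"
proof unfold_locales
  note v = coinv_subspace
  have tA: "tens RA RA = tens A A" "tens H RA = tens H A" by (rule tens_same; simp)+
  show "vect RA" by (rule v)
  show "lin_map RA A (\<lambda>x. x)" by (auto simp: lin_map_def coinvD)
  show "inj_on (\<lambda>x. x) (carr RA)" "(\<lambda>x. x) ` carr RA = coinvariants A H \<pi>" by simp_all
  show "mult RA r s \<in> carr RA" if "r \<in> carr RA" "s \<in> carr RA" for r s using that coinv_mult by simp
  show "mult RA r s = mult A r s" for r s by simp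
  show "one RA \<in> carr RA" "one RA = one A" by (simp_all add: coinv_one)
  show "counit RA r = counit A r" for r by simp
  show "act RA h r \<in> carr RA" if "h \<in> carr H" "r \<in> carr RA" for h r using that ad_coinv by simp
  show "act RA h r = ad h r" for h r by simp
  fix r assume "r \<in> carr RA"
  then have r: "r \<in> coinvariants A H \<pi>" by simp
  note [ty] = coinvD(1)[OF r] v
  have Pr_in [ty]: "Pr a \<in> carr RA" if "a \<in> carr A" for a using Pr_coinv[OF that] by simp
  have co: "coact RA r = sw A r (\<lambda>x y. tens H A (\<pi> x) y)" "comult RA r = sw A r (\<lambda>x y. tens A A (Pr x) y)"
    by (simp_all add: assoc_bialg_def Pr_def)
  \<comment> \<open>Applying \<Pi> to the second leg changes nothing for a coinvariant, and it shows
    that the tensor lies over R.\<close>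
  have "coact RA r = sw A r (\<lambda>x y. tens H RA (\<pi> x) (Pr y))"
    unfolding co tA by (rule coinv_Pr2[OF r, where X="tprod H A" and \<phi>="\<lambda>x y. tens H A (\<pi> x) y", symmetric]) (rule ty | assumption)+
  also have "\<dots> \<in> carr (tprod H RA)" by (rule ty | assumption)+
  finally show 1: "coact RA r \<in> carr (tprod H RA)" .
  show "tlift H RA (\<lambda>x y. tens H A x y) (coact RA r) = sw A r (\<lambda>x y. tens H A (\<pi> x) y)"
    using tlift_id[OF H_facts(3) v 1] unfolding tA(2) co(1) .
  have "comult RA r = sw A r (\<lambda>x y. tens RA RA (Pr x) (Pr y))"
    unfolding co tA by (rule coinv_Pr2[OF r, where X="tprod A A" and \<phi>="\<lambda>x y. tens A A (Pr x) y", symmetric]) (rule ty | assumption)+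
  also have "\<dots> \<in> carr (tprod RA RA)" by (rule ty | assumption)+
  finally show 2: "comult RA r \<in> carr (tprod RA RA)" .
  show "sw RA r (\<lambda>x y. tens A A x y) = sw A r (\<lambda>x y. tens A A (Pr x) y)"
    using tlift_id[OF v v 2] unfolding tA(1) co(2) .
qed

lemmas R0_vR = radford.vR[OF radford_assoc]
  and R0_fl = radford.fl[OF radford_assoc]
  and R0_act_R = radford.act_R[OF radford_assoc]
  and R0_mult_R = radford.mult_R[OF radford_assoc]
  and R0_R_coact = radford.R_coact[OF radford_assoc]
  and R0_R_comult = radford.R_comult[OF radford_assoc]
  and R0_coact_R = radford.coact_R[OF radford_assoc]
  and R0_comult_R = radford.comult_R[OF radford_assoc]
  and R0_yd_bialgebra = radford.yd_bialgebra_R[OF radford_assoc]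
  and R0_biproduct_iso = radford.biproduct_iso[OF radford_assoc]

lemma Pr_lin_RA: "lin_map A RA Pr"
  by (rule lin_mapI) (simp_all add: Pr_coinv lin_mapD(2,3)[OF Pr_lin])

text \<open>\<open>dual_ext\<close> is a definite description; this explicit form agrees with it on
  the dual of R (\<open>dual_ext_eq\<close>).\<close>

definition ie :: "('a \<Rightarrow> 'k) \<Rightarrow> 'a \<Rightarrow> 'k" where
  "ie p = zero_ext A (\<lambda>a. p (Pr a))"

lemma ie_apply: "a \<in> carr A \<Longrightarrow> ie p a = p (Pr a)"
  by (simp add: ie_def)

lemma ie_dual: "p \<in> carr (dual RA) \<Longrightarrow> ie p \<in> carr (dual A)"
  unfolding ie_def by (intro zero_ext_dual A_facts(4) lin_map_comp[OF _ Pr_lin_RA]) (simp add: dual_iff)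

lemma ie_mult_j:
  assumes p: "p \<in> carr (dual RA)" and r: "r \<in> coinvariants A H \<pi>" and h: "h \<in> carr H"
  shows "ie p (mult A r (j h)) = p r * counit H h"
proof -
  have l: "lin_map RA ground p" using p by (simp add: dual_iff)
  show ?thesis using lin_mapD(3)[OF l, of r "counit H h"] r h
    by (simp add: ie_apply ty coinvD(1)[OF r] Pr_mult_j Pr_id[OF r] mult.commute)
qed

lemma dual_ext_eq:
  assumes p: "p \<in> carr (dual RA)"
  shows "dual_ext A H j \<pi> p = ie p"
  unfolding dual_ext_def
proof (rule the_equality)
  show "ie p \<in> carr (dual A) \<and> (\<forall>r\<in>coinvariants A H \<pi>. \<forall>h\<in>carr H. ie p (mult A r (j h)) = p r * counit H h)"
    using ie_dual[OF p] ie_mult_j[OF p] by blast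
  fix q assume q: "q \<in> carr (dual A) \<and> (\<forall>r\<in>coinvariants A H \<pi>. \<forall>h\<in>carr H. q (mult A r (j h)) = p r * counit H h)"
  show "q = ie p"
  proof (rule dual_eqI[OF q[THEN conjunct1] ie_dual[OF p]])
    fix a assume a[ty]: "a \<in> carr A"
    have lq: "lin_map A ground q" using q by (simp add: dual_iff)
    have lp: "lin_map A ground (\<lambda>a. p (Pr a))" by (rule lin_map_comp[OF _ Pr_lin_RA]) (use p in \<open>simp add: dual_iff\<close>)
    \<comment> \<open>The decomposition of a into products r j(h) forces the value of q.\<close>
    have "q a = q (sw A a (\<lambda>x y. mult A (Pr x) (j (\<pi> y))))" by (simp only: Pr_jpi[OF a])
    also have "\<dots> = sw A a (\<lambda>x y. q (mult A (Pr x) (j (\<pi> y))))"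
      by (rule push_lin[OF lq]) (rule ty | assumption)+
    also have "\<dots> = sw A a (\<lambda>x y. scale ground (counit A y) (p (Pr x)))"
      by (rule tlift_cong[OF refl], (rule ty | assumption)+) (use q in \<open>simp add: Pr_coinv ty jp_simps mult.commute\<close>)
    also have "\<dots> = p (Pr a)" by (rule counit_sw(2)[OF A_facts(3) vect_ground a lp])
    finally show "q a = ie p a" by (simp add: ie_apply ty)
  qed
qed

lemma ie_lin: "lin_map (dual RA) (dual A) ie"
  by (rule lin_mapI) (auto simp: ie_dual, auto simp: ie_def zero_ext_def)

lemma dual_projection: "projection (fin_dual H) (fin_dual A) (transp_map A \<pi>) (transp_map H j)"
proof (rule projection.intro)
  show "hopf (fin_dual H) (antip (fin_dual H))" by (rule hopf_fin_dual[OF hopf_axioms])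
  show "projection_axioms (fin_dual H) (fin_dual A) (transp_map A \<pi>) (transp_map H j)"
  proof
    show "bialg_map (fin_dual H) (fin_dual A) (transp_map A \<pi>)" by (rule bialg_map_transp[OF pm])
    show "bialg_map (fin_dual A) (fin_dual H) (transp_map H j)" by (rule bialg_map_transp[OF jm])
    fix p assume p: "p \<in> carr (fin_dual H)"
    interpret HD: bialg_dual H by unfold_locales simp
    \<comment> \<open>The equation is one of functions, so both sides must also agree off the
      carrier.\<close>
    have "p v = 0" if "v \<notin> carr H" for v using HD.Ao_dual[OF p] that by (simp add: dual_iff)
    then show "transp_map H j (transp_map A \<pi> p) = p"
      by (auto simp: transp_map_def zero_ext_def fun_eq_iff ty)
  qed
qed

end

section \<open>Duality for the biproduct\<close>

locale dual_pair = projection H A j \<pi>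
  for H :: "('k::field, 'h::ab_group_add) bialg" and A :: "('k, 'a::ab_group_add) bialg"
    and j :: "'h \<Rightarrow> 'a" and \<pi> :: "'a \<Rightarrow> 'h"
begin

text \<open>All facts about a projection become available for the dual data; \<open>d.Pr\<close> and
  \<open>d.ad\<close> act on the finite dual of A.\<close>

sublocale d: projection "fin_dual H" "fin_dual A" "transp_map A \<pi>" "transp_map H j"
  by (rule dual_projection)

sublocale HD: bialg_dual H by unfold_locales simp
sublocale AD: bialg_dual A by unfold_locales simp
abbreviation "Ho \<equiv> fin_dual H"
abbreviation "Ao \<equiv> fin_dual A"
abbreviation "po \<equiv> transp_map A \<pi>"
abbreviation "jo \<equiv> transp_map H j"
abbreviation "Rp \<equiv> assoc_bialg Ao Ho po jo"
abbreviation "Ro \<equiv> o_dual H RA"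
abbreviation "CR \<equiv> coinvariants Ao Ho jo"

lemma po_apply: "a \<in> carr A \<Longrightarrow> po q a = q (\<pi> a)"
  and jo_apply: "h \<in> carr H \<Longrightarrow> jo p h = p (j h)"
  by (simp_all add: transp_map_def)

lemma antip_apply: "q \<in> carr Ho \<Longrightarrow> h \<in> carr H \<Longrightarrow> antip Ho q h = q (S h)"
  by (rule hopf_fin_dual(2)[OF hopf_axioms])

text \<open>The sums over the legs of P and over those of a are interchanged, after which
  \<open>AD.sw_Ao\<close> evaluates the legs of P on a product in A.\<close>

lemma d_Pr_eval:
  assumes P[ty]: "P \<in> carr Ao" and a[ty]: "a \<in> carr A"
  shows "d.Pr P a = P (Pr a)"
proof -
  have "d.Pr P a = sw Ao P (\<lambda>x y. mult Ao x (po (antip Ho (jo y))) a)"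
    unfolding d.Pr_eq by (rule tlift_eval)
  also have "\<dots> = sw Ao P (\<lambda>x y. sw A a (\<lambda>u v. x u * po (antip Ho (jo y)) v))"
    by (simp only: AD.mult_Ao[OF a])
  also have "\<dots> = sw Ao P (\<lambda>x y. sw A a (\<lambda>u v. x u * y (j (S (\<pi> v)))))"
    by (rule tlift_cong[OF refl], (rule ty | assumption)+, rule tlift_cong[OF refl], (rule ty | assumption)+)
      (simp add: po_apply antip_apply jo_apply ty)
  also have "\<dots> = sw A a (\<lambda>u v. sw Ao P (\<lambda>x y. x u * y (j (S (\<pi> v)))))"
    by (rule tlift_swap)
  also have "\<dots> = sw A a (\<lambda>u v. P (mult A u (j (S (\<pi> v)))))"
    by (rule tlift_cong[OF refl], (rule ty | assumption)+, rule AD.sw_Ao) (rule ty | assumption)+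
  also have "\<dots> = P (Pr a)"
    unfolding Pr_eq by (rule push_lin[OF AD.Ao_lin[OF P], symmetric]) (rule ty | assumption)+
  finally show ?thesis .
qed

lemma CR_iff: "P \<in> CR \<longleftrightarrow> P \<in> carr Ao \<and> (\<forall>a\<in>carr A. P (Pr a) = P a)"
proof
  assume P: "P \<in> CR"
  then show "P \<in> carr Ao \<and> (\<forall>a\<in>carr A. P (Pr a) = P a)"
    using d.coinvD(1)[OF P] d.Pr_id[OF P] d_Pr_eval[of P] by metis
next
  assume P: "P \<in> carr Ao \<and> (\<forall>a\<in>carr A. P (Pr a) = P a)"
  have "d.Pr P = P"
    by (rule AD.Ao_eqI[OF d.Pr_ty(2)]) (use P d_Pr_eval in auto)
  then show "P \<in> CR" using d.Pr_coinv P by metis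
qed

lemma dual_RA_lin: "p \<in> carr (dual RA) \<Longrightarrow> lin_map RA ground p"
  by (simp add: dual_iff)

lemma o_dual_space_iff: "p \<in> carr (o_dual_space H RA) \<longleftrightarrow> p \<in> carr (dual RA) \<and>
    (\<exists>I. ideal RA I \<and> finite_codim RA I \<and> (\<forall>h\<in>carr H. \<forall>r\<in>I. ad h r \<in> I) \<and> (\<forall>r\<in>I. p r = 0))"
  by (simp add: o_dual_space_def)

text \<open>\<open>finite_rank_linear_right\<close> is applied to s \<mapsto> p(\<Pi>(a1) (\<pi>(a2)
  . s)) on R, which vanishes on I because I is an H-stable ideal; by \<open>Pr_mult\<close>, s =
  \<Pi>(b) gives p(\<Pi>(a b)).\<close>

lemma ie_in:
  assumes p: "p \<in> carr (o_dual_space H RA)"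
  shows "ie p \<in> CR"
proof -
  obtain I where pd: "p \<in> carr (dual RA)" and I: "ideal RA I" "finite_codim RA I" "\<forall>h\<in>carr H. \<forall>r\<in>I. ad h r \<in> I" "\<forall>r\<in>I. p r = 0"
    using p unfolding o_dual_space_iff by blast
  note lp = dual_RA_lin[OF pd]
  have Pr_in [ty]: "Pr a \<in> carr RA" if "a \<in> carr A" for a using Pr_coinv[OF that] by simp
  have ad_in [ty]: "ad h r \<in> carr RA" if "h \<in> carr H" "r \<in> carr RA" for h r using R0_act_R[OF that] by simp
  have m_in [ty]: "mult A r s \<in> carr RA" if "r \<in> carr RA" "s \<in> carr RA" for r s using R0_mult_R[OF that] by simp
  have lr2: "lin_map U RA g" if "lin_map U A g" "\<And>u. u \<in> carr U \<Longrightarrow> g u \<in> carr RA" for U :: "('k, 'h, 'a) yd_bialg" and g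
    using that by (auto simp: lin_map_def)
  let ?F = "\<lambda>a s. sw A a (\<lambda>x y. p (mult A (Pr x) (ad (\<pi> y) s)))"
  have RAid: "lin_map RA A (\<lambda>x. x)" by (rule R0_fl)
  have linF: "lin_map RA ground (?F a)" if [ty]: "a \<in> carr A" for a
  proof -
    have "lin_map RA ground (\<lambda>s. p (mult A (Pr x) (ad (\<pi> y) s)))" if [ty]: "x \<in> carr A" "y \<in> carr A" for x y
      by (rule lin_map_comp[OF lp], rule lr2) (rule ty RAid | assumption)+
    then show ?thesis by (intro lin_map_tlift_const) (rule ty | assumption)+
  qed
  have zF: "?F a s = 0" if [ty]: "a \<in> carr A" and s: "s \<in> I" for a s
  proof -
    have "p (mult A (Pr x) (ad (\<pi> y) s)) = 0" if "x \<in> carr A" "y \<in> carr A" for x y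
    proof -
      have "ad (\<pi> y) s \<in> I" using I(3) s that p_ty(1) by blast
      then have "mult A (Pr x) (ad (\<pi> y) s) \<in> I" using I(1) Pr_in[OF that(1)] unfolding ideal_def by simp
      then show ?thesis using I(4) by blast
    qed
    then have "?F a s = sw A a (\<lambda>x y. 0)"
      by (intro tlift_cong[OF refl]) (rule ty | assumption | simp)+
    then show ?thesis by (simp add: tlift_def case_prod_unfold)
  qed
  have "finite_rank (carr A) (carr RA) ?F"
    by (rule finite_rank_linear_right[OF R0_vR I(2) linF zF])
  then have "finite_rank (carr A) (carr A) (\<lambda>a b. ?F a (Pr b))"
    by (rule finite_rank_comp[where f="\<lambda>x. x" and g=Pr]) (rule Pr_in | assumption)+
  then have fr: "finite_rank (carr A) (carr A) (\<lambda>a b. p (Pr (mult A a b)))"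
  proof (rule finite_rank_cong)
    fix a b assume [ty]: "a \<in> carr A" "b \<in> carr A"
    have "Pr (mult A a b) = sw A a (\<lambda>x y. mult RA (Pr x) (ad (\<pi> y) (Pr b)))"
      by (simp add: Pr_mult ty)
    then show "p (Pr (mult A a b)) = ?F a (Pr b)"
      by (simp, subst push_lin[OF lp]) (rule R0_vR ty refl | assumption)+
  qed
  have "ie p \<in> carr Ao" unfolding ie_def AD.carr_Ao
    by (rule AD.zero_ext_DI[OF lin_map_comp[OF lp Pr_lin_RA] fr])
  moreover have "ie p (Pr a) = ie p a" if "a \<in> carr A" for a
    using that Pr_id[OF Pr_coinv[OF that]] by (simp add: ie_apply ty)
  ultimately show ?thesis by (simp add: CR_iff)
qed

lemma CR_vanish:
  assumes "P \<in> CR"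
  obtains J where "ideal A J" "finite_codim A J" "\<And>a. a \<in> J \<Longrightarrow> P a = 0"
proof -
  have "P \<in> carr (fin_dual_space A)" using assms unfolding CR_iff AD.carr_Ao by blast
  then show ?thesis using that unfolding fin_dual_space_fields by blast
qed

text \<open>The ideal for the restriction is the intersection of R with a cofinite ideal J of A on
  which P vanishes. It is stable under H since h . r is a sum of products that contain r.\<close>

lemma res_in:
  assumes P: "P \<in> CR"
  shows "zero_ext RA P \<in> carr (o_dual_space H RA)" "ie (zero_ext RA P) = P"
proof -
  have PA: "P \<in> carr Ao" and PP: "\<And>a. a \<in> carr A \<Longrightarrow> P (Pr a) = P a" using P by (auto simp: CR_iff)
  note lP = AD.Ao_lin[OF PA]
  obtain J where J: "ideal A J" "finite_codim A J" "\<And>a. a \<in> J \<Longrightarrow> P a = 0" by (rule CR_vanish[OF P]) blast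
  have lRA: "lin_map RA ground P" using lin_map_comp[OF lP R0_fl] by simp
  have d: "zero_ext RA P \<in> carr (dual RA)" by (rule zero_ext_dual[OF R0_vR lRA])
  let ?I = "{r \<in> carr RA. r \<in> J}"
  have fc: "finite_codim RA ?I" by (rule finite_codim_preimage[OF R0_vR A_facts(4) R0_fl J(2)])
  moreover have "ideal RA ?I"
  proof -
    have "module.subspace (scale RA) ?I" using fc unfolding finite_codim_def by blast
    moreover have "mult A a x \<in> ?I \<and> mult A x a \<in> ?I" if "a \<in> carr RA" "x \<in> ?I" for a x
      using that J(1) coinv_mult coinvD(1)[of a] unfolding ideal_def by simp
    ultimately show ?thesis unfolding ideal_def by simp
  qed
  moreover have "ad h r \<in> ?I" if h[ty]: "h \<in> carr H" and r: "r \<in> ?I" for h r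
  proof -
    have rJ: "r \<in> J" and rR: "r \<in> carr RA" using r by auto
    have Jm: "mult A a x \<in> J" "mult A x a \<in> J" if "a \<in> carr A" "x \<in> J" for a x using J(1) that unfolding ideal_def by auto
    interpret vs: vector_space "scale A" using A_facts(4) by (simp add: vect_def)
    have Js: "vs.subspace J" using J(1) unfolding ideal_def by blast
    \<comment> \<open>J is a bare set and not a record, so \<open>tlift_closed\<close> is replaced
      by closure of J under finite sums.\<close>
    have sl: "(\<Sum>x\<leftarrow>xs. g x) \<in> J" if "\<And>x. x \<in> set xs \<Longrightarrow> g x \<in> J" for xs and g :: "'h \<times> 'h \<Rightarrow> 'a"
      using that by (induction xs) (auto intro: vs.subspace_0[OF Js] vs.subspace_add[OF Js])
    have "ad h r \<in> J" unfolding ad_def tlift_def case_prod_unfold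
    proof (rule sl)
      fix x assume "x \<in> set (trep H H (comult H h))"
      then have [ty]: "fst x \<in> carr H" "snd x \<in> carr H"
        using trep(1)[OF H_facts(3) coalgebraD(4)[OF H_facts(2) h]] by auto
      show "mult A (mult A (j (fst x)) r) (j (S (snd x))) \<in> J"
        by (rule Jm(2)[OF _ Jm(1)[OF _ rJ]]) (rule ty)+
    qed
    moreover have "ad h r \<in> carr RA" using R0_act_R[OF h rR] by simp
    ultimately show ?thesis by blast
  qed
  moreover have "zero_ext RA P r = 0" if "r \<in> ?I" for r using J(3) that by (simp add: zero_ext_def)
  ultimately show "zero_ext RA P \<in> carr (o_dual_space H RA)" unfolding o_dual_space_iff using d by blast
  show "ie (zero_ext RA P) = P"
    by (rule dual_eqI[OF ie_dual[OF d] AD.Ao_dual[OF PA]]) (simp add: ie_apply Pr_coinv PP)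
qed

lemma res_ie:
  assumes p: "p \<in> carr (dual RA)"
  shows "zero_ext RA (ie p) = p"
proof (rule dual_eqI[OF _ p])
  have "lin_map A ground (ie p)" using ie_dual[OF p] by (simp add: dual_iff)
  from zero_ext_dual[OF R0_vR lin_map_comp[OF this R0_fl]]
  show "zero_ext RA (ie p) \<in> carr (dual RA)" by simp
  fix v assume "v \<in> carr RA"
  then show "zero_ext RA (ie p) v = p v" using coinvD(1)[of v] Pr_id[of v] by (simp add: ie_apply)
qed

text \<open>This removes the stable ideals from the description of the dual of R: for a functional
  on R, membership becomes a property of \<open>ie p\<close>.\<close>

lemma Ro_iff: "p \<in> carr (o_dual_space H RA) \<longleftrightarrow> p \<in> carr (dual RA) \<and> ie p \<in> CR"
  using ie_in[of p] res_in(1)[of "ie p"] res_ie[of p] o_dual_space_iff[of p] by auto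

end

lemma dual_yd_of [simp]: "dual (yd_of R) = dual R"
  by (simp add: dual_def)

lemma tlift_mult_const: "tlift V W \<phi> t * (c :: 'k::field) = tlift V W (\<lambda>v w. \<phi> v w * c) t"
  unfolding tlift_def case_prod_unfold by (simp add: sum_list_mult_const)

section \<open>The structure maps of the dual of R\<close>

context dual_pair begin

lemma Ro_fields:
  "carr Ro = carr (o_dual_space H RA)" "scale Ro = fscale" "mult Ro = conv RA" "one Ro = zero_ext RA (counit A)"
  "comult Ro = transp_mult RA (o_dual_space H RA)" "counit Ro p = p (one A)"
  "act Ro = yd_act (r_dual H (yd_of RA))" "coact Ro = yd_coact (r_dual H (yd_of RA))"
  by (simp_all add: o_dual_def o_dual_space_def)

lemma Ro_carr: "p \<in> carr Ro \<longleftrightarrow> p \<in> carr (dual RA) \<and> ie p \<in> CR"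
  by (simp add: Ro_fields Ro_iff)

lemma Rp_fields: "carr Rp = CR" "scale Rp = fscale"
  by (simp_all add: AD.scale_Ao)

lemma vect_Ro: "vect Ro"
proof (rule vect_funI)
  note vd = vect_closed[OF vect_dual[of RA], unfolded scale_dual]
  note vC = vect_closed[OF d.coinv_subspace, unfolded Rp_fields]
  have i0: "ie 0 = 0" by (auto simp: ie_def zero_ext_def)
  have ip: "ie (p + q) = ie p + ie q" for p q by (auto simp: ie_def zero_ext_def)
  have isc: "ie (fscale c p) = fscale c (ie p)" for c p by (auto simp: ie_def zero_ext_def)
  show "scale Ro = fscale" by (simp add: Ro_fields)
  show "0 \<in> carr Ro" unfolding Ro_carr i0 using vd(1) vC(1) by blast
  show "p + q \<in> carr Ro" if "p \<in> carr Ro" "q \<in> carr Ro" for p q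
    using that vd(2) vC(2) unfolding Ro_carr ip by blast
  show "fscale c p \<in> carr Ro" if "p \<in> carr Ro" for c p
    using that vd(3) vC(3) unfolding Ro_carr isc by blast
qed

lemma ie_Ro: "p \<in> carr Ro \<Longrightarrow> ie p \<in> CR" "p \<in> carr Ro \<Longrightarrow> ie p \<in> carr Ao"
  by (simp_all add: Ro_carr CR_iff)

lemma ie_Ro_lin: "lin_map Ro Ao ie"
proof (rule lin_mapI)
  fix p q c assume p: "p \<in> carr Ro"
  show "ie p \<in> carr Ao" by (rule ie_Ro(2)[OF p])
  show "ie (scale Ro c p) = scale Ao c (ie p)" by (auto simp: Ro_fields AD.scale_Ao ie_def zero_ext_def)
  show "ie (p + q) = ie p + ie q" by (auto simp: ie_def zero_ext_def)
qed

lemma res: "P \<in> CR \<Longrightarrow> zero_ext RA P \<in> carr Ro" "P \<in> CR \<Longrightarrow> ie (zero_ext RA P) = P"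
  using res_in by (simp_all add: Ro_fields)

lemma ie_on: "x \<in> carr RA \<Longrightarrow> ie p x = p x"
  using coinvD(1)[of x] Pr_id[of x] by (simp add: ie_apply)

lemma ie_Pr: "a \<in> carr A \<Longrightarrow> ie p (Pr a) = ie p a"
  using Pr_id[OF Pr_coinv] by (simp add: ie_apply ty)

lemma ie_inj: "inj_on ie (carr Ro)"
  by (rule inj_onI) (metis Ro_carr res_ie)

lemma ie_image: "ie ` carr Ro = CR"
  using ie_Ro(1) res by force

text \<open>The coproduct of R differs from that of A by \<Pi> on the first leg, and
  \<open>ie p\<close> absorbs it. Off the carrier both sides are 0.\<close>

lemma mult_Ro:
  assumes p: "p \<in> carr Ro" and q: "q \<in> carr Ro"
  shows "mult Ro p q = zero_ext RA (mult Ao (ie p) (ie q))"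
proof (rule ext)
  fix r
  note lp = AD.Ao_lin[OF ie_Ro(2)[OF p]] and lq = AD.Ao_lin[OF ie_Ro(2)[OF q]]
  note [ty] = lp lq lin_map_comp[OF lp] lin_map_comp[OF lq]
  show "mult Ro p q r = zero_ext RA (mult Ao (ie p) (ie q)) r"
  proof (cases "r \<in> carr RA")
    case r: True
    then have [ty]: "r \<in> carr A" using coinvD(1) by simp
    have "mult Ro p q r = tlift RA RA (\<lambda>x y. p x * q y) (comult RA r)"
      using r by (simp add: Ro_fields conv_def)
    also have "\<dots> = tlift RA RA (\<lambda>x y. ie p x * ie q y) (comult RA r)"
      by (rule tlift_cong[OF refl R0_vR R0_comult_R[OF r]]) (simp only: ie_on)
    also have "\<dots> = sw A r (\<lambda>x y. ie p (Pr x) * ie q y)"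
      by (rule R0_R_comult[where X=ground and \<psi>="\<lambda>u v. ie p u * ie q v", OF vect_ground r]) (rule ty | assumption)+
    also have "\<dots> = mult Ao (ie p) (ie q) r"
      by (simp add: AD.mult_Ao ie_Pr ty cong: tlift_cong)
    finally show ?thesis using r by simp
  next
    case False
    then show ?thesis by (simp add: Ro_fields conv_def zero_ext_def)
  qed
qed

lemma one_Ro: "one Ro = zero_ext RA (one Ao)"
  by (rule ext) (simp add: Ro_fields zero_ext_def AD.one_Ao coinvD(1))

text \<open>The value is q(\<pi>(r1) S(\<pi>(r3))) P(r2), and coinvariance of r turns \<pi>(r3) into
  1. What remains is the action defined through the coaction of R.\<close>

lemma ad_eval:
  assumes q: "q \<in> carr Ho" and P: "P \<in> carr Ao" and r: "r \<in> coinvariants A H \<pi>"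
  shows "d.ad q P r = sw A r (\<lambda>x y. q (\<pi> x) * P y)"
proof -
  note lq = HD.Ao_lin[OF q] and lP = AD.Ao_lin[OF P]
  note [ty] = q coinvD(1)[OF r] lq lP lin_map_comp[OF lq] lin_map_comp[OF lP]
  have "d.ad q P r = sw Ho q (\<lambda>q1 q2. sw A r (\<lambda>s z. sw A s (\<lambda>x y. q1 (\<pi> x) * P y) * q2 (S (\<pi> z))))"
    unfolding d.ad_def tlift_eval
    by (rule tlift_cong[OF refl], (rule ty | assumption)+)
      (simp add: AD.mult_Ao po_apply antip_apply ty cong: tlift_cong)
  also have "\<dots> = sw Ho q (\<lambda>q1 q2. sw A r (\<lambda>s z. sw A s (\<lambda>x y. P y * (q1 (\<pi> x) * q2 (S (\<pi> z))))))"
    by (simp only: tlift_mult_const) (simp add: mult_ac)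
  also have "\<dots> = sw A r (\<lambda>s z. sw A s (\<lambda>x y. sw Ho q (\<lambda>q1 q2. P y * (q1 (\<pi> x) * q2 (S (\<pi> z))))))"
    by (subst tlift_swap, rule tlift_fun_cong, rule tlift_swap)
  also have "\<dots> = sw A r (\<lambda>s z. sw A s (\<lambda>x y. P y * sw Ho q (\<lambda>q1 q2. q1 (\<pi> x) * q2 (S (\<pi> z)))))"
    unfolding tlift_def[of Ho] case_prod_unfold by (simp add: sum_list_const_mult)
  also have "\<dots> = sw A r (\<lambda>s z. sw A s (\<lambda>x y. P y * q (mult H (\<pi> x) (S (\<pi> z)))))"
    by (simp add: HD.sw_Ao[OF q] ty cong: tlift_cong)
  also have "\<dots> = sw A r (\<lambda>x t. sw A t (\<lambda>y z. P y * q (mult H (\<pi> x) (S (\<pi> z)))))"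
    by (rule coassoc[where X=ground]) (rule ty | assumption)+
  also have "\<dots> = sw A r (\<lambda>x y. P y * q (mult H (\<pi> x) (S (one H))))"
    by (rule coinv_sw3[OF r vect_ground, where \<phi>="\<lambda>x y z. P y * q (mult H (\<pi> x) (S z))"]) (rule ty | assumption)+
  also have "\<dots> = sw A r (\<lambda>x y. q (\<pi> x) * P y)"
    by (simp add: H_assoc ty mult.commute cong: tlift_cong)
  finally show ?thesis .
qed

lemma act_Ro:
  assumes q: "q \<in> carr Ho" and p: "p \<in> carr Ro"
  shows "act Ro q p = zero_ext RA (d.ad q (ie p))"
proof (rule ext)
  fix r
  note lq = HD.Ao_lin[OF q] and lp = AD.Ao_lin[OF ie_Ro(2)[OF p]]
  note [ty] = lp lq lin_map_comp[OF lp] lin_map_comp[OF lq]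
  have a: "act Ro q p = zero_ext RA (\<lambda>m. tlift H RA (\<lambda>x y. q x * p y) (coact RA m))"
    by (simp add: Ro_fields r_dual_def zero_ext_def)
  show "act Ro q p r = zero_ext RA (d.ad q (ie p)) r"
  proof (cases "r \<in> carr RA")
    case r: True
    have "tlift H RA (\<lambda>x y. q x * p y) (coact RA r) = tlift H RA (\<lambda>x y. q x * ie p y) (coact RA r)"
      by (rule tlift_cong[OF refl H_facts(3) R0_coact_R[OF r]]) (simp only: ie_on)
    also have "\<dots> = sw A r (\<lambda>x y. q (\<pi> x) * ie p y)"
      by (rule R0_R_coact[where X=ground and \<psi>="\<lambda>u v. q u * ie p v", OF vect_ground r]) (rule ty | assumption)+
    also have "\<dots> = d.ad q (ie p) r" using ad_eval[OF q ie_Ro(2)[OF p]] r by simp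
    finally show ?thesis using r a by simp
  next
    case False
    then show ?thesis by (simp add: a zero_ext_def)
  qed
qed

lemma CR_mult_j:
  assumes P: "P \<in> CR" and h: "h \<in> carr H" and m: "m \<in> carr RA"
  shows "P (mult A (j h) m) = P (ad h m)"
proof -
  have m': "m \<in> carr A" "Pr m = m" using m coinvD(1) Pr_id by auto
  have "P (mult A (j h) m) = P (Pr (mult A (j h) m))" using P h m' unfolding CR_iff by (simp add: ty)
  then show ?thesis using Pr_j_mult[OF h m'(1)] m'(2) by simp
qed

text \<open>p(h . m) is the value of \<open>ie p\<close> at j(h) m, so the preimage under j of a
  cofinite ideal of A on which \<open>ie p\<close> vanishes serves as the ideal of H.\<close>

lemma Ro_r_dual: "carr Ro \<subseteq> carr (r_dual_space H (yd_of RA))"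
proof
  fix p assume p: "p \<in> carr Ro"
  obtain J where J: "ideal A J" "finite_codim A J" "\<And>a. a \<in> J \<Longrightarrow> ie p a = 0"
    by (rule CR_vanish[OF ie_Ro(1)[OF p]]) blast
  let ?K = "{h \<in> carr H. j h \<in> J}"
  have fc: "finite_codim H ?K" by (rule finite_codim_preimage[OF H_facts(3) A_facts(4) bialg_mapD(3)[OF jm] J(2)])
  have "ideal H ?K"
  proof -
    have "module.subspace (scale H) ?K" using fc unfolding finite_codim_def by blast
    moreover have "mult H a x \<in> ?K \<and> mult H x a \<in> ?K" if "a \<in> carr H" "x \<in> ?K" for a x
      using that J(1) unfolding ideal_def by (simp add: jp_simps ty)
    ultimately show ?thesis unfolding ideal_def by blast
  qed
  moreover have "p (ad h m) = 0" if h: "h \<in> ?K" and m: "m \<in> carr RA" for h m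
  proof -
    have mA: "m \<in> carr A" using m coinvD(1) by simp
    have "ad h m \<in> carr RA" using R0_act_R[OF _ m] h by simp
    then have "p (ad h m) = ie p (mult A (j h) m)"
      using CR_mult_j[OF ie_Ro(1)[OF p] _ m] h ie_on by simp
    also have "mult A (j h) m \<in> J" using J(1) h mA unfolding ideal_def by blast
    then have "ie p (mult A (j h) m) = 0" by (rule J(3))
    finally show ?thesis .
  qed
  ultimately show "p \<in> carr (r_dual_space H (yd_of RA))"
    unfolding r_dual_space_def using fc p by (auto simp: Ro_carr)
qed

lemma Ro_dual: "carr Ro \<subseteq> carr (dual RA)"
  by (auto simp: Ro_carr)

lemma res_Pr: "y \<in> carr Ao \<Longrightarrow> zero_ext RA (d.Pr y) \<in> carr Ro" "y \<in> carr Ao \<Longrightarrow> ie (zero_ext RA (d.Pr y)) = d.Pr y"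
  by (rule res, rule d.Pr_coinv, assumption)+

lemma eval_Ro: "lin_map Ro ground (\<lambda>p. p a)"
  by (rule eval_lin) (simp add: Ro_fields)

text \<open>The first formula exhibits an element with the evaluations p(h . m) and thereby
  identifies the definite description; its second leg lies in the dual of R because it is projected
  before it is restricted.\<close>

lemma coact_Ro:
  assumes p: "p \<in> carr Ro"
  shows "coact Ro p = sw Ao (ie p) (\<lambda>x y. tens Ho Ro (jo x) (zero_ext RA (d.Pr y)))" (is "_ = ?t")
    and "coact Ro p \<in> carr (tprod Ho Ro)"
    and "tlift Ho Ro (\<lambda>x y. tens Ho Ao x (ie y)) (coact Ro p) = sw Ao (ie p) (\<lambda>x y. tens Ho Ao (jo x) y)"
proof -
  note [ty] = ie_Ro(2)[OF p] vect_Ro res_Pr(1) ie_Ro(2) lin_map_comp[OF ie_Ro_lin] ie_Ro_lin eval_Ro HD.eval_Ao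
  have t: "?t \<in> carr (tprod Ho Ro)" by (rule ty | assumption)+
  let ?E = "r_dual_space H (yd_of RA)"
  have sE: "scale ?E = fscale" by (simp add: r_dual_space_def)
  have dE: "carr ?E \<subseteq> carr (dual RA)" by (auto simp: r_dual_space_def)
  have tE: "?t \<in> carr (tprod Ho ?E)"
    using tprod_mono[OF refl _ order_refl Ro_r_dual, of Ho] t sE by (auto simp: Ro_fields)
  \<comment> \<open>Evaluations are compared over the full dual of R, which contains both the space
    in the definition of the coaction and the dual under study.\<close>
  have ev: "tlift Ho ?E (\<lambda>q p'. q h * p' m) s = tlift Ho (dual RA) (\<lambda>q p'. q h * p' m) s"
    if "s \<in> carr (tprod Ho ?E)" for h m s
    by (rule tlift_restrict[where X=ground, OF _ vect_dual _ vect_ground refl _ order_refl dE _ that])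
       (simp_all add: sE ty eval_lin)
  have ev': "tlift Ho Ro (\<lambda>q p'. q h * p' m) s = tlift Ho (dual RA) (\<lambda>q p'. q h * p' m) s"
    if "s \<in> carr (tprod Ho Ro)" for h m s
    by (rule tlift_restrict[where X=ground, OF _ vect_dual _ vect_ground refl _ order_refl Ro_dual _ that])
       (simp_all add: Ro_fields ty eval_lin)
  have val: "tlift Ho (dual RA) (\<lambda>q p'. q h * p' m) ?t = p (ad h m)" if h[ty]: "h \<in> carr H" and m: "m \<in> carr RA" for h m
  proof -
    have [ty]: "m \<in> carr A" using m coinvD(1) by simp
    have "tlift Ho (dual RA) (\<lambda>q p'. q h * p' m) ?t = tlift Ho Ro (\<lambda>q p'. q h * p' m) ?t" by (rule ev'[OF t, symmetric])
    also have "\<dots> = sw Ao (ie p) (\<lambda>x y. jo x h * zero_ext RA (d.Pr y) m)"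
      by (simp add: ty push_tlift[where X=ground] tlift_tens[where X=ground] cong: tlift_cong)
    also have "\<dots> = sw Ao (ie p) (\<lambda>x y. x (j h) * y m)"
    proof (rule tlift_cong[OF refl])
      fix x y assume "x \<in> carr Ao" "y \<in> carr Ao"
      then show "jo x h * zero_ext RA (d.Pr y) m = x (j h) * y m"
        using m Pr_id[of m] by (simp add: jo_apply d_Pr_eval ty)
    qed (rule ty)+
    also have "\<dots> = ie p (mult A (j h) m)" by (rule AD.sw_Ao) (rule ty)+
    also have "\<dots> = p (ad h m)"
      using CR_mult_j[OF ie_Ro(1)[OF p] h m] R0_act_R[OF h m] ie_on by simp
    finally show ?thesis .
  qed
  show eq: "coact Ro p = ?t"
    unfolding Ro_fields r_dual_def yd.simps
  proof (rule the_equality)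
    show "?t \<in> carr (tprod Ho ?E) \<and> (\<forall>h\<in>carr H. \<forall>m\<in>carr (yd_of RA). tlift Ho ?E (\<lambda>q p'. q h * p' m) ?t = p (yd_act (yd_of RA) h m))"
      using tE ev[OF tE] val by simp
    fix s assume s: "s \<in> carr (tprod Ho ?E) \<and> (\<forall>h\<in>carr H. \<forall>m\<in>carr (yd_of RA). tlift Ho ?E (\<lambda>q p'. q h * p' m) s = p (yd_act (yd_of RA) h m))"
    have sub: "carr (tprod Ho ?E) \<subseteq> carr (tprod Ho (dual RA))"
      by (rule tprod_mono[OF refl _ order_refl dE]) (simp add: sE)
    show "s = ?t"
    proof (rule fun_tens_sep[where D=Ho and V=H and E="dual RA" and W=RA])
      show "s \<in> carr (tprod Ho (dual RA))" "?t \<in> carr (tprod Ho (dual RA))" using s tE sub by auto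
      show "carr Ho \<subseteq> carr (dual H)" using HD.Ao_dual by blast
      fix h m assume hm: "h \<in> carr H" "m \<in> carr RA"
      show "tlift Ho (dual RA) (\<lambda>p q. p h * q m) s = tlift Ho (dual RA) (\<lambda>p q. p h * q m) ?t"
        using s ev[of s h m] val[OF hm] hm by simp
    qed (simp_all add: ty HD.scale_Ao vect_dual)
  qed
  show "coact Ro p \<in> carr (tprod Ho Ro)" unfolding eq by (rule t)
  have "tlift Ho Ro (\<lambda>x y. tens Ho Ao x (ie y)) ?t = sw Ao (ie p) (\<lambda>x y. tens Ho Ao (jo x) (d.Pr y))"
    by (simp add: ty res_Pr(2) push_tlift[where X="tprod Ho Ao"] tlift_tens[where X="tprod Ho Ao"] cong: tlift_cong)
  also have "\<dots> = sw Ao (ie p) (\<lambda>x y. tens Ho Ao (jo x) y)"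
    by (rule d.coinv_Pr2[OF ie_Ro(1)[OF p], where X="tprod Ho Ao" and \<phi>="\<lambda>x y. tens Ho Ao (jo x) y"]) (rule ty | assumption)+
  finally show "tlift Ho Ro (\<lambda>x y. tens Ho Ao x (ie y)) (coact Ro p) = sw Ao (ie p) (\<lambda>x y. tens Ho Ao (jo x) y)"
    unfolding eq .
qed

text \<open>As for the coaction, with both legs projected and restricted. On elements of R the
  projection is invisible, so evaluation at a and b gives \<open>ie p (mult A a b)\<close>.\<close>

lemma comult_Ro:
  assumes p: "p \<in> carr Ro"
  shows "comult Ro p = sw Ao (ie p) (\<lambda>x y. tens Ro Ro (zero_ext RA (d.Pr x)) (zero_ext RA (d.Pr y)))" (is "_ = ?t")
    and "comult Ro p \<in> carr (tprod Ro Ro)"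
    and "tlift Ro Ro (\<lambda>x y. tens Ao Ao (ie x) (ie y)) (comult Ro p) = sw Ao (ie p) (\<lambda>x y. tens Ao Ao (d.Pr x) y)"
proof -
  note [ty] = ie_Ro(2)[OF p] vect_Ro res_Pr(1) ie_Ro(2) lin_map_comp[OF ie_Ro_lin] ie_Ro_lin eval_Ro
  have t: "?t \<in> carr (tprod Ro Ro)" by (rule ty | assumption)+
  have same: "tprod (o_dual_space H RA) (o_dual_space H RA) = tprod Ro Ro" "tlift (o_dual_space H RA) (o_dual_space H RA) = tlift Ro Ro"
    by (rule tprod_same; simp add: Ro_fields o_dual_space_def)+
  have vo: "vect (o_dual_space H RA)" using vect_Ro by (simp add: vect_def Ro_fields) (simp add: o_dual_space_def)
  show eq: "comult Ro p = ?t"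
    unfolding Ro_fields(5)
  proof (rule transp_mult_eqI[OF vo], unfold same)
    show "scale (o_dual_space H RA) = fscale" by (simp add: o_dual_space_def)
    show "carr (o_dual_space H RA) \<subseteq> carr (dual RA)" using Ro_dual by (simp add: Ro_fields)
    show "?t \<in> carr (tprod Ro Ro)" by (rule t)
    fix a b assume ab: "a \<in> carr RA" "b \<in> carr RA"
    have [ty]: "a \<in> carr A" "b \<in> carr A" using ab coinvD(1) by auto
    have "tlift Ro Ro (\<lambda>p1 p2. p1 a * p2 b) ?t = sw Ao (ie p) (\<lambda>x y. zero_ext RA (d.Pr x) a * zero_ext RA (d.Pr y) b)"
      by (simp add: ty push_tlift[where X=ground] tlift_tens[where X=ground] cong: tlift_cong)
    also have "\<dots> = sw Ao (ie p) (\<lambda>x y. x a * y b)"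
    proof (rule tlift_cong[OF refl])
      fix x y assume "x \<in> carr Ao" "y \<in> carr Ao"
      then show "zero_ext RA (d.Pr x) a * zero_ext RA (d.Pr y) b = x a * y b"
        using ab Pr_id[of a] Pr_id[of b] by (simp add: d_Pr_eval ty)
    qed (rule ty)+
    also have "\<dots> = ie p (mult A a b)" by (rule AD.sw_Ao) (rule ty)+
    also have "\<dots> = p (mult RA a b)" using ie_on R0_mult_R[OF ab] by simp
    finally show "tlift Ro Ro (\<lambda>p1 p2. p1 a * p2 b) ?t = p (mult RA a b)" .
  qed
  show "comult Ro p \<in> carr (tprod Ro Ro)" unfolding eq by (rule t)
  have "tlift Ro Ro (\<lambda>x y. tens Ao Ao (ie x) (ie y)) ?t = sw Ao (ie p) (\<lambda>x y. tens Ao Ao (d.Pr x) (d.Pr y))"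
    by (simp add: ty res_Pr(2) push_tlift[where X="tprod Ao Ao"] tlift_tens[where X="tprod Ao Ao"] cong: tlift_cong)
  also have "\<dots> = sw Ao (ie p) (\<lambda>x y. tens Ao Ao (d.Pr x) y)"
    by (rule d.coinv_Pr2[OF ie_Ro(1)[OF p], where X="tprod Ao Ao" and \<phi>="\<lambda>x y. tens Ao Ao (d.Pr x) y"]) (rule ty | assumption)+
  finally show "tlift Ro Ro (\<lambda>x y. tens Ao Ao (ie x) (ie y)) (comult Ro p) = sw Ao (ie p) (\<lambda>x y. tens Ao Ao (d.Pr x) y)"
    unfolding eq .
qed

lemma radford_Ro: "radford Ho Ao po jo Ro ie"
proof unfold_locales
  show "vect Ro" by (rule vect_Ro)
  show "lin_map Ro Ao ie" by (rule ie_Ro_lin)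
  show "inj_on ie (carr Ro)" by (rule ie_inj)
  show "ie ` carr Ro = CR" by (rule ie_image)
  show "mult Ro p q \<in> carr Ro" "ie (mult Ro p q) = mult Ao (ie p) (ie q)" if "p \<in> carr Ro" "q \<in> carr Ro" for p q
    using res[OF d.coinv_mult[OF ie_Ro(1)[OF that(1)] ie_Ro(1)[OF that(2)]]] by (simp_all only: mult_Ro[OF that])
  show "one Ro \<in> carr Ro" "ie (one Ro) = one Ao"
    using res[OF d.coinv_one] by (simp_all only: one_Ro)
  show "counit Ro p = counit Ao (ie p)" if "p \<in> carr Ro" for p
    using ie_on[of "one A"] coinv_one by (simp add: Ro_fields fin_dual_fields)
  show "act Ro q p \<in> carr Ro" "ie (act Ro q p) = d.ad q (ie p)" if "q \<in> carr Ho" "p \<in> carr Ro" for q p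
    using res[OF d.ad_coinv[OF that(1) ie_Ro(1)[OF that(2)]]] by (simp_all only: act_Ro[OF that])
  show "coact Ro p \<in> carr (tprod Ho Ro)" if "p \<in> carr Ro" for p by (rule coact_Ro(2)[OF that])
  show "tlift Ho Ro (\<lambda>x y. tens Ho Ao x (ie y)) (coact Ro p) = sw Ao (ie p) (\<lambda>x y. tens Ho Ao (jo x) y)" if "p \<in> carr Ro" for p
    by (rule coact_Ro(3)[OF that])
  show "comult Ro p \<in> carr (tprod Ro Ro)" if "p \<in> carr Ro" for p by (rule comult_Ro(2)[OF that])
  show "tlift Ro Ro (\<lambda>x y. tens Ao Ao (ie x) (ie y)) (comult Ro p) = sw Ao (ie p) (\<lambda>x y. tens Ao Ao (d.Pr x) y)" if "p \<in> carr Ro" for p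
    by (rule comult_Ro(3)[OF that])
qed

text \<open>\<open>i\<close> is tied to \<open>ie\<close> only on the carrier because
  \<open>dual_ext\<close> is identified with \<open>ie\<close> only on the dual of R.\<close>

lemma Ro_Rp_iso:
  assumes i: "\<And>p. p \<in> carr Ro \<Longrightarrow> i p = ie p"
  shows "yd_bialg_iso Ho Ro Rp i"
proof -
  interpret r: radford Ho Ao po jo Ro ie by (rule radford_Ro)
  have t: "tens Rp Rp = tens Ao Ao" "tens Ho Rp = tens Ho Ao" by (rule tens_same; simp)+
  have co: "coact Rp P = sw Ao P (\<lambda>x y. tens Ho Ao (jo x) y)" "comult Rp P = sw Ao P (\<lambda>x y. tens Ao Ao (d.Pr x) y)" for P
    by (simp_all add: assoc_bialg_def d.Pr_def)
  have b: "yd_bialgebra Ho Ro" "yd_bialgebra Ho Rp" by (rule r.yd_bialgebra_R, rule d.R0_yd_bialgebra)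
  have ti: "tlift Ho Ro (\<lambda>x y. tens Ho Ao x (i y)) s = tlift Ho Ro (\<lambda>x y. tens Ho Ao x (ie y)) s" if "s \<in> carr (tprod Ho Ro)" for s
    by (rule tlift_cong[OF refl d.H_facts(3) that]) (simp only: i)
  have ti2: "tlift Ro Ro (\<lambda>x y. tens Ao Ao (i x) (i y)) s = tlift Ro Ro (\<lambda>x y. tens Ao Ao (ie x) (ie y)) s" if "s \<in> carr (tprod Ro Ro)" for s
    by (rule tlift_cong[OF refl vect_Ro that]) (simp only: i)
  have "lin_map Ro Rp ie" using ie_Ro_lin ie_Ro(1) by (auto simp: lin_map_def)
  then have "lin_map Ro Rp i" by (rule lin_map_eq[OF _ vect_Ro i])
  then have "yd_morphism Ho (yd_of Ro) (yd_of Rp) i"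
    unfolding yd_morphism_def using b r.f_act r.f_coact
    by (simp add: yd_bialgebra_def yd_algebra_def t co i r.act_R ti r.coact_R)
  moreover have "bij_betw i (carr Ro) (carr Rp)"
    using ie_inj ie_image bij_betw_cong[of "carr Ro" i ie CR] i by (simp add: bij_betw_def)
  ultimately show ?thesis unfolding yd_bialg_iso_def t co
    using b r.f_one r.f_mult r.counit_R r.f_comult by (simp add: i r.mult_R r.one_R ti2 r.comult_R)
qed

section \<open>The map theta and the comparison with the canonical isomorphisms\<close>

lemma can_eq: "canonical_iso A H j \<pi> = radford.G H A j RA (\<lambda>x. x)"
  by (simp add: canonical_iso_def radford.G_def[OF radford_assoc] fun_eq_iff)

lemma G0_tens:
  assumes "r \<in> coinvariants A H \<pi>" "h \<in> carr H"
  shows "canonical_iso A H j \<pi> (tens RA H r h) = mult A r (j h)"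
  unfolding can_eq using radford.G_tens[OF radford_assoc] assms by simp

lemma G0_lin: "lin_map (tprod RA H) A (canonical_iso A H j \<pi>)"
  unfolding can_eq by (rule radford.G_lin[OF radford_assoc])

text \<open>\<open>ie p\<close> turns the factor j(h1) into a counit value, and coinvariance of r
  replaces \<pi>(r2) by 1. So the product of \<open>ie p\<close> and \<open>po q\<close>, pulled
  back along r \<otimes> h \<mapsto> r j(h), is the functional p \<otimes> q.\<close>

lemma pairing:
  assumes p: "p \<in> carr Ro" and q: "q \<in> carr Ho" and r: "r \<in> coinvariants A H \<pi>" and h: "h \<in> carr H"
  shows "mult Ao (ie p) (po q) (mult A r (j h)) = p r * q h"
proof -
  note lq = HD.Ao_lin[OF q] and lp = AD.Ao_lin[OF ie_Ro(2)[OF p]]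
  note [ty] = lq lp lin_map_comp[OF lq] lin_map_comp[OF lp] coinvD(1)[OF r] h
  have s: "ie p (Pr (scale A c x)) = c * ie p x" if [ty]: "x \<in> carr A" for c x
    using lin_mapD(3)[OF lp] by (simp add: ie_Pr ty)
  have e: "ie p (mult A x (j k)) = counit H k * ie p x" if [ty]: "x \<in> carr A" "k \<in> carr H" for x k
    using ie_Pr[of "mult A x (j k)" p] lin_mapD(3)[OF lp] by (simp add: Pr_mult_j ie_Pr ty)
  have "mult Ao (ie p) (po q) (mult A r (j h)) = sw A r (\<lambda>x y. sw H h (\<lambda>k l. counit H k * (ie p x * q (mult H (\<pi> y) l))))"
    by (simp add: AD.mult_Ao ty swr[where X=ground] jp_sw[where X=ground] po_apply jp_simps e mult.assoc cong: tlift_cong)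
  also have "\<dots> = sw A r (\<lambda>x y. ie p x * q (mult H (\<pi> y) h))"
    by (rule tlift_cong[OF refl], (rule ty | assumption)+,
        rule counit_sw(1)[OF H_facts(2) vect_ground h, unfolded scale_ground]) (rule ty | assumption)+
  also have "\<dots> = ie p r * q (mult H (one H) h)"
    by (rule coinv_sw[OF r vect_ground, where \<phi>="\<lambda>x y. ie p x * q (mult H y h)"]) (rule ty | assumption)+
  finally show ?thesis using ie_on[of r p] r by (simp add: H_assoc ty)
qed

abbreviation "GR \<equiv> radford.G Ho Ao po Ro ie"

lemma GR_eq: "GR x = tlift Ro Ho (\<lambda>p q. mult Ao (ie p) (po q)) x"
  by (simp add: radford.G_def[OF radford_Ro])

lemma GR_in: "x \<in> carr (tprod Ro Ho) \<Longrightarrow> GR x \<in> carr Ao"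
  by (rule lin_mapD(1)[OF radford.G_lin[OF radford_Ro]])

text \<open>By \<open>pairing\<close> both sides agree on pure tensors r \<otimes> h, and both
  vanish off the carrier. Bijectivity and multiplicativity of \<open>theta\<close> are thereby
  reduced to those of two known isomorphisms.\<close>

lemma theta_eq:
  assumes x: "x \<in> carr (tprod Ro Ho)"
  shows "theta H RA x = transp_map (biproduct RA H) (canonical_iso A H j \<pi>) (GR x)"
proof (rule ext)
  fix t
  have B: "carr (biproduct RA H) = carr (tprod RA H)" by (simp add: biproduct_def)
  note [ty] = R0_vR vect_Ro
  have th: "theta H RA x t = tlift Ro Ho (\<lambda>p q. zero_ext (tprod RA H) (tlift RA H (\<lambda>r h. p r * q h)) t) x"
    unfolding theta_def by (rule tlift_eval)
  show "theta H RA x t = transp_map (biproduct RA H) (canonical_iso A H j \<pi>) (GR x) t"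
  proof (cases "t \<in> carr (tprod RA H)")
    case t: True
    let ?f = "canonical_iso A H j \<pi>"
    have "tlift RA H (\<lambda>r h. p r * q h) t = mult Ao (ie p) (po q) (?f t)" if p: "p \<in> carr Ro" and q: "q \<in> carr Ho" for p q
    proof (rule tprod_eqI[OF R0_vR H_facts(3) _ _ t, where X=ground and f="tlift RA H (\<lambda>r h. p r * q h)" and g="\<lambda>t. mult Ao (ie p) (po q) (?f t)"])
      have lp: "lin_map RA ground p" using p by (simp add: Ro_carr dual_iff)
      note lq = HD.Ao_lin[OF q]
      show l: "lin_map (tprod RA H) ground (tlift RA H (\<lambda>r h. p r * q h))"
        by (rule tlift_universal(1)) (rule ty lp lq | assumption)+
      have "mult Ao (ie p) (po q) \<in> carr Ao" using ie_Ro(2)[OF p] q by (rule_tac ty) (rule ty | assumption)+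
      from lin_map_comp[OF AD.Ao_lin[OF this] G0_lin]
      show "lin_map (tprod RA H) ground (\<lambda>t. mult Ao (ie p) (po q) (?f t))" .
      fix r h assume rh: "r \<in> carr RA" "h \<in> carr H"
      have "tlift RA H (\<lambda>r h. p r * q h) (tens RA H r h) = p r * q h"
        by (rule tlift_tens[where X=ground]) (rule ty lp lq rh | assumption)+
      then show "tlift RA H (\<lambda>r h. p r * q h) (tens RA H r h) = mult Ao (ie p) (po q) (?f (tens RA H r h))"
        using pairing[OF p q, of r h] G0_tens[of r h] rh by simp
    qed
    then have "theta H RA x t = tlift Ro Ho (\<lambda>p q. mult Ao (ie p) (po q) (?f t)) x"
      unfolding th by (intro tlift_cong[OF refl vect_Ro x]) (simp add: t)
    also have "\<dots> = GR x (?f t)" unfolding GR_eq by (rule tlift_eval[symmetric])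
    finally show ?thesis using t by (simp add: transp_map_def B)
  next
    case False
    then have "theta H RA x t = tlift Ro Ho (\<lambda>p q. 0) x" unfolding th by (simp add: zero_ext_def)
    then show ?thesis using False by (simp add: transp_map_def zero_ext_def B tlift_def case_prod_unfold)
  qed
qed

lemma theta_tens:
  assumes p: "p \<in> carr Ro" and q: "q \<in> carr Ho" and r: "r \<in> carr RA" and h: "h \<in> carr H"
  shows "theta H RA (tens Ro Ho p q) (tens RA H r h) = p r * q h"
proof -
  have t: "tens RA H r h \<in> carr (biproduct RA H)" using tens_in_tprod[of r RA h H] r h by (simp add: biproduct_def)
  have "theta H RA (tens Ro Ho p q) (tens RA H r h) = GR (tens Ro Ho p q) (mult A r (j h))"
    using theta_eq[OF tens_in_tprod[OF p q]] t G0_tens[of r h] r h by (simp add: transp_map_def)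
  also have "GR (tens Ro Ho p q) = mult Ao (ie p) (po q)" by (rule radford.G_tens[OF radford_Ro p q])
  finally show ?thesis using pairing[OF p q, of r h] r h by simp
qed

lemma canonical_iso_bialg: "bialg_iso (biproduct RA H) A (canonical_iso A H j \<pi>)"
  unfolding can_eq by (rule R0_biproduct_iso)

lemma d_canonical_iso_bialg: "bialg_iso (biproduct Rp Ho) Ao (canonical_iso Ao Ho po jo)"
  using d.R0_biproduct_iso by (simp add: canonical_iso_def radford.G_def[OF d.radford_assoc])

lemma carr_biproduct: "carr (biproduct Ro Ho) = carr (tprod Ro Ho)"
  by (simp add: biproduct_def)

lemma theta_iso: "bialg_iso (biproduct Ro Ho) (fin_dual (biproduct RA H)) (theta H RA)"
  by (rule bialg_iso_comp[OF radford.biproduct_iso[OF radford_Ro] bialg_iso_transp[OF canonical_iso_bialg]])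
     (simp add: theta_eq carr_biproduct)

text \<open>With \<open>theta_eq\<close> the canonical map cancels against its inverse and
  \<open>GR x\<close> remains, which is the canonical map of the dual data after \<open>ie\<close>
  on the first leg.\<close>

lemma theta_canonical:
  assumes x: "x \<in> carr (tprod Ro Ho)"
  shows "transp_map A (inv_into (carr (biproduct RA H)) (canonical_iso A H j \<pi>)) (theta H RA x) =
    canonical_iso Ao Ho po jo (tlift Ro Ho (\<lambda>p q. tens Rp Ho (ie p) q) x)"
proof -
  let ?f = "canonical_iso A H j \<pi>" and ?B = "biproduct RA H"
  have bij: "bij_betw ?f (carr ?B) (carr A)" using canonical_iso_bialg by (simp add: bialg_iso_def)
  have G: "GR x \<in> carr Ao" by (rule GR_in[OF x])
  have "transp_map A (inv_into (carr ?B) ?f) (theta H RA x) = GR x"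
  proof (rule ext)
    fix a show "transp_map A (inv_into (carr ?B) ?f) (theta H RA x) a = GR x a"
    proof (cases "a \<in> carr A")
      case True
      then have "inv_into (carr ?B) ?f a \<in> carr ?B" "?f (inv_into (carr ?B) ?f a) = a"
        using bij by (auto simp: bij_betw_def inv_into_into f_inv_into_f)
      then show ?thesis using True by (simp add: transp_map_def theta_eq[OF x])
    next
      case False
      then show ?thesis using AD.Ao_dual[OF G] by (simp add: transp_map_def zero_ext_def dual_iff)
    qed
  qed
  also have "GR x = canonical_iso Ao Ho po jo (tlift Ro Ho (\<lambda>p q. tens Rp Ho (ie p) q) x)"
  proof -
    note v = d.R0_vR
    have bl: "bilin_map Rp Ho Ao (\<lambda>r h. mult Ao r (po h))"
      by (rule ty d.R0_fl lin_map_comp[OF d.R0_fl] d.coinvD(1) | assumption | simp)+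
    show ?thesis
      unfolding GR_eq canonical_iso_def
      by (subst push_tlift[where X=Ao, OF v d.H_facts(3) d.A_facts(4) bl vect_Ro x])
         (auto intro!: tens_in_tprod tlift_cong[OF refl vect_Ro x] simp: ie_Ro(1) tlift_tens[OF v d.H_facts(3) d.A_facts(4) bl])
  qed
  finally show ?thesis .
qed

end

theorem proposition7p1:
  fixes H :: "('k::field, 'h::ab_group_add) bialg"
    and A :: "('k, 'a::ab_group_add) bialg"
    and j :: "'h \<Rightarrow> 'a" and \<pi> :: "'a \<Rightarrow> 'h"
  assumes "hopf_algebra H" and "bij_betw (antip H) (carr H) (carr H)"
    and "bialgebra A"
    and "bialg_map H A j" and "bialg_map A H \<pi>"
    and "\<forall>h\<in>carr H. \<pi> (j h) = h"
  defines "Ho \<equiv> fin_dual H" and "Ao \<equiv> fin_dual A"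
    and "\<pi>o \<equiv> transp_map A \<pi>" and "jo \<equiv> transp_map H j"
    and "R \<equiv> assoc_bialg A H j \<pi>"
  defines "Ro \<equiv> o_dual H R"
    and "R' \<equiv> assoc_bialg Ao Ho \<pi>o jo"
    and "i \<equiv> dual_ext A H j \<pi>"
    and "f \<equiv> canonical_iso A H j \<pi>"
    and "g \<equiv> canonical_iso Ao Ho \<pi>o jo"
    and "\<theta> \<equiv> theta H R"
  shows
    "(bialg_map Ho Ao \<pi>o \<and> bialg_map Ao Ho jo \<and> (\<forall>p\<in>carr Ho. jo (\<pi>o p) = p) \<and>
      lin_map (dual R) (dual A) i \<and>
      (\<forall>p\<in>carr (dual R). \<forall>r\<in>carr R. \<forall>h\<in>carr H. i p (mult A r (j h)) = p r * counit H h) \<and>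
      bij_betw i (carr Ro) (carr R') \<and>
      yd_bialg_iso Ho Ro R' i) \<and>
     (bialg_iso (biproduct Ro Ho) (fin_dual (biproduct R H)) \<theta> \<and>
      (\<forall>p\<in>carr Ro. \<forall>q\<in>carr Ho. \<forall>r\<in>carr R. \<forall>h\<in>carr H.
         \<theta> (tens Ro Ho p q) (tens R H r h) = p r * q h) \<and>
      bialg_iso (biproduct R H) A f \<and> bialg_iso (biproduct R' Ho) Ao g \<and>
      (\<forall>x\<in>carr (biproduct Ro Ho).
         transp_map A (inv_into (carr (biproduct R H)) f) (\<theta> x) =
         g (tlift Ro Ho (\<lambda>p q. tens R' Ho (i p) q) x)))"
proof -
  have "antipode H (antip H)" using assms(1) unfolding hopf_algebra_def antip_def by (metis someI_ex)
  then interpret dual_pair H A j \<pi>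
    using assms(1,4,5,6) by unfold_locales (auto simp: hopf_algebra_def)
  have ie: "i p = ie p" if "p \<in> carr (dual R)" for p using dual_ext_eq that by (simp add: i_def R_def)
  have ieRo: "i p = ie p" if "p \<in> carr Ro" for p
    using ie[of p] that Ro_dual unfolding Ro_def R_def by blast
  note defs = Ho_def Ao_def \<pi>o_def jo_def Ro_def R'_def f_def g_def \<theta>_def R_def
  have "bialg_map Ho Ao \<pi>o" "bialg_map Ao Ho jo" "\<forall>p\<in>carr Ho. jo (\<pi>o p) = p"
    unfolding defs using d.jm d.pm d.pj by blast+
  moreover have "lin_map (dual R) (dual A) i"
    using lin_map_eq[OF ie_lin vect_dual, of i] ie unfolding R_def by blast
  moreover have "\<forall>p\<in>carr (dual R). \<forall>r\<in>carr R. \<forall>h\<in>carr H. i p (mult A r (j h)) = p r * counit H h"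
    using ie ie_mult_j unfolding R_def by simp
  moreover have iso: "yd_bialg_iso Ho Ro R' i"
    using Ro_Rp_iso[of i] ieRo unfolding defs by blast
  moreover have "bij_betw i (carr Ro) (carr R')"
    using iso unfolding yd_bialg_iso_def by blast
  moreover have "bialg_iso (biproduct Ro Ho) (fin_dual (biproduct R H)) \<theta>"
    unfolding defs by (rule theta_iso)
  moreover have "\<forall>p\<in>carr Ro. \<forall>q\<in>carr Ho. \<forall>r\<in>carr R. \<forall>h\<in>carr H. \<theta> (tens Ro Ho p q) (tens R H r h) = p r * q h"
    unfolding defs using theta_tens by blast
  moreover have "bialg_iso (biproduct R H) A f" "bialg_iso (biproduct R' Ho) Ao g"
    unfolding defs by (rule canonical_iso_bialg, rule d_canonical_iso_bialg)
  moreover have "transp_map A (inv_into (carr (biproduct R H)) f) (\<theta> x) = g (tlift Ro Ho (\<lambda>p q. tens R' Ho (i p) q) x)"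
    if x: "x \<in> carr (biproduct Ro Ho)" for x
  proof -
    have x': "x \<in> carr (tprod Ro Ho)" using x by (simp add: biproduct_def)
    have "tlift Ro Ho (\<lambda>p q. tens R' Ho (i p) q) x = tlift Ro Ho (\<lambda>p q. tens R' Ho (ie p) q) x"
      by (rule tlift_cong[OF refl _ x']) (use vect_Ro ieRo in \<open>simp_all only: Ro_def R_def\<close>)
    then show ?thesis using theta_canonical x' unfolding defs by simp
  qed
  ultimately show ?thesis by blast
qed

end
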